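(* Let $m\geq 2$ be an integer and let $\mathcal L_n$ be the composition vector at time $n$ of the fringe nodes of the different types in a random B-tree with parameter $m$. Then, as $n\to\infty$: (i) when $m\leq 59$, $\dfrac{\mathcal L_n-nP^{-1}v_1}{\sqrt n}$ converges in distribution to a centered Gaussian vector; (ii) when $m\geq 60$, there is a complex-valued random variable $W_m^{\rm B-tree}$ with expectation $\dfrac{m!}{\Gamma(m+\lambda_2)}$ such that $$\mathcal L_n=nP^{-1}v_1+2\Re\left(n^{\lambda_2}W_m^{\rm B-tree}P^{-1}v_2\right)+o\left(n^{\sigma_2}\right)$$ almost surely and in $\mathrm L^p$ for every $p\geq 1$.
   Context: B-tree model: in the B-tree considered, every fringe node (internal node whose only descendants are leaves) contains between $m-1$ and $2m-2$ keys; a fringe node with $m+k-2$ keys is of type $k$ ($1\le k\le m$) and has $m+k-1$ insertion gaps. Each new key is inserted in a gap chosen uniformly among all gaps of the tree. Insertion in a fringe node of type $k\le m-1$ turns it into a fringe node of type $k+1$; insertion in a fringe node of type $m$ replaces it by two fringe nodes of type $1$ (one key being moved up to the parent). The initial tree (time $0$) consists of a single fringe node of type $1$, and time $n$ is the number of keys inserted since. Equivalently, with $(e_k)$ the canonical basis of $\mathbb R^m$, $w_k=-e_k+e_{k+1}$ for $k\le m-1$ and $w_m=2e_1-e_m$, $(\mathcal L_n)_{n\ge0}$ is the Markov chain with $\mathcal L_0=e_1=(1,0,\dots,0)$ and $$\mathbb P\left(\mathcal L_{n+1}=\mathcal L_n+w_k\mid \mathcal L_n\right)=\frac{(m+k-1)\mathcal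 L_n^{(k)}}{n+m},\quad 1\le k\le m,$$ where $\mathcal L_n^{(k)}$, the $k$-th coordinate, is the number of fringe nodes of type $k$ and $n+m=\sum_k(m+k-1)\mathcal L_n^{(k)}$ is the total number of gaps. Notation: $P=\mathrm{Diag}(m,m+1,\dots,2m-1)$. Let $\chi_m(X)=\prod_{k=m}^{2m-1}(X+k)-\frac{(2m)!}{m!}$. Its roots are simple, $1$ is the root with largest real part, and two distinct roots with the same real part are complex conjugate. For $m\ge 60$, $\lambda_2=\sigma_2+i\tau_2$ denotes the root having the second largest real part $\sigma_2$ and positive imaginary part $\tau_2$. Put $H_{m+1}(X)=\sum_{k=1}^m\frac1{X+k}$, and for a root $\lambda$ let $v(\lambda)\in\mathbb C^m$ be the vector with $k$-th coordinate $$\frac{1}{(m+\lambda)H_{m+1}(m+\lambda-1)}\prod_{j=1}^{k-1}\frac{m+j}{m+j+\lambda}.$$ Put $v_1=v(1)=\frac1{H_{m+1}(m)}\left(\frac1{m+1},\dots,\frac1{2m}\right)$ and $v_2=v(\lambda_2)$. $\Gamma$ is Euler's Gamma function; $\Re$ of a complex vector is taken coordinatewise. *)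

theory Defs
  imports "HOL-Probability.Probability"
begin

text \<open>Vectors of \<open>\<real>\<^sup>m\<close> are functions on \<open>{1..m}\<close>; values outside this set are irrelevant.\<close>

definition gaps :: "nat \<Rightarrow> nat \<Rightarrow> nat" where
  "gaps m k = m + k - 1"

text \<open>\<open>P\<^sup>-\<^sup>1 u\<close> for the matrix \<open>P = Diag(m, m+1, \<dots>, 2m-1)\<close>, whose diagonal entries are
  the \<open>gaps m k\<close>.\<close>

definition P_inv :: "nat \<Rightarrow> (nat \<Rightarrow> 'b) \<Rightarrow> nat \<Rightarrow> 'b::field_char_0" where
  "P_inv m u k = u k / of_nat (gaps m k)"

definition unit_vec :: "nat \<Rightarrow> nat \<Rightarrow> real" where
  "unit_vec k j = (if j = k then 1 else 0)"

definition increment :: "nat \<Rightarrow> nat \<Rightarrow> nat \<Rightarrow> real" where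
  "increment m k j =
     (if k < m then - unit_vec k j + unit_vec (k + 1) j
      else 2 * unit_vec 1 j - unit_vec m j)"

text \<open>The Markov property is expressed by conditioning on the whole history
  \<open>L 0 = x 0, \<dots>, L n = x n\<close>, for all histories of positive probability.\<close>

definition btree_fringe_chain ::
    "nat \<Rightarrow> 'a measure \<Rightarrow> (nat \<Rightarrow> 'a \<Rightarrow> nat \<Rightarrow> real) \<Rightarrow> bool" where
  "btree_fringe_chain m M L \<longleftrightarrow>
     prob_space M \<and>
     (\<forall>n. \<forall>k\<in>{1..m}. (\<lambda>\<omega>. L n \<omega> k) \<in> borel_measurable M) \<and>
     (AE \<omega> in M. \<forall>j\<in>{1..m}. L 0 \<omega> j = unit_vec 1 j) \<and>
     (\<forall>n x. \<P>(\<omega> in M. \<forall>i\<le>n. \<forall>j\<in>{1..m}. L i \<omega> j = x i j) > 0 \<longrightarrow>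
       (\<forall>k\<in>{1..m}.
         \<P>(\<omega> in M. (\<forall>j\<in>{1..m}. L (Suc n) \<omega> j = L n \<omega> j + increment m k j)
              \<bar> (\<forall>i\<le>n. \<forall>j\<in>{1..m}. L i \<omega> j = x i j))
           = real (gaps m k) * x n k / real (n + m)))"

definition chi :: "nat \<Rightarrow> complex poly" where
  "chi m = (\<Prod>k=m..2*m-1. [:of_nat k, 1:]) - [:fact (2*m) / fact m:]"

definition chi_roots :: "nat \<Rightarrow> complex set" where
  "chi_roots m = {z. poly (chi m) z = 0}"

definition sigma2 :: "nat \<Rightarrow> real" where
  "sigma2 m = Max (Re ` chi_roots m - {Max (Re ` chi_roots m)})"

definition lambda2 :: "nat \<Rightarrow> complex" where
  "lambda2 m = (THE z. z \<in> chi_roots m \<and> Re z = sigma2 m \<and> Im z > 0)"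

text \<open>\<open>H_fun m\<close> is the function usually written with index \<open>m + 1\<close>.\<close>

definition H_fun :: "nat \<Rightarrow> 'b \<Rightarrow> 'b::field_char_0" where
  "H_fun m X = (\<Sum>k=1..m. 1 / (X + of_nat k))"

text \<open>Polymorphic, so that \<open>v_vec m (1::real)\<close> is the real vector \<open>v\<^sub>1\<close>.\<close>

definition v_vec :: "nat \<Rightarrow> 'b \<Rightarrow> nat \<Rightarrow> 'b::field_char_0" where
  "v_vec m l k =
     1 / ((of_nat m + l) * H_fun m (of_nat m + l - 1)) *
     (\<Prod>j=1..k-1. of_nat (m + j) / (of_nat (m + j) + l))"

text \<open>Weak convergence of laws on \<open>\<real>\<^sup>I\<close> (\<open>I\<close> finite), tested on bounded continuous functions.\<close>

definition weak_conv_vec ::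
    "'i set \<Rightarrow> (nat \<Rightarrow> ('i \<Rightarrow> real) measure) \<Rightarrow> ('i \<Rightarrow> real) measure \<Rightarrow> bool" where
  "weak_conv_vec I \<mu> N \<longleftrightarrow>
     (\<forall>f. continuous_map (powertop_real I) euclideanreal f \<and>
          bounded (f ` topspace (powertop_real I)) \<longrightarrow>
          (\<lambda>n. \<integral>x. f x \<partial>\<mu> n) \<longlonglongrightarrow> (\<integral>x. f x \<partial>N))"

text \<open>Every linear form is a centered real Gaussian variable. Singular covariance matrices are
  allowed: a variance-zero linear form has the Dirac law at \<open>0\<close>.\<close>

definition centered_gaussian :: "'i set \<Rightarrow> ('i \<Rightarrow> real) measure \<Rightarrow> bool" where
  "centered_gaussian I N \<longleftrightarrow>
     prob_space N \<and> sets N = sets (Pi\<^sub>M I (\<lambda>_. borel)) \<and>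
     (\<forall>t. \<exists>s\<ge>0. distr N borel (\<lambda>x. \<Sum>i\<in>I. t i * x i) =
        (if s = 0 then return borel 0 else density lborel (\<lambda>x. ennreal (normal_density 0 s x))))"

definition btree_remainder ::
    "nat \<Rightarrow> (nat \<Rightarrow> 'a \<Rightarrow> nat \<Rightarrow> real) \<Rightarrow> ('a \<Rightarrow> complex) \<Rightarrow> nat \<Rightarrow> 'a \<Rightarrow> nat \<Rightarrow> real" where
  "btree_remainder m L W n \<omega> k =
     L n \<omega> k - (real n * P_inv m (v_vec m 1) k +
       2 * Re (of_nat n powr lambda2 m * W \<omega> * P_inv m (v_vec m (lambda2 m)) k))"

end

theory Submission
  imports Defs "HOL-Real_Asymp.Real_Asymp" "HOL-Computational_Algebra.Fundamental_Theorem_Algebra"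
begin

text \<open>The eigenvectors of the mean replacement matrix turn the chain into coordinates \<open>Y\<close>, one for each
  root \<open>l\<close> of \<open>chi m\<close>, whose conditional mean is multiplied by \<open>1 + l / (n + m)\<close> at time \<open>n\<close>; divided
  by \<open>\<Prod>(1 + l / (i + m)) \<sim> const \<cdot> n\<^sup>l\<close> they are martingales. The coordinate of the root \<open>1\<close> is
  deterministic. If \<open>Re l > 1/2\<close>, the martingale converges in every \<open>L\<^sup>p\<close>, which gives the oscillating term;
  coordinates with smaller real part are negligible. If all roots other than \<open>1\<close> satisfy \<open>Re l < 1/2\<close>,
  the characteristic function of a linear form of the chain satisfies a recursion in time
  with summable error, and converges to a Gaussian one.

  Which case occurs is decided by moduli and arguments. A root \<open>z = a + i t\<close> with \<open>a, t \<ge> 0\<close> satisfies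
  \<open>\<Prod>\<bar>z + k\<bar> = \<Prod>(k + 1)\<close> and \<open>\<Sum> arctan (t / (a + k)) \<in> 2\<pi>\<int>\<close>, for \<open>m \<le> k < 2m\<close>. If \<open>a\<close> decreases, the
  first equation makes \<open>t\<close> and the sum of the arguments grow, so the question is whether at \<open>a = 1/2\<close> the
  sum exceeds \<open>2\<pi>\<close>. For large \<open>m\<close>, \<open>t \<approx> sqrt (2 m ln 2)\<close> and the sum is about \<open>t ln 2\<close>, which crosses \<open>2\<pi>\<close>
  between \<open>m = 59\<close> and \<open>m = 60\<close>.\<close>

section \<open>Real parts of the roots\<close>

text \<open>Expectations are finite sums over insertion histories, so conditioning is a one-step
  sum. The central estimate \<open>moment_bound\<close> takes arbitrary coefficients
  \<open>q\<close> that obey the backward recursion cancelling the drift: with \<open>q\<close> the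
  products \<open>Gp\<close> up to a final time it bounds the coordinates themselves, with
  \<open>q\<close> the inverse products it bounds the increments of the normalized martingale.
  Locating the roots is delicate because at real part 1/2 the total argument differs from 2 pi by
  less than one percent both at m = 59 and at m = 60. What helps is that k + 1/2 is the midpoint of
  [k, k+1]: all sums are midpoint rules on [m, 2m], so they agree with elementary integrals up to a
  relative error of order m^(-2). In the Gaussian regime moment bounds with an exponent above 1/2
  are too weak for the variance, which is why the exact limit of the sums of products of
  \<open>Gp\<close> is computed. Weak convergence on R^m then follows from characteristic functions
  and bounded second moments, by Stone-Weierstrass on a torus.\<close>

lemma arctan_ge_cubic:
  fixes x :: real assumes "x \<ge> 0" shows "x - x^3/3 \<le> arctan x"
proof -
  have "(\<lambda>x. arctan x - (x - x^3/3)) 0 \<le> (\<lambda>x. arctan x - (x - x^3/3)) x"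
  proof (rule DERIV_nonneg_imp_nondecreasing[OF assms])
    fix y :: real assume "0 \<le> y"
    have d: "((\<lambda>x. arctan x - (x - x^3/3)) has_real_derivative (inverse (1 + y\<^sup>2) - (1 - y\<^sup>2))) (at y)"
      by (auto intro!: derivative_eq_intros)
    have "inverse (1 + y\<^sup>2) - (1 - y\<^sup>2) = y^4 / (1 + y\<^sup>2)"
    proof -
      have "1 + y\<^sup>2 \<noteq> 0" by (smt (verit) zero_le_power2)
      then show ?thesis by (simp add: field_simps)
    qed
    then have "inverse (1 + y\<^sup>2) - (1 - y\<^sup>2) \<ge> 0" by simp
    with d show "\<exists>d. ((\<lambda>x. arctan x - (x - x^3/3)) has_real_derivative d) (at y) \<and> 0 \<le> d" by blast
  qed
  then show ?thesis by simp
qed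

lemma arctan_le_quintic:
  fixes x :: real assumes "x \<ge> 0" shows "arctan x \<le> x - x^3/3 + x^5/5"
proof -
  have "(\<lambda>x. (x - x^3/3 + x^5/5) - arctan x) 0 \<le> (\<lambda>x. (x - x^3/3 + x^5/5) - arctan x) x"
  proof (rule DERIV_nonneg_imp_nondecreasing[OF assms])
    fix y :: real assume "0 \<le> y"
    have d: "((\<lambda>x. (x - x^3/3 + x^5/5) - arctan x) has_real_derivative ((1 - y\<^sup>2 + y^4) - inverse (1 + y\<^sup>2))) (at y)"
      by (auto intro!: derivative_eq_intros)
    have "((1 - y\<^sup>2 + y^4) - inverse (1 + y\<^sup>2)) = y^6 / (1 + y\<^sup>2)"
    proof -
      have "1 + y\<^sup>2 \<noteq> 0" by (smt (verit) zero_le_power2)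
      then show ?thesis by (simp add: field_simps)
    qed
    then have "((1 - y\<^sup>2 + y^4) - inverse (1 + y\<^sup>2)) \<ge> 0" by simp
    with d show "\<exists>d. ((\<lambda>x. (x - x^3/3 + x^5/5) - arctan x) has_real_derivative d) (at y) \<and> 0 \<le> d" by blast
  qed
  then show ?thesis by simp
qed


text \<open>Euler's formula 5 arctan(1/7) + 2 arctan(3/79) = pi/4 has arguments small enough for the
  two Taylor bounds. The precision is dictated by \<open>sum_arctan_less_2pi\<close>, where 2 pi is
  compared with a number close to 6.2825.\<close>

lemma pi_bounds: "31413/10000 < pi" "pi < 31418/10000"
proof -
  have "arctan (1/7) \<le> 1/7 - (1/7)^3/3 + (1/7)^5/5" "1/7 - (1/7)^3/3 \<le> arctan (1/7::real)"
     "arctan (3/79) \<le> 3/79 - (3/79)^3/3 + (3/79)^5/5" "3/79 - (3/79)^3/3 \<le> arctan (3/79::real)"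
    by (rule arctan_le_quintic arctan_ge_cubic; simp)+
  then show "31413/10000 < pi" "pi < 31418/10000"
    using machin_Euler by (simp_all add: power_divide)
qed

lemma ln2_bounds: "69314/100000 < ln (2::real)" "ln (2::real) < 69315/100000"
proof -
  have 5: "(\<Sum>k<5. f k) = f 0 + f 1 + f 2 + f 3 + f 4" for f :: "nat \<Rightarrow> real"
    by (simp add: eval_nat_numeral)
  have "ln (2::real) \<in> {(\<Sum>k<5. 2*((2-1)/(2+1))^(2*k+1) / of_nat (2*k+1))..
     (\<Sum>k<5. 2*((2-1)/(2+1))^(2*k+1) / of_nat (2*k+1)) + 2 * (((2-1)/(2+1))^(2*5+1) / (1 - ((2-1)/(2+1))^2) / of_nat (2*5+1))}"
    by (rule ln_approx_bounds) simp
  then have "ln (2::real) \<in> {2 * (1/3) + 2 * (1/3)^3 / 3 + 2 * (1/3)^5 / 5 + 2 * (1/3)^7/7 + 2 * (1/3)^9/9 ..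
     2 * (1/3) + 2 * (1/3)^3 / 3 + 2 * (1/3)^5 / 5 + 2 * (1/3)^7/7 + 2 * (1/3)^9/9 + 2 * ((1/3)^11 / (1 - (1/3)^2) / 11)}"
    unfolding 5 by simp
  then show "69314/100000 < ln (2::real)" "ln (2::real) < 69315/100000"
    by (simp_all add: power_divide)
qed

lemma ln_ge_quadratic:
  fixes x :: real assumes "x \<ge> 0" shows "x - x^2/2 \<le> ln (1 + x)"
proof -
  have "(\<lambda>x. ln (1 + x) - (x - x^2/2)) 0 \<le> (\<lambda>x. ln (1 + x) - (x - x^2/2)) x"
  proof (rule DERIV_nonneg_imp_nondecreasing[OF assms])
    fix y :: real assume y: "0 \<le> y"
    have d: "((\<lambda>x. ln (1 + x) - (x - x^2/2)) has_real_derivative (1 / (1 + y) - (1 - y))) (at y)"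
      using y by (auto intro!: derivative_eq_intros)
    have "1 / (1 + y) - (1 - y) = y^2 / (1 + y)"
      using y by (simp add: field_simps power2_eq_square)
    then have "1 / (1 + y) - (1 - y) \<ge> 0" using y by simp
    with d show "\<exists>d. ((\<lambda>x. ln (1 + x) - (x - x^2/2)) has_real_derivative d) (at y) \<and> 0 \<le> d" by blast
  qed
  then show ?thesis by simp
qed

lemma ln_le_cubic:
  fixes x :: real assumes "x \<ge> 0" shows "ln (1 + x) \<le> x - x^2/2 + x^3/3"
proof -
  have "(\<lambda>x. (x - x^2/2 + x^3/3) - ln (1 + x)) 0 \<le> (\<lambda>x. (x - x^2/2 + x^3/3) - ln (1 + x)) x"
  proof (rule DERIV_nonneg_imp_nondecreasing[OF assms])
    fix y :: real assume y: "0 \<le> y"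
    have d: "((\<lambda>x. (x - x^2/2 + x^3/3) - ln (1 + x)) has_real_derivative ((1 - y + y^2) - 1 / (1 + y))) (at y)"
      using y by (auto intro!: derivative_eq_intros)
    have "(1 - y + y^2) - 1 / (1 + y) = y^3 / (1 + y)"
      using y by (simp add: field_simps power2_eq_square power3_eq_cube)
    then have "(1 - y + y^2) - 1 / (1 + y) \<ge> 0" using y by simp
    with d show "\<exists>d. ((\<lambda>x. (x - x^2/2 + x^3/3) - ln (1 + x)) has_real_derivative d) (at y) \<and> 0 \<le> d" by blast
  qed
  then show ?thesis by simp
qed

text \<open>The midpoint rule for 1/x on [k, k+1]: ln((k+1)/k) is twice the artanh of 1/(2k+1), the
  first term of that series is the midpoint value, and the remainder is relatively of order
  k^(-2).\<close>

lemma ln_Suc_ratio_bounds: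
  fixes k :: nat assumes "k \<ge> 1"
  shows "1 / (real k + 1/2) \<le> ln (real (Suc k)) - ln (real k)"
    and "ln (real (Suc k)) - ln (real k) \<le> 1 / (real k + 1/2) * (1 + 1 / (12 * (real k)^2))"
proof -
  define x where "x = (real k + 1) / real k"
  have k: "real k > 0" using assms by simp
  have x1: "x > 1" using k by (simp add: x_def field_simps)
  have y: "(x - 1) / (x + 1) = 1 / (2 * real k + 1)"
    using k by (simp add: x_def field_simps)
  have ln: "ln (real (Suc k)) - ln (real k) = ln x"
    using k by (simp add: x_def ln_div add.commute)
  have *: "ln x \<in> {(\<Sum>j<1. 2*((x-1)/(x+1))^(2*j+1) / of_nat (2*j+1)) ..
     (\<Sum>j<1. 2*((x-1)/(x+1))^(2*j+1) / of_nat (2*j+1)) + 2 * (((x-1)/(x+1))^(2*1+1) / (1 - ((x-1)/(x+1))^2) / of_nat (2*1+1))}"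
    by (rule ln_approx_bounds[OF x1])
  define z where "z = 1 / (2 * real k + 1)"
  have z: "0 < z" "z < 1" using k by (auto simp: z_def field_simps)
  have "2 * z \<le> ln x" "ln x \<le> 2 * z + 2 * (z^3 / (1 - z^2) / 3)"
    using * unfolding y z_def[symmetric] by simp_all
  moreover have "2 * z = 1 / (real k + 1/2)" by (simp add: z_def field_simps)
  moreover have "2 * (z^3 / (1 - z^2) / 3) \<le> 2 * z * (1 / (12 * (real k)^2))"
  proof -
    have "1 - z^2 = 4 * real k * (real k + 1) * z^2"
    proof -
      have "((2 * real k + 1) * z)^2 = 1" using k by (simp add: z_def)
      then show ?thesis by (simp add: power2_eq_square algebra_simps)
    qed
    then have "z^3 / (1 - z^2) = z / (4 * real k * (real k + 1))"
      using z by (simp add: power3_eq_cube power2_eq_square)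
    also have "\<dots> \<le> z / (4 * (real k)^2)"
      using k z by (intro divide_left_mono) (auto simp: power2_eq_square)
    finally have "2 / 3 * (z^3 / (1 - z^2)) \<le> 2 / 3 * (z / (4 * (real k)^2))" by (intro mult_left_mono) auto
    then show ?thesis by (simp add: ac_simps)
  qed
  ultimately show "1 / (real k + 1/2) \<le> ln (real (Suc k)) - ln (real k)"
    "ln (real (Suc k)) - ln (real k) \<le> 1 / (real k + 1/2) * (1 + 1 / (12 * (real k)^2))"
    unfolding ln by (simp_all add: distrib_left)
qed

text \<open>For a root with real part 1/2 the factors are k + 1/2 + i t, and expanding
  \<open>ln\<close> and \<open>arctan\<close> in powers of t/(k + 1/2) leaves these sums. They
  approximate the integrals of x^(-p) over [m, 2m], namely ln 2, 1/(2m), 3/(8 m^2) and 7/(24 m^3)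
  for p = 1, 2, 3, 4.\<close>

definition mid_sum :: "nat \<Rightarrow> nat \<Rightarrow> real" where
  "mid_sum m p = (\<Sum>k=m..<2*m. 1 / (real k + 1/2)^p)"

lemma mid_sum_1:
  assumes "m \<ge> 1"
  shows "mid_sum m 1 \<le> ln 2" "ln 2 * (1 - 1 / (12 * (real m)^2)) \<le> mid_sum m 1"
proof -
  have tel: "(\<Sum>k=m..<2*m. ln (real (Suc k)) - ln (real k)) = ln 2"
    using assms by (subst sum_Suc_diff') (auto simp: ln_mult)
  show "mid_sum m 1 \<le> ln 2"
    unfolding tel[symmetric] mid_sum_def power_one_right
    by (intro sum_mono ln_Suc_ratio_bounds) (use assms in auto)
  have "ln 2 * (1 - 1 / (12 * (real m)^2)) = (\<Sum>k=m..<2*m. (ln (real (Suc k)) - ln (real k)) * (1 - 1 / (12 * (real m)^2)))"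
    by (simp only: sum_distrib_right[symmetric] tel)
  also have "\<dots> \<le> mid_sum m 1"
    unfolding mid_sum_def power_one_right
  proof (rule sum_mono)
    fix k assume "k \<in> {m..<2*m}"
    then have km: "k \<ge> m" "k \<ge> 1" using assms by auto
    define e where "e = 1 / (12 * (real m)^2)"
    have "1 \<le> (real m)^2" using assms by (intro one_le_power) simp
    then have e: "0 \<le> e" "e \<le> 1" by (auto simp: e_def divide_le_eq)
    have "1 / (12 * (real k)^2) \<le> e" unfolding e_def
      using km assms by (intro divide_left_mono) (auto intro!: power_mono)
    then have "1 / (real k + 1/2) * (1 + 1 / (12 * (real k)^2)) \<le> 1 / (real k + 1/2) * (1 + e)"
      by (intro mult_left_mono) auto
    with ln_Suc_ratio_bounds(2)[OF km(2)]
    have "ln (real (Suc k)) - ln (real k) \<le> 1 / (real k + 1/2) * (1 + e)" by linarith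
    \<comment> \<open>Multiplying by \<open>1 - e\<close> turns the factor \<open>1 + e\<close> of
      the upper bound into \<open>1 - e^2\<close>, which is at most 1; this converts it into a lower
      bound for the midpoint value.\<close>
    then have "(ln (real (Suc k)) - ln (real k)) * (1 - e) \<le> (1 / (real k + 1/2) * (1 + e)) * (1 - e)"
      using e by (intro mult_right_mono) auto
    also have "\<dots> = 1 / (real k + 1/2) * (1 - e^2)" by (simp add: field_simps power2_eq_square)
    also have "\<dots> \<le> 1 / (real k + 1/2) * 1" by (intro mult_left_mono) auto
    finally show "(ln (real (Suc k)) - ln (real k)) * (1 - 1 / (12 * (real m)^2)) \<le> 1 / (real k + 1/2)"
      by (simp add: e_def)
  qed
  finally show "ln 2 * (1 - 1 / (12 * (real m)^2)) \<le> mid_sum m 1" .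
qed

text \<open>The terms 1/(k(k+1)) telescope, and k(k+1) = (k + 1/2)^2 - 1/4 gives the comparison with
  the midpoint terms in both directions.\<close>

lemma mid_sum_2:
  assumes "m \<ge> 1"
  shows "mid_sum m 2 \<le> 1 / (2 * real m)" "1 / (2 * real m) * (1 - 1 / (4 * (real m)^2)) \<le> mid_sum m 2"
proof -
  have tel: "(\<Sum>k=m..<2*m. - 1 / real (Suc k) - (- 1 / real k)) = 1 / (2 * real m)"
    using assms by (subst sum_Suc_diff') (auto simp: field_simps)
  have eq: "- 1 / real (Suc k) - (- 1 / real k) = 1 / (real k * (real k + 1))" if "k \<in> {m..<2*m}" for k
    using that assms by (simp add: field_simps)
  show "mid_sum m 2 \<le> 1 / (2 * real m)"
    unfolding tel[symmetric] mid_sum_def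
  proof (rule sum_mono)
    fix k assume k: "k \<in> {m..<2*m}"
    then show "1 / (real k + 1/2)^2 \<le> - 1 / real (Suc k) - (- 1 / real k)"
      unfolding eq[OF k] using assms by (intro divide_left_mono mult_pos_pos zero_less_power) (auto simp: power2_eq_square algebra_simps)
  qed
  have "1 / (2 * real m) * (1 - 1 / (4 * (real m)^2)) = (\<Sum>k=m..<2*m. (- 1 / real (Suc k) - (- 1 / real k)) * (1 - 1 / (4 * (real m)^2)))"
    by (simp only: sum_distrib_right[symmetric] tel)
  also have "\<dots> \<le> mid_sum m 2" unfolding mid_sum_def
  proof (rule sum_mono)
    fix k assume k: "k \<in> {m..<2*m}"
    have kp: "real k > 0" "real m > 0" "real k \<ge> real m" using k assms by auto
    have "1 / (4 * (real k + 1/2)^2) \<le> 1 / (4 * (real m)^2)"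
      using kp by (intro divide_left_mono mult_left_mono power_mono) auto
    then have "(1 / (real k * (real k + 1))) * (1 - 1 / (4 * (real m)^2)) \<le> (1 / (real k * (real k + 1))) * (1 - 1 / (4 * (real k + 1/2)^2))"
      using kp by (intro mult_left_mono) auto
    also have "\<dots> = 1 / (real k + 1/2)^2"
    proof -
      have "1 - 1 / (4 * (real k + 1/2)^2) = (real k * (real k + 1)) / (real k + 1/2)^2"
      proof -
        have "1 - 1 / (4 * w) = (w - 1/4) / w" if "w > 0" for w :: real
          using that by (simp add: field_simps)
        moreover have "(real k + 1/2)^2 - 1/4 = real k * (real k + 1)"
          by (simp add: power2_eq_square algebra_simps)
        moreover have "(real k + 1/2)^2 > 0" using kp by (intro zero_less_power) auto
        ultimately show ?thesis by metis
      qed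
      then show ?thesis using kp by simp
    qed
    finally show "(- 1 / real (Suc k) - (- 1 / real k)) * (1 - 1 / (4 * (real m)^2)) \<le> 1 / (real k + 1/2)^2"
      unfolding eq[OF k] .
  qed
  finally show "1 / (2 * real m) * (1 - 1 / (4 * (real m)^2)) \<le> mid_sum m 2" .
qed

text \<open>By convexity the midpoint value is below the integral over [k, k+1], here in algebraic
  form through k(k+1) <= (k + 1/2)^2. Orders three and four are correction terms, always with the
  sign for which an upper bound is what counts.\<close>

lemma mid_sum_3:
  assumes "m \<ge> 1"
  shows "mid_sum m 3 \<le> 3 / (8 * (real m)^2)"
proof -
  have tel: "(\<Sum>k=m..<2*m. - 1 / (2 * real (Suc k)^2) - (- 1 / (2 * real k ^ 2))) = 3 / (8 * (real m)^2)"
    using assms by (subst sum_Suc_diff') (auto simp: field_simps power2_eq_square)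
  show ?thesis unfolding tel[symmetric] mid_sum_def
  proof (rule sum_mono)
    fix k assume k: "k \<in> {m..<2*m}"
    have kp: "real k > 0" using k assms by auto
    have "- 1 / (2 * real (Suc k)^2) - (- 1 / (2 * real k ^ 2)) = (real k + 1/2) / (real k * (real k + 1))^2"
    proof -
      have "- 1 / (2 * b^2) - (- 1 / (2 * a^2)) = (b^2 - a^2) / (2 * (a * b)^2)" if "a > 0" "b > 0" for a b :: real
        using that by (simp add: field_simps)
      from this[of "real k" "real (Suc k)"] kp show ?thesis
        by (simp add: power2_eq_square field_simps)
    qed
    also have "(real k + 1/2) / (real k * (real k + 1))^2 \<ge> (real k + 1/2) / ((real k + 1/2)^2)^2"
      using kp by (intro divide_left_mono power_mono mult_pos_pos zero_less_power) (auto simp: power2_eq_square algebra_simps)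
    also have "(real k + 1/2) / ((real k + 1/2)^2)^2 = 1 / (real k + 1/2)^3"
      using kp by (simp add: power3_eq_cube power2_eq_square)
    finally show "1 / (real k + 1/2)^3 \<le> - 1 / (2 * real (Suc k)^2) - (- 1 / (2 * real k ^ 2))" .
  qed
qed

lemma mid_sum_4:
  assumes "m \<ge> 1"
  shows "mid_sum m 4 \<le> 7 / (24 * (real m)^3)"
proof -
  have tel: "(\<Sum>k=m..<2*m. - 1 / (3 * real (Suc k)^3) - (- 1 / (3 * real k ^ 3))) = 7 / (24 * (real m)^3)"
    using assms by (subst sum_Suc_diff') (auto simp: field_simps power3_eq_cube)
  show ?thesis unfolding tel[symmetric] mid_sum_def
  proof (rule sum_mono)
    fix k assume k: "k \<in> {m..<2*m}"
    have kp: "real k > 0" using k assms by auto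
    have "- 1 / (3 * real (Suc k)^3) - (- 1 / (3 * real k ^ 3)) = (real k * (real k + 1) + 1/3) / (real k * (real k + 1))^3"
    proof -
      have *: "- 1 / (3 * b^3) - (- 1 / (3 * a^3)) = (b^3 - a^3) / 3 / (a * b)^3" if "a > 0" "b > 0" for a b :: real
        using that by (simp add: field_simps)
      have "((real (Suc k))^3 - (real k)^3) / 3 = real k * (real k + 1) + 1/3"
        by (simp add: power3_eq_cube algebra_simps)
      moreover have "real k * real (Suc k) = real k * (real k + 1)" by simp
      ultimately show ?thesis
        using *[of "real k" "real (Suc k)"] kp by (simp only: of_nat_0_less_iff zero_less_Suc simp_thms)
    qed
    also have "\<dots> \<ge> (real k * (real k + 1)) / (real k * (real k + 1))^3"
      using kp by (intro divide_right_mono) auto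
    also have "(real k * (real k + 1)) / (real k * (real k + 1))^3 = 1 / (real k * (real k + 1))^2"
      using kp by (simp add: power3_eq_cube power2_eq_square)
    also have "\<dots> \<ge> 1 / ((real k + 1/2)^2)^2"
      using kp by (intro divide_left_mono power_mono mult_pos_pos zero_less_power) (auto simp: power2_eq_square algebra_simps)
    also have "1 / ((real k + 1/2)^2)^2 = 1 / (real k + 1/2)^4" by simp
    finally show "1 / (real k + 1/2)^4 \<le> - 1 / (3 * real (Suc k)^3) - (- 1 / (3 * real k ^ 3))" .
  qed
qed

lemma ln_ratio_half:
  "ln ((real k + 1) / (real k + 1/2)) = ln (1 + 1 / (2 * (real k + 1/2)))"
  by (rule arg_cong[of _ _ ln]) (simp add: field_simps)

text \<open>The line \<open>27/20 m + 5/2\<close> lies above the square of the solution \<open>t\<close> of the modulus condition for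
  \<open>2 \<le> m \<le> 59\<close>, and is close enough to it at \<open>m = 59\<close>; \<open>90637/10000\<close> exceeds \<open>sqrt (27/20 \<cdot> 59 + 5/2)\<close>.\<close>

lemma sum_arctan_less_2pi:
  fixes t :: real
  assumes m: "2 \<le> m" "m \<le> 59" and t: "t \<ge> 0"
    and le: "(\<Sum>k=m..<2*m. ln (1 + t^2 / (real k + 1/2)^2) / 2) \<le> (\<Sum>k=m..<2*m. ln ((real k + 1) / (real k + 1/2)))"
  shows "(\<Sum>k=m..<2*m. arctan (t / (real k + 1/2))) < 2 * pi"
proof -
  define s where "s = 27/20 * real m + 5/2"
  have s0: "s \<ge> 0" by (simp add: s_def)
  have "(\<Sum>k=m..<2*m. ln ((real k + 1) / (real k + 1/2))) \<le> (\<Sum>k=m..<2*m. 1/2 * (1 / (real k + 1/2)^1) - 1/8 * (1 / (real k + 1/2)^2) + 1/24 * (1 / (real k + 1/2)^3))"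
  proof (rule sum_mono)
    fix k
    show "ln ((real k + 1) / (real k + 1/2)) \<le> 1/2 * (1 / (real k + 1/2)^1) - 1/8 * (1 / (real k + 1/2)^2) + 1/24 * (1 / (real k + 1/2)^3)"
    proof -
      define w where "w = 1 / (real k + 1/2)"
      have "w \<ge> 0" "1 / (2 * (real k + 1/2)) = w / 2" by (auto simp: w_def field_simps)
      then have "ln (1 + w/2) \<le> w/2 - (w/2)^2/2 + (w/2)^3/3" by (intro ln_le_cubic) auto
      then have "ln (1 + w/2) \<le> 1/2 * w^1 - 1/8 * w^2 + 1/24 * w^3"
        by (simp add: power_divide)
      then show ?thesis
        unfolding ln_ratio_half \<open>1 / (2 * (real k + 1/2)) = w / 2\<close> by (simp add: w_def power_one_over)
    qed
  qed
  also have "\<dots> = 1/2 * mid_sum m 1 - 1/8 * mid_sum m 2 + 1/24 * mid_sum m 3"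
    by (simp add: mid_sum_def sum.distrib sum_subtractf sum_distrib_left)
  also have "\<dots> \<le> 1/2 * (69315/100000) - 1/8 * (1 / (2 * real m) * (1 - 1 / (4 * (real m)^2))) + 1/24 * (3 / (8 * (real m)^2))"
    using mid_sum_1[of m] mid_sum_2[of m] mid_sum_3[of m] ln2_bounds m
    by (intro add_mono diff_mono mult_left_mono) auto
  also have "\<dots> < 1/2 * s * (1 / (2 * real m) * (1 - 1 / (4 * (real m)^2))) - 1/4 * s^2 * (7 / (24 * (real m)^3))"
  proof -
    \<comment> \<open>In terms of u = 1/m the inequality between the two expansions becomes
      positivity of a cubic polynomial on [1/59, 1/2].\<close>
    define u where "u = 1 / real m"
    have u: "1/59 \<le> u" "u \<le> 1/2" using m by (auto simp: u_def field_simps)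
    \<comment> \<open>A convex function lies below its chord: \<open>u^2\<close> is replaced by a
      linear function on [1/59, 1/2] and \<open>u^3\<close> by \<open>u^2 / 2\<close>, so that
      linear arithmetic finishes. The tight end is u = 1/59.\<close>
    have "(u - 1/59) * (1/2 - u) \<ge> 0" using u by simp
    moreover have "(u - 1/59) * (1/2 - u) = (1/59 + 1/2) * u - 1/118 - u^2" by (simp add: power2_eq_square field_simps)
    ultimately have u2: "u^2 \<le> (1/59 + 1/2) * u - 1/118" by linarith
    have u3: "u^3 \<le> u^2 / 2" using mult_left_mono[OF u(2), of "u^2"] by (simp add: power3_eq_cube power2_eq_square)
    have s_u: "s = (27/20 + 5/2 * u) / u" "real m = 1 / u" using m by (auto simp: s_def u_def field_simps)
    have eq: "1/2 * s * (1 / (2 * real m) * (1 - 1 / (4 * (real m)^2))) - 1/4 * s^2 * (7 / (24 * (real m)^3))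
       = (27/20 + 5/2 * u) / 4 * (1 - u^2/4) - 7/96 * u * (27/20 + 5/2 * u)^2"
      using u unfolding s_u by (simp add: power2_eq_square power3_eq_cube field_simps)
    have eq': "1/2 * (69315/100000) - 1/8 * (1 / (2 * real m) * (1 - 1 / (4 * (real m)^2))) + 1/24 * (3 / (8 * (real m)^2))
       = 1/2 * (69315/100000) - u/16 * (1 - u^2/4) + u^2/64"
      using u unfolding s_u by (simp add: power2_eq_square field_simps)
    have "(27/20 + 5/2 * u) / 4 * (1 - u^2/4) - 7/96 * u * (27/20 + 5/2 * u)^2 -
        (1/2 * (69315/100000) - u/16 * (1 - u^2/4) + u^2/64) =
       (-363/40000) + (7099/12800) * u + (-379/640) * u^2 + (-241/384) * u^3"
      by (simp add: power2_eq_square power3_eq_cube field_simps)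
    moreover have "0 < (-363/40000) + (7099/12800) * x + (-379/640) * y + (-241/384) * z"
      if "1/59 \<le> x" "x \<le> 1/2" "y \<le> (1/59 + 1/2) * x - 1/118" "z \<le> y / 2" for x y z :: real
      using that by simp
    from this[OF u u2 u3] have "0 < (-363/40000) + (7099/12800) * u + (-379/640) * u^2 + (-241/384) * u^3" .
    ultimately show ?thesis unfolding eq eq' by simp
  qed
  also have "\<dots> \<le> 1/2 * s * mid_sum m 2 - 1/4 * s^2 * mid_sum m 4"
    using mid_sum_2[of m] mid_sum_4[of m] m s0 by (intro diff_mono mult_left_mono) auto
  also have "\<dots> = (\<Sum>k=m..<2*m. 1/2 * s * (1 / (real k + 1/2)^2) - 1/4 * s^2 * (1 / (real k + 1/2)^4))"
    by (simp add: mid_sum_def sum_subtractf sum_distrib_left)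
  also have "\<dots> \<le> (\<Sum>k=m..<2*m. ln (1 + s / (real k + 1/2)^2) / 2)"
  proof (rule sum_mono)
    fix k
    have "(s / (real k + 1/2)^2) - (s / (real k + 1/2)^2)^2 / 2 \<le> ln (1 + s / (real k + 1/2)^2)"
      by (rule ln_ge_quadratic) (use s0 in auto)
    moreover have "((real k + 1/2)^2)^2 = (real k + 1/2)^4" by simp
    ultimately show "1/2 * s * (1 / (real k + 1/2)^2) - 1/4 * s^2 * (1 / (real k + 1/2)^4) \<le> ln (1 + s / (real k + 1/2)^2) / 2"
      by (simp add: power_divide)
  qed
  finally have lt: "(\<Sum>k=m..<2*m. ln ((real k + 1) / (real k + 1/2))) < (\<Sum>k=m..<2*m. ln (1 + s / (real k + 1/2)^2) / 2)" .
  have "t^2 < s"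
  proof (rule ccontr)
    assume "\<not> t^2 < s"
    then have "(\<Sum>k=m..<2*m. ln (1 + s / (real k + 1/2)^2) / 2) \<le> (\<Sum>k=m..<2*m. ln (1 + t^2 / (real k + 1/2)^2) / 2)"
      using s0 by (intro sum_mono divide_right_mono ln_mono add_left_mono) (auto intro!: add_pos_nonneg)
    with lt le show False by linarith
  qed
  also have "s \<le> 8215/100" using m by (simp add: s_def)
  also have "\<dots> < (90637/10000)^2" by (simp add: power2_eq_square)
  finally have t9: "t < 90637/10000" by (rule power_less_imp_less_base) simp
  have "(\<Sum>k=m..<2*m. arctan (t / (real k + 1/2))) \<le> (\<Sum>k=m..<2*m. t * (1 / (real k + 1/2)^1))"
    by (intro sum_mono) (use t arctan_le_self in auto)
  also have "\<dots> = t * mid_sum m 1" by (simp add: mid_sum_def sum_distrib_left)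
  also have "\<dots> \<le> 90637/10000 * (69315/100000)"
    using mid_sum_1[of m] m t t9 ln2_bounds by (intro mult_mono) (auto simp: mid_sum_def intro!: sum_nonneg)
  also have "\<dots> < 2 * pi" using pi_bounds by simp
  finally show ?thesis .
qed

text \<open>The constant \<open>9.105\<close> lies between \<open>2\<pi> / ln 2\<close> and the solution \<open>t\<close> of the modulus condition for
  \<open>m = 60\<close>, with room for the error terms on both sides.\<close>

lemma sum_arctan_greater_2pi:
  fixes t :: real
  assumes m: "m \<ge> 60" and t: "t \<ge> 0"
    and ge: "(\<Sum>k=m..<2*m. ln ((real k + 1) / (real k + 1/2))) \<le> (\<Sum>k=m..<2*m. ln (1 + t^2 / (real k + 1/2)^2) / 2)"
  shows "2 * pi < (\<Sum>k=m..<2*m. arctan (t / (real k + 1/2)))"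
proof -
  define u :: real where "u = 1 / real m"
  have u: "0 < u" "u \<le> 1/60" using m by (auto simp: u_def field_simps)
  have u2: "u^2 \<le> 1/3600" using power_mono[OF u(2), of 2] u by (simp add: power2_eq_square)
  have mu: "1 / (2 * real m) = u / 2" "1 / (12 * (real m)^2) = u^2 / 12" "3 / (8 * (real m)^2) = 3/8 * u^2"
    by (auto simp: u_def power_divide)
  have t9: "t \<ge> 9105/1000"
  proof (rule ccontr)
    assume "\<not> 9105/1000 \<le> t"
    then have tt: "t^2 \<le> 82901025/1000000" using power_mono[of t "9105/1000" 2] t by (simp add: power2_eq_square)
    have "(\<Sum>k=m..<2*m. ln (1 + t^2 / (real k + 1/2)^2) / 2) \<le> (\<Sum>k=m..<2*m. t^2 / 2 * (1 / (real k + 1/2)^2))"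
    proof (rule sum_mono)
      fix k
      show "ln (1 + t^2 / (real k + 1/2)^2) / 2 \<le> t^2 / 2 * (1 / (real k + 1/2)^2)"
        using ln_add_one_self_le_self[of "t^2 / (real k + 1/2)^2"] by simp
    qed
    also have "\<dots> = t^2 / 2 * mid_sum m 2" by (simp add: mid_sum_def sum_distrib_left)
    also have "\<dots> \<le> (82901025/1000000) / 2 * (u / 2)"
      using mid_sum_2[of m] m tt u unfolding mu by (intro mult_mono) (auto simp: mid_sum_def intro!: sum_nonneg)
    \<comment> \<open>The binding case is u = 1/60, where the two sides differ by about
      10^(-4).\<close>
    also have "\<dots> < 1/2 * (69314/100000 * (1 - u^2/12)) - 1/8 * (u / 2)"
      using u u2 by (simp add: field_simps)
    also have "\<dots> \<le> 1/2 * mid_sum m 1 - 1/8 * mid_sum m 2"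
    proof -
      have "69314/100000 * (1 - u^2/12) \<le> ln 2 * (1 - u^2/12)" using ln2_bounds u2 by (intro mult_right_mono) auto
      also have "\<dots> \<le> mid_sum m 1" using mid_sum_1[of m] m unfolding mu by simp
      finally show ?thesis using mid_sum_2[of m] m unfolding mu by (intro diff_mono mult_left_mono) auto
    qed
    also have "\<dots> = (\<Sum>k=m..<2*m. 1/2 * (1 / (real k + 1/2)^1) - 1/8 * (1 / (real k + 1/2)^2))"
      by (simp add: mid_sum_def sum_subtractf sum_distrib_left)
    also have "\<dots> \<le> (\<Sum>k=m..<2*m. ln ((real k + 1) / (real k + 1/2)))"
    proof (rule sum_mono)
      fix k
      show "1/2 * (1 / (real k + 1/2)^1) - 1/8 * (1 / (real k + 1/2)^2) \<le> ln ((real k + 1) / (real k + 1/2))"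
      proof -
        define w where "w = 1 / (real k + 1/2)"
        have "w \<ge> 0" "1 / (2 * (real k + 1/2)) = w / 2" by (auto simp: w_def field_simps)
        then have "w/2 - (w/2)^2/2 \<le> ln (1 + w/2)" by (intro ln_ge_quadratic) auto
        then have "1/2 * w^1 - 1/8 * w^2 \<le> ln (1 + w/2)"
          by (simp add: power_divide)
        then show ?thesis
          unfolding ln_ratio_half \<open>1 / (2 * (real k + 1/2)) = w / 2\<close> by (simp add: w_def power_one_over)
      qed
    qed
    finally show False using ge by linarith
  qed
  have "2 * pi < 2 * (31418/10000)" using pi_bounds by simp
  also have "\<dots> < 9105/1000 * (69314/100000 * (1 - u^2/12)) - 1/3 * (9105/1000)^3 * (3/8 * u^2)"
    using u2 by (simp add: power3_eq_cube field_simps)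
  also have "\<dots> \<le> 9105/1000 * mid_sum m 1 - 1/3 * (9105/1000)^3 * mid_sum m 3"
  proof -
    have "69314/100000 * (1 - u^2/12) \<le> ln 2 * (1 - u^2/12)" using ln2_bounds u2 by (intro mult_right_mono) auto
    also have "\<dots> \<le> mid_sum m 1" using mid_sum_1[of m] m unfolding mu by simp
    finally show ?thesis using mid_sum_3[of m] m unfolding mu by (intro diff_mono mult_left_mono) auto
  qed
  also have "\<dots> = (\<Sum>k=m..<2*m. 9105/1000 * (1 / (real k + 1/2)^1) - 1/3 * (9105/1000)^3 * (1 / (real k + 1/2)^3))"
    by (simp add: mid_sum_def sum_subtractf sum_distrib_left)
  also have "\<dots> \<le> (\<Sum>k=m..<2*m. arctan (t / (real k + 1/2)))"
  proof (rule sum_mono)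
    fix k
    have "a * (1 / x^1) - 1/3 * a^3 * (1 / x^3) = a / x - (a / x)^3 / 3" for a x :: real
      by (simp add: power_divide)
    then have "9105/1000 * (1 / (real k + 1/2)^1) - 1/3 * (9105/1000)^3 * (1 / (real k + 1/2)^3)
        = ((9105/1000) / (real k + 1/2)) - ((9105/1000) / (real k + 1/2))^3 / 3" .
    also have "\<dots> \<le> arctan ((9105/1000) / (real k + 1/2))" by (rule arctan_ge_cubic) simp
    also have "\<dots> \<le> arctan (t / (real k + 1/2))" using t9 by (intro arctan_monotone' divide_right_mono) auto
    finally show "9105/1000 * (1 / (real k + 1/2)^1) - 1/3 * (9105/1000)^3 * (1 / (real k + 1/2)^3) \<le> arctan (t / (real k + 1/2))" .
  qed
  finally show ?thesis .
qed

section \<open>Moduli and arguments of the roots\<close>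

lemma prod_strict_mono_one:
  fixes f g :: "'b \<Rightarrow> real"
  assumes "\<And>k. k \<in> A \<Longrightarrow> 0 < f k \<and> f k \<le> g k" "f i < g i" "i \<in> A" "finite A"
  shows "prod f A < prod g A"
proof -
  have "f i * prod f (A - {i}) < g i * prod g (A - {i})"
    using assms by (intro mult_less_le_imp_less prod_mono prod_pos) (auto intro: less_imp_le)
  then show ?thesis using assms by (simp add: prod.remove)
qed

lemma prod_Suc_fact:
  assumes "m \<le> n" shows "fact m * (\<Prod>k=m..<n. of_nat k + 1) = (fact n :: 'a::field_char_0)"
  using assms
proof (induction n rule: dec_induct)
  case (step n) then show ?case by (simp add: algebra_simps)
qed simp

lemma fact_ratio_prod: "fact (2*m) / fact m = (\<Prod>k=m..<2*m. of_nat k + 1 :: 'a::field_char_0)"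
  using prod_Suc_fact[of m "2*m", where 'a='a] by (simp add: field_simps)

text \<open>Since (2m)!/m! is the product of the k + 1 for m <= k < 2m, the roots are the points
  where the product of the z + k takes the value it has at z = 1. All later comparisons are made
  factor by factor with the root 1.\<close>

lemma chi_roots_iff:
  assumes "m \<ge> 1"
  shows "z \<in> chi_roots m \<longleftrightarrow> (\<Prod>k=m..<2*m. z + of_nat k) = (\<Prod>k=m..<2*m. of_nat k + 1)"
proof -
  have "{m..2*m-1} = {m..<2*m}" using assms by auto
  then show ?thesis
    unfolding chi_roots_def chi_def fact_ratio_prod by (simp add: poly_prod add.commute)
qed

lemma root_norm_prod:
  assumes "m \<ge> 1" "z \<in> chi_roots m"
  shows "(\<Prod>k=m..<2*m. cmod (z + of_nat k)) = (\<Prod>k=m..<2*m. real k + 1)"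
proof -
  have "cmod (\<Prod>k=m..<2*m. z + of_nat k) = cmod (\<Prod>k=m..<2*m. of_nat k + 1)"
    using assms chi_roots_iff by metis
  moreover have "cmod (of_nat k + 1) = real k + 1" for k
    by (metis norm_of_nat of_nat_Suc add.commute)
  ultimately show ?thesis by (simp add: prod_norm[symmetric])
qed

lemma root_plus_nonzero:
  assumes "m \<ge> 1" "z \<in> chi_roots m" "k \<in> {m..<2*m}"
  shows "z + of_nat k \<noteq> 0"
proof
  assume "z + of_nat k = 0"
  then have "(\<Prod>k=m..<2*m. z + of_nat k) = 0" using assms(3) by (intro prod_zero) auto
  moreover have "(\<Prod>k=m..<2*m. of_nat k + 1 :: complex) \<noteq> 0"
    by (simp flip: of_nat_Suc add: add.commute del: of_nat_Suc)
  ultimately show False using chi_roots_iff[OF assms(1), of z] assms(2) by argo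
qed

lemma one_in_chi_roots: "m \<ge> 1 \<Longrightarrow> 1 \<in> chi_roots m"
  by (simp add: chi_roots_iff add.commute)

lemma cnj_in_chi_roots:
  assumes "m \<ge> 1" "z \<in> chi_roots m" shows "cnj z \<in> chi_roots m"
proof -
  have "cnj (\<Prod>k=m..<2*m. z + of_nat k) = cnj (\<Prod>k=m..<2*m. of_nat k + 1)"
    using assms chi_roots_iff by metis
  then show ?thesis using assms(1) by (simp add: chi_roots_iff)
qed

lemma cmod_plus_nat: "cmod (z + of_nat k) = sqrt ((Re z + real k)^2 + (Im z)^2)"
  by (simp add: cmod_def)

text \<open>Otherwise every factor would have modulus at least k + 1, and the factor at k = m a
  strictly larger one.\<close>

lemma root_Re_less_1:
  assumes "m \<ge> 1" "z \<in> chi_roots m" "z \<noteq> 1" shows "Re z < 1"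
proof (rule ccontr)
  assume "\<not> Re z < 1"
  then have a: "Re z \<ge> 1" by simp
  have "(\<Prod>k=m..<2*m. real k + 1) < (\<Prod>k=m..<2*m. cmod (z + of_nat k))"
  proof (rule prod_strict_mono_one[where i=m])
    fix k
    show "0 < real k + 1 \<and> real k + 1 \<le> cmod (z + of_nat k)"
      using a complex_Re_le_cmod[of "z + of_nat k"] by simp
  next
    show "real m + 1 < cmod (z + of_nat m)"
    proof (cases "Re z = 1")
      case True
      with assms(3) have "Im z \<noteq> 0" by (simp add: complex_eq_iff)
      then have "sqrt ((real m + 1)^2) < cmod (z + of_nat m)" unfolding cmod_plus_nat True
        by (intro real_sqrt_less_mono) (simp add: add.commute)
      then show ?thesis by simp
    next
      case False
      with a complex_Re_le_cmod[of "z + of_nat m"] show ?thesis by simp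
    qed
  qed (use assms in auto)
  with root_norm_prod[OF assms(1,2)] show False by simp
qed

text \<open>At a fixed real part, of either sign, each modulus increases with the square of the
  imaginary part, so the modulus condition determines that square.\<close>

lemma roots_same_Re:
  assumes "m \<ge> 1" "z \<in> chi_roots m" "w \<in> chi_roots m" "Re z = Re w"
  shows "w = z \<or> w = cnj z"
proof -
  have *: False if zw: "z \<in> chi_roots m" "w \<in> chi_roots m" "Re z = Re w" "(Im z)^2 < (Im w)^2" for z w
  proof -
    have "(\<Prod>k=m..<2*m. cmod (z + of_nat k)) < (\<Prod>k=m..<2*m. cmod (w + of_nat k))"
    proof (rule prod_strict_mono_one[where i=m])
      fix k assume "k \<in> {m..<2*m}"
      then show "0 < cmod (z + of_nat k) \<and> cmod (z + of_nat k) \<le> cmod (w + of_nat k)"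
        using root_plus_nonzero[OF assms(1) zw(1)] zw(3,4) unfolding zero_less_norm_iff
        by (auto simp: cmod_plus_nat)
    next
      show "cmod (z + of_nat m) < cmod (w + of_nat m)"
        using zw unfolding cmod_plus_nat by (intro real_sqrt_less_mono) simp
    qed (use assms in auto)
    then show False using root_norm_prod[OF assms(1)] zw by simp
  qed
  have "(Im z)^2 = (Im w)^2" using *[of z w] *[of w z] assms by (metis linorder_neqE_linordered_idom)
  then show ?thesis using assms(4) by (auto simp: power2_eq_iff complex_eq_iff)
qed

lemma polar_form:
  fixes x t :: real assumes "x > 0"
  shows "Complex x t = of_real (sqrt (x^2 + t^2)) * cis (arctan (t / x))"
proof -
  have "sqrt (x^2 + t^2) = x * sqrt (1 + (t/x)^2)"
  proof -
    have "x^2 + t^2 = x^2 * (1 + (t/x)^2)" using assms by (simp add: field_simps)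
    then show ?thesis using assms by (simp add: real_sqrt_mult)
  qed
  moreover have "sqrt (1 + (t/x)^2) > 0" by (intro real_sqrt_gt_zero add_pos_nonneg) auto
  ultimately show ?thesis using assms
    by (simp add: complex_eq_iff cos_arctan sin_arctan)
qed

lemma prod_polar:
  assumes "a > 0" "m \<ge> 1"
  shows "(\<Prod>k=m..<2*m. Complex a t + of_nat k) =
    of_real (\<Prod>k=m..<2*m. sqrt ((a + real k)^2 + t^2)) * cis (\<Sum>k=m..<2*m. arctan (t / (a + real k)))"
proof -
  have "(\<Prod>k=m..<2*m. Complex a t + of_nat k) = (\<Prod>k=m..<2*m. of_real (sqrt ((a + real k)^2 + t^2)) * cis (arctan (t / (a + real k))))"
  proof (rule prod.cong[OF refl])
    fix k
    have "Complex a t + of_nat k = Complex (a + real k) t" by (simp add: complex_eq_iff)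
    then show "Complex a t + of_nat k = of_real (sqrt ((a + real k)^2 + t^2)) * cis (arctan (t / (a + real k)))"
      using polar_form[of "a + real k" t] assms by simp
  qed
  then show ?thesis by (simp add: prod.distrib cis_conv_exp exp_sum sum_distrib_left)
qed

text \<open>Factoring out (k + 1/2)^2 puts the modulus condition at real part 1/2 into the form in
  which the numerical lemmas on \<open>arctan\<close> sums state it.\<close>

lemma sum_ln_half:
  fixes t :: real
  shows "(\<Sum>k=m..<2*m. ln ((1/2 + real k)^2 + t^2) / 2) - (\<Sum>k=m..<2*m. ln (real k + 1)) =
    (\<Sum>k=m..<2*m. ln (1 + t^2 / (real k + 1/2)^2) / 2) - (\<Sum>k=m..<2*m. ln ((real k + 1) / (real k + 1/2)))"
  unfolding sum_subtractf[symmetric]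
proof (rule sum.cong[OF refl])
  fix k :: nat
  have h: "(real k + 1/2)^2 > 0" by (intro zero_less_power) auto
  have "ln ((1/2 + real k)^2 + t^2) = ln ((real k + 1/2)^2 * (1 + t^2 / (real k + 1/2)^2))"
    using h by (intro arg_cong[of _ _ ln]) (simp add: field_simps)
  also have "\<dots> = ln ((real k + 1/2)^2) + ln (1 + t^2 / (real k + 1/2)^2)"
    using h by (intro ln_mult_pos) (auto intro!: add_pos_nonneg)
  also have "ln ((real k + 1/2)^2) = 2 * ln (real k + 1/2)" by (simp add: ln_realpow)
  finally show "ln ((1/2 + real k)^2 + t^2) / 2 - ln (real k + 1) =
    ln (1 + t^2 / (real k + 1/2)^2) / 2 - ln ((real k + 1) / (real k + 1/2))"
    by (simp add: ln_div)
qed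

text \<open>After reflection into the upper half plane the total argument is a positive multiple of
  2 pi. A real root is excluded beforehand: below 1 all its factors would be too small.\<close>

lemma root_Re_less_half:
  assumes m: "2 \<le> m" "m \<le> 59" and z: "z \<in> chi_roots m" "z \<noteq> 1"
  shows "Re z < 1/2"
proof (rule ccontr)
  assume "\<not> Re z < 1/2"
  define w where "w = Complex (Re z) \<bar>Im z\<bar>"
  have "w = z \<or> w = cnj z" by (auto simp: w_def complex_eq_iff abs_if)
  then have w: "w \<in> chi_roots m" using cnj_in_chi_roots[of m z] z m by auto
  define a t where "a = Re z" and "t = \<bar>Im z\<bar>"
  have a: "a \<ge> 1/2" using \<open>\<not> Re z < 1/2\<close> by (simp add: a_def)
  have w_at: "w = Complex a t" by (simp add: w_def a_def t_def)
  have t: "t > 0"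
  proof (rule ccontr)
    assume "\<not> t > 0"
    then have "z = cnj z" by (auto simp: t_def complex_eq_iff)
    have "Re z < 1" using root_Re_less_1[of m z] z m by auto
    have "(\<Prod>k=m..<2*m. cmod (z + of_nat k)) < (\<Prod>k=m..<2*m. real k + 1)"
    proof (rule prod_strict_mono_one[where i=m])
      fix k
      have "cmod (z + of_nat k) = Re z + real k" using \<open>\<not> t > 0\<close> a
        by (simp add: cmod_plus_nat t_def a_def)
      then show "0 < cmod (z + of_nat k) \<and> cmod (z + of_nat k) \<le> real k + 1"
        using \<open>Re z < 1\<close> a by (simp add: a_def)
    next
      have "cmod (z + of_nat m) = Re z + real m" using \<open>\<not> t > 0\<close> a
        by (simp add: cmod_plus_nat t_def a_def)
      then show "cmod (z + of_nat m) < real m + 1" using \<open>Re z < 1\<close> by simp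
    qed (use m in auto)
    then show False using root_norm_prod[of m z] z m by simp
  qed
  let ?\<Theta> = "\<Sum>k=m..<2*m. arctan (t / (a + real k))"
  have pos: "(\<Prod>k=m..<2*m. sqrt ((a + real k)^2 + t^2)) = (\<Prod>k=m..<2*m. real k + 1)"
    using root_norm_prod[OF _ w] m by (simp add: w_at cmod_plus_nat)
  have P0: "(\<Prod>k=m..<2*m. real k + 1) > 0" by (intro prod_pos) auto
  have "of_real (\<Prod>k=m..<2*m. real k + 1) * cis ?\<Theta> = of_real (\<Prod>k=m..<2*m. real k + 1)"
    using chi_roots_iff[of m w] w m prod_polar[of a m t] a by (simp add: w_at pos)
  then have "cis ?\<Theta> = 1" using P0 by (metis less_irrefl mult_cancel_left mult.right_neutral of_real_eq_0_iff)
  then have "cos ?\<Theta> = 1" by (metis cis.sel(1) one_complex.sel(1))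
  then obtain n :: int where n: "?\<Theta> = of_int n * (2 * pi)" using cos_one_2pi_int by auto
  have "0 < ?\<Theta>" using t a m by (intro sum_pos) auto
  then have "n \<ge> 1" unfolding n by (simp add: zero_less_mult_iff)
  then have "2 * pi \<le> ?\<Theta>" unfolding n by (simp add: mult_le_cancel_right1)
  \<comment> \<open>The real part is lowered to 1/2 while \<open>t\<close> is kept. The arguments
    grow and the moduli shrink, so the modulus equation becomes the inequality that
    \<open>sum_arctan_less_2pi\<close> assumes.\<close>
  also have "?\<Theta> \<le> (\<Sum>k=m..<2*m. arctan (t / (real k + 1/2)))"
    using t a by (intro sum_mono arctan_monotone' divide_left_mono) auto
  also have "\<dots> < 2 * pi"
  proof (rule sum_arctan_less_2pi[OF m])
    have "(\<Sum>k=m..<2*m. ln ((1/2 + real k)^2 + t^2) / 2) \<le> (\<Sum>k=m..<2*m. ln ((a + real k)^2 + t^2) / 2)"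
      using t a by (intro sum_mono divide_right_mono ln_mono add_mono power_mono) (auto intro!: add_pos_pos)
    also have "\<dots> = ln (\<Prod>k=m..<2*m. sqrt ((a + real k)^2 + t^2))"
      using t a by (subst ln_prod) (auto simp: ln_sqrt add_pos_pos intro!: sum.cong add_pos_pos)
    also have "\<dots> = (\<Sum>k=m..<2*m. ln (real k + 1))" unfolding pos by (subst ln_prod) auto
    finally show "(\<Sum>k=m..<2*m. ln (1 + t^2 / (real k + 1/2)^2) / 2) \<le> (\<Sum>k=m..<2*m. ln ((real k + 1) / (real k + 1/2)))"
      using sum_ln_half[where m=m and t=t] by simp
  qed (use t in simp)
  finally show False by simp
qed

text \<open>The modulus condition determines \<open>t\<close> as a continuous function of the real part \<open>a\<close>; the total
  argument then varies continuously from more than \<open>2\<pi>\<close> at \<open>a = 1/2\<close> to \<open>0\<close> at \<open>a = 1\<close>.\<close>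

lemma exists_root_Re_greater_half:
  assumes m: "m \<ge> 60"
  shows "\<exists>z \<in> chi_roots m. 1/2 < Re z \<and> Re z < 1"
proof -
  \<comment> \<open>The logarithm of the modulus condition, with s in the place of t^2, in which it
    is strictly increasing on s >= 0.\<close>
  define G where "G a s = (\<Sum>k=m..<2*m. ln ((a + real k)^2 + s) / 2) - (\<Sum>k=m..<2*m. ln (real k + 1))" for a s :: real
  \<comment> \<open>Large enough for a sign change: k + 1 <= 2m for all k that occur, so
    \<open>G a S\<close> is nonnegative term by term.\<close>
  define S where "S = (2 * real m)^2"
  have cont: "continuous_on ({1/2..1} \<times> {0..S}) (\<lambda>p. G (fst p) (snd p))"
  proof -
    have "(fst p + real k)^2 + snd p > 0" if "p \<in> {1/2..1} \<times> {0..S}" for p and k :: nat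
      using that by (intro add_pos_nonneg) auto
    then show ?thesis unfolding G_def by (intro continuous_intros ballI) (metis less_irrefl, simp)
  qed
  have mono: "G a s < G a s'" if "a > 0" "0 \<le> s" "s < s'" for a s s'
    unfolding G_def
  proof (intro diff_strict_right_mono sum_strict_mono)
    fix k show "ln ((a + real k)^2 + s) / 2 < ln ((a + real k)^2 + s') / 2"
      using that by (intro divide_strict_right_mono ln_less_cancel_iff[THEN iffD2]) (auto intro!: add_pos_nonneg)
  qed (use m in auto)
  have ex: "\<exists>s\<in>{0..S}. G a s = 0" if a: "a \<in> {1/2..1}" for a
  proof -
    have "G a 0 \<le> 0"
      unfolding G_def using a
      by (simp add: sum_subtractf[symmetric] ln_realpow) (intro sum_nonpos, auto)
    moreover have "0 \<le> G a S" unfolding G_def sum_subtractf[symmetric]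
    proof (rule sum_nonneg)
      fix k assume k: "k \<in> {m..<2*m}"
      have "(real k + 1)^2 \<le> S" unfolding S_def using k by (intro power_mono) auto
      then have "ln ((real k + 1)^2) \<le> ln ((a + real k)^2 + S)" by (intro ln_mono) (auto intro: add_increasing)
      then show "0 \<le> ln ((a + real k)^2 + S) / 2 - ln (real k + 1)"
        by (simp add: ln_realpow)
    qed
    moreover have "continuous_on {0..S} (G a)"
    proof -
      have "continuous_on {0..S} (\<lambda>s. (\<lambda>p. G (fst p) (snd p)) (a, s))"
        using a by (intro continuous_on_compose2[OF cont]) (auto intro!: continuous_intros)
      then show ?thesis by simp
    qed
    ultimately show ?thesis using IVT'[of "G a" 0 0 S] by (auto simp: S_def)
  qed
  define sf where "sf a = (SOME s. s \<in> {0..S} \<and> G a s = 0)" for a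
  have sf: "sf a \<in> {0..S}" "G a (sf a) = 0" if "a \<in> {1/2..1}" for a
  proof -
    have "sf a \<in> {0..S} \<and> G a (sf a) = 0" unfolding sf_def by (rule someI_ex) (use ex[OF that] in blast)
    then show "sf a \<in> {0..S}" "G a (sf a) = 0" by auto
  qed
  have uniq: "s = sf a" if "a \<in> {1/2..1}" "s \<in> {0..S}" "G a s = 0" for a s
    using mono[of a s "sf a"] mono[of a "sf a" s] sf[OF that(1)] that by (metis atLeastAtMost_iff less_irrefl linorder_neqE_linordered_idom half_gt_zero_iff less_le_trans zero_less_one)
  \<comment> \<open>The graph of the implicit function is a closed zero set, and its values stay in
    a compact interval; this yields continuity without differentiating \<open>G\<close>.\<close>
  have "(\<lambda>x. (x, sf x)) ` {1/2..1} = {p \<in> {1/2..1} \<times> {0..S}. G (fst p) (snd p) \<in> {0}}"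
    using sf uniq by force
  moreover have "closed {p \<in> {1/2..1} \<times> {0..S}. G (fst p) (snd p) \<in> {0}}"
    using continuous_closed_preimage[OF cont _ closed_singleton[of 0]] by (simp add: closed_Times vimage_def Int_def)
  ultimately have contsf: "continuous_on {1/2..1} sf"
    using sf by (intro continuous_from_closed_graph[of "{0..S}"]) auto
  define \<Theta> where "\<Theta> a = (\<Sum>k=m..<2*m. arctan (sqrt (sf a) / (a + real k)))" for a
  have contT: "continuous_on {1/2..1} \<Theta>"
    unfolding \<Theta>_def by (intro continuous_intros contsf) auto
  have "G 1 0 = 0" unfolding G_def by (simp add: ln_realpow add.commute)
  then have "sf 1 = 0" using uniq[of 1 0] by (simp add: S_def)
  then have T1: "\<Theta> 1 = 0" by (simp add: \<Theta>_def)
  have T2: "2 * pi < \<Theta> (1/2)"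
  proof -
    have "2 * pi < (\<Sum>k=m..<2*m. arctan (sqrt (sf (1/2)) / (real k + 1/2)))"
      using sf[of "1/2"] sum_ln_half[where m=m and t="sqrt (sf (1/2))"] m by (intro sum_arctan_greater_2pi) (auto simp: G_def)
    then show ?thesis by (simp add: \<Theta>_def add.commute)
  qed
  obtain a where a: "1/2 \<le> a" "a \<le> 1" "\<Theta> a = 2 * pi"
    using IVT2'[of \<Theta> 1 "2*pi" "1/2"] T1 T2 contT by auto
  define t where "t = sqrt (sf a)"
  have sfa: "sf a \<ge> 0" "G a (sf a) = 0" using sf[of a] a by auto
  have t2: "t^2 = sf a" using sfa by (simp add: t_def)
  have Lpos: "(a + real k)^2 + t^2 > 0" for k using a by (intro add_pos_nonneg) auto
  have "ln (\<Prod>k=m..<2*m. sqrt ((a + real k)^2 + t^2)) = (\<Sum>k=m..<2*m. ln ((a + real k)^2 + t^2) / 2)"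
    using Lpos by (subst ln_prod) (auto simp: ln_sqrt)
  also have "\<dots> = (\<Sum>k=m..<2*m. ln (real k + 1))" using sfa(2) by (simp add: G_def t2)
  also have "\<dots> = ln (\<Prod>k=m..<2*m. real k + 1)" by (subst ln_prod) auto
  finally have "(\<Prod>k=m..<2*m. sqrt ((a + real k)^2 + t^2)) = (\<Prod>k=m..<2*m. real k + 1)"
    using Lpos by (subst (asm) ln_inj_iff) (auto intro!: prod_pos)
  then have "(\<Prod>k=m..<2*m. Complex a t + of_nat k) = (\<Prod>k=m..<2*m. of_nat k + 1)"
    using prod_polar[of a m t] a m by (simp add: \<Theta>_def t_def)
  then have "Complex a t \<in> chi_roots m" using m by (subst chi_roots_iff) auto
  moreover have "a \<noteq> 1/2" using T2 a(3) by (metis less_irrefl)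
  moreover have "a \<noteq> 1" using T1 a(3) by auto
  ultimately show ?thesis using a by (intro bexI[of _ "Complex a t"]) auto
qed

section \<open>Eigenvectors\<close>

text \<open>Left eigenvectors, scaled to have first entry m. As functions of \<open>l\<close> the
  entries are polynomials of degree k - 1 that vanish at -m, ..., -(m+k-2), a Newton basis; for l =
  1 they are the numbers of gaps.\<close>

definition uvec :: "nat \<Rightarrow> complex \<Rightarrow> nat \<Rightarrow> complex" where
  "uvec m l k = of_nat m * (\<Prod>i<k-1. (of_nat (m + i) + l) / of_nat (m + i))"

definition U :: "nat \<Rightarrow> complex \<Rightarrow> (nat \<Rightarrow> complex) \<Rightarrow> complex" where
  "U m l x = (\<Sum>k=1..m. uvec m l k * x k)"

abbreviation yvec :: "nat \<Rightarrow> complex \<Rightarrow> nat \<Rightarrow> complex" where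
  "yvec m l \<equiv> P_inv m (v_vec m l)"

lemma gaps_nonzero:
  assumes "m \<ge> 2" "k \<ge> 1" shows "of_nat (gaps m k) \<noteq> (0::'a::semiring_char_0)"
proof -
  have "gaps m k \<noteq> 0" using assms by (simp add: gaps_def)
  then show ?thesis unfolding of_nat_eq_0_iff .
qed

lemma sum_increment_left:
  fixes f :: "nat \<Rightarrow> complex"
  assumes "k \<in> {1..m}" "m \<ge> 2"
  shows "(\<Sum>j=1..m. f j * of_real (increment m k j)) = (if k < m then f (k + 1) - f k else 2 * f 1 - f m)"
proof (cases "k < m")
  case True
  then have "(\<Sum>j=1..m. f j * of_real (increment m k j)) = (\<Sum>j=1..m. (if j = k + 1 then f j else 0) - (if j = k then f j else 0))"
    using assms by (intro sum.cong) (auto simp: increment_def unit_vec_def)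
  with True assms show ?thesis by (simp add: sum_subtractf)
next
  case False
  then have "(\<Sum>j=1..m. f j * of_real (increment m k j)) = (\<Sum>j=1..m. (if j = 1 then 2 * f j else 0) - (if j = m then f j else 0))"
    using assms by (intro sum.cong) (auto simp: increment_def unit_vec_def)
  with False assms show ?thesis by (simp add: sum_subtractf)
qed

lemma sum_increment_right:
  fixes f :: "nat \<Rightarrow> complex"
  assumes "j \<in> {1..m}" "m \<ge> 2"
  shows "(\<Sum>k=1..m. f k * of_real (increment m k j)) = (if j = 1 then 2 * f m - f 1 else f (j - 1) - f j)"
proof -
  have "(\<Sum>k=1..m. f k * of_real (increment m k j)) =
     (\<Sum>k=1..m. (if k = m \<and> j = 1 then 2 * f k else 0) + (if k = j - 1 \<and> j \<ge> 2 then f k else 0) - (if k = j then f k else 0))"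
    using assms by (intro sum.cong) (auto simp: increment_def unit_vec_def)
  then show ?thesis using assms by (auto simp: sum_subtractf sum.distrib)
qed

text \<open>The characteristic equation divided by the product of the m + i. The ratios
  (m+i+1)/(m+i) telescope to 2, and this 2 is the number of nodes produced by a split.\<close>

lemma root_ratio_prod:
  assumes "m \<ge> 2" "l \<in> chi_roots m"
  shows "(\<Prod>i<m. (of_nat (m + i) + l) / of_nat (m + i)) = 2"
proof -
  have shift: "(\<Prod>k=m..<2*m. g k) = (\<Prod>i<m. g (m + i))" for g :: "nat \<Rightarrow> complex"
    by (rule prod.reindex_bij_witness[of _ "\<lambda>i. m + i" "\<lambda>k. k - m"]) auto
  have "of_nat m * (\<Prod>i<n. of_nat (m + i) + 1) = (of_nat (m + n) * (\<Prod>i<n. of_nat (m + i)) :: complex)" for n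
    by (induction n) (auto simp: algebra_simps)
  from this[of m] have "of_nat m * (\<Prod>i<m. of_nat (m + i) + 1) = (of_nat m * (2 * (\<Prod>i<m. of_nat (m + i))) :: complex)"
    by (simp add: algebra_simps)
  then have "(\<Prod>i<m. of_nat (m + i) + 1) = (2 * (\<Prod>i<m. of_nat (m + i)) :: complex)"
    using assms by (simp del: of_nat_add)
  moreover have "(\<Prod>i<m. of_nat (m + i) + l) = (\<Prod>i<m. of_nat (m + i) + 1)"
    using chi_roots_iff[of m l] assms by (simp add: shift add.commute)
  moreover have "(\<Prod>i<m. of_nat (m + i)) \<noteq> (0::complex)"
    using assms by (simp del: of_nat_add)
  ultimately show ?thesis by (simp add: prod_dividef)
qed

lemma uvec_Suc:
  assumes "k \<ge> 1" shows "uvec m l (Suc k) = uvec m l k * ((of_nat (gaps m k) + l) / of_nat (gaps m k))"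
  using assms by (cases k) (auto simp: uvec_def gaps_def)

lemma uvec_last:
  assumes "m \<ge> 2" "l \<in> chi_roots m"
  shows "uvec m l m * ((of_nat (gaps m m) + l) / of_nat (gaps m m)) = 2 * of_nat m"
proof -
  have "uvec m l m * ((of_nat (gaps m m) + l) / of_nat (gaps m m)) = uvec m l (Suc m)"
    using uvec_Suc[of m m l] assms by simp
  also have "\<dots> = of_nat m * 2" using root_ratio_prod[OF assms] by (simp only: uvec_def diff_Suc_1)
  finally show ?thesis by simp
qed

text \<open>For k < m this is the recursion of \<open>uvec\<close>; for k = m it is the closing
  condition supplied by the root equation. Since the insertion probability is gaps times count over
  n + m, it makes the drift of the coordinate proportional to the coordinate.\<close>

lemma U_increment:
  assumes "m \<ge> 2" "l \<in> chi_roots m" "k \<in> {1..m}"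
  shows "of_nat (gaps m k) * U m l (\<lambda>j. of_real (increment m k j)) = l * uvec m l k"
proof -
  have g: "of_nat (gaps m k) \<noteq> (0::complex)" using assms gaps_nonzero[of m k] by auto
  have "U m l (\<lambda>j. of_real (increment m k j)) = (if k < m then uvec m l (k + 1) - uvec m l k else 2 * uvec m l 1 - uvec m l m)"
    unfolding U_def by (rule sum_increment_left) (use assms in auto)
  moreover have "uvec m l 1 = of_nat m" by (simp add: uvec_def)
  moreover have "k < m \<or> k = m" using assms by auto
  ultimately show ?thesis using uvec_Suc[of k m l] uvec_last[OF assms(1,2)] assms(3) g
    by (auto simp: field_simps)
qed

lemma gaps_plus_root_nonzero:
  assumes "m \<ge> 2" "l \<in> chi_roots m" "k \<in> {1..m}"
  shows "of_nat (gaps m k) + l \<noteq> 0"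
proof -
  have "gaps m k \<in> {m..<2*m}" using assms by (auto simp: gaps_def)
  then show ?thesis using root_plus_nonzero[of m l "gaps m k"] assms by (auto simp: add.commute)
qed

text \<open>The sum is the logarithmic derivative of the product of the X + k, and also the constant
  H in the denominator of v(l). Off the real axis its imaginary part is a sum of terms of one sign.
  On the axis it could only vanish between two poles, where the modulus condition fails.\<close>

lemma sum_inverse_root_nonzero:
  assumes "m \<ge> 1" "l \<in> chi_roots m"
  shows "(\<Sum>k=m..<2*m. 1 / (l + of_nat k)) \<noteq> 0"
proof
  assume z: "(\<Sum>k=m..<2*m. 1 / (l + of_nat k)) = 0"
  show False
  proof (cases "Im l = 0")
    case False
    have "Im (\<Sum>k=m..<2*m. 1 / (l + of_nat k)) = - Im l * (\<Sum>k=m..<2*m. 1 / (cmod (l + of_nat k))^2)"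
      by (simp add: sum_distrib_left Im_divide cmod_power2)
    moreover have "(\<Sum>k=m..<2*m. 1 / (cmod (l + of_nat k))^2) > 0"
      using root_plus_nonzero[OF assms] assms by (intro sum_pos) auto
    ultimately show False using z False by simp
  next
    case True
    define x where "x = Re l"
    have lx: "l = of_real x" using True by (simp add: x_def complex_eq_iff)
    have nz: "x + real k \<noteq> 0" if "k \<in> {m..<2*m}" for k
      using root_plus_nonzero[OF assms that] by (metis lx of_real_0 of_real_add of_real_of_nat_eq)
    have "complex_of_real (\<Sum>k=m..<2*m. 1 / (x + real k)) = 0" using z by (simp add: lx)
    then have zr: "(\<Sum>k=m..<2*m. 1 / (x + real k)) = 0" by (simp only: of_real_eq_0_iff)
    have "\<exists>k\<in>{m..<2*m}. x + real k > 0"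
    proof (rule ccontr)
      assume "\<not> ?thesis"
      then have "(\<Sum>k=m..<2*m. - (1 / (x + real k))) > 0" using nz assms(1)
        by (intro sum_pos) (auto simp: not_less intro: le_neq_trans)
      then show False using zr by (simp add: sum_negf)
    qed
    moreover have "\<exists>k\<in>{m..<2*m}. x + real k < 0"
    proof (rule ccontr)
      assume "\<not> ?thesis"
      then have "x + real k > 0" if "k \<in> {m..<2*m}" for k using nz[OF that] that by force
      then have "(\<Sum>k=m..<2*m. 1 / (x + real k)) > 0" using assms(1)
        by (intro sum_pos) auto
      then show False using zr by simp
    qed
    ultimately obtain i j where ij: "i \<in> {m..<2*m}" "x + real i > 0" "j \<in> {m..<2*m}" "x + real j < 0" by blast
    \<comment> \<open>Here -i < x < -j with i and j in [m, 2m), so |x + k| is below k - j or below i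
      - k, and both are less than k + 1.\<close>
    have less: "cmod (l + of_nat k) < real k + 1" if "k \<in> {m..<2*m}" for k
    proof -
      have "cmod (l + of_nat k) = \<bar>x + real k\<bar>" by (metis lx of_real_add of_real_of_nat_eq norm_of_real)
      moreover have "real k < real j + real m" "real i < real k + real m" "real k \<ge> real m" using that ij by auto
      ultimately show ?thesis using ij by (auto simp: abs_if)
    qed
    have "(\<Prod>k=m..<2*m. cmod (l + of_nat k)) < (\<Prod>k=m..<2*m. real k + 1)"
      by (rule prod_strict_mono_one[where i=m]) (use less root_plus_nonzero[OF assms] assms in \<open>auto intro: less_imp_le\<close>)
    with root_norm_prod[OF assms] show False by simp
  qed
qed

text \<open>The shift by -1 aligns the indices: with X = m + l - 1, the denominator X + k is
  \<open>gaps m k + l\<close>.\<close>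

lemma H_fun_root:
  assumes "m \<ge> 2"
  shows "H_fun m (of_nat m + l - 1) = (\<Sum>k=1..m. 1 / (of_nat (gaps m k) + l))"
  unfolding H_fun_def by (intro sum.cong refl arg_cong2[of _ _ _ _ "(/)"]) (use assms in \<open>auto simp: gaps_def of_nat_diff\<close>)

lemma H_fun_nonzero:
  assumes "m \<ge> 2" "l \<in> chi_roots m" shows "H_fun m (of_nat m + l - 1) \<noteq> 0"
proof -
  have "(\<Sum>k=1..m. 1 / (of_nat (gaps m k) + l)) = (\<Sum>k=m..<2*m. 1 / (l + of_nat k))"
    by (rule sum.reindex_bij_witness[of _ "\<lambda>k. k - m + 1" "\<lambda>k. m + k - 1"]) (use assms in \<open>auto simp: gaps_def add.commute\<close>)
  then show ?thesis using sum_inverse_root_nonzero[of m l] H_fun_root[of m l] assms by simp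
qed

lemma v_vec_Suc:
  assumes "k \<ge> 1"
  shows "v_vec m l (Suc k) = v_vec m l k * (of_nat (m + k) / (of_nat (m + k) + l))"
proof -
  have "{1..k} = insert k {1..k-1}" using assms by auto
  then show ?thesis using assms by (simp add: v_vec_def)
qed

text \<open>The two products run through reciprocal factors, so in the entrywise product of left and
  right eigenvector everything cancels except the boundary factors.\<close>

lemma uvec_v_vec:
  assumes "m \<ge> 2" "l \<in> chi_roots m" "k \<ge> 1" "k \<le> m"
  shows "uvec m l k * v_vec m l k * (of_nat (gaps m k) + l) * H_fun m (of_nat m + l - 1) = of_nat (gaps m k)"
  using assms(3,4)
proof (induction k rule: dec_induct)
  case base
  have "of_nat m + l \<noteq> 0" using gaps_plus_root_nonzero[of m l 1] assms by (simp add: gaps_def)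
  then show ?case using H_fun_nonzero[OF assms(1,2)] assms(1) by (simp add: uvec_def v_vec_def gaps_def)
next
  case (step k)
  have nz: "of_nat (gaps m k) + l \<noteq> 0" "of_nat (gaps m (Suc k)) + l \<noteq> 0" "of_nat (gaps m k) \<noteq> (0::complex)"
    using gaps_plus_root_nonzero[of m l k] gaps_plus_root_nonzero[of m l "Suc k"] assms step gaps_nonzero[of m k] by auto
  have g: "of_nat (gaps m (Suc k)) = (of_nat (m + k) :: complex)" using step by (simp add: gaps_def)
  have E: "uvec m l (Suc k) * v_vec m l (Suc k) * (of_nat (gaps m (Suc k)) + l) * H_fun m (of_nat m + l - 1)
    = (uvec m l k * v_vec m l k * (of_nat (gaps m k) + l) * H_fun m (of_nat m + l - 1)) / of_nat (gaps m k) * of_nat (m + k)"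
    using nz unfolding uvec_Suc[OF step(1)] v_vec_Suc[OF step(1)] g by simp
  have X: "uvec m l k * v_vec m l k * (of_nat (gaps m k) + l) * H_fun m (of_nat m + l - 1) = of_nat (gaps m k)"
    using step by simp
  from E[unfolded X] nz show ?case by (simp add: g)
qed

text \<open>By \<open>uvec_v_vec\<close> the pairing is the sum of the 1/(gaps + l) divided by H,
  and that sum is H itself. This is the purpose of the factor H in the definition of v(l).\<close>

lemma U_yvec_self:
  assumes "m \<ge> 2" "l \<in> chi_roots m" shows "U m l (yvec m l) = 1"
proof -
  define h where "h = H_fun m (of_nat m + l - 1)"
  have h: "h \<noteq> 0" using H_fun_nonzero[OF assms] by (simp add: h_def)
  have "U m l (yvec m l) = (\<Sum>k=1..m. 1 / (of_nat (gaps m k) + l) / h)"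
    unfolding U_def
  proof (rule sum.cong[OF refl])
    fix k assume k: "k \<in> {1..m}"
    have "of_nat (gaps m k) \<noteq> (0::complex)" using k assms gaps_nonzero[of m k] by auto
    then have key: "a * (b / g) = 1 / d / h" if "a * b * d * h = g" "d \<noteq> 0" "g \<noteq> 0" for a b g d
      using that h by (simp add: field_simps)
    show "uvec m l k * yvec m l k = 1 / (of_nat (gaps m k) + l) / h"
      unfolding P_inv_def
      by (rule key) (use uvec_v_vec[OF assms, of k] gaps_plus_root_nonzero[OF assms k] gaps_nonzero[of m k] k assms(1) in \<open>auto simp: h_def\<close>)
  qed
  also have "\<dots> = h / h" unfolding sum_divide_distrib[symmetric] by (simp add: h_def H_fun_root[OF assms(1)])
  finally show ?thesis using h by simp
qed

text \<open>For j > 1 this is the recursion of \<open>v_vec\<close>. For j = 1 it balances the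
  splits of full nodes against the loss of type 1, and the value of \<open>v_vec\<close> at m is
  read off from its product with \<open>uvec\<close>, where the root equation enters.\<close>

lemma yvec_eigen:
  assumes "m \<ge> 2" "l \<in> chi_roots m" "j \<in> {1..m}"
  shows "(\<Sum>k=1..m. v_vec m l k * of_real (increment m k j)) = l * yvec m l j"
proof (cases "j = 1")
  case True
  have "gaps m 1 = m" by (simp add: gaps_def)
  have nz: "of_nat (gaps m m) + l \<noteq> 0" "of_nat (gaps m m) \<noteq> (0::complex)" "of_nat m \<noteq> (0::complex)" "of_nat m + l \<noteq> 0"
    using gaps_plus_root_nonzero[OF assms(1,2), of m] gaps_plus_root_nonzero[OF assms(1,2), of 1] gaps_nonzero[of m m] assms(1) \<open>gaps m 1 = m\<close> by auto
  have h: "H_fun m (of_nat m + l - 1) \<noteq> 0" using H_fun_nonzero[OF assms(1,2)] .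
  have "uvec m l m = 2 * of_nat m * of_nat (gaps m m) / (of_nat (gaps m m) + l)"
    using uvec_last[OF assms(1,2)] nz by (simp add: field_simps)
  then have "2 * of_nat m * v_vec m l m * H_fun m (of_nat m + l - 1) = 1"
    using uvec_v_vec[OF assms(1,2), of m] nz assms(1) by (simp add: mult_ac)
  moreover have "v_vec m l 1 * (of_nat m + l) * H_fun m (of_nat m + l - 1) = 1" using nz h by (simp add: v_vec_def)
  ultimately have "2 * of_nat m * v_vec m l m = v_vec m l 1 * (of_nat m + l)" using h by (metis mult_right_cancel)
  then have "2 * v_vec m l m - v_vec m l 1 = l * (v_vec m l 1 / of_nat m)" using nz by (simp add: field_simps)
  with True show ?thesis using sum_increment_right[OF assms(3,1), of "v_vec m l"] by (simp add: P_inv_def gaps_def)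
next
  case False
  then obtain k where k: "j = Suc k" "k \<ge> 1" using assms(3) by (cases j) auto
  have nz: "of_nat (m + k) + l \<noteq> 0" "of_nat (m + k) \<noteq> (0::complex)"
    using gaps_plus_root_nonzero[OF assms(1,2,3)] gaps_nonzero[of m j, where 'a=complex] assms(1) k
    by (simp_all add: gaps_def del: of_nat_add)
  have "v_vec m l k = v_vec m l (Suc k) * ((of_nat (m + k) + l) / of_nat (m + k))"
    unfolding v_vec_Suc[OF k(2)] using nz by simp
  then have "v_vec m l k - v_vec m l (Suc k) = l * (v_vec m l (Suc k) / of_nat (m + k))"
    using nz by (simp add: field_simps)
  with False show ?thesis using sum_increment_right[OF assms(3,1), of "v_vec m l"] k by (simp add: P_inv_def gaps_def)
qed

text \<open>The increment matrix between a left and a right eigenvector acts as \<open>l\<close> on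
  one side and as \<open>n\<close> on the other.\<close>

lemma U_yvec_distinct:
  assumes "m \<ge> 2" "l \<in> chi_roots m" "n \<in> chi_roots m" "l \<noteq> n"
  shows "U m l (yvec m n) = 0"
proof -
  have "l * U m l (yvec m n) = (\<Sum>k=1..m. (l * uvec m l k) * yvec m n k)"
    by (simp add: U_def sum_distrib_left mult.assoc)
  also have "\<dots> = (\<Sum>k=1..m. U m l (\<lambda>j. of_real (increment m k j)) * v_vec m n k)"
  proof (rule sum.cong[OF refl])
    fix k assume k: "k \<in> {1..m}"
    have "of_nat (gaps m k) \<noteq> (0::complex)" using k assms gaps_nonzero[of m k] by auto
    then show "l * uvec m l k * yvec m n k = U m l (\<lambda>j. of_real (increment m k j)) * v_vec m n k"
      unfolding U_increment[OF assms(1,2) k, symmetric] by (simp add: P_inv_def)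
  qed
  also have "\<dots> = (\<Sum>j=1..m. uvec m l j * (\<Sum>k=1..m. v_vec m n k * of_real (increment m k j)))"
    unfolding U_def sum_distrib_left sum_distrib_right by (subst sum.swap) (simp add: mult_ac)
  also have "\<dots> = n * U m l (yvec m n)"
    using yvec_eigen[OF assms(1,3)] by (simp add: U_def sum_distrib_left mult_ac)
  finally show ?thesis using assms(4) by simp
qed

text \<open>At a root the derivative is the product of the z + k times the sum of their inverses,
  both nonzero; hence the roots are simple and there are as many as the degree.\<close>

lemma finite_chi_roots:
  assumes "m \<ge> 1" shows "finite (chi_roots m)" and card_chi_roots: "card (chi_roots m) = m"
proof -
  let ?p = "\<Prod>k=m..2*m-1. [:of_nat k, 1:] :: complex poly"
  have deg: "degree ?p = m"
    using assms by (subst degree_prod_eq_sum_degree) auto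
  then have degchi: "degree (chi m) = m"
    unfolding chi_def diff_conv_add_uminus using assms by (subst degree_add_eq_left) auto
  have nz: "chi m \<noteq> 0" using degchi assms by auto
  have set: "{m..2*m-1} = {m..<2*m}" using assms by auto
  have "poly (pderiv (chi m)) z \<noteq> 0" if z: "z \<in> chi_roots m" for z
  proof -
    have "poly (pderiv (chi m)) z = (\<Sum>k=m..<2*m. \<Prod>j\<in>{m..<2*m} - {k}. z + of_nat j)"
      unfolding chi_def set by (simp add: pderiv_diff pderiv_prod poly_sum poly_prod pderiv_pCons add.commute)
    also have "\<dots> = (\<Sum>k=m..<2*m. (\<Prod>j=m..<2*m. z + of_nat j) * (1 / (z + of_nat k)))"
    proof (rule sum.cong[OF refl])
      fix k assume k: "k \<in> {m..<2*m}"
      then show "(\<Prod>j\<in>{m..<2*m} - {k}. z + of_nat j) = (\<Prod>j=m..<2*m. z + of_nat j) * (1 / (z + of_nat k))"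
        using root_plus_nonzero[OF assms z k] by (subst prod.remove[OF _ k]) auto
    qed
    also have "\<dots> = (\<Prod>j=m..<2*m. z + of_nat j) * (\<Sum>k=m..<2*m. 1 / (z + of_nat k))"
      by (simp add: sum_distrib_left)
    finally show ?thesis using sum_inverse_root_nonzero[OF assms z] root_plus_nonzero[OF assms z] by simp
  qed
  then have sq: "rsquarefree (chi m)" unfolding rsquarefree_roots by (auto simp: chi_roots_def)
  show fin: "finite (chi_roots m)" unfolding chi_roots_def by (rule poly_roots_finite[OF nz])
  have "chi m = smult (lead_coeff (chi m)) (\<Prod>z\<in>chi_roots m. [:-z, 1:])"
    using complex_poly_decompose_rsquarefree[OF sq] by (simp add: chi_roots_def)
  then have "degree (chi m) = degree (\<Prod>z\<in>chi_roots m. [:-z, 1:])"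
    using nz by (metis degree_smult_eq leading_coeff_0_iff)
  also have "\<dots> = card (chi_roots m)" by (subst degree_prod_eq_sum_degree) auto
  finally show "card (chi_roots m) = m" using degchi by simp
qed

text \<open>As a function of \<open>l\<close>, \<open>U m l x\<close> is a polynomial of degree less
  than m with m zeros, hence it vanishes identically and may be evaluated at points that are not
  roots.\<close>

lemma U_all_zero:
  assumes "m \<ge> 2" "\<And>l. l \<in> chi_roots m \<Longrightarrow> U m l x = 0" "k \<in> {1..m}"
  shows "x k = 0"
proof -
  define Q where "Q = (\<Sum>k=1..m. smult (of_nat m * x k) (\<Prod>i<k-1. smult (1 / of_nat (m + i)) [:of_nat (m + i), 1:]))"
  have QU: "poly Q z = U m z x" for z
    unfolding Q_def U_def uvec_def poly_sum poly_prod poly_smult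
    by (intro sum.cong refl) (simp add: mult_ac)
  have "degree Q \<le> m - 1" unfolding Q_def
  proof (rule degree_sum_le)
    fix k assume k: "k \<in> {1..m}"
    have "degree (smult (of_nat m * x k) (\<Prod>i<k-1. smult (1 / of_nat (m + i)) [:of_nat (m + i), 1:]))
      \<le> degree (\<Prod>i<k-1. smult (1 / of_nat (m + i)) [:of_nat (m + i), 1::complex:])" by (rule degree_smult_le)
    also have "\<dots> \<le> sum (degree \<circ> (\<lambda>i. smult (1 / of_nat (m + i)) [:of_nat (m + i), 1::complex:])) {..<k-1}"
      by (rule degree_prod_sum_le) auto
    also have "\<dots> \<le> (\<Sum>i<k-1. 1)" by (intro sum_mono) auto
    also have "\<dots> \<le> m - 1" using k by auto
    finally show "degree (smult (of_nat m * x k) (\<Prod>i<k-1. smult (1 / of_nat (m + i)) [:of_nat (m + i), 1:])) \<le> m - 1" .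
  qed auto
  moreover have "chi_roots m \<subseteq> {z. poly Q z = 0}" using assms(2) QU by auto
  ultimately have "Q = 0"
  proof (rule_tac ccontr)
    assume "Q \<noteq> 0" "degree Q \<le> m - 1" "chi_roots m \<subseteq> {z. poly Q z = 0}"
    then have "card (chi_roots m) \<le> degree Q"
      using card_mono[OF poly_roots_finite] card_poly_roots_bound le_trans by blast
    then show False using card_chi_roots[of m] assms(1) \<open>degree Q \<le> m - 1\<close> by simp
  qed
  then have U0: "U m z x = 0" for z using QU by (metis poly_0)
  show ?thesis using assms(3)
  proof (induction k rule: less_induct)
    case (less k)
    \<comment> \<open>At this point the entries of \<open>uvec\<close> beyond k contain a zero
      factor, and the coordinates of \<open>x\<close> before k vanish by induction; only entry k
      survives.\<close>
    have "0 = U m (- of_nat (m + (k - 1))) x" using U0 by simp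
    also have "\<dots> = (\<Sum>j\<in>{k}. uvec m (- of_nat (m + (k - 1))) j * x j)"
      unfolding U_def
    proof (rule sum.mono_neutral_right)
      show "\<forall>j\<in>{1..m} - {k}. uvec m (- of_nat (m + (k - 1))) j * x j = 0"
      proof
        fix j assume j: "j \<in> {1..m} - {k}"
        show "uvec m (- of_nat (m + (k - 1))) j * x j = 0"
        proof (cases "j < k")
          case True then show ?thesis using less j by auto
        next
          case False
          then have "k - 1 \<in> {..<j-1}" using j less.prems by auto
          then have "(\<Prod>i<j-1. (of_nat (m + i) + - of_nat (m + (k - 1))) / of_nat (m + i)) = (0::complex)"
            by (intro prod_zero) (auto intro!: bexI[of _ "k-1"])
          then show ?thesis by (simp add: uvec_def)
        qed
      qed
    qed (use less.prems in auto)
    finally have "uvec m (- of_nat (m + (k - 1))) k * x k = 0" by simp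
    moreover have "uvec m (- of_nat (m + (k - 1))) k \<noteq> 0"
    proof -
      have "of_nat (m + i) + - of_nat (m + (k - 1)) \<noteq> (0::complex)" if "i < k - 1" for i
        using that by (simp only: add_uminus_conv_diff right_minus_eq of_nat_eq_iff)
      then show ?thesis using assms(1) by (auto simp: uvec_def simp del: of_nat_add)
    qed
    ultimately show ?case by simp
  qed
qed

lemma U_diff: "U m l (\<lambda>k. x k - y k) = U m l x - U m l y"
  by (simp add: U_def right_diff_distrib sum_subtractf)

lemma U_add: "U m l (\<lambda>k. x k + y k) = U m l x + U m l y"
  by (simp add: U_def distrib_left sum.distrib)

lemma U_sum: "U m l (\<lambda>k. \<Sum>i\<in>A. f i k) = (\<Sum>i\<in>A. U m l (f i))"
  unfolding U_def sum_distrib_left by (rule sum.swap)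

lemma U_scale: "U m l (\<lambda>k. c * x k) = c * U m l x"
  by (simp add: U_def sum_distrib_left mult_ac)

text \<open>By biorthogonality the difference of the two sides is annihilated by every form
  \<open>U m l\<close>, hence is zero by \<open>U_all_zero\<close>.\<close>

lemma spectral_decomposition:
  assumes "m \<ge> 2" "k \<in> {1..m}"
  shows "x k = (\<Sum>l\<in>chi_roots m. U m l x * yvec m l k)"
proof -
  have "(\<lambda>k. x k - (\<Sum>l\<in>chi_roots m. U m l x * yvec m l k)) k = 0"
  proof (rule U_all_zero[OF assms(1) _ assms(2)])
    fix n assume n: "n \<in> chi_roots m"
    have "U m n (\<lambda>k. x k - (\<Sum>l\<in>chi_roots m. U m l x * yvec m l k)) = U m n x - (\<Sum>l\<in>chi_roots m. U m l x * U m n (yvec m l))"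
      by (simp add: U_diff U_sum U_scale)
    also have "(\<Sum>l\<in>chi_roots m. U m l x * U m n (yvec m l)) = (\<Sum>l\<in>{n}. U m l x * U m n (yvec m l))"
      using n finite_chi_roots[of m] assms(1) U_yvec_distinct[OF assms(1) n] by (intro sum.mono_neutral_right) auto
    also have "\<dots> = U m n x" using U_yvec_self[OF assms(1) n] by simp
    finally show "U m n (\<lambda>k. x k - (\<Sum>l\<in>chi_roots m. U m l x * yvec m l k)) = 0" by simp
  qed
  then show ?thesis by simp
qed

lemma cnj_uvec: "cnj (uvec m l k) = uvec m (cnj l) k" by (simp add: uvec_def)

lemma cnj_U: "cnj (U m l (\<lambda>k. of_real (x k))) = U m (cnj l) (\<lambda>k. of_real (x k))"
  by (simp add: U_def cnj_uvec)

lemma cnj_yvec: "cnj (yvec m l k) = yvec m (cnj l) k"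
  by (simp add: P_inv_def v_vec_def H_fun_def)

lemma uvec_one: assumes "m \<ge> 2" "k \<ge> 1" shows "uvec m 1 k = of_nat (gaps m k)"
  using assms(2)
proof (induction k rule: dec_induct)
  case (step k)
  have "of_nat (gaps m k) \<noteq> (0::complex)" using assms step gaps_nonzero[of m k] by auto
  then show ?case using step assms by (simp add: uvec_Suc) (simp add: gaps_def)
qed (simp add: uvec_def gaps_def)

lemma U_one: assumes "m \<ge> 2" shows "U m 1 x = (\<Sum>k=1..m. of_nat (gaps m k) * x k)"
  unfolding U_def by (intro sum.cong refl) (use assms in \<open>simp add: uvec_one\<close>)

lemma v_vec_of_real: "v_vec m 1 k = complex_of_real (v_vec m 1 k)"
  by (simp add: v_vec_def H_fun_def)

lemma yvec_one: "yvec m 1 k = of_real (P_inv m (v_vec m 1) k)"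
  by (simp add: P_inv_def v_vec_of_real)

text \<open>Together with nonnegativity this makes v(1) a probability vector: it is the limit law of
  the type in which a key is inserted, and the limiting variance is taken with respect to
  it.\<close>

lemma sum_v_vec_one: assumes "m \<ge> 2" shows "(\<Sum>k=1..m. v_vec m (1::real) k) = 1"
proof -
  have "complex_of_real (\<Sum>k=1..m. v_vec m 1 k) = (\<Sum>k=1..m. of_nat (gaps m k) * yvec m 1 k)"
    unfolding of_real_sum by (intro sum.cong refl) (use assms gaps_nonzero in \<open>auto simp: P_inv_def v_vec_of_real\<close>)
  also have "\<dots> = 1" using U_yvec_self[of m 1] one_in_chi_roots[of m] U_one[of m] assms by simp
  finally show ?thesis by (simp only: of_real_eq_1_iff)
qed

lemma v_vec_one_nonneg: assumes "m \<ge> 2" shows "v_vec m (1::real) k \<ge> 0"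
  unfolding v_vec_def H_fun_def by (intro mult_nonneg_nonneg prod_nonneg divide_nonneg_nonneg sum_nonneg) (use assms in auto)

lemma U_unit_vec: assumes "m \<ge> 2" shows "U m l (\<lambda>k. of_real (unit_vec 1 k)) = of_nat m"
proof -
  have "U m l (\<lambda>k. of_real (unit_vec 1 k)) = (\<Sum>k\<in>{1}. uvec m l k * of_real (unit_vec 1 k))"
    unfolding U_def using assms by (intro sum.mono_neutral_right) (auto simp: unit_vec_def)
  then show ?thesis by (simp add: uvec_def unit_vec_def)
qed

section \<open>Histories\<close>

text \<open>Histories are encoded by the list of the types of the successive insertion nodes, most recent
  first, so that \<open>drop\<close> returns to earlier times. Histories of probability \<open>0\<close> are kept; their states
  may leave the positive orthant.\<close>

primrec st :: "nat \<Rightarrow> nat list \<Rightarrow> nat \<Rightarrow> real" where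
  "st m [] = unit_vec 1"
| "st m (k # w) = (\<lambda>j. st m w j + increment m k j)"

text \<open>On a history of probability 0 these numbers may be negative, yet they always sum to 1;
  signs are therefore settled only along histories with \<open>pr m w\<close> nonzero.\<close>

definition step_prob :: "nat \<Rightarrow> nat list \<Rightarrow> nat \<Rightarrow> real" where
  "step_prob m w k = (if k \<in> {1..m} then real (gaps m k) * st m w k / real (length w + m) else 0)"

primrec pr :: "nat \<Rightarrow> nat list \<Rightarrow> real" where
  "pr m [] = 1"
| "pr m (k # w) = pr m w * step_prob m w k"

definition words :: "nat \<Rightarrow> nat \<Rightarrow> nat list set" where
  "words m n = {w. set w \<subseteq> {1..m} \<and> length w = n}"

text \<open>The expectation at time n as a finite sum, with values in any normed space so that it
  serves real and complex functions alike. \<open>Ew_Suc\<close> is the tower property.\<close>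

definition Ew :: "nat \<Rightarrow> nat \<Rightarrow> (nat list \<Rightarrow> 'b::real_normed_vector) \<Rightarrow> 'b" where
  "Ew m n h = (\<Sum>w\<in>words m n. pr m w *\<^sub>R h w)"

lemma words_0 [simp]: "words m 0 = {[]}" by (auto simp: words_def)

lemma words_Suc: "words m (Suc n) = (\<lambda>(k, w). k # w) ` ({1..m} \<times> words m n)"
  unfolding words_def by (auto simp: length_Suc_conv image_iff)

lemma finite_words [simp]: "finite (words m n)"
  by (induction n) (auto simp: words_Suc)

lemma length_words: "w \<in> words m n \<Longrightarrow> length w = n" by (simp add: words_def)

lemma Ew_0 [simp]: "Ew m 0 h = h []" by (simp add: Ew_def)

lemma Ew_Suc: "Ew m (Suc n) h = Ew m n (\<lambda>w. \<Sum>k=1..m. step_prob m w k *\<^sub>R h (k # w))"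
proof -
  have inj: "inj_on (\<lambda>(k, w). k # w) ({1..m} \<times> words m n)" by (auto simp: inj_on_def)
  have "Ew m (Suc n) h = (\<Sum>(k, w)\<in>{1..m} \<times> words m n. pr m (k # w) *\<^sub>R h (k # w))"
    unfolding Ew_def words_Suc by (subst sum.reindex[OF inj]) (simp add: case_prod_unfold)
  also have "\<dots> = (\<Sum>w\<in>words m n. \<Sum>k=1..m. pr m (k # w) *\<^sub>R h (k # w))"
    by (subst sum.cartesian_product[symmetric]) (rule sum.swap)
  finally show ?thesis by (simp add: Ew_def scaleR_sum_right)
qed

lemma Ew_add: "Ew m n (\<lambda>w. f w + g w) = Ew m n f + Ew m n g"
  by (simp add: Ew_def scaleR_add_right sum.distrib)

lemma Ew_diff: "Ew m n (\<lambda>w. f w - g w) = Ew m n f - Ew m n g"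
  by (simp add: Ew_def scaleR_diff_right sum_subtractf)

lemma Ew_cmult: "Ew m n (\<lambda>w. c * f w) = c * Ew m n (f :: _ \<Rightarrow> 'a::real_normed_algebra)"
  by (simp add: Ew_def sum_distrib_left)

lemma Ew_sum: "Ew m n (\<lambda>w. \<Sum>i\<in>A. f i w) = (\<Sum>i\<in>A. Ew m n (f i))"
  unfolding Ew_def scaleR_sum_right by (rule sum.swap)

lemma sum_gaps_increment:
  assumes "m \<ge> 2" "k \<in> {1..m}" shows "(\<Sum>j=1..m. real (gaps m j) * increment m k j) = 1"
proof -
  have "complex_of_real (\<Sum>j=1..m. real (gaps m j) * increment m k j) = (\<Sum>j=1..m. of_nat (gaps m j) * of_real (increment m k j))"
    by simp
  also have "\<dots> = 1"
    by (subst sum_increment_left) (use assms in \<open>auto simp: gaps_def of_nat_diff\<close>)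
  finally show ?thesis by (simp only: of_real_eq_1_iff)
qed

lemma sum_gaps_st:
  assumes "m \<ge> 2" "set w \<subseteq> {1..m}"
  shows "(\<Sum>j=1..m. real (gaps m j) * st m w j) = real (length w + m)"
  using assms(2)
proof (induction w)
  case Nil
  have "(\<Sum>j=1..m. real (gaps m j) * unit_vec 1 j) = (\<Sum>j\<in>{1}. real (gaps m j) * unit_vec 1 j)"
    using assms(1) by (intro sum.mono_neutral_right) (auto simp: unit_vec_def)
  then show ?case by (simp add: unit_vec_def gaps_def)
next
  case (Cons k w)
  then have "(\<Sum>j=1..m. real (gaps m j) * increment m k j) = 1" using sum_gaps_increment assms by auto
  with Cons show ?case by (simp add: distrib_left sum.distrib)
qed

lemma sum_step_prob:
  assumes "m \<ge> 2" "w \<in> words m n" shows "(\<Sum>k=1..m. step_prob m w k) = 1"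
  using sum_gaps_st[of m w] assms by (simp add: step_prob_def words_def flip: sum_divide_distrib)

lemma Ew_const [simp]: assumes "m \<ge> 2" shows "Ew m n (\<lambda>_. c) = c"
proof (induction n)
  case (Suc n)
  have "Ew m (Suc n) (\<lambda>_. c) = Ew m n (\<lambda>_. c)"
    unfolding Ew_Suc unfolding Ew_def
    by (intro sum.cong refl) (simp only: sum_step_prob[OF assms] scaleR_sum_left[symmetric] scaleR_one)
  with Suc show ?case by simp
qed simp

lemma increment_ge: "k \<in> {1..m} \<Longrightarrow> increment m k j \<ge> (if j = k then -1 else 0)"
  by (auto simp: increment_def unit_vec_def)

lemma increment_Ints: "increment m k j \<in> \<int>"
  by (auto simp: increment_def unit_vec_def)

text \<open>Integrality is carried along because it drives the induction: a nonzero step probability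
  means a nonzero count, hence a count of at least 1, and a step lowers only that count and by at
  most 1.\<close>

lemma st_nonneg:
  assumes "pr m w \<noteq> 0" shows "st m w j \<ge> 0 \<and> st m w j \<in> \<int>"
  using assms
proof (induction w arbitrary: j)
  case (Cons k w)
  then have IH: "\<And>j. st m w j \<ge> 0 \<and> st m w j \<in> \<int>" and "st m w k \<noteq> 0" and k: "k \<in> {1..m}"
    by (auto simp: step_prob_def split: if_splits)
  then have "st m w k \<ge> 1" using Ints_nonzero_abs_ge1[of "st m w k"] by fastforce
  then have "st m w j + increment m k j \<ge> 0" using IH[of j] increment_ge[OF k, of j] by (auto split: if_splits)
  then show ?case using IH[of j] increment_Ints by auto
qed (auto simp: unit_vec_def)

lemma step_prob_nonneg: "pr m w \<noteq> 0 \<Longrightarrow> step_prob m w k \<ge> 0"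
  using st_nonneg by (simp add: step_prob_def)

lemma pr_nonneg: "pr m w \<ge> 0"
proof (induction w)
  case (Cons k w)
  then show ?case using step_prob_nonneg[of m w k] by (cases "pr m w = 0") auto
qed simp

lemma Ew_mono:
  fixes f g :: "nat list \<Rightarrow> real"
  assumes "\<And>w. w \<in> words m n \<Longrightarrow> pr m w \<noteq> 0 \<Longrightarrow> f w \<le> g w"
  shows "Ew m n f \<le> Ew m n g"
  unfolding Ew_def
proof (rule sum_mono)
  fix w assume w: "w \<in> words m n"
  show "pr m w *\<^sub>R f w \<le> pr m w *\<^sub>R g w"
    using assms[OF w] pr_nonneg[of m w] by (cases "pr m w = 0") (auto intro: mult_left_mono)
qed

lemma Ew_cong:
  assumes "\<And>w. w \<in> words m n \<Longrightarrow> pr m w \<noteq> 0 \<Longrightarrow> f w = g w"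
  shows "Ew m n f = Ew m n g"
  unfolding Ew_def by (intro sum.cong refl) (metis assms scaleR_zero_left)

lemma Ew_nonneg:
  fixes f :: "nat list \<Rightarrow> real"
  assumes "\<And>w. w \<in> words m n \<Longrightarrow> f w \<ge> 0" shows "Ew m n f \<ge> 0"
  unfolding Ew_def using assms pr_nonneg by (intro sum_nonneg) auto

lemma norm_Ew_le: "norm (Ew m n f) \<le> Ew m n (\<lambda>w. norm (f w))"
  unfolding Ew_def by (rule order_trans[OF norm_sum]) (auto simp: pr_nonneg)

lemma st_le:
  assumes "m \<ge> 2" "w \<in> words m n" "pr m w \<noteq> 0" "k \<in> {1..m}"
  shows "st m w k \<le> real (n + m)"
proof -
  have "1 * st m w k \<le> real (gaps m k) * st m w k"
    using assms st_nonneg[OF assms(3)] by (intro mult_right_mono) (auto simp: gaps_def)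
  also have "\<dots> \<le> (\<Sum>j=1..m. real (gaps m j) * st m w j)"
    using assms(4) st_nonneg[OF assms(3)] by (intro member_le_sum) auto
  also have "\<dots> = real (n + m)" using sum_gaps_st[of m w] assms by (simp add: words_def)
  finally show ?thesis by simp
qed

section \<open>Eigencoordinates along a history and their moments\<close>

definition Y :: "nat \<Rightarrow> complex \<Rightarrow> nat list \<Rightarrow> complex" where
  "Y m l w = U m l (\<lambda>j. of_real (st m w j))"

definition Uinc :: "nat \<Rightarrow> complex \<Rightarrow> nat \<Rightarrow> complex" where
  "Uinc m l k = U m l (\<lambda>j. of_real (increment m k j))"

lemma Y_Nil: "m \<ge> 2 \<Longrightarrow> Y m l [] = of_nat m"
  using U_unit_vec by (simp add: Y_def)

lemma Y_Cons: "Y m l (k # w) = Y m l w + Uinc m l k"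
  by (simp add: Y_def Uinc_def U_add)

lemma mean_Uinc:
  assumes "m \<ge> 2" "l \<in> chi_roots m" "w \<in> words m n"
  shows "(\<Sum>k=1..m. of_real (step_prob m w k) * Uinc m l k) = l / of_nat (n + m) * Y m l w"
proof -
  have "(\<Sum>k=1..m. of_real (step_prob m w k) * Uinc m l k) = (\<Sum>k=1..m. (l * uvec m l k) * of_real (st m w k) / of_nat (n + m))"
  proof (rule sum.cong[OF refl])
    fix k assume k: "k \<in> {1..m}"
    show "of_real (step_prob m w k) * Uinc m l k = (l * uvec m l k) * of_real (st m w k) / of_nat (n + m)"
      using assms(3) k unfolding U_increment[OF assms(1,2) k, symmetric] step_prob_def Uinc_def
      by (simp add: words_def)
  qed
  also have "\<dots> = l / of_nat (n + m) * Y m l w"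
    unfolding Y_def U_def sum_distrib_left by (intro sum.cong refl) simp
  finally show ?thesis .
qed

lemma Y_le:
  assumes "m \<ge> 2" "w \<in> words m n" "pr m w \<noteq> 0"
  shows "cmod (Y m l w) \<le> (\<Sum>k=1..m. cmod (uvec m l k)) * real (n + m)"
proof -
  have "cmod (Y m l w) \<le> (\<Sum>k=1..m. cmod (uvec m l k * of_real (st m w k)))"
    unfolding Y_def U_def by (rule norm_sum)
  also have "\<dots> \<le> (\<Sum>k=1..m. cmod (uvec m l k) * real (n + m))"
    unfolding norm_mult norm_of_real
    using st_le[OF assms] st_nonneg[OF assms(3)] by (intro sum_mono mult_left_mono) auto
  finally show ?thesis by (simp add: sum_distrib_right)
qed

text \<open>The martingale increment: the jump of \<open>Y\<close> minus its conditional
  mean.\<close>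

definition dev :: "nat \<Rightarrow> complex \<Rightarrow> nat list \<Rightarrow> nat \<Rightarrow> complex" where
  "dev m l w k = Uinc m l k - l / of_nat (length w + m) * Y m l w"

definition devB :: "nat \<Rightarrow> complex \<Rightarrow> real" where
  "devB m l = 1 + (\<Sum>k=1..m. cmod (Uinc m l k)) + cmod l * (\<Sum>k=1..m. cmod (uvec m l k))"

lemma devB_pos: "devB m l \<ge> 1"
  unfolding devB_def by (simp add: sum_nonneg)

text \<open>The bound is uniform in time because \<open>Y\<close> grows at most linearly, so that
  the drift, of size |l| |Y| / (n + m), stays bounded.\<close>

lemma dev_le:
  assumes "m \<ge> 2" "w \<in> words m n" "pr m w \<noteq> 0" "k \<in> {1..m}"
  shows "cmod (dev m l w k) \<le> devB m l"
proof -
  have len: "length w = n" using assms(2) by (rule length_words)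
  have "cmod (l / of_nat (n + m) * Y m l w) = cmod l / real (n + m) * cmod (Y m l w)"
    by (simp add: norm_mult norm_divide del: of_nat_add)
  also have "\<dots> \<le> cmod l / real (n + m) * ((\<Sum>k=1..m. cmod (uvec m l k)) * real (n + m))"
    using Y_le[OF assms(1-3)] by (intro mult_left_mono) auto
  also have "\<dots> = cmod l * (\<Sum>k=1..m. cmod (uvec m l k))" using assms(1) by simp
  finally have "cmod (l / of_nat (n + m) * Y m l w) \<le> cmod l * (\<Sum>k=1..m. cmod (uvec m l k))" .
  moreover have "cmod (Uinc m l k) \<le> (\<Sum>k=1..m. cmod (Uinc m l k))"
    using assms(4) by (intro member_le_sum) auto
  ultimately show ?thesis unfolding dev_def devB_def len
    using norm_triangle_ineq4[of "Uinc m l k" "l / of_nat (n + m) * Y m l w"] by linarith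
qed

lemma mean_dev:
  assumes "m \<ge> 2" "l \<in> chi_roots m" "w \<in> words m n"
  shows "(\<Sum>k=1..m. of_real (step_prob m w k) * dev m l w k) = 0"
proof -
  have "(\<Sum>k=1..m. of_real (step_prob m w k) * dev m l w k) =
    (\<Sum>k=1..m. of_real (step_prob m w k) * Uinc m l k) - of_real (\<Sum>k=1..m. step_prob m w k) * (l / of_nat (n + m) * Y m l w)"
    using assms(3) by (simp only: dev_def right_diff_distrib sum_subtractf sum_distrib_right of_real_sum length_words)
  then show ?thesis unfolding mean_Uinc[OF assms] sum_step_prob[OF assms(1,3)] by simp
qed

text \<open>For |x| <= 1 it follows from exp x <= 1 + x + x^2. For x >= 1 the exponents already
  compare, and for x <= -1 the right side is at least 1 + x + x^2 >= 1.\<close>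

lemma exp_le_add_exp_square: "exp (x::real) \<le> x + exp (x\<^sup>2)"
proof -
  consider "x \<ge> 1" | "\<bar>x\<bar> \<le> 1" | "x \<le> -1" by linarith
  then show ?thesis
  proof cases
    case 1
    then have "x * 1 \<le> x * x" by (intro mult_left_mono) auto
    then have "exp x \<le> exp (x\<^sup>2)" unfolding exp_le_cancel_iff by (simp add: power2_eq_square)
    with 1 show ?thesis by linarith
  next
    case 2
    then have "exp x \<le> 1 + x + x\<^sup>2"
    proof (cases "x \<ge> 0")
      case True with 2 show ?thesis using exp_bound[of x] by simp
    next
      case False
      have "1 + (-x) + (-x)\<^sup>2/2 \<le> exp (-x)" using exp_lower_Taylor_quadratic[of "-x"] False by simp
      moreover have "0 < 1 + (-x) + (-x)\<^sup>2/2" using False by (intro add_pos_nonneg) auto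
      ultimately have "1 / exp (-x) \<le> 1 / (1 + (-x) + (-x)\<^sup>2/2)" by (intro divide_left_mono) auto
      then have "exp x \<le> 1 / (1 - x + x\<^sup>2/2)" by (simp add: exp_minus inverse_eq_divide)
      also have "\<dots> \<le> 1 + x + x\<^sup>2"
      proof -
        have pos: "0 < 1 - x + x\<^sup>2/2" using False by (intro add_pos_nonneg) auto
        have "(1 + x + x\<^sup>2) * (1 - x + x\<^sup>2/2) = 1 + x\<^sup>2/2 * (1 - x) + x^4/2"
          by (simp add: power2_eq_square power4_eq_xxxx field_simps)
        also have "\<dots> \<ge> 1" using False by simp
        finally show ?thesis using pos by (simp add: field_simps)
      qed
      finally show ?thesis .
    qed
    also have "1 + x\<^sup>2 \<le> exp (x\<^sup>2)" by (rule exp_ge_add_one_self)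
    then have "1 + x + x\<^sup>2 \<le> x + exp (x\<^sup>2)" by simp
    finally show ?thesis .
  next
    case 3
    have "1 + x\<^sup>2 \<le> exp (x\<^sup>2)" by (rule exp_ge_add_one_self)
    moreover have "x * (x + 1) \<ge> 0" using 3 by (intro mult_nonpos_nonpos) auto
    then have "x\<^sup>2 + x \<ge> 0" by (simp add: power2_eq_square algebra_simps)
    moreover have "exp x \<le> 1" using 3 by simp
    ultimately show ?thesis by linarith
  qed
qed

text \<open>Azuma's argument: the increments have conditional mean \<open>0\<close> and are bounded, and
  \<open>exp x \<le> x + exp (x\<^sup>2)\<close>.\<close>

lemma mgf_bound:
  assumes m: "m \<ge> 2" and l: "l \<in> chi_roots m" and n: "k0 \<le> n"
    and q: "\<And>j. k0 \<le> j \<Longrightarrow> j < n \<Longrightarrow> q j = q (Suc j) * (1 + l / of_nat (j + m))"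
  shows "Ew m n (\<lambda>w. exp (Re (q n * Y m l w - q k0 * Y m l (drop (n - k0) w))))
    \<le> exp ((devB m l)\<^sup>2 * (\<Sum>j=k0..<n. (cmod (q (Suc j)))\<^sup>2))"
  using n q
proof (induction n rule: dec_induct)
  case base
  then show ?case using m by simp
next
  case (step n)
  define \<Delta> where "\<Delta> w = Re (q n * Y m l w - q k0 * Y m l (drop (n - k0) w))" for w
  define b where "b = devB m l * cmod (q (Suc n))"
  have "Ew m (Suc n) (\<lambda>w. exp (Re (q (Suc n) * Y m l w - q k0 * Y m l (drop (Suc n - k0) w))))
    = Ew m n (\<lambda>w. \<Sum>k=1..m. step_prob m w k *\<^sub>R exp (Re (q (Suc n) * Y m l (k # w) - q k0 * Y m l (drop (Suc n - k0) (k # w)))))"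
    by (rule Ew_Suc)
  also have "\<dots> \<le> Ew m n (\<lambda>w. exp (b\<^sup>2) * exp (\<Delta> w))"
  proof (rule Ew_mono)
    fix w assume w: "w \<in> words m n" "pr m w \<noteq> 0"
    have len: "length w = n" using w(1) by (rule length_words)
    define \<theta> where "\<theta> k = Re (q (Suc n) * dev m l w k)" for k
    \<comment> \<open>The recursion for \<open>q\<close> absorbs the drift: q(n+1) Y(n+1) exceeds
      q(n) Y(n) by exactly q(n+1) times the centred jump.\<close>
    have eq: "Re (q (Suc n) * Y m l (k # w) - q k0 * Y m l (drop (Suc n - k0) (k # w))) = \<Delta> w + \<theta> k" for k
    proof -
      have "drop (Suc n - k0) (k # w) = drop (n - k0) w" using step by (simp add: Suc_diff_le)
      moreover have "q n = q (Suc n) * (1 + l / of_nat (n + m))" using step by auto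
      ultimately show ?thesis unfolding \<Delta>_def \<theta>_def dev_def Y_Cons len
        by (simp only: minus_complex.sel(1)[symmetric] plus_complex.sel(1)[symmetric])
           (simp add: algebra_simps)
    qed
    have th: "(\<theta> k)\<^sup>2 \<le> b\<^sup>2" if "k \<in> {1..m}" for k
    proof -
      have "\<bar>\<theta> k\<bar> \<le> cmod (q (Suc n) * dev m l w k)" unfolding \<theta>_def by (rule abs_Re_le_cmod)
      also have "\<dots> \<le> b" unfolding b_def norm_mult mult.commute[of "devB m l"]
        by (intro mult_left_mono dev_le[OF m w that]) auto
      finally show ?thesis using power_mono[of "\<bar>\<theta> k\<bar>" b 2] by simp
    qed
    have "(\<Sum>k=1..m. step_prob m w k * exp (\<theta> k)) \<le> (\<Sum>k=1..m. step_prob m w k * (\<theta> k + exp (b\<^sup>2)))"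
    proof (intro sum_mono mult_left_mono)
      fix k assume k: "k \<in> {1..m}"
      have "exp (\<theta> k) \<le> \<theta> k + exp ((\<theta> k)\<^sup>2)" by (rule exp_le_add_exp_square)
      also have "\<dots> \<le> \<theta> k + exp (b\<^sup>2)" using th[OF k] by simp
      finally show "exp (\<theta> k) \<le> \<theta> k + exp (b\<^sup>2)" .
    qed (use step_prob_nonneg w in auto)
    also have "\<dots> = (\<Sum>k=1..m. step_prob m w k * \<theta> k) + exp (b\<^sup>2)"
      using sum_step_prob[OF m w(1)] by (simp add: distrib_left sum.distrib flip: sum_distrib_right)
    also have "(\<Sum>k=1..m. step_prob m w k * \<theta> k) = Re (q (Suc n) * (\<Sum>k=1..m. of_real (step_prob m w k) * dev m l w k))"
      unfolding \<theta>_def sum_distrib_left Re_sum by (intro sum.cong refl) (simp add: algebra_simps)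
    also have "\<dots> = 0" unfolding mean_dev[OF m l w(1)] by simp
    finally have "(\<Sum>k=1..m. step_prob m w k * exp (\<theta> k)) * exp (\<Delta> w) \<le> exp (b\<^sup>2) * exp (\<Delta> w)"
      by (intro mult_right_mono) auto
    then show "(\<Sum>k=1..m. step_prob m w k *\<^sub>R exp (Re (q (Suc n) * Y m l (k # w) - q k0 * Y m l (drop (Suc n - k0) (k # w)))))
        \<le> exp (b\<^sup>2) * exp (\<Delta> w)"
      unfolding eq by (simp add: exp_add sum_distrib_right sum_distrib_left mult_ac)
  qed
  also have "\<dots> = exp (b\<^sup>2) * Ew m n (\<lambda>w. exp (\<Delta> w))" by (rule Ew_cmult)
  also have "\<dots> \<le> exp (b\<^sup>2) * exp ((devB m l)\<^sup>2 * (\<Sum>j=k0..<n. (cmod (q (Suc j)))\<^sup>2))"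
    unfolding \<Delta>_def using step by (intro mult_left_mono step.IH) auto
  also have "\<dots> = exp (b\<^sup>2 + (devB m l)\<^sup>2 * (\<Sum>j=k0..<n. (cmod (q (Suc j)))\<^sup>2))"
    by (simp only: exp_add)
  also have "b\<^sup>2 + (devB m l)\<^sup>2 * (\<Sum>j=k0..<n. (cmod (q (Suc j)))\<^sup>2) = (devB m l)\<^sup>2 * (\<Sum>j=k0..<Suc n. (cmod (q (Suc j)))\<^sup>2)"
    using step by (simp add: b_def power_mult_distrib distrib_left)
  finally show ?case .
qed

lemma even_power_le_exp: "(x::real)^(2*r) \<le> fact (2*r) * (exp x + exp (-x))"
proof -
  have "\<bar>x\<bar>^(2*r) / fact (2*r) \<le> exp \<bar>x\<bar>"
  proof -
    have "(\<Sum>k\<in>{2*r}. \<bar>x\<bar>^k /\<^sub>R fact k) \<le> (\<Sum>k. \<bar>x\<bar>^k /\<^sub>R fact k)"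
      by (intro sum_le_suminf summable_exp_generic) auto
    then show ?thesis by (simp add: exp_def divide_inverse mult.commute)
  qed
  also have "exp \<bar>x\<bar> \<le> exp x + exp (-x)" by (simp add: abs_if)
  finally have "\<bar>x\<bar>^(2*r) \<le> fact (2*r) * (exp x + exp (-x))" by (simp add: field_simps)
  then show ?thesis by (simp add: power_mult)
qed

lemma sum_power_le:
  fixes a b :: real assumes "a \<ge> 0" "b \<ge> 0"
  shows "(a + b)^r \<le> 2^r * (a^r + b^r)"
proof -
  have "(a + b)^r \<le> (2 * max a b)^r" using assms by (intro power_mono) auto
  also have "\<dots> = 2^r * (max a b)^r" by (rule power_mult_distrib)
  also have "(max a b)^r \<le> a^r + b^r" using assms by (auto simp: max_def)
  finally show ?thesis by simp
qed

definition momK :: "nat \<Rightarrow> complex \<Rightarrow> nat \<Rightarrow> real" where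
  "momK m l r = 2^r * (4 * fact (2*r) * exp ((devB m l)\<^sup>2))"

lemma momK_pos: "momK m l r > 0" by (simp add: momK_def)

text \<open>Divide \<open>q\<close> by the square root of S, the sum of squares; then
  \<open>mgf_bound\<close> is uniform. The four directions 1, -1, i, -i control the exponentials of
  plus and minus the real and imaginary parts, and these dominate even powers with the constant
  (2r)!.\<close>

lemma moment_bound:
  assumes m: "m \<ge> 2" and l: "l \<in> chi_roots m" and n: "k0 \<le> n" and r: "r \<ge> 1"
    and q: "\<And>j. k0 \<le> j \<Longrightarrow> j < n \<Longrightarrow> q j = q (Suc j) * (1 + l / of_nat (j + m))"
  shows "Ew m n (\<lambda>w. cmod (q n * Y m l w - q k0 * Y m l (drop (n - k0) w)) ^ (2*r))
    \<le> momK m l r * (\<Sum>j=k0..<n. (cmod (q (Suc j)))\<^sup>2)^r"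
proof (cases "k0 = n")
  case True
  then show ?thesis using r m by (cases r) (simp_all add: momK_def)
next
  case False
  with n have n': "k0 < n" by simp
  define S where "S = (\<Sum>j=k0..<n. (cmod (q (Suc j)))\<^sup>2)"
  define \<Delta> where "\<Delta> w = q n * Y m l w - q k0 * Y m l (drop (n - k0) w)" for w
  have S0: "S \<ge> 0" unfolding S_def by (intro sum_nonneg) auto
  show ?thesis
  proof (cases "S = 0")
    case True
    \<comment> \<open>Here no rescaling is possible, but the recursion then also gives
      \<open>q k0 = 0\<close>, so the difference vanishes.\<close>
    then have "\<forall>j\<in>{k0..<n}. q (Suc j) = 0" unfolding S_def by (subst (asm) sum_nonneg_eq_0_iff) auto
    then have "q n = 0" "q k0 = 0" using n' q[of k0] by (auto dest: bspec[of _ _ "n-1"])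
    moreover have "momK m l r * (\<Sum>j=k0..<n. (cmod (q (Suc j)))\<^sup>2)^r \<ge> 0"
      using momK_pos[of m l r] by (intro mult_nonneg_nonneg zero_le_power sum_nonneg) auto
    ultimately show ?thesis using r m by (simp add: power_0_left)
  next
    case False
    with S0 have Spos: "S > 0" by simp
    have rexp: "Ew m n (\<lambda>w. exp (Re (c * \<Delta> w / of_real (sqrt S)))) \<le> exp ((devB m l)\<^sup>2)" if c: "cmod c = 1" for c
    proof -
      have h1: "Ew m n (\<lambda>w. exp (Re ((c * q n / of_real (sqrt S)) * Y m l w - (c * q k0 / of_real (sqrt S)) * Y m l (drop (n - k0) w))))
        \<le> exp ((devB m l)\<^sup>2 * (\<Sum>j=k0..<n. (cmod (c * q (Suc j) / of_real (sqrt S)))\<^sup>2))"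
        by (rule mgf_bound[OF m l n, where q="\<lambda>j. c * q j / of_real (sqrt S)"]) (simp add: q)
      have h2: "(\<Sum>j=k0..<n. (cmod (c * q (Suc j) / of_real (sqrt S)))\<^sup>2) = 1"
        using Spos c by (simp add: norm_mult norm_divide power_divide S_def[symmetric] flip: sum_divide_distrib)
      have h3: "(c * q n / of_real (sqrt S)) * Y m l w - (c * q k0 / of_real (sqrt S)) * Y m l (drop (n - k0) w) = c * \<Delta> w / of_real (sqrt S)" for w
        by (simp add: \<Delta>_def algebra_simps diff_divide_distrib)
      show ?thesis using h1 unfolding h2 h3 mult_1_right .
    qed
    have pt: "cmod (\<Delta> w) ^ (2*r) \<le> S^r * (2^r * (fact (2*r) *
       (exp (Re (1 * \<Delta> w / of_real (sqrt S))) + exp (Re (-1 * \<Delta> w / of_real (sqrt S))) +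
        exp (Re (\<i> * \<Delta> w / of_real (sqrt S))) + exp (Re (- \<i> * \<Delta> w / of_real (sqrt S))))))" for w
    proof -
      define z where "z = \<Delta> w / of_real (sqrt S)"
      have "cmod z ^ (2*r) = ((Re z)\<^sup>2 + (Im z)\<^sup>2)^r" by (simp add: power_mult cmod_power2)
      also have "\<dots> \<le> 2^r * (((Re z)\<^sup>2)^r + ((Im z)\<^sup>2)^r)" by (intro sum_power_le) auto
      also have "\<dots> = 2^r * ((Re z)^(2*r) + (Im z)^(2*r))" by (simp add: power_mult)
      also have "\<dots> \<le> 2^r * (fact (2*r) * (exp (Re z) + exp (- Re z)) + fact (2*r) * (exp (Im z) + exp (- Im z)))"
        by (intro mult_left_mono add_mono even_power_le_exp) auto
      finally have "cmod z ^ (2*r) \<le> 2^r * (fact (2*r) * (exp (Re z) + exp (- Re z) + exp (- Im z) + exp (Im z)))"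
        by (simp add: algebra_simps)
      moreover have "cmod (\<Delta> w) ^ (2*r) = S^r * cmod z ^ (2*r)"
        using Spos by (simp add: z_def norm_divide power_divide power_mult real_sqrt_pow2)
      moreover have "Re z = Re (1 * \<Delta> w / of_real (sqrt S))" "- Re z = Re (-1 * \<Delta> w / of_real (sqrt S))"
        "- Im z = Re (\<i> * \<Delta> w / of_real (sqrt S))" "Im z = Re (- \<i> * \<Delta> w / of_real (sqrt S))"
        by (simp_all add: z_def)
      ultimately show ?thesis using Spos by simp
    qed
    have "Ew m n (\<lambda>w. cmod (\<Delta> w) ^ (2*r)) \<le> Ew m n (\<lambda>w. S^r * (2^r * (fact (2*r) *
       (exp (Re (1 * \<Delta> w / of_real (sqrt S))) + exp (Re (-1 * \<Delta> w / of_real (sqrt S))) +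
        exp (Re (\<i> * \<Delta> w / of_real (sqrt S))) + exp (Re (- \<i> * \<Delta> w / of_real (sqrt S)))))))"
      by (rule Ew_mono) (rule pt)
    also have "\<dots> \<le> S^r * (2^r * (fact (2*r) * (exp ((devB m l)\<^sup>2) + exp ((devB m l)\<^sup>2) + exp ((devB m l)\<^sup>2) + exp ((devB m l)\<^sup>2))))"
      unfolding Ew_cmult Ew_add using Spos by (intro mult_left_mono add_mono rexp) auto
    also have "\<dots> = momK m l r * S^r" by (simp add: momK_def)
    finally show ?thesis unfolding S_def \<Delta>_def .
  qed
qed

text \<open>The whole path up to time \<open>length w\<close> is prescribed, because the law of the
  chain is given conditionally on whole paths. Since \<open>w\<close> lists the latest step first,
  dropping \<open>length w - i\<close> entries leaves the history at time i.\<close>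

definition hist_event :: "nat \<Rightarrow> 'a measure \<Rightarrow> (nat \<Rightarrow> 'a \<Rightarrow> nat \<Rightarrow> real) \<Rightarrow> nat list \<Rightarrow> 'a set" where
  "hist_event m M L w = {\<omega>\<in>space M. \<forall>i\<le>length w. \<forall>j\<in>{1..m}. L i \<omega> j = st m (drop (length w - i) w) j}"

lemma hist_event_Cons:
  "hist_event m M L (k # w) = {\<omega>\<in>hist_event m M L w. \<forall>j\<in>{1..m}. L (Suc (length w)) \<omega> j = L (length w) \<omega> j + increment m k j}"
proof -
  have *: "(\<forall>i\<le>Suc n. P i) \<longleftrightarrow> (\<forall>i\<le>n. P i) \<and> P (Suc n)" for P n by (auto simp: le_Suc_eq)
  have "(\<forall>i\<le>length w. \<forall>j\<in>{1..m}. L i \<omega> j = st m (drop (Suc (length w) - i) (k # w)) j) \<longleftrightarrow>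
     (\<forall>i\<le>length w. \<forall>j\<in>{1..m}. L i \<omega> j = st m (drop (length w - i) w) j)" for \<omega>
    by (auto simp: Suc_diff_le)
  then show ?thesis by (auto simp: hist_event_def *)
qed

lemma hist_event_measurable [measurable]:
  assumes "btree_fringe_chain m M L" shows "hist_event m M L w \<in> sets M"
proof -
  have [measurable]: "(\<lambda>\<omega>. L i \<omega> j) \<in> borel_measurable M" if "j \<in> {1..m}" for i j
    using assms that by (auto simp: btree_fringe_chain_def)
  have "hist_event m M L w = {\<omega>\<in>space M. \<forall>i\<in>{..length w}. \<forall>j\<in>{1..m}. L i \<omega> j = st m (drop (length w - i) w) j}"
    by (auto simp: hist_event_def)
  also have "\<dots> \<in> sets M" by (intro sets.sets_Collect_finite_All) auto
  finally show ?thesis .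
qed

text \<open>Induction on the history. A prefix of probability 0 is treated separately, since the
  transition rule speaks only of histories of positive probability; monotonicity of the measure
  settles that case.\<close>

lemma measure_hist_event:
  assumes m: "m \<ge> 2" and chain: "btree_fringe_chain m M L" and w: "set w \<subseteq> {1..m}"
  shows "measure M (hist_event m M L w) = pr m w"
  using w
proof (induction w)
  interpret prob_space M using chain by (simp add: btree_fringe_chain_def)
  case Nil
  have "AE \<omega> in M. \<forall>j\<in>{1..m}. L 0 \<omega> j = unit_vec 1 j" using chain by (simp add: btree_fringe_chain_def)
  then have "AE \<omega> in M. \<omega> \<in> hist_event m M L []" by (auto simp: hist_event_def)
  then show ?case using prob_eq_1[OF hist_event_measurable[OF chain]] by simp
next
  interpret prob_space M using chain by (simp add: btree_fringe_chain_def)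
  case (Cons k w)
  have IH: "prob (hist_event m M L w) = pr m w" and k: "k \<in> {1..m}" using Cons by auto
  show ?case
  proof (cases "pr m w = 0")
    case True
    have "prob (hist_event m M L (k # w)) \<le> prob (hist_event m M L w)"
      by (intro finite_measure_mono hist_event_measurable[OF chain]) (auto simp: hist_event_Cons)
    with True IH have "prob (hist_event m M L (k # w)) = 0" by (intro antisym) auto
    with True show ?thesis by simp
  next
    case False
    define x where "x i = st m (drop (length w - i) w)" for i
    have ev: "hist_event m M L w = {\<omega>\<in>space M. \<forall>i\<le>length w. \<forall>j\<in>{1..m}. L i \<omega> j = x i j}"
      by (simp add: hist_event_def x_def)
    have pos: "\<P>(\<omega> in M. \<forall>i\<le>length w. \<forall>j\<in>{1..m}. L i \<omega> j = x i j) > 0"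
      using False IH pr_nonneg[of m w] by (simp add: ev less_le)
    have c1: "\<P>(\<omega> in M. (\<forall>j\<in>{1..m}. L (Suc (length w)) \<omega> j = L (length w) \<omega> j + increment m k j)
              \<bar> (\<forall>i\<le>length w. \<forall>j\<in>{1..m}. L i \<omega> j = x i j)) = real (gaps m k) * x (length w) k / real (length w + m)"
      using chain pos k unfolding btree_fringe_chain_def by blast
    have c2: "{\<omega>\<in>space M. (\<forall>j\<in>{1..m}. L (Suc (length w)) \<omega> j = L (length w) \<omega> j + increment m k j)
              \<and> (\<forall>i\<le>length w. \<forall>j\<in>{1..m}. L i \<omega> j = x i j)} = hist_event m M L (k # w)"
      by (auto simp: hist_event_Cons ev)
    have "prob (hist_event m M L (k # w)) / pr m w = step_prob m w k"
      using c1[unfolded cond_prob_def c2 ev[symmetric] IH] k by (simp add: step_prob_def x_def)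
    with False show ?thesis by (simp add: field_simps)
  qed
qed

text \<open>The type of the insertion node can be recovered from a jump as the coordinate that
  decreases, so a path determines its history.\<close>

lemma hist_event_disjoint:
  assumes "\<omega> \<in> hist_event m M L w" "\<omega> \<in> hist_event m M L w'" "length w = length w'" "set w \<subseteq> {1..m}" "set w' \<subseteq> {1..m}"
  shows "w = w'"
  using assms(3,1,2,4,5)
proof (induction w w' rule: list_induct2)
  case (Cons k w k' w')
  then have "w = w'" by (auto simp: hist_event_Cons)
  have inc: "increment m k j = increment m k' j" if "j \<in> {1..m}" for j
    using Cons.prems Cons.hyps that unfolding hist_event_Cons by force
  have "k = k'"
  proof (rule ccontr)
    assume "k \<noteq> k'"
    then have "increment m k' k \<ge> 0" "increment m k k' \<ge> 0"
      using increment_ge[of k' m k] increment_ge[of k m k'] Cons.prems by auto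
    moreover have "increment m k k = -1 \<or> increment m k' k' = -1"
      using \<open>k \<noteq> k'\<close> Cons.prems by (auto simp: increment_def unit_vec_def)
    ultimately show False using inc[of k] inc[of k'] Cons.prems by auto
  qed
  with \<open>w = w'\<close> show ?case by simp
qed simp

lemma sum_pr: "m \<ge> 2 \<Longrightarrow> (\<Sum>w\<in>words m n. pr m w) = 1"
  using Ew_const[of m n "1::real"] by (simp add: Ew_def)

text \<open>The disjoint history events already have total mass 1, which leaves no room for jumps
  other than the prescribed increments.\<close>

lemma AE_hist_event:
  assumes m: "m \<ge> 2" and chain: "btree_fringe_chain m M L"
  shows "AE \<omega> in M. \<exists>w\<in>words m n. \<omega> \<in> hist_event m M L w"
proof -
  interpret prob_space M using chain by (simp add: btree_fringe_chain_def)
  have "prob (\<Union>w\<in>words m n. hist_event m M L w) = (\<Sum>w\<in>words m n. prob (hist_event m M L w))"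
  proof (intro finite_measure_finite_Union)
    show "hist_event m M L ` words m n \<subseteq> events" using hist_event_measurable[OF chain] by auto
    show "disjoint_family_on (hist_event m M L) (words m n)"
      unfolding disjoint_family_on_def
    proof (intro ballI impI)
      fix v w assume "v \<in> words m n" "w \<in> words m n" "v \<noteq> w"
      then show "hist_event m M L v \<inter> hist_event m M L w = {}"
        using hist_event_disjoint[of _ m M L v w] by (auto simp: words_def)
    qed
  qed simp
  also have "\<dots> = 1" using measure_hist_event[OF m chain] sum_pr[OF m, of n] by (simp add: words_def)
  finally have "AE \<omega> in M. \<omega> \<in> (\<Union>w\<in>words m n. hist_event m M L w)"
    by (subst (asm) prob_eq_1) (auto intro!: sets.finite_UN hist_event_measurable[OF chain])
  then show ?thesis by auto
qed

text \<open>The bridge from the given probability space to finite sums: a measurable function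
  determined by the history up to time n is almost surely a simple function.\<close>

lemma integral_history:
  fixes g :: "'a \<Rightarrow> 'b::{banach, second_countable_topology}"
  assumes m: "m \<ge> 2" and chain: "btree_fringe_chain m M L"
    and g: "g \<in> borel_measurable M"
    and gh: "\<And>w \<omega>. w \<in> words m n \<Longrightarrow> \<omega> \<in> hist_event m M L w \<Longrightarrow> g \<omega> = h w"
  shows "integrable M g" "integral\<^sup>L M g = Ew m n h"
proof -
  interpret prob_space M using chain by (simp add: btree_fringe_chain_def)
  note [measurable] = hist_event_measurable[OF chain]
  define f where "f \<omega> = (\<Sum>w\<in>words m n. indicator (hist_event m M L w) \<omega> *\<^sub>R h w)" for \<omega>
  have fg: "AE \<omega> in M. g \<omega> = f \<omega>"
    using AE_hist_event[OF m chain, of n]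
  proof eventually_elim
    case (elim \<omega>)
    then obtain w where w: "w \<in> words m n" "\<omega> \<in> hist_event m M L w" by auto
    have "f \<omega> = (\<Sum>v\<in>{w}. indicator (hist_event m M L v) \<omega> *\<^sub>R h v)"
      unfolding f_def
    proof (intro sum.mono_neutral_right ballI)
      fix v assume v: "v \<in> words m n - {w}"
      then have "\<omega> \<notin> hist_event m M L v"
        using hist_event_disjoint[OF w(2), of v] w(1) by (auto simp: words_def)
      then show "indicator (hist_event m M L v) \<omega> *\<^sub>R h v = 0" by simp
    qed (use w in auto)
    then show ?case using w gh by simp
  qed
  have f: "integrable M f" unfolding f_def by (intro Bochner_Integration.integrable_sum integrable_scaleR_left integrable_real_indicator) (auto simp: emeasure_eq_measure)
  have [measurable]: "f \<in> borel_measurable M" using f by auto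
  show "integrable M g" using integrable_cong_AE[OF g _ fg] f by auto
  have "integral\<^sup>L M g = integral\<^sup>L M f" by (rule integral_cong_AE[OF g _ fg]) simp
  also have "\<dots> = (\<Sum>w\<in>words m n. measure M (hist_event m M L w) *\<^sub>R h w)"
    unfolding f_def by (subst Bochner_Integration.integral_sum) (auto simp: emeasure_eq_measure intro!: integrable_scaleR_left integrable_real_indicator)
  also have "\<dots> = Ew m n h" unfolding Ew_def using measure_hist_event[OF m chain] by (intro sum.cong refl) (auto simp: words_def)
  finally show "integral\<^sup>L M g = Ew m n h" .
qed

section \<open>Growth of the eigencoordinates\<close>

lemma powr_pow: "x > 0 \<Longrightarrow> ((x::real) powr a)^k = x powr (a * real k)"
  by (metis powr_gt_zero powr_powr powr_realpow less_irrefl)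

text \<open>The factor by which the conditional mean of the coordinate \<open>l\<close> grows
  between times j and n.\<close>

definition Gp :: "nat \<Rightarrow> complex \<Rightarrow> nat \<Rightarrow> nat \<Rightarrow> complex" where
  "Gp m l j n = (\<Prod>i=j..<n. 1 + l / of_nat (i + m))"

lemma Gp_self [simp]: "Gp m l n n = 1" by (simp add: Gp_def)

lemma Gp_Suc: "j \<le> n \<Longrightarrow> Gp m l j (Suc n) = Gp m l j n * (1 + l / of_nat (n + m))"
  by (simp add: Gp_def)

lemma Gp_rec: "j < n \<Longrightarrow> Gp m l j n = Gp m l (Suc j) n * (1 + l / of_nat (j + m))"
  by (simp add: Gp_def prod.atLeast_Suc_lessThan mult.commute)

lemma norm_one_plus_le:
  assumes "x > 0" "Re l \<le> s"
  shows "cmod (1 + l / of_real x) \<le> exp (s / x + (cmod l)\<^sup>2 / (2 * x\<^sup>2))"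
proof -
  have "(cmod (1 + l / of_real x))\<^sup>2 = 1 + (2 * Re l / x + (cmod l)\<^sup>2 / x\<^sup>2)"
  proof -
    have "Re (1 + l / of_real x) = 1 + Re l / x" "Im (1 + l / of_real x) = Im l / x" by simp_all
    then show ?thesis unfolding cmod_power2 using assms(1) by (simp add: power2_eq_square field_simps)
  qed
  also have "\<dots> \<le> 1 + (2 * s / x + (cmod l)\<^sup>2 / x\<^sup>2)"
    using assms by (intro add_mono divide_right_mono) auto
  also have "\<dots> \<le> exp (2 * s / x + (cmod l)\<^sup>2 / x\<^sup>2)" by (rule exp_ge_add_one_self)
  also have "\<dots> = (exp (s / x + (cmod l)\<^sup>2 / (2 * x\<^sup>2)))\<^sup>2"
    by (simp add: exp_double[symmetric] distrib_left)
  finally show ?thesis by (rule power2_le_imp_le) simp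
qed

text \<open>The correction to ln(x+1) - ln x is written as a difference 1/(x-1) - 1/x so that it
  telescopes in the product \<open>Gp\<close>.\<close>

lemma inverse_le_ln_diff:
  assumes "x > (1::real)" shows "1 / x \<le> ln (x + 1) - ln x + (1 / (x - 1) - 1 / x)"
proof -
  have "1 / x - (1/x)^2/2 \<le> ln (1 + 1/x)" by (rule ln_ge_quadratic) (use assms in auto)
  also have "1 + 1/x = (x + 1) / x" using assms by (simp add: field_simps)
  also have "ln ((x + 1) / x) = ln (x + 1) - ln x" using assms by (intro ln_divide_pos) auto
  finally have "1 / x \<le> ln (x + 1) - ln x + (1/x)^2/2" by simp
  moreover have "(1/x)^2/2 \<le> 1 / (x - 1) - 1 / x"
  proof -
    have "1 / (x - 1) - 1 / x = 1 / (x * (x - 1))" using assms by (simp add: field_simps)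
    also have "\<dots> \<ge> 1 / (x * x * 2)" using assms by (intro divide_left_mono mult_pos_pos) (auto intro!: mult_mono simp: mult.assoc)
    also have "1 / (x * x * 2) = (1/x)^2/2" by (simp add: power2_eq_square)
    finally show ?thesis .
  qed
  ultimately show ?thesis by linarith
qed

lemma inverse_square_le_diff:
  assumes "x > (1::real)" shows "1 / (2 * x\<^sup>2) \<le> 1 / (x - 1) - 1 / x"
proof -
  have "1 / (x - 1) - 1 / x = 1 / (x * (x - 1))" using assms by (simp add: field_simps)
  also have "\<dots> \<ge> 1 / (2 * (x * x))" using assms by (intro divide_left_mono mult_pos_pos) (auto simp: algebra_simps)
  finally show ?thesis by (simp add: power2_eq_square)
qed

text \<open>Summing the logarithms gives s times the logarithm of the ratio plus a telescoping
  correction. That correction is at most D, as m >= 2 gives 1/(j+m-1) <= 1; hence the constant exp(s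
  + |l|^2), uniform in j and n.\<close>

lemma norm_Gp_le:
  assumes m: "m \<ge> 2" and s: "Re l \<le> s" "0 \<le> s" and "j \<le> n"
  shows "cmod (Gp m l j n) \<le> exp (s + (cmod l)\<^sup>2) * (real (n + m) / real (j + m)) powr s"
proof -
  define D where "D = s + (cmod l)\<^sup>2"
  have D: "D \<ge> 0" using s by (simp add: D_def)
  have "cmod (Gp m l j n) \<le> exp (s * (ln (real (n + m)) - ln (real (j + m))) + D * (1 / (real (j + m) - 1) - 1 / (real (n + m) - 1)))"
    using \<open>j \<le> n\<close>
  proof (induction n rule: dec_induct)
    case (step n)
    define x where "x = real (n + m)"
    have x: "x > 1" using m by (simp add: x_def)
    have "cmod (1 + l / of_nat (n + m)) = cmod (1 + l / of_real x)" by (simp add: x_def)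
    also have "\<dots> \<le> exp (s / x + (cmod l)\<^sup>2 / (2 * x\<^sup>2))" using x s by (intro norm_one_plus_le) auto
    also have "\<dots> \<le> exp (s * (ln (x + 1) - ln x) + D * (1 / (x - 1) - 1 / x))"
    proof -
      have "s * (1 / x) \<le> s * (ln (x + 1) - ln x + (1 / (x - 1) - 1 / x))"
        using inverse_le_ln_diff[OF x] s by (intro mult_left_mono) auto
      moreover have "(cmod l)\<^sup>2 * (1 / (2 * x\<^sup>2)) \<le> (cmod l)\<^sup>2 * (1 / (x - 1) - 1 / x)"
        using inverse_square_le_diff[OF x] by (intro mult_left_mono) auto
      ultimately have "s * (1 / x) + (cmod l)\<^sup>2 * (1 / (2 * x\<^sup>2)) \<le> s * (ln (x + 1) - ln x) + D * (1 / (x - 1) - 1 / x)"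
        unfolding D_def by (simp add: algebra_simps)
      then show ?thesis by simp
    qed
    finally have "cmod (Gp m l j (Suc n)) \<le> exp (s * (ln (real (n + m)) - ln (real (j + m))) + D * (1 / (real (j + m) - 1) - 1 / (real (n + m) - 1)))
       * exp (s * (ln (x + 1) - ln x) + D * (1 / (x - 1) - 1 / x))"
      using step unfolding Gp_Suc[OF step(1)] norm_mult by (intro mult_mono) auto
    also have "\<dots> = exp ((s * (ln (real (n + m)) - ln (real (j + m))) + D * (1 / (real (j + m) - 1) - 1 / (real (n + m) - 1)))
       + (s * (ln (x + 1) - ln x) + D * (1 / (x - 1) - 1 / x)))" by (rule exp_add[symmetric])
    also have "(s * (ln (real (n + m)) - ln (real (j + m))) + D * (1 / (real (j + m) - 1) - 1 / (real (n + m) - 1)))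
       + (s * (ln (x + 1) - ln x) + D * (1 / (x - 1) - 1 / x))
       = s * (ln (real (Suc n + m)) - ln (real (j + m))) + D * (1 / (real (j + m) - 1) - 1 / (real (Suc n + m) - 1))"
    proof -
      have "real (Suc n + m) = x + 1" "real (n + m) = x" by (simp_all add: x_def)
      then show ?thesis by (simp add: algebra_simps)
    qed
    finally show ?case .
  qed simp
  also have "\<dots> \<le> exp (s * (ln (real (n + m)) - ln (real (j + m))) + D * 1)"
  proof -
    have "1 / (real (j + m) - 1) \<le> 1" "0 \<le> 1 / (real (n + m) - 1)" using m by (auto simp: field_simps)
    then have "1 / (real (j + m) - 1) - 1 / (real (n + m) - 1) \<le> 1" by linarith
    then have "D * (1 / (real (j + m) - 1) - 1 / (real (n + m) - 1)) \<le> D * 1" using D by (intro mult_left_mono)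
    then show ?thesis by simp
  qed
  also have "\<dots> = exp D * (real (n + m) / real (j + m)) powr s"
    using m by (simp add: powr_def ln_div exp_add mult.commute)
  finally show ?thesis by (simp add: D_def)
qed

lemma Gp_powr_sum_le:
  assumes "m \<ge> 2" "Re l \<le> s" "0 \<le> s"
  shows "(\<Sum>j=0..<n. (cmod (Gp m l (Suc j) n))\<^sup>2) \<le>
    (exp (s + (cmod l)\<^sup>2))\<^sup>2 * real (n + m) powr (2 * s) * (\<Sum>j<n. real (Suc j) powr (-2 * s))"
proof -
  have "(\<Sum>j=0..<n. (cmod (Gp m l (Suc j) n))\<^sup>2) \<le> (\<Sum>j=0..<n. (exp (s + (cmod l)\<^sup>2))\<^sup>2 * real (n + m) powr (2 * s) * real (Suc j) powr (-2 * s))"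
  proof (rule sum_mono)
    fix j assume j: "j \<in> {0..<n}"
    have "(cmod (Gp m l (Suc j) n))\<^sup>2 \<le> (exp (s + (cmod l)\<^sup>2) * (real (n + m) / real (Suc j + m)) powr s)\<^sup>2"
      using j by (intro power_mono norm_Gp_le[OF assms]) auto
    also have "\<dots> = (exp (s + (cmod l)\<^sup>2))\<^sup>2 * (real (n + m) powr (2 * s) * real (Suc j + m) powr (-2 * s))"
      using assms by (simp add: power_mult_distrib powr_divide powr_minus field_simps powr_pow)
    also have "\<dots> \<le> (exp (s + (cmod l)\<^sup>2))\<^sup>2 * (real (n + m) powr (2 * s) * real (Suc j) powr (-2 * s))"
      using assms by (intro mult_left_mono powr_mono2') auto
    finally show "(cmod (Gp m l (Suc j) n))\<^sup>2 \<le> (exp (s + (cmod l)\<^sup>2))\<^sup>2 * real (n + m) powr (2 * s) * real (Suc j) powr (-2 * s)"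
      by (simp add: mult.assoc)
  qed
  then show ?thesis by (simp add: atLeast0LessThan sum_distrib_left)
qed

lemma summable_Suc_powr: "a < -1 \<Longrightarrow> summable (\<lambda>j. real (Suc j) powr a)"
  by (subst summable_Suc_iff) (simp add: summable_real_powr_iff)

lemma sum_Suc_powr_le: "a < -1 \<Longrightarrow> (\<Sum>j\<in>{..<n}. real (Suc j) powr a) \<le> (\<Sum>j. real (Suc j) powr a)"
  by (intro sum_le_suminf summable_Suc_powr) auto

text \<open>With \<open>q j = Gp m l j n\<close> the bound of \<open>moment_bound\<close> is
  (n+m)^(2s) times a partial sum of j^(-2s), which converges for s > 1/2; the initial state
  contributes the same order. Roots with real part at most 1/2 are covered by any such s.\<close>

lemma Y_even_moment_le:
  assumes m: "m \<ge> 2" and l: "l \<in> chi_roots m" and s: "Re l \<le> s" "1/2 < s" and r: "r \<ge> 1"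
  shows "\<exists>C\<ge>0. \<forall>n. Ew m n (\<lambda>w. cmod (Y m l w) ^ (2*r)) \<le> C * real (n + m) powr (2 * s * real r)"
proof -
  define c where "c = exp (s + (cmod l)\<^sup>2)"
  define Z where "Z = (\<Sum>j. real (Suc j) powr (-2 * s))"
  define C where "C = 2^(2*r) * (momK m l r * (c\<^sup>2 * Z)^r + (c * real m)^(2*r))"
  have Z0: "Z \<ge> 0" unfolding Z_def using s by (intro suminf_nonneg summable_Suc_powr) auto
  have C0: "C \<ge> 0" using momK_pos[of m l r] Z0 by (auto simp: C_def c_def)
  have "Ew m n (\<lambda>w. cmod (Y m l w) ^ (2*r)) \<le> C * real (n + m) powr (2 * s * real r)" for n
  proof -
    define N where "N = real (n + m)"
    have N: "N \<ge> 1" using m by (simp add: N_def)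
    have Npow: "(N powr (2 * s))^r = N powr (2 * s * real r)" "(N powr s)^(2*r) = N powr (2 * s * real r)"
      using N by (simp_all add: powr_pow mult_ac)
    have "Ew m n (\<lambda>w. cmod (Gp m l n n * Y m l w - Gp m l 0 n * Y m l (drop (n - 0) w)) ^ (2*r))
      \<le> momK m l r * (\<Sum>j=0..<n. (cmod (Gp m l (Suc j) n))\<^sup>2)^r"
      by (rule moment_bound[OF m l _ r, where q="\<lambda>j. Gp m l j n"]) (auto simp: Gp_rec)
    also have "\<dots> \<le> momK m l r * (c\<^sup>2 * N powr (2 * s) * Z)^r"
    proof (intro mult_left_mono power_mono)
      have "(\<Sum>j=0..<n. (cmod (Gp m l (Suc j) n))\<^sup>2) \<le> c\<^sup>2 * N powr (2 * s) * (\<Sum>j<n. real (Suc j) powr (-2 * s))"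
        unfolding c_def N_def by (rule Gp_powr_sum_le) (use m s in auto)
      also have "\<dots> \<le> c\<^sup>2 * N powr (2 * s) * Z"
        unfolding Z_def using s by (intro mult_left_mono sum_Suc_powr_le) auto
      finally show "(\<Sum>j=0..<n. (cmod (Gp m l (Suc j) n))\<^sup>2) \<le> c\<^sup>2 * N powr (2 * s) * Z" .
    qed (use momK_pos[of m l r] in \<open>auto intro!: sum_nonneg\<close>)
    also have "\<dots> = momK m l r * (c\<^sup>2 * Z)^r * N powr (2 * s * real r)"
      by (simp add: power_mult_distrib Npow[symmetric])
    finally have b: "Ew m n (\<lambda>w. cmod (Gp m l n n * Y m l w - Gp m l 0 n * Y m l (drop (n - 0) w)) ^ (2*r)) \<le> momK m l r * (c\<^sup>2 * Z)^r * N powr (2 * s * real r)" .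
    have "cmod (Gp m l 0 n) \<le> c * (N / real (0 + m)) powr s"
      unfolding c_def N_def by (rule norm_Gp_le) (use m s in auto)
    also have "\<dots> \<le> c * N powr s" using m N s by (intro mult_left_mono powr_mono2) (auto simp: c_def divide_le_eq)
    finally have g0: "cmod (Gp m l 0 n * of_nat m) \<le> c * real m * N powr s"
      using m by (simp add: norm_mult mult_right_mono)
    have "Ew m n (\<lambda>w. cmod (Y m l w) ^ (2*r)) \<le>
      Ew m n (\<lambda>w. 2^(2*r) * (cmod (Gp m l n n * Y m l w - Gp m l 0 n * Y m l (drop (n - 0) w)) ^ (2*r) + (c * real m * N powr s)^(2*r)))"
    proof (rule Ew_mono)
      fix w assume w: "w \<in> words m n"
      define d where "d = Gp m l n n * Y m l w - Gp m l 0 n * Y m l (drop (n - 0) w)"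
      have "Y m l w = d + Gp m l 0 n * of_nat m"
        using length_words[OF w] Y_Nil[OF m] by (simp add: d_def)
      then have "cmod (Y m l w) \<le> cmod d + c * real m * N powr s"
        using norm_triangle_ineq[of d "Gp m l 0 n * of_nat m"] g0 by simp
      then have "cmod (Y m l w) ^ (2*r) \<le> (cmod d + c * real m * N powr s)^(2*r)" by (intro power_mono) auto
      also have "\<dots> \<le> 2^(2*r) * (cmod d ^ (2*r) + (c * real m * N powr s)^(2*r))"
        by (rule sum_power_le) (auto simp: c_def)
      finally show "cmod (Y m l w) ^ (2*r) \<le> 2^(2*r) * (cmod (Gp m l n n * Y m l w - Gp m l 0 n * Y m l (drop (n - 0) w)) ^ (2*r) + (c * real m * N powr s)^(2*r))"
        by (simp add: d_def)
    qed
    also have "\<dots> \<le> 2^(2*r) * (momK m l r * (c\<^sup>2 * Z)^r * N powr (2 * s * real r) + (c * real m * N powr s)^(2*r))"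
      unfolding Ew_cmult Ew_add Ew_const[OF m] using b by (intro mult_left_mono add_mono) auto
    also have "\<dots> = C * N powr (2 * s * real r)"
    proof -
      have "(c * real m * N powr s)^(2*r) = (c * real m)^(2*r) * N powr (2 * s * real r)"
        by (simp only: power_mult_distrib Npow)
      then show ?thesis by (simp only: C_def distrib_left distrib_right mult.assoc)
    qed
    finally show ?thesis by (simp add: N_def)
  qed
  with C0 show ?thesis by blast
qed

lemma Ew_Y:
  assumes "m \<ge> 2" "l \<in> chi_roots m" shows "Ew m n (Y m l) = Gp m l 0 n * of_nat m"
proof (induction n)
  case (Suc n)
  have "Ew m (Suc n) (Y m l) = Ew m n (\<lambda>w. (1 + l / of_nat (n + m)) * Y m l w)"
    unfolding Ew_Suc
  proof (rule Ew_cong)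
    fix w assume w: "w \<in> words m n"
    have "(\<Sum>k=1..m. step_prob m w k *\<^sub>R Y m l (k # w)) = of_real (\<Sum>k=1..m. step_prob m w k) * Y m l w + (\<Sum>k=1..m. of_real (step_prob m w k) * Uinc m l k)"
      by (simp add: Y_Cons scaleR_conv_of_real distrib_left sum.distrib sum_distrib_right)
    also have "\<dots> = Y m l w + l / of_nat (n + m) * Y m l w"
      unfolding mean_Uinc[OF assms w] sum_step_prob[OF assms(1) w] by simp
    finally show "(\<Sum>k=1..m. step_prob m w k *\<^sub>R Y m l (k # w)) = (1 + l / of_nat (n + m)) * Y m l w"
      by (simp add: distrib_right)
  qed
  then show ?case using Suc by (simp add: Ew_cmult Gp_Suc del: of_nat_add)
qed (use assms in \<open>simp add: Y_Nil\<close>)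

text \<open>\<open>Gp\<close> is a quotient of Pochhammer symbols, and these occur in the limit
  formula for Gamma. \<open>Gamma_series\<close> uses n + 1 factors instead of n, which explains the
  additional quotient tending to 1.\<close>

lemma Gp_asymp:
  assumes m: "m \<ge> 2" and l: "Re l > 0"
  shows "(\<lambda>n. Gp m l 0 n / of_nat n powr l) \<longlonglongrightarrow> Gamma (of_nat m) / Gamma (of_nat m + l)"
proof -
  have poch: "Gp m l 0 n = pochhammer (of_nat m + l) n / pochhammer (of_nat m) n" for n
  proof -
    have "(\<Prod>i=0..<n. of_nat m + l + of_nat i) / (\<Prod>i=0..<n. of_nat m + of_nat i) = Gp m l 0 n"
      unfolding Gp_def prod_dividef[symmetric]
    proof (rule prod.cong[OF refl])
      fix i
      have "of_nat (i + m) \<noteq> (0::complex)" using m unfolding of_nat_eq_0_iff by simp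
      then show "(of_nat m + l + of_nat i) / (of_nat m + of_nat i) = 1 + l / of_nat (i + m)"
        by (simp add: field_simps)
    qed
    then show ?thesis by (simp add: pochhammer_prod)
  qed
  have nz: "of_nat m \<notin> (\<int>\<^sub>\<le>\<^sub>0 :: complex set)" "of_nat m + l \<notin> \<int>\<^sub>\<le>\<^sub>0"
    using m l by (auto elim!: nonpos_Ints_cases simp: complex_eq_iff)
  have nz2: "of_nat m + l + of_nat k \<noteq> 0" "of_nat m + of_nat k \<noteq> (0::complex)" for k
    using m l by (auto simp: complex_eq_iff)
  have "(\<lambda>n. Gamma_series (of_nat m) n / Gamma_series (of_nat m + l) n) \<longlonglongrightarrow> Gamma (of_nat m) / Gamma (of_nat m + l)"
    using nz by (intro tendsto_divide Gamma_series_LIMSEQ) (auto simp: Gamma_eq_zero_iff)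
  moreover have "(\<lambda>n. (of_nat m + of_nat n) / (of_nat m + l + of_nat n)) \<longlonglongrightarrow> (1::complex)"
  proof -
    have "(\<lambda>n. 1 - l * (1 / (of_nat m + l + of_nat n))) \<longlonglongrightarrow> 1 - l * 0"
    proof (intro tendsto_intros)
      have "filterlim (\<lambda>n. of_nat m + l + of_nat n :: complex) at_infinity sequentially"
        by (intro tendsto_add_filterlim_at_infinity[OF tendsto_const] tendsto_of_nat)
      then show "(\<lambda>n. 1 / (of_nat m + l + of_nat n)) \<longlonglongrightarrow> 0"
        using tendsto_divide_0[OF tendsto_const] by blast
    qed
    moreover have "1 - l * (1 / (of_nat m + l + of_nat n)) = (of_nat m + of_nat n) / (of_nat m + l + of_nat n)" for n
      using nz2(1)[of n] by (simp add: field_simps)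
    ultimately show ?thesis by simp
  qed
  ultimately have "(\<lambda>n. (Gamma_series (of_nat m) n / Gamma_series (of_nat m + l) n) * ((of_nat m + of_nat n) / (of_nat m + l + of_nat n))) \<longlonglongrightarrow> Gamma (of_nat m) / Gamma (of_nat m + l) * 1"
    by (intro tendsto_mult)
  moreover have "eventually (\<lambda>n. (Gamma_series (of_nat m) n / Gamma_series (of_nat m + l) n) * ((of_nat m + of_nat n) / (of_nat m + l + of_nat n)) = Gp m l 0 n / of_nat n powr l) sequentially"
    using eventually_gt_at_top[of 0]
  proof eventually_elim
    case (elim n)
    have p: "pochhammer (of_nat m) n \<noteq> (0::complex)" "pochhammer (of_nat m + l) n \<noteq> 0"
      using nz2 by (auto simp: pochhammer_eq_0_iff eq_neg_iff_add_eq_0)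
    have ex: "exp ((of_nat m + l) * of_real (ln (real n))) = exp (of_nat m * of_real (ln (real n))) * of_nat n powr l"
      using elim by (simp add: powr_def exp_add distrib_right Ln_of_nat)
    have key: "(F * E / (p * a)) / (F * (E * w) / (q * b)) * (a / b) = q / p / w"
      if "F \<noteq> 0" "E \<noteq> 0" "p \<noteq> 0" "a \<noteq> 0" "w \<noteq> 0" "q \<noteq> 0" "b \<noteq> 0" for F E p a w q b :: complex
      using that by simp
    show ?case unfolding Gamma_series_def poch ex Suc_eq_plus1[symmetric] pochhammer_Suc
      by (rule key) (use p nz2[of n] elim in auto)
  qed
  ultimately show ?thesis by (simp add: tendsto_cong)
qed

section \<open>The oscillating regime\<close>

text \<open>All factors would be positive and smaller than k + 1. Consequently the roots with real
  part \<open>sigma2\<close> are not real.\<close>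

lemma nonneg_real_root:
  assumes "m \<ge> 1" "z \<in> chi_roots m" "Im z = 0" "Re z \<ge> 0" shows "z = 1"
proof (rule ccontr)
  assume "z \<noteq> 1"
  then have z1: "Re z < 1" using root_Re_less_1 assms by auto
  have c: "cmod (z + of_nat k) = Re z + real k" for k
    using assms(3,4) by (simp add: cmod_plus_nat)
  have "(\<Prod>k=m..<2*m. cmod (z + of_nat k)) < (\<Prod>k=m..<2*m. real k + 1)"
    by (rule prod_strict_mono_one[where i=m]) (use assms z1 c in \<open>auto intro: add_nonneg_pos\<close>)
  then show False using root_norm_prod[OF assms(1,2)] by simp
qed

lemma Max_Re_chi_roots: assumes "m \<ge> 1" shows "Max (Re ` chi_roots m) = 1"
proof (rule Max_eqI)
  show "finite (Re ` chi_roots m)" using finite_chi_roots assms by auto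
  show "1 \<in> Re ` chi_roots m" using one_in_chi_roots[OF assms] by force
  fix y assume "y \<in> Re ` chi_roots m"
  then show "y \<le> 1" using root_Re_less_1[OF assms] by fastforce
qed

text \<open>A root with real part in (1/2, 1) makes the second largest real part exceed 1/2. Such a
  root is not real, and \<open>roots_same_Re\<close> gives the uniqueness behind the definite
  description of \<open>lambda2\<close>.\<close>

lemma lambda2_properties:
  assumes m: "m \<ge> 60"
  shows "1/2 < sigma2 m" "lambda2 m \<in> chi_roots m" "Re (lambda2 m) = sigma2 m" "Im (lambda2 m) > 0"
    and "\<And>l. l \<in> chi_roots m \<Longrightarrow> l \<noteq> 1 \<Longrightarrow> l \<noteq> lambda2 m \<Longrightarrow> l \<noteq> cnj (lambda2 m) \<Longrightarrow> Re l < sigma2 m"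
proof -
  have m1: "m \<ge> 1" using m by simp
  define S where "S = Re ` chi_roots m - {1}"
  have S: "finite S" "sigma2 m = Max S"
    using finite_chi_roots[OF m1] by (auto simp: S_def sigma2_def Max_Re_chi_roots[OF m1])
  obtain z where z: "z \<in> chi_roots m" "1/2 < Re z" "Re z < 1" using exists_root_Re_greater_half[OF m] by auto
  then have zS: "Re z \<in> S" by (auto simp: S_def)
  then have gt: "1/2 < Max S" "Max S \<in> S" using z(2) Max_ge[OF S(1) zS] Max_in[OF S(1)] by auto
  then show half: "1/2 < sigma2 m" by (simp add: S)
  obtain w where w: "w \<in> chi_roots m" "Re w = sigma2 m" "Re w \<noteq> 1" using gt(2) unfolding S(2) by (auto simp: S_def)
  have "Im w \<noteq> 0" using nonneg_real_root[OF m1 w(1)] w half by auto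
  define u where "u = (if Im w > 0 then w else cnj w)"
  have u: "u \<in> chi_roots m" "Re u = sigma2 m" "Im u > 0"
    using w cnj_in_chi_roots[OF m1 w(1)] \<open>Im w \<noteq> 0\<close> by (auto simp: u_def)
  have uniq: "v = u" if "v \<in> chi_roots m \<and> Re v = sigma2 m \<and> Im v > 0" for v
    using roots_same_Re[OF m1 u(1), of v] that u by (auto simp: complex_eq_iff)
  have lu: "lambda2 m = u" unfolding lambda2_def by (rule the_equality) (use u uniq in blast)+
  show "lambda2 m \<in> chi_roots m" "Re (lambda2 m) = sigma2 m" "Im (lambda2 m) > 0"
    using u by (simp_all add: lu)
  fix l assume l: "l \<in> chi_roots m" "l \<noteq> 1" "l \<noteq> lambda2 m" "l \<noteq> cnj (lambda2 m)"
  have "Re l \<in> S" using root_Re_less_1[OF m1 l(1,2)] l(1) by (auto simp: S_def)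
  then have "Re l \<le> sigma2 m" unfolding S(2) using S(1) by simp
  moreover have "Re l \<noteq> sigma2 m" using roots_same_Re[OF m1 u(1) l(1)] l u lu by auto
  ultimately show "Re l < sigma2 m" by simp
qed

text \<open>Serves as a Borel-Cantelli argument: summable expectations make the random series finite
  almost surely.\<close>

lemma AE_summable_of_integral:
  fixes f :: "nat \<Rightarrow> 'a \<Rightarrow> real"
  assumes int: "\<And>j. integrable M (f j)" and nn: "\<And>j \<omega>. 0 \<le> f j \<omega>"
    and le: "\<And>j. (\<integral>\<omega>. f j \<omega> \<partial>M) \<le> b j" and b: "summable b"
  shows "AE \<omega> in M. summable (\<lambda>j. f j \<omega>)"
proof -
  have [measurable]: "\<And>j. f j \<in> borel_measurable M" using int by auto
  have b0: "b j \<ge> 0" for j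
    by (rule order_trans[OF integral_nonneg_AE le[of j]]) (use nn in auto)
  have "(\<integral>\<^sup>+\<omega>. (\<Sum>j. ennreal (f j \<omega>)) \<partial>M) = (\<Sum>j. \<integral>\<^sup>+\<omega>. ennreal (f j \<omega>) \<partial>M)"
    by (rule nn_integral_suminf) simp
  also have "\<dots> \<le> (\<Sum>j. ennreal (b j))"
    by (intro suminf_le summableI) (auto simp: nn_integral_eq_integral[OF int] nn intro!: ennreal_leI le)
  also have "\<dots> = ennreal (\<Sum>j. b j)" using b b0 by (intro suminf_ennreal2)
  also have "\<dots> < \<infinity>" by simp
  finally have "AE \<omega> in M. (\<Sum>j. ennreal (f j \<omega>)) \<noteq> \<infinity>"
    by (intro nn_integral_PInf_AE) auto
  then show ?thesis by eventually_elim (auto intro!: summable_suminf_not_top nn)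
qed

text \<open>No martingale convergence theorem is needed: the moment bounds make the subsequence \<open>X (2 ^ j)\<close>
  absolutely convergent almost surely, and Fatou's lemma passes the bounds to the limit.\<close>

lemma (in prob_space) Lp_Cauchy_limit:
  fixes X :: "nat \<Rightarrow> 'a \<Rightarrow> complex"
  assumes X [measurable]: "\<And>n. X n \<in> borel_measurable M"
    and int: "\<And>r k n. r \<ge> 1 \<Longrightarrow> k \<le> n \<Longrightarrow> integrable M (\<lambda>\<omega>. cmod (X n \<omega> - X k \<omega>) ^ (2*r))"
    and le: "\<And>r k n. r \<ge> 1 \<Longrightarrow> k \<le> n \<Longrightarrow> (\<integral>\<omega>. cmod (X n \<omega> - X k \<omega>) ^ (2*r) \<partial>M) \<le> K r * real (Suc k) powr (- \<delta> * real r)"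
    and \<delta>: "\<delta> > 0" and K: "\<And>r. K r \<ge> 0"
  shows "\<exists>Z\<in>borel_measurable M. \<forall>r\<ge>1. \<forall>k. integrable M (\<lambda>\<omega>. cmod (Z \<omega> - X k \<omega>) ^ (2*r)) \<and>
    (\<integral>\<omega>. cmod (Z \<omega> - X k \<omega>) ^ (2*r) \<partial>M) \<le> K r * real (Suc k) powr (- \<delta> * real r)"
proof -
  define d where "d j \<omega> = X (2^Suc j) \<omega> - X (2^j) \<omega>" for j \<omega>
  have [measurable]: "\<And>j. d j \<in> borel_measurable M" unfolding d_def by simp
  \<comment> \<open>The size in L^2 of the increment over the dyadic block [2^j, 2^(j+1)] is of
    order a^j.\<close>
  define a where "a = 2 powr (- \<delta> / 2)"
  have a: "0 < a" "a < 1" using \<delta> by (auto simp: a_def powr_less_one)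
  have aj: "a^j > 0" for j using a by simp
  have sq: "integrable M (\<lambda>\<omega>. (cmod (d j \<omega>))\<^sup>2)" "(\<integral>\<omega>. (cmod (d j \<omega>))\<^sup>2 \<partial>M) \<le> K 1 * (a^j)\<^sup>2" for j
  proof -
    show "integrable M (\<lambda>\<omega>. (cmod (d j \<omega>))\<^sup>2)" using int[of 1 "2^j" "2^Suc j"] by (simp add: d_def)
    have "(\<integral>\<omega>. (cmod (d j \<omega>))\<^sup>2 \<partial>M) \<le> K 1 * real (Suc (2^j)) powr (- \<delta>)"
      using le[of 1 "2^j" "2^Suc j"] by (simp add: d_def)
    also have "\<dots> \<le> K 1 * real (2^j) powr (- \<delta>)" using K \<delta> by (intro mult_left_mono powr_mono2') auto
    also have "real (2^j) powr (- \<delta>) = (a^j)\<^sup>2"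
      unfolding a_def by (simp add: powr_pow powr_powr flip: powr_realpow) (simp add: powr_powr mult.commute)
    finally show "(\<integral>\<omega>. (cmod (d j \<omega>))\<^sup>2 \<partial>M) \<le> K 1 * (a^j)\<^sup>2" .
  qed
  \<comment> \<open>Passes from second to first moments: x <= a + x^2/a for every a > 0, applied
    with a of the typical size of x.\<close>
  have dom: "cmod (d j \<omega>) \<le> a^j + (cmod (d j \<omega>))\<^sup>2 / a^j" for j \<omega>
  proof (cases "cmod (d j \<omega>) \<le> a^j")
    case False
    then have "cmod (d j \<omega>) * a^j \<le> cmod (d j \<omega>) * cmod (d j \<omega>)" by (intro mult_left_mono) auto
    then have "cmod (d j \<omega>) \<le> (cmod (d j \<omega>))\<^sup>2 / a^j" using aj[of j] by (simp add: power2_eq_square field_simps)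
    then show ?thesis using aj[of j] by linarith
  qed (use aj[of j] in \<open>simp add: add_increasing2\<close>)
  have d1: "integrable M (\<lambda>\<omega>. cmod (d j \<omega>))" for j
    by (rule Bochner_Integration.integrable_bound[where f="\<lambda>\<omega>. a^j + (cmod (d j \<omega>))\<^sup>2 / a^j"])
       (use sq(1)[of j] dom[of j] in \<open>auto simp: abs_of_nonneg order_trans[OF _ abs_ge_self]\<close>)
  have "(\<integral>\<omega>. cmod (d j \<omega>) \<partial>M) \<le> (1 + K 1) * a^j" for j
  proof -
    have "(\<integral>\<omega>. cmod (d j \<omega>) \<partial>M) \<le> (\<integral>\<omega>. a^j + (cmod (d j \<omega>))\<^sup>2 / a^j \<partial>M)"
      using d1 sq dom by (intro integral_mono) auto
    also have "\<dots> = a^j + (\<integral>\<omega>. (cmod (d j \<omega>))\<^sup>2 \<partial>M) / a^j"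
      using sq(1)[of j] by (subst Bochner_Integration.integral_add) (auto simp: prob_space)
    also have "\<dots> \<le> a^j + K 1 * (a^j)\<^sup>2 / a^j" using sq(2)[of j] aj[of j] by (intro add_left_mono divide_right_mono) auto
    also have "\<dots> = (1 + K 1) * a^j" using aj[of j] by (simp add: power2_eq_square distrib_right)
    finally show ?thesis .
  qed
  then have "AE \<omega> in M. summable (\<lambda>j. cmod (d j \<omega>))"
    by (intro AE_summable_of_integral[where b="\<lambda>j. (1 + K 1) * a^j"] d1 summable_mult summable_geometric) (use a in auto)
  then have conv: "AE \<omega> in M. convergent (\<lambda>j. X (2^j) \<omega>)"
  proof eventually_elim
    case (elim \<omega>)
    then have "summable (\<lambda>j. d j \<omega>)" by (rule summable_norm_cancel)
    then have "(\<lambda>n. \<Sum>j<n. d j \<omega>) \<longlonglongrightarrow> suminf (\<lambda>j. d j \<omega>)" by (rule summable_LIMSEQ)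
    then have "(\<lambda>n. X (2^n) \<omega> - X (2^0) \<omega> + X 1 \<omega>) \<longlonglongrightarrow> suminf (\<lambda>j. d j \<omega>) + X 1 \<omega>"
      using sum_lessThan_telescope[of "\<lambda>j. X (2^j) \<omega>"] unfolding d_def by (intro tendsto_add tendsto_const) simp
    then show ?case by (auto simp: convergent_def)
  qed
  define Z where "Z \<omega> = lim (\<lambda>j. X (2^j) \<omega>)" for \<omega>
  have Zm [measurable]: "Z \<in> borel_measurable M" unfolding Z_def by (rule borel_measurable_lim_metric) simp
  have lim: "AE \<omega> in M. (\<lambda>j. X (2^j) \<omega>) \<longlonglongrightarrow> Z \<omega>"
    using conv by eventually_elim (simp add: Z_def convergent_LIMSEQ_iff)
  have "integrable M (\<lambda>\<omega>. cmod (Z \<omega> - X k \<omega>) ^ (2*r)) \<and>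
    (\<integral>\<omega>. cmod (Z \<omega> - X k \<omega>) ^ (2*r) \<partial>M) \<le> K r * real (Suc k) powr (- \<delta> * real r)" if r: "r \<ge> 1" for r k
  proof -
    define B where "B = K r * real (Suc k) powr (- \<delta> * real r)"
    have B0: "B \<ge> 0" using K by (simp add: B_def)
    have "(\<integral>\<^sup>+\<omega>. ennreal (cmod (Z \<omega> - X k \<omega>) ^ (2*r)) \<partial>M) = (\<integral>\<^sup>+\<omega>. liminf (\<lambda>j. ennreal (cmod (X (2^j) \<omega> - X k \<omega>) ^ (2*r))) \<partial>M)"
    proof (rule nn_integral_cong_AE)
      show "AE \<omega> in M. ennreal (cmod (Z \<omega> - X k \<omega>) ^ (2*r)) = liminf (\<lambda>j. ennreal (cmod (X (2^j) \<omega> - X k \<omega>) ^ (2*r)))"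
        using lim
      proof eventually_elim
        case (elim \<omega>)
        then have "(\<lambda>j. ennreal (cmod (X (2^j) \<omega> - X k \<omega>) ^ (2*r))) \<longlonglongrightarrow> ennreal (cmod (Z \<omega> - X k \<omega>) ^ (2*r))"
          by (intro tendsto_intros)
        then show ?case by (rule lim_imp_Liminf[OF trivial_limit_sequentially, symmetric])
      qed
    qed
    also have "\<dots> \<le> liminf (\<lambda>j. \<integral>\<^sup>+\<omega>. ennreal (cmod (X (2^j) \<omega> - X k \<omega>) ^ (2*r)) \<partial>M)"
      by (rule nn_integral_liminf) simp
    also have "\<dots> \<le> limsup (\<lambda>j. \<integral>\<^sup>+\<omega>. ennreal (cmod (X (2^j) \<omega> - X k \<omega>) ^ (2*r)) \<partial>M)"
      by (rule Liminf_le_Limsup) simp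
    also have "\<dots> \<le> ennreal B"
    proof (rule Limsup_bounded)
      show "eventually (\<lambda>j. (\<integral>\<^sup>+\<omega>. ennreal (cmod (X (2^j) \<omega> - X k \<omega>) ^ (2*r)) \<partial>M) \<le> ennreal B) sequentially"
        using eventually_ge_at_top[of k]
      proof eventually_elim
        case (elim j)
        \<comment> \<open>From here on the moment bound applies with the same right side for all j,
          which is what Fatou's lemma needs.\<close>
        then have kj: "k \<le> 2^j" by (meson le_trans less_exp less_imp_le_nat)
        have "(\<integral>\<^sup>+\<omega>. ennreal (cmod (X (2^j) \<omega> - X k \<omega>) ^ (2*r)) \<partial>M) = ennreal (\<integral>\<omega>. cmod (X (2^j) \<omega> - X k \<omega>) ^ (2*r) \<partial>M)"
          by (rule nn_integral_eq_integral[OF int[OF r kj]]) auto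
        also have "\<dots> \<le> ennreal B" unfolding B_def by (intro ennreal_leI le r kj)
        finally show ?case .
      qed
    qed
    finally have nn: "(\<integral>\<^sup>+\<omega>. ennreal (cmod (Z \<omega> - X k \<omega>) ^ (2*r)) \<partial>M) \<le> ennreal B" .
    then have i: "integrable M (\<lambda>\<omega>. cmod (Z \<omega> - X k \<omega>) ^ (2*r))"
      by (intro integrableI_bounded) (auto simp: le_less_trans[OF _ ennreal_less_top])
    then have "ennreal (\<integral>\<omega>. cmod (Z \<omega> - X k \<omega>) ^ (2*r) \<partial>M) \<le> ennreal B"
      using nn by (subst (asm) nn_integral_eq_integral) auto
    with i B0 show ?thesis by (simp add: B_def)
  qed
  then show ?thesis using Zm by blast
qed

text \<open>Of smaller order than n^s almost surely and in every even L^p norm. Even integer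
  exponents keep the estimates polynomial; general exponents are recovered in
  \<open>negl_imp_smallo\<close>.\<close>

definition negl :: "'a measure \<Rightarrow> real \<Rightarrow> (nat \<Rightarrow> 'a \<Rightarrow> real) \<Rightarrow> bool" where
  "negl M s g \<longleftrightarrow> (\<forall>n. g n \<in> borel_measurable M) \<and> (\<forall>n \<omega>. 0 \<le> g n \<omega>) \<and>
    (AE \<omega> in M. (\<lambda>n. g n \<omega> / real n powr s) \<longlonglongrightarrow> 0) \<and>
    (\<forall>r\<ge>1. (\<forall>n. integrable M (\<lambda>\<omega>. g n \<omega> ^ (2*r))) \<and>
      (\<lambda>n. (\<integral>\<omega>. g n \<omega> ^ (2*r) \<partial>M) / real n powr (2 * s * real r)) \<longlonglongrightarrow> 0)"

lemma negl_dom: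
  assumes g: "negl M s g" and h [measurable]: "\<And>n. h n \<in> borel_measurable M" and h0: "\<And>n \<omega>. 0 \<le> h n \<omega>"
    and C: "C \<ge> 0" and le: "AE \<omega> in M. \<forall>n. h n \<omega> \<le> C * g n \<omega>"
  shows "negl M s h"
proof -
  have gm [measurable]: "\<And>n. g n \<in> borel_measurable M" and g0: "\<And>n \<omega>. 0 \<le> g n \<omega>"
    and gAE: "AE \<omega> in M. (\<lambda>n. g n \<omega> / real n powr s) \<longlonglongrightarrow> 0"
    and gi: "\<And>r n. r \<ge> 1 \<Longrightarrow> integrable M (\<lambda>\<omega>. g n \<omega> ^ (2*r))"
    and gl: "\<And>r. r \<ge> 1 \<Longrightarrow> (\<lambda>n. (\<integral>\<omega>. g n \<omega> ^ (2*r) \<partial>M) / real n powr (2 * s * real r)) \<longlonglongrightarrow> 0"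
    using g unfolding negl_def by auto
  have "AE \<omega> in M. (\<lambda>n. h n \<omega> / real n powr s) \<longlonglongrightarrow> 0"
    using le gAE
  proof eventually_elim
    case (elim \<omega>)
    have "(\<lambda>n. C * (g n \<omega> / real n powr s)) \<longlonglongrightarrow> 0"
      using tendsto_mult[OF tendsto_const elim(2), of C] by simp
    then show ?case
      by (rule Lim_null_comparison[rotated])
         (use elim h0 in \<open>auto simp: divide_right_mono\<close>)
  qed
  moreover have pw: "AE \<omega> in M. \<forall>n. h n \<omega> ^ (2*r) \<le> C^(2*r) * g n \<omega> ^ (2*r)" for r
    using le by eventually_elim (auto simp: power_mult_distrib[symmetric] h0 intro!: power_mono)
  moreover have hi: "integrable M (\<lambda>\<omega>. h n \<omega> ^ (2*r))" if "r \<ge> 1" for n r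
    by (rule Bochner_Integration.integrable_bound[OF integrable_mult_right[OF gi[OF that, of n], of "C^(2*r)"]])
       (use pw[of r] h0 g0 in \<open>auto elim!: eventually_mono simp: abs_mult\<close>)
  moreover have "(\<lambda>n. (\<integral>\<omega>. h n \<omega> ^ (2*r) \<partial>M) / real n powr (2 * s * real r)) \<longlonglongrightarrow> 0" if r: "r \<ge> 1" for r
  proof (rule Lim_null_comparison)
    show "(\<lambda>n. C^(2*r) * ((\<integral>\<omega>. g n \<omega> ^ (2*r) \<partial>M) / real n powr (2 * s * real r))) \<longlonglongrightarrow> 0"
      using tendsto_mult[OF tendsto_const gl[OF r], of "C^(2*r)"] by simp
    show "\<forall>\<^sub>F n in sequentially. norm ((\<integral>\<omega>. h n \<omega> ^ (2*r) \<partial>M) / real n powr (2 * s * real r)) \<le> C^(2*r) * ((\<integral>\<omega>. g n \<omega> ^ (2*r) \<partial>M) / real n powr (2 * s * real r))"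
    proof (rule always_eventually, rule allI)
      fix n
      have "(\<integral>\<omega>. h n \<omega> ^ (2*r) \<partial>M) \<le> (\<integral>\<omega>. C^(2*r) * g n \<omega> ^ (2*r) \<partial>M)"
        using pw[of r] by (intro integral_mono_AE hi r integrable_mult_right gi) (auto elim!: eventually_mono)
      then have "(\<integral>\<omega>. h n \<omega> ^ (2*r) \<partial>M) \<le> C^(2*r) * (\<integral>\<omega>. g n \<omega> ^ (2*r) \<partial>M)" by simp
      moreover have "0 \<le> (\<integral>\<omega>. h n \<omega> ^ (2*r) \<partial>M)" using h0 by (intro integral_nonneg_AE) auto
      ultimately show "norm ((\<integral>\<omega>. h n \<omega> ^ (2*r) \<partial>M) / real n powr (2 * s * real r)) \<le> C^(2*r) * ((\<integral>\<omega>. g n \<omega> ^ (2*r) \<partial>M) / real n powr (2 * s * real r))"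
        by (simp add: divide_right_mono)
    qed
  qed
  ultimately show ?thesis unfolding negl_def using h h0 by auto
qed

lemma negl_add:
  assumes g: "negl M s g" and h: "negl M s h"
  shows "negl M s (\<lambda>n \<omega>. g n \<omega> + h n \<omega>)"
proof -
  have [measurable]: "\<And>n. g n \<in> borel_measurable M" "\<And>n. h n \<in> borel_measurable M"
    and nn: "\<And>n \<omega>. 0 \<le> g n \<omega>" "\<And>n \<omega>. 0 \<le> h n \<omega>"
    and AE: "AE \<omega> in M. (\<lambda>n. g n \<omega> / real n powr s) \<longlonglongrightarrow> 0" "AE \<omega> in M. (\<lambda>n. h n \<omega> / real n powr s) \<longlonglongrightarrow> 0"
    and i: "\<And>r n. r \<ge> 1 \<Longrightarrow> integrable M (\<lambda>\<omega>. g n \<omega> ^ (2*r))" "\<And>r n. r \<ge> 1 \<Longrightarrow> integrable M (\<lambda>\<omega>. h n \<omega> ^ (2*r))"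
    and l: "\<And>r. r \<ge> 1 \<Longrightarrow> (\<lambda>n. (\<integral>\<omega>. g n \<omega> ^ (2*r) \<partial>M) / real n powr (2 * s * real r)) \<longlonglongrightarrow> 0"
      "\<And>r. r \<ge> 1 \<Longrightarrow> (\<lambda>n. (\<integral>\<omega>. h n \<omega> ^ (2*r) \<partial>M) / real n powr (2 * s * real r)) \<longlonglongrightarrow> 0"
    using g h unfolding negl_def by auto
  have "AE \<omega> in M. (\<lambda>n. (g n \<omega> + h n \<omega>) / real n powr s) \<longlonglongrightarrow> 0"
    using AE by eventually_elim (auto simp: add_divide_distrib intro: tendsto_add_zero)
  moreover have pw: "(g n \<omega> + h n \<omega>) ^ (2*r) \<le> 2^(2*r) * (g n \<omega> ^ (2*r) + h n \<omega> ^ (2*r))" for n \<omega> r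
    by (rule sum_power_le) (use nn in auto)
  moreover have ii: "integrable M (\<lambda>\<omega>. 2^(2*r) * (g n \<omega> ^ (2*r) + h n \<omega> ^ (2*r)))" if "r \<ge> 1" for n r
    by (intro integrable_mult_right Bochner_Integration.integrable_add i that)
  moreover have gi: "integrable M (\<lambda>\<omega>. (g n \<omega> + h n \<omega>) ^ (2*r))" if "r \<ge> 1" for n r
    by (rule Bochner_Integration.integrable_bound[OF ii[OF that, of n]]) (use pw[of n _ r] in auto)
  moreover have "(\<lambda>n. (\<integral>\<omega>. (g n \<omega> + h n \<omega>) ^ (2*r) \<partial>M) / real n powr (2 * s * real r)) \<longlonglongrightarrow> 0" if r: "r \<ge> 1" for r
  proof (rule Lim_null_comparison)
    show "(\<lambda>n. 2^(2*r) * ((\<integral>\<omega>. g n \<omega> ^ (2*r) \<partial>M) / real n powr (2 * s * real r) + (\<integral>\<omega>. h n \<omega> ^ (2*r) \<partial>M) / real n powr (2 * s * real r))) \<longlonglongrightarrow> 0"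
      using tendsto_mult[OF tendsto_const tendsto_add[OF l[OF r]], of "2^(2*r)"] by simp
    show "\<forall>\<^sub>F n in sequentially. norm ((\<integral>\<omega>. (g n \<omega> + h n \<omega>) ^ (2*r) \<partial>M) / real n powr (2 * s * real r)) \<le>
      2^(2*r) * ((\<integral>\<omega>. g n \<omega> ^ (2*r) \<partial>M) / real n powr (2 * s * real r) + (\<integral>\<omega>. h n \<omega> ^ (2*r) \<partial>M) / real n powr (2 * s * real r))"
    proof (rule always_eventually, rule allI)
      fix n
      have e: "c * (a + b) / d = c * (a / d + b / d)" for a b c d :: real
        by (simp add: add_divide_distrib distrib_left)
      have "(\<integral>\<omega>. (g n \<omega> + h n \<omega>) ^ (2*r) \<partial>M) \<le> (\<integral>\<omega>. 2^(2*r) * (g n \<omega> ^ (2*r) + h n \<omega> ^ (2*r)) \<partial>M)"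
        using pw by (intro integral_mono gi ii r) auto
      also have "\<dots> = 2^(2*r) * ((\<integral>\<omega>. g n \<omega> ^ (2*r) \<partial>M) + (\<integral>\<omega>. h n \<omega> ^ (2*r) \<partial>M))"
        using i[OF r, of n] by simp
      finally have "(\<integral>\<omega>. (g n \<omega> + h n \<omega>) ^ (2*r) \<partial>M) / real n powr (2 * s * real r) \<le> 2^(2*r) * ((\<integral>\<omega>. g n \<omega> ^ (2*r) \<partial>M) + (\<integral>\<omega>. h n \<omega> ^ (2*r) \<partial>M)) / real n powr (2 * s * real r)"
        by (intro divide_right_mono) auto
      moreover have "0 \<le> (\<integral>\<omega>. (g n \<omega> + h n \<omega>) ^ (2*r) \<partial>M)" by (intro integral_nonneg_AE) auto
      ultimately show "norm ((\<integral>\<omega>. (g n \<omega> + h n \<omega>) ^ (2*r) \<partial>M) / real n powr (2 * s * real r)) \<le>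
      2^(2*r) * ((\<integral>\<omega>. g n \<omega> ^ (2*r) \<partial>M) / real n powr (2 * s * real r) + (\<integral>\<omega>. h n \<omega> ^ (2*r) \<partial>M) / real n powr (2 * s * real r))"
        unfolding e by simp
    qed
  qed
  ultimately show ?thesis unfolding negl_def using nn by auto
qed

lemma tendsto_zero_of_power:
  fixes x :: "nat \<Rightarrow> real"
  assumes "\<And>n. x n \<ge> 0" "k \<ge> 1" "(\<lambda>n. x n ^ k) \<longlonglongrightarrow> 0" shows "x \<longlonglongrightarrow> 0"
proof -
  have "(\<lambda>n. root k (x n ^ k)) \<longlonglongrightarrow> root k 0" by (intro tendsto_real_root assms)
  then show ?thesis using assms by (simp add: real_root_power_cancel)
qed

text \<open>Moments of order (n+m)^t with t < s give convergence in the even norms at once. For the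
  almost sure part a high moment is used: once r >= 1/(s - t), the scaled moments are at most of
  order n^(-2), hence summable.\<close>

lemma negl_of_moments:
  assumes g [measurable]: "\<And>n. g n \<in> borel_measurable M" and g0: "\<And>n \<omega>. 0 \<le> g n \<omega>" and t: "0 \<le> t" "t < s"
    and i: "\<And>r n. r \<ge> 1 \<Longrightarrow> integrable M (\<lambda>\<omega>. g n \<omega> ^ (2*r))"
    and le: "\<And>r. r \<ge> 1 \<Longrightarrow> \<exists>C\<ge>0. \<forall>n. (\<integral>\<omega>. g n \<omega> ^ (2*r) \<partial>M) \<le> C * real (n + m) powr (2 * t * real r)"
  shows "negl M s g"
proof -
  have bnd: "\<exists>C\<ge>0. \<forall>n\<ge>1. (\<integral>\<omega>. g n \<omega> ^ (2*r) \<partial>M) / real n powr (2 * s * real r) \<le> C * real n powr (2 * (t - s) * real r)" if r: "r \<ge> 1" for r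
  proof -
    obtain C where C: "C \<ge> 0" "\<And>n. (\<integral>\<omega>. g n \<omega> ^ (2*r) \<partial>M) \<le> C * real (n + m) powr (2 * t * real r)"
      using le[OF r] by blast
    show ?thesis
    proof (intro exI[of _ "C * real (m+1) powr (2 * t * real r)"] conjI allI impI)
      fix n :: nat assume n: "n \<ge> 1"
      have "real n + real m \<le> real (m+1) * real n" using n mult_left_mono[of 1 "real n" "real m"] by (simp add: algebra_simps)
      then have "real (n + m) powr (2 * t * real r) \<le> (real (m+1) * real n) powr (2 * t * real r)"
        using t by (intro powr_mono2) auto
      also have "\<dots> = real (m+1) powr (2 * t * real r) * real n powr (2 * t * real r)" by (simp add: powr_mult)
      finally have "(\<integral>\<omega>. g n \<omega> ^ (2*r) \<partial>M) \<le> C * (real (m+1) powr (2 * t * real r) * real n powr (2 * t * real r))"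
        using C(1) by (intro order_trans[OF C(2)] mult_left_mono)
      then have "(\<integral>\<omega>. g n \<omega> ^ (2*r) \<partial>M) / real n powr (2 * s * real r) \<le> C * (real (m+1) powr (2 * t * real r) * real n powr (2 * t * real r)) / real n powr (2 * s * real r)"
        by (rule divide_right_mono) simp
      also have "\<dots> = C * real (m+1) powr (2 * t * real r) * (real n powr (2 * t * real r) / real n powr (2 * s * real r))" by simp
      also have "real n powr (2 * t * real r) / real n powr (2 * s * real r) = real n powr (2 * (t - s) * real r)"
        by (simp add: powr_diff[symmetric] algebra_simps)
      finally show "(\<integral>\<omega>. g n \<omega> ^ (2*r) \<partial>M) / real n powr (2 * s * real r) \<le> C * real (m+1) powr (2 * t * real r) * real n powr (2 * (t - s) * real r)" .
    qed (use C in auto)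
  qed
  have nn: "0 \<le> (\<integral>\<omega>. g n \<omega> ^ (2*r) \<partial>M)" for n r using g0 by (intro integral_nonneg_AE) auto
  have lim: "(\<lambda>n. (\<integral>\<omega>. g n \<omega> ^ (2*r) \<partial>M) / real n powr (2 * s * real r)) \<longlonglongrightarrow> 0" if r: "r \<ge> 1" for r
  proof -
    obtain C where C: "C \<ge> 0" "\<And>n. n \<ge> 1 \<Longrightarrow> (\<integral>\<omega>. g n \<omega> ^ (2*r) \<partial>M) / real n powr (2 * s * real r) \<le> C * real n powr (2 * (t - s) * real r)"
      using bnd[OF r] by blast
    have "(\<lambda>n. real n powr (2 * (t - s) * real r)) \<longlonglongrightarrow> 0"
      using t r by (intro tendsto_neg_powr filterlim_real_sequentially) (auto intro!: mult_neg_pos)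
    then have "(\<lambda>n. C * real n powr (2 * (t - s) * real r)) \<longlonglongrightarrow> 0" using tendsto_mult[OF tendsto_const, of _ 0 _ C] by simp
    then show ?thesis
      by (rule Lim_null_comparison[rotated]) (use C nn in \<open>auto simp: eventually_sequentially intro!: exI[of _ 1]\<close>)
  qed
  have "AE \<omega> in M. (\<lambda>n. g n \<omega> / real n powr s) \<longlonglongrightarrow> 0"
  proof -
    obtain r :: nat where r: "real r \<ge> 1 / (s - t)" "r \<ge> 1"
      by (metis real_arch_simple max.bounded_iff of_nat_le_iff le_max_iff_disj nat_le_linear of_nat_max max.cobounded1 max.cobounded2 order_trans)
    have rs: "2 * (t - s) * real r \<le> -2" using r(1) t by (simp add: field_simps)
    obtain C where C: "C \<ge> 0" "\<And>n. n \<ge> 1 \<Longrightarrow> (\<integral>\<omega>. g n \<omega> ^ (2*r) \<partial>M) / real n powr (2 * s * real r) \<le> C * real n powr (2 * (t - s) * real r)"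
      using bnd[OF r(2)] by blast
    have "AE \<omega> in M. summable (\<lambda>n. g n \<omega> ^ (2*r) / real n powr (2 * s * real r))"
    proof (rule AE_summable_of_integral[where b="\<lambda>n. C * real n powr (-2)"])
      fix n
      show "integrable M (\<lambda>\<omega>. g n \<omega> ^ (2*r) / real n powr (2 * s * real r))" using i[OF r(2), of n] by simp
      show "(\<integral>\<omega>. g n \<omega> ^ (2*r) / real n powr (2 * s * real r) \<partial>M) \<le> C * real n powr (-2)"
      proof (cases "n \<ge> 1")
        case True
        have "(\<integral>\<omega>. g n \<omega> ^ (2*r) / real n powr (2 * s * real r) \<partial>M) \<le> C * real n powr (2 * (t - s) * real r)"
          using C(2)[OF True] by simp
        also have "\<dots> \<le> C * real n powr (-2)" using C(1) True rs by (intro mult_left_mono powr_mono) auto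
        finally show ?thesis .
      next
        case False
        \<comment> \<open>At n = 0 both sides are 0, since \<open>0 powr x = 0\<close> and division
          by 0 gives 0.\<close>
        then have "n = 0" by simp
        then show ?thesis by simp
      qed
    next
      show "summable (\<lambda>n. C * real n powr (-2))" by (intro summable_mult) (simp add: summable_real_powr_iff)
    qed (use g0 in auto)
    then show ?thesis
    proof eventually_elim
      case (elim \<omega>)
      have "(\<lambda>n. (g n \<omega> / real n powr s) ^ (2*r)) \<longlonglongrightarrow> 0"
      proof (rule Lim_transform_eventually[OF summable_LIMSEQ_zero[OF elim]])
        show "\<forall>\<^sub>F n in sequentially. g n \<omega> ^ (2*r) / real n powr (2 * s * real r) = (g n \<omega> / real n powr s) ^ (2*r)"
          using eventually_gt_at_top[of 0] by eventually_elim (simp add: power_divide powr_pow mult_ac)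
      qed
      then show ?case by (rule tendsto_zero_of_power[rotated 2]) (use g0 r in auto)
    qed
  qed
  then show ?thesis unfolding negl_def using g g0 i lim by auto
qed

lemma (in prob_space) negl_of_bounded_factor:
  assumes c: "\<And>n. 0 \<le> c n" "(\<lambda>n. c n / real n powr s) \<longlonglongrightarrow> 0"
    and V [measurable]: "V \<in> borel_measurable M" and V0: "\<And>\<omega>. 0 \<le> V \<omega>"
    and i: "\<And>r. r \<ge> 1 \<Longrightarrow> integrable M (\<lambda>\<omega>. V \<omega> ^ (2*r))"
  shows "negl M s (\<lambda>n \<omega>. c n * V \<omega>)"
proof -
  have "(\<lambda>n. c n * V \<omega> / real n powr s) \<longlonglongrightarrow> 0" for \<omega>
    using tendsto_mult[OF c(2) tendsto_const, of "V \<omega>"] by simp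
  moreover have "(\<lambda>n. (\<integral>\<omega>. (c n * V \<omega>) ^ (2*r) \<partial>M) / real n powr (2 * s * real r)) \<longlonglongrightarrow> 0" if r: "r \<ge> 1" for r
  proof -
    have "(\<lambda>n. (c n / real n powr s)^(2*r) * (\<integral>\<omega>. V \<omega> ^ (2*r) \<partial>M)) \<longlonglongrightarrow> 0^(2*r) * (\<integral>\<omega>. V \<omega> ^ (2*r) \<partial>M)"
      by (intro tendsto_intros c)
    then have "(\<lambda>n. (c n / real n powr s)^(2*r) * (\<integral>\<omega>. V \<omega> ^ (2*r) \<partial>M)) \<longlonglongrightarrow> 0"
      using r by (simp add: power_0_left)
    then show ?thesis
    proof (rule Lim_transform_eventually)
      show "\<forall>\<^sub>F n in sequentially. (c n / real n powr s)^(2*r) * (\<integral>\<omega>. V \<omega> ^ (2*r) \<partial>M) = (\<integral>\<omega>. (c n * V \<omega>) ^ (2*r) \<partial>M) / real n powr (2 * s * real r)"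
        using eventually_gt_at_top[of 0]
        by eventually_elim (simp add: power_divide power_mult_distrib powr_pow mult_ac)
    qed
  qed
  ultimately show ?thesis unfolding negl_def using c V0 i
    by (auto simp: power_mult_distrib intro!: integrable_mult_right)
qed

text \<open>Below \<open>e\<close> the first term dominates; above \<open>e\<close> the power p - 2r
  <= 0 of x is at most that of \<open>e\<close>. With \<open>e\<close> free, smallness of one even
  moment gives smallness of the moment of order p.\<close>

lemma powr_le_split:
  fixes x e p :: real
  assumes "0 \<le> x" "0 < e" "1 \<le> p" "p \<le> real (2*r)"
  shows "x powr p \<le> e powr p + e powr (p - real (2*r)) * x^(2*r)"
proof (cases "x \<le> e")
  case True
  then have "x powr p \<le> e powr p" using assms by (intro powr_mono2) auto
  then show ?thesis by (simp add: add_increasing2)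
next
  case False
  then have x: "x > 0" using assms by simp
  have "x powr p = x powr (p - real (2*r)) * x powr real (2*r)" by (simp flip: powr_add)
  also have "x powr real (2*r) = x^(2*r)" using x by (rule powr_realpow)
  also have "x powr (p - real (2*r)) * x^(2*r) \<le> e powr (p - real (2*r)) * x^(2*r)"
    using False assms by (intro mult_right_mono powr_mono2') auto
  finally show ?thesis by (simp add: add_increasing)
qed

lemma (in prob_space) negl_imp_smallo:
  assumes h: "negl M s h"
  shows "AE \<omega> in M. (\<lambda>n. h n \<omega>) \<in> o(\<lambda>n. real n powr s)"
    and "\<And>p. p \<ge> 1 \<Longrightarrow> integrable M (\<lambda>\<omega>. h n \<omega> powr p)"
    and "\<And>p. p \<ge> 1 \<Longrightarrow> (\<lambda>n. (\<integral>\<omega>. h n \<omega> powr p \<partial>M) powr (1 / p)) \<in> o(\<lambda>n. real n powr s)"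
proof -
  have [measurable]: "\<And>n. h n \<in> borel_measurable M"
    and nn: "\<And>n \<omega>. 0 \<le> h n \<omega>"
    and AE: "AE \<omega> in M. (\<lambda>n. h n \<omega> / real n powr s) \<longlonglongrightarrow> 0"
    and i: "\<And>r n. r \<ge> 1 \<Longrightarrow> integrable M (\<lambda>\<omega>. h n \<omega> ^ (2*r))"
    and l: "\<And>r. r \<ge> 1 \<Longrightarrow> (\<lambda>n. (\<integral>\<omega>. h n \<omega> ^ (2*r) \<partial>M) / real n powr (2 * s * real r)) \<longlonglongrightarrow> 0"
    using h unfolding negl_def by auto
  have npos: "\<forall>\<^sub>F n in sequentially. real n powr s \<noteq> 0"
    using eventually_gt_at_top[of 0] by eventually_elim simp
  show "AE \<omega> in M. (\<lambda>n. h n \<omega>) \<in> o(\<lambda>n. real n powr s)"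
    using AE by eventually_elim (intro smalloI_tendsto npos)
  fix p :: real assume p: "p \<ge> 1"
  define r where "r = nat \<lceil>p\<rceil>"
  have r: "r \<ge> 1" "p \<le> real (2*r)" using p by (auto simp: r_def) linarith+
  have ip: "integrable M (\<lambda>\<omega>. h n \<omega> powr p)" for n
  proof (rule Bochner_Integration.integrable_bound[where f="\<lambda>\<omega>. 1 + h n \<omega> ^ (2*r)"])
    show "integrable M (\<lambda>\<omega>. 1 + h n \<omega> ^ (2*r))" using i[OF r(1), of n] by simp
    show "AE \<omega> in M. norm (h n \<omega> powr p) \<le> norm (1 + h n \<omega> ^ (2*r))"
      using powr_le_split[OF nn _ p r(2), of 1 n] nn by auto
  qed simp
  then show "integrable M (\<lambda>\<omega>. h n \<omega> powr p)" .
  have Ip0: "0 \<le> (\<integral>\<omega>. h n \<omega> powr p \<partial>M)" for n by (intro integral_nonneg_AE) auto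
  define J where "J n = (\<integral>\<omega>. h n \<omega> ^ (2*r) \<partial>M) / real n powr (2 * s * real r)" for n
  have bound: "(\<integral>\<omega>. h n \<omega> powr p \<partial>M) / real n powr (s * p) \<le> e powr p + e powr (p - real (2*r)) * J n"
    if n: "n \<ge> 1" and e: "e > 0" for n e
  proof -
    define a where "a = real n powr s"
    have a: "a > 0" using n by (simp add: a_def)
    have ap: "real n powr (s * p) = a powr p" "real n powr (2 * s * real r) = a^(2*r)"
      using n by (auto simp: a_def powr_powr powr_pow mult_ac)
    have "h n \<omega> powr p \<le> a powr p * (e powr p + e powr (p - real (2*r)) * (h n \<omega> ^ (2*r) / a^(2*r)))" for \<omega>
    proof -
      have "h n \<omega> powr p = a powr p * (h n \<omega> / a) powr p" using a nn[of n \<omega>] by (simp add: powr_divide)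
      also have "\<dots> \<le> a powr p * (e powr p + e powr (p - real (2*r)) * (h n \<omega> / a)^(2*r))"
        using a nn[of n \<omega>] e p r by (intro mult_left_mono powr_le_split) auto
      finally show ?thesis by (simp add: power_divide)
    qed
    then have "(\<integral>\<omega>. h n \<omega> powr p \<partial>M) \<le> (\<integral>\<omega>. a powr p * (e powr p + e powr (p - real (2*r)) * (h n \<omega> ^ (2*r) / a^(2*r))) \<partial>M)"
      using i[OF r(1), of n] by (intro integral_mono ip) auto
    also have "\<dots> = a powr p * (e powr p + e powr (p - real (2*r)) * J n)"
      using i[OF r(1), of n] by (simp add: J_def ap prob_space)
    finally show ?thesis unfolding ap using a by (simp add: field_simps)
  qed
  have J: "J \<longlonglongrightarrow> 0" unfolding J_def by (rule l[OF r(1)])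
  have "(\<lambda>n. (\<integral>\<omega>. h n \<omega> powr p \<partial>M) / real n powr (s * p)) \<longlonglongrightarrow> 0"
  proof (rule LIMSEQ_I)
    fix \<epsilon> :: real assume \<epsilon>: "\<epsilon> > 0"
    define e where "e = (\<epsilon>/2) powr (1/p)"
    have e: "e > 0" "e powr p = \<epsilon>/2" using \<epsilon> p by (auto simp: e_def powr_powr)
    have "(\<lambda>n. e powr (p - real (2*r)) * J n) \<longlonglongrightarrow> 0" using tendsto_mult[OF tendsto_const J] by simp
    then obtain N where N: "\<And>n. n \<ge> N \<Longrightarrow> e powr (p - real (2*r)) * J n < \<epsilon>/2"
      using order_tendstoD(2)[of _ 0 sequentially "\<epsilon>/2"] \<epsilon> unfolding eventually_sequentially by (meson half_gt_zero)
    show "\<exists>no. \<forall>n\<ge>no. norm ((\<integral>\<omega>. h n \<omega> powr p \<partial>M) / real n powr (s * p) - 0) < \<epsilon>"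
    proof (intro exI[of _ "max N 1"] allI impI)
      fix n assume "n \<ge> max N 1"
      then have "(\<integral>\<omega>. h n \<omega> powr p \<partial>M) / real n powr (s * p) < \<epsilon>/2 + \<epsilon>/2"
        using bound[of n e] N[of n] e by simp
      then show "norm ((\<integral>\<omega>. h n \<omega> powr p \<partial>M) / real n powr (s * p) - 0) < \<epsilon>"
        using Ip0[of n] by simp
    qed
  qed
  then have "(\<lambda>n. ((\<integral>\<omega>. h n \<omega> powr p \<partial>M) / real n powr (s * p)) powr (1/p)) \<longlonglongrightarrow> 0 powr (1/p)"
    using p Ip0 by (intro tendsto_powr') auto
  then have "(\<lambda>n. (\<integral>\<omega>. h n \<omega> powr p \<partial>M) powr (1/p) / real n powr s) \<longlonglongrightarrow> 0"
    using p Ip0 by (simp add: powr_divide powr_powr)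
  then show "(\<lambda>n. (\<integral>\<omega>. h n \<omega> powr p \<partial>M) powr (1 / p)) \<in> o(\<lambda>n. real n powr s)"
    by (intro smalloI_tendsto npos)
qed

section \<open>Eigencoordinates of the chain and the leading oscillation\<close>

definition UL :: "nat \<Rightarrow> (nat \<Rightarrow> 'a \<Rightarrow> nat \<Rightarrow> real) \<Rightarrow> complex \<Rightarrow> nat \<Rightarrow> 'a \<Rightarrow> complex" where
  "UL m L l n \<omega> = U m l (\<lambda>k. of_real (L n \<omega> k))"

lemma UL_measurable:
  assumes "btree_fringe_chain m M L" shows "UL m L l n \<in> borel_measurable M"
proof -
  have [measurable]: "(\<lambda>\<omega>. L n \<omega> j) \<in> borel_measurable M" if "j \<in> {1..m}" for j
    using assms that by (auto simp: btree_fringe_chain_def)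
  show ?thesis unfolding UL_def[abs_def] U_def by (intro borel_measurable_sum) measurable
qed

lemma UL_hist_event:
  assumes "\<omega> \<in> hist_event m M L w" "length w = n" "i \<le> n"
  shows "UL m L l i \<omega> = Y m l (drop (n - i) w)"
  unfolding UL_def Y_def U_def using assms by (intro sum.cong refl) (auto simp: hist_event_def)

lemma AE_UL_one:
  assumes "m \<ge> 2" "btree_fringe_chain m M L"
  shows "AE \<omega> in M. \<forall>n. UL m L 1 n \<omega> = of_nat (n + m)"
proof -
  have "AE \<omega> in M. UL m L 1 n \<omega> = of_nat (n + m)" for n
    using AE_hist_event[OF assms, of n]
  proof eventually_elim
    case (elim \<omega>)
    then obtain w where w: "w \<in> words m n" "\<omega> \<in> hist_event m M L w" by auto
    have len: "length w = n" using w(1) by (rule length_words)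
    have "UL m L 1 n \<omega> = (\<Sum>k=1..m. of_nat (gaps m k) * of_real (st m w k))"
      using UL_hist_event[OF w(2) len order_refl, of 1] by (simp add: Y_def U_one[OF assms(1)])
    also have "\<dots> = of_real (\<Sum>k=1..m. real (gaps m k) * st m w k)" by simp
    also have "\<dots> = of_nat (n + m)"
      using sum_gaps_st[OF assms(1), of w] w(1) len by (simp add: words_def)
    finally show ?case .
  qed
  then show ?thesis by (simp add: AE_all_countable)
qed

lemma negl_UL:
  assumes m: "m \<ge> 2" and chain: "btree_fringe_chain m M L" and l: "l \<in> chi_roots m" and t: "Re l \<le> t" "1/2 < t" "t < s"
  shows "negl M s (\<lambda>n \<omega>. cmod (UL m L l n \<omega>))"
proof (rule negl_of_moments)
  note [measurable] = UL_measurable[OF chain]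
  show "(\<lambda>\<omega>. cmod (UL m L l n \<omega>)) \<in> borel_measurable M" for n by simp
  have h: "cmod (UL m L l n \<omega>) ^ (2*r) = cmod (Y m l w) ^ (2*r)" if "w \<in> words m n" "\<omega> \<in> hist_event m M L w" for w \<omega> n r
    using UL_hist_event[OF that(2) length_words[OF that(1)] order_refl, of l] by simp
  show "integrable M (\<lambda>\<omega>. cmod (UL m L l n \<omega>) ^ (2*r))" for n r
    by (rule integral_history(1)[OF m chain _ h]) auto
  have "(\<integral>\<omega>. cmod (UL m L l n \<omega>) ^ (2*r) \<partial>M) = Ew m n (\<lambda>w. cmod (Y m l w) ^ (2*r))" for n r
    by (rule integral_history(2)[OF m chain _ h]) auto
  then show "\<exists>C\<ge>0. \<forall>n. (\<integral>\<omega>. cmod (UL m L l n \<omega>) ^ (2*r) \<partial>M) \<le> C * real (n + m) powr (2 * t * real r)" if "r \<ge> 1" for r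
    using Y_even_moment_le[OF m l t(1,2) that] by simp
qed (use t in auto)

text \<open>The coordinate divided by its mean growth \<open>Gp m l 0 n\<close> converges to some Z
  of mean m, the value of the coordinate at time 0. The growth factor is asymptotic to
  Gamma(m)/Gamma(m+l) times n^l; including this constant in W gives the mean m Gamma(m)/Gamma(m+l) =
  m!/Gamma(m+l).\<close>

lemma leading_term:
  assumes m: "m \<ge> 2" and chain: "btree_fringe_chain m M L" and l: "l \<in> chi_roots m"
    and s: "s = Re l" "1/2 < s"
  shows "\<exists>W. integrable M W \<and> (\<integral>\<omega>. W \<omega> \<partial>M) = fact m / Gamma (of_nat m + l) \<and>
    negl M s (\<lambda>n \<omega>. cmod (UL m L l n \<omega> - of_nat n powr l * W \<omega>))"
proof -
  interpret prob_space M using chain by (simp add: btree_fringe_chain_def)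
  note [measurable] = UL_measurable[OF chain]
  define \<gamma> where "\<gamma> n = Gp m l 0 n" for n
  define \<kappa> where "\<kappa> = Gamma (of_nat m) / Gamma (of_nat m + l)"
  have Re0: "Re l > 0" using s by simp
  have asym: "(\<lambda>n. \<gamma> n / of_nat n powr l) \<longlonglongrightarrow> \<kappa>" unfolding \<gamma>_def \<kappa>_def by (rule Gp_asymp[OF m Re0])
  have nz: "\<gamma> n \<noteq> 0" for n
  proof -
    have "1 + l / of_nat (i + m) \<noteq> 0" for i
    proof -
      have "Re (1 + l / of_nat (i + m)) = 1 + Re l / real (i + m)" by simp
      then show ?thesis using Re0 by (metis add_pos_nonneg divide_nonneg_nonneg less_imp_le less_irrefl of_nat_0_le_iff zero_complex.sel(1) zero_less_one)
    qed
    then show ?thesis unfolding \<gamma>_def Gp_def by auto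
  qed
  have "of_nat m + l \<notin> \<int>\<^sub>\<le>\<^sub>0" "of_nat m \<notin> (\<int>\<^sub>\<le>\<^sub>0 :: complex set)" using m Re0 by (auto elim!: nonpos_Ints_cases simp: complex_eq_iff)
  then have \<kappa>0: "\<kappa> \<noteq> 0" unfolding \<kappa>_def by (auto simp: Gamma_eq_zero_iff)
  have npow: "cmod (of_nat n powr l) = real n powr s" for n
    using norm_powr_real_powr[of "of_nat n" l] by (simp add: s)
  obtain B where B: "B > 0" "\<And>n. n \<ge> 1 \<Longrightarrow> cmod (1 / \<gamma> n) \<le> B * real n powr (-s)"
  proof -
    have "Bseq (\<lambda>n. inverse (\<gamma> n / of_nat n powr l))"
      using tendsto_inverse[OF asym \<kappa>0] by (intro convergent_imp_Bseq) (auto simp: convergent_def)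
    then obtain B where B: "B > 0" "\<And>n. norm (inverse (\<gamma> n / of_nat n powr l)) \<le> B" by (auto simp: Bseq_def)
    have "cmod (1 / \<gamma> n) \<le> B * real n powr (-s)" if n: "n \<ge> 1" for n
    proof -
      have p: "real n powr s > 0" using n by simp
      have "cmod (1 / \<gamma> n) * real n powr s \<le> B" using B(2)[of n] by (simp add: norm_divide norm_inverse npow)
      then have "cmod (1 / \<gamma> n) \<le> B / real n powr s" using p by (simp add: pos_le_divide_eq)
      then show ?thesis by (simp add: powr_minus divide_inverse)
    qed
    with B(1) show ?thesis by (rule that)
  qed
  \<comment> \<open>Half of the excess of 2s over 1: the exponent -2s + \<delta> is still summable,
    and \<delta> remains as the rate of convergence.\<close>
  define \<delta> where "\<delta> = (2 * s - 1) / 2"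
  have \<delta>: "\<delta> > 0" using s by (simp add: \<delta>_def)
  have sd: "- 2 * s + \<delta> < -1" using s(2) by (simp add: \<delta>_def field_simps)
  define Z1 where "Z1 = (\<Sum>j. real (Suc j) powr (- 2 * s + \<delta>))"
  have Z1: "Z1 \<ge> 0" unfolding Z1_def by (intro suminf_nonneg summable_Suc_powr[OF sd]) auto
  define K where "K r = momK m l r * (B\<^sup>2 * Z1)^r" for r
  have K0: "K r \<ge> 0" for r using momK_pos[of m l r] Z1 by (simp add: K_def)
  define X where "X n \<omega> = UL m L l n \<omega> / \<gamma> n" for n \<omega>
  have [measurable]: "X n \<in> borel_measurable M" for n unfolding X_def by simp
  have h: "X n \<omega> - X k \<omega> = (1 / \<gamma> n) * Y m l w - (1 / \<gamma> k) * Y m l (drop (n - k) w)"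
    if "k \<le> n" "w \<in> words m n" "\<omega> \<in> hist_event m M L w" for w \<omega> n k
    using UL_hist_event[OF that(3) length_words[OF that(2)], of n l] UL_hist_event[OF that(3) length_words[OF that(2)], of k l] that(1)
    by (simp add: X_def)
  have Xi: "integrable M (\<lambda>\<omega>. cmod (X n \<omega> - X k \<omega>) ^ (2*r))" if "k \<le> n" for k n r
    by (rule integral_history(1)[OF m chain, where n=n and h="\<lambda>w. cmod ((1 / \<gamma> n) * Y m l w - (1 / \<gamma> k) * Y m l (drop (n - k) w)) ^ (2*r)"])
       (use h[OF that] in \<open>simp_all del: times_divide_eq_left\<close>)
  have Xle: "(\<integral>\<omega>. cmod (X n \<omega> - X k \<omega>) ^ (2*r) \<partial>M) \<le> K r * real (Suc k) powr (- \<delta> * real r)" if r: "r \<ge> 1" and kn: "k \<le> n" for k n r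
  proof -
    have "(\<integral>\<omega>. cmod (X n \<omega> - X k \<omega>) ^ (2*r) \<partial>M) = Ew m n (\<lambda>w. cmod ((1 / \<gamma> n) * Y m l w - (1 / \<gamma> k) * Y m l (drop (n - k) w)) ^ (2*r))"
      by (rule integral_history(2)[OF m chain]) (use h[OF kn] in \<open>simp_all del: times_divide_eq_left\<close>)
    \<comment> \<open>The inverse growth factors also satisfy the backward recursion that
      \<open>moment_bound\<close> asks of \<open>q\<close>.\<close>
    also have "\<dots> \<le> momK m l r * (\<Sum>j=k..<n. (cmod (1 / \<gamma> (Suc j)))\<^sup>2)^r"
    proof (rule moment_bound[OF m l kn r, where q="\<lambda>j. 1 / \<gamma> j"])
      fix j
      have g: "\<gamma> (Suc j) = \<gamma> j * (1 + l / of_nat (j + m))" unfolding \<gamma>_def by (simp add: Gp_Suc)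
      then have "1 + l / of_nat (j + m) \<noteq> 0" using nz[of "Suc j"] by auto
      then show "1 / \<gamma> j = 1 / \<gamma> (Suc j) * (1 + l / of_nat (j + m))" using nz[of j] unfolding g by simp
    qed
    also have "\<dots> \<le> momK m l r * (B\<^sup>2 * Z1 * real (Suc k) powr (- \<delta>))^r"
    proof (intro mult_left_mono power_mono)
      have "(\<Sum>j=k..<n. (cmod (1 / \<gamma> (Suc j)))\<^sup>2) \<le> (\<Sum>j=k..<n. B\<^sup>2 * real (Suc j) powr (- 2 * s + \<delta>) * real (Suc k) powr (- \<delta>))"
      proof (rule sum_mono)
        fix j assume j: "j \<in> {k..<n}"
        have "(cmod (1 / \<gamma> (Suc j)))\<^sup>2 \<le> (B * real (Suc j) powr (-s))\<^sup>2" by (intro power_mono B) auto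
        also have "\<dots> = B\<^sup>2 * (real (Suc j) powr (- 2 * s + \<delta>) * real (Suc j) powr (- \<delta>))"
          by (simp add: power_mult_distrib powr_pow mult.commute flip: powr_add)
        also have "\<dots> \<le> B\<^sup>2 * (real (Suc j) powr (- 2 * s + \<delta>) * real (Suc k) powr (- \<delta>))"
          using j \<delta> by (intro mult_left_mono powr_mono2') auto
        finally show "(cmod (1 / \<gamma> (Suc j)))\<^sup>2 \<le> B\<^sup>2 * real (Suc j) powr (- 2 * s + \<delta>) * real (Suc k) powr (- \<delta>)" by (simp add: mult.assoc)
      qed
      also have "\<dots> = B\<^sup>2 * (\<Sum>j=k..<n. real (Suc j) powr (- 2 * s + \<delta>)) * real (Suc k) powr (- \<delta>)"
        by (simp add: sum_distrib_left sum_distrib_right)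
      also have "\<dots> \<le> B\<^sup>2 * Z1 * real (Suc k) powr (- \<delta>)"
        unfolding Z1_def by (intro mult_left_mono mult_right_mono sum_le_suminf summable_Suc_powr[OF sd]) auto
      finally show "(\<Sum>j=k..<n. (cmod (1 / \<gamma> (Suc j)))\<^sup>2) \<le> B\<^sup>2 * Z1 * real (Suc k) powr (- \<delta>)" .
    qed (use momK_pos[of m l r] in \<open>auto intro!: sum_nonneg\<close>)
    also have "\<dots> = K r * real (Suc k) powr (- \<delta> * real r)"
      unfolding K_def power_mult_distrib[of "B\<^sup>2 * Z1"] by (subst powr_pow) auto
    finally show ?thesis .
  qed
  obtain Z where Zm [measurable]: "Z \<in> borel_measurable M"
    and Zi: "\<And>r k. r \<ge> 1 \<Longrightarrow> integrable M (\<lambda>\<omega>. cmod (Z \<omega> - X k \<omega>) ^ (2*r))"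
    and Zle: "\<And>r k. r \<ge> 1 \<Longrightarrow> (\<integral>\<omega>. cmod (Z \<omega> - X k \<omega>) ^ (2*r) \<partial>M) \<le> K r * real (Suc k) powr (- \<delta> * real r)"
    using Lp_Cauchy_limit[of X K \<delta>] Xi Xle \<delta> K0 by auto
  have hX: "X k \<omega> = (1 / \<gamma> k) * Y m l w" if "w \<in> words m k" "\<omega> \<in> hist_event m M L w" for w \<omega> k
    using UL_hist_event[OF that(2) length_words[OF that(1)], of k l] by (simp add: X_def)
  have XI: "integrable M (X k)" for k
    by (rule integral_history(1)[OF m chain _ hX]) auto
  have XE: "(\<integral>\<omega>. X k \<omega> \<partial>M) = of_nat m" for k
  proof -
    have "(\<integral>\<omega>. X k \<omega> \<partial>M) = Ew m k (\<lambda>w. (1 / \<gamma> k) * Y m l w)"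
      by (rule integral_history(2)[OF m chain _ hX]) auto
    also have "\<dots> = (1 / \<gamma> k) * (\<gamma> k * of_nat m)" unfolding Ew_cmult Ew_Y[OF m l] \<gamma>_def ..
    finally show ?thesis using nz[of k] by simp
  qed
  have dom: "x \<le> a + x\<^sup>2 / a" if "x \<ge> 0" "a > 0" for x a :: real
  proof (cases "x \<le> a")
    case False
    then have "x * a \<le> x * x" using that by (intro mult_left_mono) auto
    then have "x \<le> x\<^sup>2 / a" using that by (simp add: power2_eq_square field_simps)
    then show ?thesis using that by linarith
  qed (use that in \<open>simp add: add_increasing2\<close>)
  have Zi2: "integrable M (\<lambda>\<omega>. (cmod (Z \<omega> - X k \<omega>))\<^sup>2)" "(\<integral>\<omega>. (cmod (Z \<omega> - X k \<omega>))\<^sup>2 \<partial>M) \<le> K 1 * real (Suc k) powr (- \<delta>)" for k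
    using Zi[of 1 k] Zle[of 1 k] by simp_all
  have Zd: "integrable M (\<lambda>\<omega>. Z \<omega> - X k \<omega>)" for k
    by (rule Bochner_Integration.integrable_bound[where f="\<lambda>\<omega>. 1 + (cmod (Z \<omega> - X k \<omega>))\<^sup>2 / 1"])
       (use Zi2(1)[of k] dom[of "cmod (Z _ - X k _)" 1] in \<open>auto simp del: div_by_1 simp: abs_of_nonneg\<close>)
  have ZI: "integrable M Z"
    using Bochner_Integration.integrable_add[OF Zd[of 0] XI[of 0]] by simp
  have ZE: "(\<integral>\<omega>. Z \<omega> \<partial>M) = of_nat m"
  proof -
    have le: "cmod ((\<integral>\<omega>. Z \<omega> \<partial>M) - of_nat m) \<le> (1 + K 1) * real (Suc k) powr (- \<delta> / 2)" for k
    proof -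
      define a where "a = real (Suc k) powr (- \<delta> / 2)"
      have a: "a > 0" by (simp add: a_def)
      have a2: "real (Suc k) powr (- \<delta>) = a\<^sup>2" by (simp add: a_def powr_pow)
      have "(\<integral>\<omega>. Z \<omega> \<partial>M) - of_nat m = (\<integral>\<omega>. Z \<omega> - X k \<omega> \<partial>M)"
        using ZI XI[of k] by (simp add: XE)
      then have "cmod ((\<integral>\<omega>. Z \<omega> \<partial>M) - of_nat m) \<le> (\<integral>\<omega>. cmod (Z \<omega> - X k \<omega>) \<partial>M)"
        by (simp add: integral_norm_bound)
      also have "\<dots> \<le> (\<integral>\<omega>. a + (cmod (Z \<omega> - X k \<omega>))\<^sup>2 / a \<partial>M)"
        using Zd[of k] Zi2(1)[of k] dom a by (intro integral_mono) auto
      also have "\<dots> = a + (\<integral>\<omega>. (cmod (Z \<omega> - X k \<omega>))\<^sup>2 \<partial>M) / a"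
        using Zi2(1)[of k] by (simp add: prob_space)
      also have "\<dots> \<le> a + K 1 * a\<^sup>2 / a" using Zi2(2)[of k] a unfolding a2 by (intro add_left_mono divide_right_mono) auto
      also have "\<dots> = (1 + K 1) * a" using a by (simp add: power2_eq_square distrib_right)
      finally show ?thesis by (simp add: a_def)
    qed
    have "(\<lambda>k. real (Suc k) powr (- \<delta> / 2)) \<longlonglongrightarrow> 0"
      using \<delta> by (intro tendsto_neg_powr filterlim_compose[OF filterlim_real_sequentially filterlim_Suc]) auto
    then have "(\<lambda>k. (1 + K 1) * real (Suc k) powr (- \<delta> / 2)) \<longlonglongrightarrow> 0"
      using tendsto_mult[OF tendsto_const, of _ 0 _ "1 + K 1"] by simp
    then have "cmod ((\<integral>\<omega>. Z \<omega> \<partial>M) - of_nat m) \<le> 0"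
      by (rule LIMSEQ_le_const) (use le in auto)
    then show ?thesis by simp
  qed
  have ZiAll: "integrable M (\<lambda>\<omega>. cmod (Z \<omega>) ^ (2*r))" if r: "r \<ge> 1" for r
  proof -
    have X0: "integrable M (\<lambda>\<omega>. cmod (X 0 \<omega>) ^ (2*r))"
      by (rule integral_history(1)[OF m chain, where n=0 and h="\<lambda>w. cmod ((1 / \<gamma> 0) * Y m l w) ^ (2*r)"]) (use hX[of _ 0] in auto)
    show ?thesis
    proof (rule Bochner_Integration.integrable_bound[where f="\<lambda>\<omega>. 2^(2*r) * (cmod (Z \<omega> - X 0 \<omega>) ^ (2*r) + cmod (X 0 \<omega>) ^ (2*r))"])
      show "integrable M (\<lambda>\<omega>. 2^(2*r) * (cmod (Z \<omega> - X 0 \<omega>) ^ (2*r) + cmod (X 0 \<omega>) ^ (2*r)))"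
        using Zi[OF r, of 0] X0 by (intro integrable_mult_right Bochner_Integration.integrable_add)
      have "cmod (Z \<omega>) ^ (2*r) \<le> 2^(2*r) * (cmod (Z \<omega> - X 0 \<omega>) ^ (2*r) + cmod (X 0 \<omega>) ^ (2*r))" for \<omega>
      proof -
        have "cmod (Z \<omega>) ^ (2*r) \<le> (cmod (Z \<omega> - X 0 \<omega>) + cmod (X 0 \<omega>)) ^ (2*r)"
          using norm_triangle_ineq[of "Z \<omega> - X 0 \<omega>" "X 0 \<omega>"] by (intro power_mono) auto
        also have "\<dots> \<le> 2^(2*r) * (cmod (Z \<omega> - X 0 \<omega>) ^ (2*r) + cmod (X 0 \<omega>) ^ (2*r))" by (rule sum_power_le) auto
        finally show ?thesis .
      qed
      then show "AE \<omega> in M. norm (cmod (Z \<omega>) ^ (2*r)) \<le> norm (2^(2*r) * (cmod (Z \<omega> - X 0 \<omega>) ^ (2*r) + cmod (X 0 \<omega>) ^ (2*r)))"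
        by (auto simp: abs_mult)
    qed simp
  qed
  \<comment> \<open>The error splits as (gamma(n) - kappa n^l) Z - gamma(n) (Z - X(n)).
    \<open>g1\<close> covers the distance to the limit, \<open>g2\<close> the deterministic
    asymptotics of gamma.\<close>
  define g1 where "g1 n \<omega> = real (n + m) powr s * cmod (Z \<omega> - X n \<omega>)" for n \<omega>
  define g2 where "g2 n \<omega> = cmod (\<gamma> n - \<kappa> * of_nat n powr l) * cmod (Z \<omega>)" for n \<omega>
  have n1: "negl M s g1"
  proof (rule negl_of_moments[where t="s - \<delta>/2" and m=m])
    show "g1 n \<in> borel_measurable M" for n unfolding g1_def by simp
    show "0 \<le> s - \<delta>/2" "s - \<delta>/2 < s" using s by (auto simp: \<delta>_def field_simps)
    show "integrable M (\<lambda>\<omega>. g1 n \<omega> ^ (2*r))" if "r \<ge> 1" for n r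
      unfolding g1_def power_mult_distrib by (intro integrable_mult_right Zi that)
    fix r :: nat assume r: "r \<ge> 1"
    show "\<exists>C\<ge>0. \<forall>n. (\<integral>\<omega>. g1 n \<omega> ^ (2*r) \<partial>M) \<le> C * real (n + m) powr (2 * (s - \<delta>/2) * real r)"
    proof (intro exI[of _ "K r * real m powr (\<delta> * real r)"] conjI allI)
      fix n
      define N where "N = real (n + m)"
      have N: "N > 0" using m by (simp add: N_def)
      \<comment> \<open>Trades the rate in n + 1 from the Cauchy estimate for a rate in n + m, at
        the cost of a constant.\<close>
      have "N / real m \<le> real (Suc n)"
        using m mult_left_mono[of 1 "real m" "real n"] by (simp add: N_def field_simps)
      then have "real (Suc n) powr (- \<delta> * real r) \<le> (N / real m) powr (- \<delta> * real r)"
        using N m \<delta> by (intro powr_mono2') auto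
      also have "\<dots> = real m powr (\<delta> * real r) * N powr (- \<delta> * real r)"
        using N m by (simp add: powr_divide powr_minus field_simps)
      finally have e: "real (Suc n) powr (- \<delta> * real r) \<le> real m powr (\<delta> * real r) * N powr (- \<delta> * real r)" .
      have "(\<integral>\<omega>. g1 n \<omega> ^ (2*r) \<partial>M) = (N powr s)^(2*r) * (\<integral>\<omega>. cmod (Z \<omega> - X n \<omega>) ^ (2*r) \<partial>M)"
        unfolding g1_def power_mult_distrib N_def by simp
      also have "\<dots> \<le> (N powr s)^(2*r) * (K r * real (Suc n) powr (- \<delta> * real r))"
        by (intro mult_left_mono Zle r) auto
      also have "\<dots> \<le> (N powr s)^(2*r) * (K r * (real m powr (\<delta> * real r) * N powr (- \<delta> * real r)))"
        using e K0 by (intro mult_left_mono) auto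
      also have "\<dots> = K r * real m powr (\<delta> * real r) * (N powr (s * real (2*r)) * N powr (- \<delta> * real r))"
        unfolding powr_pow[OF N] by simp
      also have "N powr (s * real (2*r)) * N powr (- \<delta> * real r) = N powr (2 * (s - \<delta>/2) * real r)"
        unfolding powr_add[symmetric] by (simp add: algebra_simps)
      finally show "(\<integral>\<omega>. g1 n \<omega> ^ (2*r) \<partial>M) \<le> K r * real m powr (\<delta> * real r) * real (n + m) powr (2 * (s - \<delta>/2) * real r)"
        by (simp add: N_def)
    qed (use K0 in simp)
  qed (simp add: g1_def)
  have n2: "negl M s g2"
    unfolding g2_def
  proof (rule negl_of_bounded_factor)
    have "(\<lambda>n. cmod (\<gamma> n / of_nat n powr l - \<kappa>)) \<longlonglongrightarrow> cmod (\<kappa> - \<kappa>)" by (intro tendsto_intros asym)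
    then have "(\<lambda>n. cmod (\<gamma> n / of_nat n powr l - \<kappa>)) \<longlonglongrightarrow> 0" by simp
    then show "(\<lambda>n. cmod (\<gamma> n - \<kappa> * of_nat n powr l) / real n powr s) \<longlonglongrightarrow> 0"
    proof (rule Lim_transform_eventually)
      show "\<forall>\<^sub>F n in sequentially. cmod (\<gamma> n / of_nat n powr l - \<kappa>) = cmod (\<gamma> n - \<kappa> * of_nat n powr l) / real n powr s"
        using eventually_gt_at_top[of 0]
      proof eventually_elim
        case (elim n)
        then have "of_nat n powr l \<noteq> 0" by simp
        then have "\<gamma> n / of_nat n powr l - \<kappa> = (\<gamma> n - \<kappa> * of_nat n powr l) / of_nat n powr l" by (simp add: field_simps)
        then show ?case by (simp add: norm_divide npow)
      qed
    qed
  qed (use ZiAll in auto)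
  define c where "c = exp (s + (cmod l)\<^sup>2)"
  define W where "W \<omega> = \<kappa> * Z \<omega>" for \<omega>
  have [measurable]: "W \<in> borel_measurable M" unfolding W_def by simp
  have "negl M s (\<lambda>n \<omega>. cmod (UL m L l n \<omega> - of_nat n powr l * W \<omega>))"
  proof (rule negl_dom[OF negl_add[OF n1 n2], where C="1 + c"])
    show "AE \<omega> in M. \<forall>n. cmod (UL m L l n \<omega> - of_nat n powr l * W \<omega>) \<le> (1 + c) * (g1 n \<omega> + g2 n \<omega>)"
    proof (intro AE_I2 allI)
      fix \<omega> n
      have "cmod (\<gamma> n) \<le> c * (real (n + m) / real (0 + m)) powr s"
        unfolding \<gamma>_def c_def by (rule norm_Gp_le[OF m]) (use s in auto)
      also have "\<dots> \<le> c * real (n + m) powr s"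
        using m s by (intro mult_left_mono powr_mono2) (auto simp: c_def divide_le_eq mult_le_cancel_left1)
      finally have g: "cmod (\<gamma> n) \<le> c * real (n + m) powr s" .
      have "UL m L l n \<omega> - of_nat n powr l * W \<omega> = (\<gamma> n - \<kappa> * of_nat n powr l) * Z \<omega> - \<gamma> n * (Z \<omega> - X n \<omega>)"
        using nz[of n] by (simp add: X_def W_def algebra_simps)
      also have "cmod \<dots> \<le> g2 n \<omega> + cmod (\<gamma> n) * cmod (Z \<omega> - X n \<omega>)"
        unfolding g2_def by (rule order_trans[OF norm_triangle_ineq4]) (simp add: norm_mult)
      also have "cmod (\<gamma> n) * cmod (Z \<omega> - X n \<omega>) \<le> c * g1 n \<omega>"
        unfolding g1_def mult.assoc[symmetric] using g by (intro mult_right_mono) auto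
      also have "g2 n \<omega> + c * g1 n \<omega> \<le> (1 + c) * (g1 n \<omega> + g2 n \<omega>)"
      proof -
        have "0 \<le> g1 n \<omega>" "0 \<le> c * g2 n \<omega>" by (auto simp: g1_def g2_def c_def)
        then show ?thesis by (simp add: algebra_simps)
      qed
      finally show "cmod (UL m L l n \<omega> - of_nat n powr l * W \<omega>) \<le> (1 + c) * (g1 n \<omega> + g2 n \<omega>)" by simp
    qed
  qed (auto simp: c_def)
  moreover have "integrable M W" unfolding W_def using ZI by simp
  moreover have "(\<integral>\<omega>. W \<omega> \<partial>M) = fact m / Gamma (of_nat m + l)"
  proof -
    have "Gamma (of_nat m) = (fact (m - 1) :: complex)" using Gamma_fact[of "m-1", where 'a=complex] m by (simp add: of_nat_diff)
    moreover have "fact m = of_nat m * (fact (m - 1) :: complex)" using m by (intro fact_reduce) auto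
    ultimately show ?thesis unfolding W_def using ZI by (simp add: ZE \<kappa>_def)
  qed
  ultimately show ?thesis by blast
qed

lemma (in prob_space) negl_const:
  assumes "0 \<le> c" "0 < s" shows "negl M s (\<lambda>n \<omega>. c)"
  using assms by (intro negl_of_moments[where t=0 and m=1]) (auto simp: prob_space intro!: exI[of _ "c^(2*_)"])

lemma negl_zero: "negl M s (\<lambda>n \<omega>. 0)"
  unfolding negl_def by (auto simp: power_0_left)

lemma negl_sum:
  assumes "finite A" "\<And>i. i \<in> A \<Longrightarrow> negl M s (g i)"
  shows "negl M s (\<lambda>n \<omega>. \<Sum>i\<in>A. g i n \<omega>)"
  using assms by (induction A rule: finite_induct) (auto simp: negl_zero intro!: negl_add)

text \<open>In the spectral decomposition the conjugate roots \<open>lambda2\<close> and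
  \<open>cnj lambda2\<close> contribute complex conjugate terms, whence twice a real part. All other
  roots except 1 have strictly smaller real part.\<close>

lemma remainder_negl:
  assumes m: "m \<ge> 60" and chain: "btree_fringe_chain m M L"
  shows "\<exists>W. integrable M W \<and> (\<integral>\<omega>. W \<omega> \<partial>M) = fact m / Gamma (of_nat m + lambda2 m) \<and>
    negl M (sigma2 m) (\<lambda>n \<omega>. L2_set (btree_remainder m L W n \<omega>) {1..m})"
proof -
  interpret prob_space M using chain by (simp add: btree_fringe_chain_def)
  have m2: "m \<ge> 2" and m1: "m \<ge> 1" using m by auto
  define l where "l = lambda2 m"
  define s where "s = sigma2 m"
  have l: "s > 1/2" "l \<in> chi_roots m" "Re l = s" "Im l > 0"
    and other: "\<And>z. z \<in> chi_roots m \<Longrightarrow> z \<noteq> 1 \<Longrightarrow> z \<noteq> l \<Longrightarrow> z \<noteq> cnj l \<Longrightarrow> Re z < s"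
    using lambda2_properties[OF m] by (simp_all add: l_def s_def)
  have [measurable]: "(\<lambda>\<omega>. L n \<omega> j) \<in> borel_measurable M" if "j \<in> {1..m}" for n j
    using chain that by (auto simp: btree_fringe_chain_def)
  obtain W where W: "integrable M W" "(\<integral>\<omega>. W \<omega> \<partial>M) = fact m / Gamma (of_nat m + l)"
    and lead: "negl M s (\<lambda>n \<omega>. cmod (UL m L l n \<omega> - of_nat n powr l * W \<omega>))"
    using leading_term[OF m2 chain l(2), of s] l by auto
  have [measurable]: "W \<in> borel_measurable M" using W(1) by auto
  define R where "R = chi_roots m - {1, l, cnj l}"
  have fin: "finite R" using finite_chi_roots[OF m1] by (simp add: R_def)
  have roots: "chi_roots m = insert 1 (insert l (insert (cnj l) R))"
    using one_in_chi_roots[OF m1] l(2) cnj_in_chi_roots[OF m1 l(2)] by (auto simp: R_def)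
  have dist: "1 \<noteq> l" "1 \<noteq> cnj l" "l \<noteq> cnj l" using l(4) by (auto simp: complex_eq_iff)
  have negR: "negl M s (\<lambda>n \<omega>. cmod (UL m L z n \<omega>))" if z: "z \<in> R" for z
  proof (rule negl_UL[OF m2 chain])
    have "Re z < s" using other z by (auto simp: R_def)
    \<comment> \<open>\<open>negl_UL\<close> needs an exponent strictly between 1/2 and s that is at
      least \<open>Re z\<close>; the midpoint of 1/2 and s serves when \<open>Re z\<close> is
      small.\<close>
    then show "Re z \<le> max (Re z) ((1/2 + s) / 2)" "1/2 < max (Re z) ((1/2 + s) / 2)" "max (Re z) ((1/2 + s) / 2) < s"
      using l(1) by (auto simp: less_max_iff_disj field_simps)
    show "z \<in> chi_roots m" using z by (simp add: R_def)
  qed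
  \<comment> \<open>The constant m appears because the coordinate of the root 1 equals n + m,
    whereas the centring uses n.\<close>
  define G where "G n \<omega> = real m + cmod (UL m L l n \<omega> - of_nat n powr l * W \<omega>) + (\<Sum>z\<in>R. cmod (UL m L z n \<omega>))" for n \<omega>
  have G: "negl M s G" unfolding G_def using l(1)
    by (intro negl_add negl_const negl_sum lead negR fin) auto
  define C where "C = (\<Sum>k=1..m. \<Sum>z\<in>chi_roots m. 2 * cmod (yvec m z k))"
  have rem: "\<bar>btree_remainder m L W n \<omega> k\<bar> \<le> (\<Sum>z\<in>chi_roots m. 2 * cmod (yvec m z k)) * G n \<omega>"
    if one: "UL m L 1 n \<omega> = of_nat (n + m)" and k: "k \<in> {1..m}" for n \<omega> k
  proof -
    define b where "b = of_nat n powr l * W \<omega>"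
    define D where "D = UL m L l n \<omega> - b"
    have cc: "z + cnj z = of_real (2 * Re z)" for z :: complex by (simp add: complex_eq_iff)
    have "UL m L (cnj l) n \<omega> * yvec m (cnj l) k = cnj (UL m L l n \<omega> * yvec m l k)"
      by (simp add: UL_def cnj_U cnj_yvec)
    then have "complex_of_real (L n \<omega> k) = of_nat (n + m) * yvec m 1 k + (UL m L l n \<omega> * yvec m l k + cnj (UL m L l n \<omega> * yvec m l k)) + (\<Sum>z\<in>R. UL m L z n \<omega> * yvec m z k)"
      using spectral_decomposition[OF m2 k, of "\<lambda>k. of_real (L n \<omega> k)"] fin dist one
      unfolding roots UL_def[symmetric] by (simp add: R_def)
    also have "\<dots> = of_real (real (n + m) * P_inv m (v_vec m 1) k + 2 * Re (UL m L l n \<omega> * yvec m l k)) + (\<Sum>z\<in>R. UL m L z n \<omega> * yvec m z k)"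
      unfolding cc yvec_one by simp
    finally have eq: "complex_of_real (btree_remainder m L W n \<omega> k) =
      of_real (real m * P_inv m (v_vec m 1) k) + of_real (2 * Re (D * yvec m l k)) + (\<Sum>z\<in>R. UL m L z n \<omega> * yvec m z k)"
      unfolding btree_remainder_def l_def[symmetric] b_def[symmetric] D_def by (simp add: algebra_simps)
    have "\<bar>btree_remainder m L W n \<omega> k\<bar> = cmod (complex_of_real (btree_remainder m L W n \<omega> k))" by simp
    also have "\<dots> \<le> cmod (of_real (real m * P_inv m (v_vec m 1) k)) + cmod (of_real (2 * Re (D * yvec m l k))) + cmod (\<Sum>z\<in>R. UL m L z n \<omega> * yvec m z k)"
      unfolding eq by (rule order_trans[OF norm_triangle_ineq add_right_mono[OF norm_triangle_ineq]])
    also have "\<dots> \<le> real m * cmod (yvec m 1 k) + cmod D * (2 * cmod (yvec m l k)) + (\<Sum>z\<in>R. cmod (UL m L z n \<omega>) * cmod (yvec m z k))"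
    proof (intro add_mono)
      show "cmod (of_real (real m * P_inv m (v_vec m 1) k)) \<le> real m * cmod (yvec m 1 k)"
        unfolding yvec_one by (simp add: abs_mult norm_mult)
      show "cmod (of_real (2 * Re (D * yvec m l k))) \<le> cmod D * (2 * cmod (yvec m l k))"
        using abs_Re_le_cmod[of "D * yvec m l k"] unfolding norm_of_real norm_mult abs_mult by simp
      show "cmod (\<Sum>z\<in>R. UL m L z n \<omega> * yvec m z k) \<le> (\<Sum>z\<in>R. cmod (UL m L z n \<omega>) * cmod (yvec m z k))"
        by (rule order_trans[OF norm_sum]) (simp add: norm_mult)
    qed
    also have "\<dots> \<le> G n \<omega> * (2 * cmod (yvec m 1 k)) + G n \<omega> * (2 * cmod (yvec m l k)) + (\<Sum>z\<in>R. G n \<omega> * (2 * cmod (yvec m z k)))"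
    proof (intro add_mono sum_mono mult_mono)
      have S0: "0 \<le> (\<Sum>z\<in>R. cmod (UL m L z n \<omega>))" by (intro sum_nonneg) auto
      show "real m \<le> G n \<omega>" "cmod D \<le> G n \<omega>" "0 \<le> G n \<omega>" "0 \<le> G n \<omega>" using S0 by (auto simp: G_def D_def b_def)
      fix z assume "z \<in> R"
      then have "cmod (UL m L z n \<omega>) \<le> (\<Sum>z\<in>R. cmod (UL m L z n \<omega>))" by (intro member_le_sum fin) auto
      then show "cmod (UL m L z n \<omega>) \<le> G n \<omega>" by (simp add: G_def add_increasing)
      show "0 \<le> G n \<omega>" using S0 by (auto simp: G_def)
    qed auto
    also have "\<dots> \<le> G n \<omega> * (\<Sum>z\<in>chi_roots m. 2 * cmod (yvec m z k))"
    proof -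
      have "0 \<le> G n \<omega>" by (auto simp: G_def intro!: add_nonneg_nonneg sum_nonneg)
      moreover have "(\<Sum>z\<in>chi_roots m. 2 * cmod (yvec m z k)) = 2 * cmod (yvec m 1 k) + (2 * cmod (yvec m l k) + (2 * cmod (yvec m (cnj l) k) + (\<Sum>z\<in>R. 2 * cmod (yvec m z k))))"
        unfolding roots using fin dist by (simp add: R_def)
      ultimately show ?thesis by (simp add: distrib_left sum_distrib_left)
    qed
    finally show ?thesis by (simp add: mult.commute)
  qed
  have "negl M s (\<lambda>n \<omega>. L2_set (btree_remainder m L W n \<omega>) {1..m})"
  proof (rule negl_dom[OF G, where C=C])
    show "(\<lambda>\<omega>. L2_set (btree_remainder m L W n \<omega>) {1..m}) \<in> borel_measurable M" for n
      unfolding L2_set_def btree_remainder_def by measurable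
    show "AE \<omega> in M. \<forall>n. L2_set (btree_remainder m L W n \<omega>) {1..m} \<le> C * G n \<omega>"
      using AE_UL_one[OF m2 chain]
    proof eventually_elim
      case (elim \<omega>)
      show ?case
      proof
        fix n
        have "L2_set (btree_remainder m L W n \<omega>) {1..m} \<le> (\<Sum>k=1..m. \<bar>btree_remainder m L W n \<omega> k\<bar>)"
          by (rule L2_set_le_sum_abs)
        also have "\<dots> \<le> (\<Sum>k=1..m. (\<Sum>z\<in>chi_roots m. 2 * cmod (yvec m z k)) * G n \<omega>)"
          using elim by (intro sum_mono rem) auto
        finally show "L2_set (btree_remainder m L W n \<omega>) {1..m} \<le> C * G n \<omega>"
          by (simp add: C_def sum_distrib_right)
      qed
    qed
  qed (auto simp: L2_set_nonneg C_def intro!: sum_nonneg)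
  with W show ?thesis unfolding l_def s_def by blast
qed

section \<open>Weak convergence from characteristic functions\<close>

lemma continuous_on_coordinate: "continuous_on S (\<lambda>z :: nat \<Rightarrow> 'b::topological_space. z i)"
  by (rule continuous_on_subset[OF continuous_on_product_coordinates]) auto

context
  fixes I :: "nat set"
  assumes finI: "finite I"
begin

definition lf :: "(nat \<Rightarrow> real) \<Rightarrow> (nat \<Rightarrow> real) \<Rightarrow> real" where
  "lf t x = (\<Sum>k\<in>I. t k * x k)"

text \<open>The linear span of cosines and sines of linear forms. Integrals of its members are
  determined by the characteristic function, and \<open>tp_mult\<close> makes it an algebra, as
  Stone-Weierstrass requires.\<close>

inductive trig_poly :: "((nat \<Rightarrow> real) \<Rightarrow> real) \<Rightarrow> bool" where
  tp_cos: "trig_poly (\<lambda>x. cos (lf t x))"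
| tp_sin: "trig_poly (\<lambda>x. sin (lf t x))"
| tp_add: "trig_poly f \<Longrightarrow> trig_poly g \<Longrightarrow> trig_poly (\<lambda>x. f x + g x)"
| tp_scale: "trig_poly f \<Longrightarrow> trig_poly (\<lambda>x. c * f x)"

lemma lf_add: "lf (\<lambda>k. t k + u k) x = lf t x + lf u x"
  and lf_diff: "lf (\<lambda>k. t k - u k) x = lf t x - lf u x"
  by (simp_all add: lf_def distrib_right left_diff_distrib sum.distrib sum_subtractf)

lemma tp_mult_aux:
  assumes "trig_poly g"
  shows "trig_poly (\<lambda>x. cos (lf t x) * g x) \<and> trig_poly (\<lambda>x. sin (lf t x) * g x)"
  using assms
proof induction
  case (tp_cos u)
  have eq: "(\<lambda>x. cos (lf t x) * cos (lf u x)) = (\<lambda>x. 1/2 * cos (lf (\<lambda>k. t k - u k) x) + 1/2 * cos (lf (\<lambda>k. t k + u k) x))"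
    "(\<lambda>x. sin (lf t x) * cos (lf u x)) = (\<lambda>x. 1/2 * sin (lf (\<lambda>k. t k + u k) x) + 1/2 * sin (lf (\<lambda>k. t k - u k) x))"
    by (simp_all add: cos_times_cos sin_times_cos lf_add lf_diff add_divide_distrib)
  show ?case unfolding eq by (intro conjI trig_poly.intros)
next
  case (tp_sin u)
  have eq: "(\<lambda>x. cos (lf t x) * sin (lf u x)) = (\<lambda>x. 1/2 * sin (lf (\<lambda>k. t k + u k) x) + (-1/2) * sin (lf (\<lambda>k. t k - u k) x))"
    "(\<lambda>x. sin (lf t x) * sin (lf u x)) = (\<lambda>x. 1/2 * cos (lf (\<lambda>k. t k - u k) x) + (-1/2) * cos (lf (\<lambda>k. t k + u k) x))"
    by (simp_all add: cos_times_sin sin_times_sin lf_add lf_diff diff_divide_distrib)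
  show ?case unfolding eq by (intro conjI trig_poly.intros)
next
  case (tp_add f g)
  then show ?case by (auto simp: distrib_left intro!: trig_poly.intros)
next
  case (tp_scale f c)
  have "(\<lambda>x. a x * (c * f x)) = (\<lambda>x. c * (a x * f x))" for a by (simp add: mult_ac)
  with tp_scale show ?case by (auto intro!: trig_poly.intros)
qed

lemma tp_mult:
  assumes "trig_poly f" "trig_poly g" shows "trig_poly (\<lambda>x. f x * g x)"
  using assms
proof induction
  case (tp_add f h)
  then show ?case by (auto simp: distrib_right intro!: trig_poly.intros)
next
  case (tp_scale f c)
  then show ?case by (auto simp: mult.assoc intro!: trig_poly.intros)
qed (use tp_mult_aux in auto)

lemma tp_const: "trig_poly (\<lambda>x. c)"
  using tp_scale[OF tp_cos[of "\<lambda>_. 0"], of c] by (simp add: lf_def)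

lemma lf_measurable [measurable]: "lf t \<in> borel_measurable (Pi\<^sub>M I (\<lambda>_. borel))"
  unfolding lf_def by measurable

lemma tp_bounded_measurable:
  assumes "trig_poly f"
  shows "f \<in> borel_measurable (Pi\<^sub>M I (\<lambda>_. borel)) \<and> (\<exists>B. \<forall>x. \<bar>f x\<bar> \<le> B)"
  using assms
proof induction
  case (tp_add f g)
  then obtain A B where "\<forall>x. \<bar>f x\<bar> \<le> A" "\<forall>x. \<bar>g x\<bar> \<le> B" by auto
  then have "\<forall>x. \<bar>f x + g x\<bar> \<le> A + B" by (meson abs_triangle_ineq add_mono order_trans)
  with tp_add show ?case by auto
next
  case (tp_scale f c)
  then obtain A where "\<forall>x. \<bar>f x\<bar> \<le> A" by auto
  then have "\<forall>x. \<bar>c * f x\<bar> \<le> \<bar>c\<bar> * A" by (simp add: abs_mult mult_left_mono)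
  with tp_scale show ?case by auto
qed (auto intro!: exI[of _ 1])

lemma tp_integral_tendsto:
  assumes "trig_poly f"
    and \<mu>: "\<And>n. prob_space (\<mu> n)" "\<And>n. sets (\<mu> n) = sets (Pi\<^sub>M I (\<lambda>_. borel))"
    and N: "prob_space N" "sets N = sets (Pi\<^sub>M I (\<lambda>_. borel))"
    and char: "\<And>t. (\<lambda>n. \<integral>x. exp (\<i> * of_real (lf t x)) \<partial>\<mu> n) \<longlonglongrightarrow> (\<integral>x. exp (\<i> * of_real (lf t x)) \<partial>N)"
  shows "(\<lambda>n. \<integral>x. f x \<partial>\<mu> n) \<longlonglongrightarrow> (\<integral>x. f x \<partial>N)"
proof -
  have int: "integrable P f" if tp: "trig_poly f" and "prob_space P" and sP: "sets P = sets (Pi\<^sub>M I (\<lambda>_. borel))" for f P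
  proof -
    interpret P: prob_space P by fact
    obtain B where "\<forall>x. \<bar>f x\<bar> \<le> B" "f \<in> borel_measurable (Pi\<^sub>M I (\<lambda>_. borel))" using tp_bounded_measurable[OF tp] by auto
    then show ?thesis using measurable_cong_sets[OF sP refl, of borel] by (intro P.integrable_const_bound[of _ B]) auto
  qed
  have e: "integrable P (\<lambda>x. exp (\<i> * of_real (lf t x)))" if "prob_space P" "sets P = sets (Pi\<^sub>M I (\<lambda>_. borel))" for t P
  proof -
    interpret P: prob_space P by fact
    have [measurable]: "lf t \<in> borel_measurable P" using lf_measurable unfolding measurable_cong_sets[OF that(2) refl] .
    show ?thesis by (rule P.integrable_const_bound[of _ 1]) (simp, measurable)
  qed
  have re: "(\<integral>x. cos (lf t x) \<partial>P) = Re (\<integral>x. exp (\<i> * of_real (lf t x)) \<partial>P)" "(\<integral>x. sin (lf t x) \<partial>P) = Im (\<integral>x. exp (\<i> * of_real (lf t x)) \<partial>P)"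
    if "prob_space P" "sets P = sets (Pi\<^sub>M I (\<lambda>_. borel))" for t P
    using e[OF that, of t] by (simp_all add: integral_Re[symmetric] integral_Im[symmetric] Re_exp Im_exp)
  show ?thesis using assms(1)
  proof induction
    case (tp_cos t) show ?case unfolding re[OF \<mu>] re[OF N] by (intro tendsto_intros char)
  next
    case (tp_sin t) show ?case unfolding re[OF \<mu>] re[OF N] by (intro tendsto_intros char)
  next
    case (tp_add f g)
    then show ?case using int[OF _ \<mu>] int[OF _ N] by (simp add: tendsto_add)
  next
    case (tp_scale f c)
    then show ?case by (simp add: tendsto_mult)
  qed
qed

text \<open>Coordinates outside I are frozen at 1, so that the set is compact in the full function
  space and its points are separated by the coordinates in I.\<close>

definition torus :: "(nat \<Rightarrow> complex) set" where
  "torus = (\<Pi>\<^sub>E i\<in>UNIV. if i \<in> I then sphere 0 1 else {1})"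

definition wrap :: "real \<Rightarrow> (nat \<Rightarrow> real) \<Rightarrow> nat \<Rightarrow> complex" where
  "wrap R x i = (if i \<in> I then cis (x i / R) else 1)"

lemma wrap_in_torus: "wrap R x \<in> torus"
  by (auto simp: wrap_def torus_def PiE_iff)

lemma compact_torus: "compact torus"
proof -
  have "compactin (product_topology (\<lambda>i::nat. euclidean :: complex topology) UNIV) torus"
    unfolding torus_def compactin_PiE by auto
  then show ?thesis by (simp add: euclidean_product_topology)
qed

text \<open>The continuous functions on the torus whose pullback under \<open>wrap R\<close> is a
  trigonometric polynomial form an algebra; real and imaginary parts of the coordinates belong to it
  and separate points.\<close>

lemma trig_poly_dense:
  assumes g: "continuous_on torus g" and e: "e > 0" and R: "R > 0"
  shows "\<exists>P. trig_poly P \<and> (\<forall>x. \<bar>g (wrap R x) - P x\<bar> < e)"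
proof -
  define A where "A = {g. continuous_on torus g \<and> trig_poly (\<lambda>x. g (wrap R x))}"
  interpret function_ring_on A torus
  proof
    show "compact torus" by (rule compact_torus)
    fix z w :: "nat \<Rightarrow> complex" assume zw: "z \<in> torus" "w \<in> torus" "z \<noteq> w"
    then obtain i where i: "z i \<noteq> w i" by auto
    have iI: "i \<in> I"
    proof (rule ccontr)
      assume "i \<notin> I"
      then have "z i = 1" "w i = 1" using zw(1,2) by (auto simp: torus_def PiE_iff split: if_splits)
      with i show False by simp
    qed
    have lf_i: "lf (\<lambda>k. if k = i then 1 / R else 0) x = x i / R" for x
    proof -
      have "lf (\<lambda>k. if k = i then 1 / R else 0) x = (\<Sum>k\<in>I. if k = i then x k / R else 0)"
        unfolding lf_def by (intro sum.cong) auto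
      then show ?thesis using finI iI by simp
    qed
    have "(\<lambda>z. Re (z i)) \<in> A" "(\<lambda>z. Im (z i)) \<in> A"
      using tp_cos[of "\<lambda>k. if k = i then 1 / R else 0"] tp_sin[of "\<lambda>k. if k = i then 1 / R else 0"] iI
      by (auto simp: A_def wrap_def lf_i intro!: continuous_intros continuous_on_coordinate)
    moreover have "Re (z i) \<noteq> Re (w i) \<or> Im (z i) \<noteq> Im (w i)" using i by (auto simp: complex_eq_iff)
    ultimately show "\<exists>f\<in>A. f z \<noteq> f w" by (elim disjE) (rule bexI, assumption, assumption)+
  qed (auto simp: A_def intro!: continuous_intros tp_add tp_mult tp_const)
  obtain h where "h \<in> A" "\<forall>z\<in>torus. \<bar>g z - h z\<bar> < e" using Stone_Weierstrass_basic[OF g e] by auto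
  then show ?thesis using wrap_in_torus by (intro exI[of _ "\<lambda>x. h (wrap R x)"]) (auto simp: A_def)
qed

text \<open>Points of the finite product are undefined outside I, so \<open>f\<close> is extended by
  restriction to the full function space, where continuity implies measurability, and pulled back by
  extending points with 0.\<close>

lemma continuous_imp_measurable_PiM:
  fixes f :: "(nat \<Rightarrow> real) \<Rightarrow> real"
  assumes "continuous_map (powertop_real I) euclideanreal f"
  shows "f \<in> borel_measurable (Pi\<^sub>M I (\<lambda>_. borel))"
proof -
  have "continuous_map (euclidean :: (nat \<Rightarrow> real) topology) (powertop_real I) (\<lambda>x. restrict x I)"
    unfolding continuous_map_componentwise by (auto intro!: continuous_on_product_coordinates)
  from continuous_map_compose[OF this assms]
  have "continuous_on UNIV (\<lambda>x. f (restrict x I))" by (simp add: o_def)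
  then have F: "(\<lambda>x. f (restrict x I)) \<in> borel_measurable (Pi\<^sub>M UNIV (\<lambda>i::nat. borel))"
    using borel_measurable_continuous_onI measurable_cong_sets[OF sets_PiM_equal_borel refl] by blast
  have "(\<lambda>x i. if i \<in> I then x i else 0) \<in> Pi\<^sub>M I (\<lambda>_. borel) \<rightarrow>\<^sub>M Pi\<^sub>M UNIV (\<lambda>i::nat. borel :: real measure)"
  proof (rule measurable_PiM_single')
    show "(\<lambda>x. if i \<in> I then x i else 0) \<in> borel_measurable (Pi\<^sub>M I (\<lambda>_. borel))" for i :: nat
      by (cases "i \<in> I") auto
  qed auto
  from measurable_compose[OF this F]
  have "(\<lambda>x. f (restrict (\<lambda>i. if i \<in> I then x i else 0) I)) \<in> borel_measurable (Pi\<^sub>M I (\<lambda>_. borel))" .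
  then show ?thesis
  proof (rule measurable_cong[THEN iffD1, rotated])
    fix x assume "x \<in> space (Pi\<^sub>M I (\<lambda>_. borel :: real measure))"
    then have "restrict (\<lambda>i. if i \<in> I then x i else 0) I = x"
      by (auto simp: space_PiM PiE_def extensional_def restrict_def)
    then show "f (restrict (\<lambda>i. if i \<in> I then x i else 0) I) = f x" by simp
  qed
qed

lemma one_minus_sum_le_prod:
  fixes c :: "nat \<Rightarrow> real"
  assumes "finite A" "\<And>k. k \<in> A \<Longrightarrow> 0 \<le> c k \<and> c k \<le> 1"
  shows "1 - (\<Sum>k\<in>A. 1 - c k) \<le> (\<Prod>k\<in>A. c k)"
  using assms
proof (induction A rule: finite_induct)
  case (insert a A)
  have p: "(\<Prod>k\<in>A. c k) \<le> 1" using insert by (intro prod_le_1) auto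
  have "(1 - c a) * (\<Prod>k\<in>A. c k) \<le> (1 - c a) * 1" using insert p by (intro mult_left_mono) auto
  then have "(\<Prod>k\<in>A. c k) - (1 - c a) \<le> c a * (\<Prod>k\<in>A. c k)" by (simp add: algebra_simps)
  moreover have "1 - (\<Sum>k\<in>A. 1 - c k) \<le> (\<Prod>k\<in>A. c k)" using insert by auto
  ultimately have "1 - (\<Sum>k\<in>A. 1 - c k) - (1 - c a) \<le> c a * (\<Prod>k\<in>A. c k)" by linarith
  with insert(1,2) show ?case by simp
qed simp

lemma one_minus_cos_le: "1 - cos (y::real) \<le> y\<^sup>2 / 2"
proof -
  have "1 - cos y = 2 * (sin (y/2))\<^sup>2" using cos_double_sin[of "y/2"] by simp
  also have "(sin (y/2))\<^sup>2 \<le> (y/2)\<^sup>2" using abs_sin_x_le_abs_x[of "y/2"] by (simp only: abs_le_square_iff)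
  finally show ?thesis by (simp add: power_divide)
qed

text \<open>The function below agrees with \<open>f\<close> up to the factor \<open>\<Prod> cos (x k / R)\<close> on the box
  \<open>\<bar>x k\<bar> \<le> \<pi> R / 2\<close> and factors through the torus, hence is a uniform limit of trigonometric
  polynomials; being bounded everywhere, it differs from \<open>f\<close> by at most a multiple of
  \<open>\<Sum> (x k / R)\<^sup>2\<close>.\<close>

lemma trig_poly_approx:
  assumes f: "continuous_map (powertop_real I) euclideanreal f"
    and B: "\<And>x. x \<in> (\<Pi>\<^sub>E i\<in>I. UNIV) \<Longrightarrow> \<bar>f x\<bar> \<le> B" and e: "e > 0" and R: "R > 0"
  shows "\<exists>P. trig_poly P \<and> (\<forall>x\<in>(\<Pi>\<^sub>E i\<in>I. UNIV). \<bar>f x - P x\<bar> \<le> e + 2 * B * (\<Sum>k\<in>I. (x k)\<^sup>2) / R\<^sup>2)"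
proof -
  \<comment> \<open>On the half circle with nonnegative real part the arcsine of the imaginary part
    recovers the angle, so \<open>a\<close> inverts \<open>wrap R\<close> on the box.\<close>
  define a where "a z = (\<lambda>i\<in>I. R * arcsin (Im (z i)))" for z :: "nat \<Rightarrow> complex"
  define g where "g z = f (a z) * (\<Prod>i\<in>I. max 0 (Re (z i)))" for z
  have im: "-1 \<le> Im (z i) \<and> Im (z i) \<le> 1" if "z \<in> torus" "i \<in> I" for z i
  proof -
    have "cmod (z i) = 1" using that by (auto simp: torus_def PiE_iff split: if_splits)
    then show ?thesis using abs_Im_le_cmod[of "z i"] by auto
  qed
  have ca: "continuous_map (top_of_set torus) (powertop_real I) a"
    unfolding continuous_map_componentwise
  proof (intro conjI ballI)
    show "a ` topspace (top_of_set torus) \<subseteq> extensional I" by (auto simp: a_def)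
    fix i assume i: "i \<in> I"
    have "continuous_on torus (\<lambda>z. R * arcsin (Im (z i)))"
      by (intro continuous_intros continuous_on_coordinate ballI im i)
    then show "continuous_map (top_of_set torus) euclideanreal (\<lambda>x. a x i)" using i by (simp add: a_def)
  qed
  have "continuous_on torus (\<lambda>z. f (a z))"
    using continuous_map_compose[OF ca f] by (simp add: o_def)
  then have "continuous_on torus g"
    unfolding g_def by (intro continuous_intros continuous_on_coordinate)
  then obtain P where P: "trig_poly P" "\<And>x. \<bar>g (wrap R x) - P x\<bar> < e" using trig_poly_dense[OF _ e R] by blast
  have "\<bar>f x - g (wrap R x)\<bar> \<le> 2 * B * (\<Sum>k\<in>I. (x k)\<^sup>2) / R\<^sup>2" if x: "x \<in> (\<Pi>\<^sub>E i\<in>I. UNIV)" for x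
  proof -
    have B0: "B \<ge> 0" using B[OF x] by simp
    have sumR: "(\<Sum>k\<in>I. (x k)\<^sup>2) / R\<^sup>2 = (\<Sum>k\<in>I. (x k / R)\<^sup>2)" by (simp add: sum_divide_distrib power_divide)
    have gw: "g (wrap R x) = f (\<lambda>i\<in>I. R * arcsin (sin (x i / R))) * (\<Prod>i\<in>I. max 0 (cos (x i / R)))"
      unfolding g_def a_def by (intro arg_cong2[of _ _ _ _ "(*)"] arg_cong[of _ _ f] prod.cong) (auto simp: wrap_def restrict_def)
    have p01: "0 \<le> (\<Prod>i\<in>I. max 0 (cos (x i / R)))" "(\<Prod>i\<in>I. max 0 (cos (x i / R))) \<le> 1"
      by (auto intro!: prod_nonneg prod_le_1)
    show ?thesis
    proof (cases "\<forall>k\<in>I. \<bar>x k / R\<bar> \<le> pi / 2")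
      case True
      have "(\<lambda>i\<in>I. R * arcsin (sin (x i / R))) = x"
      proof
        fix i show "(\<lambda>i\<in>I. R * arcsin (sin (x i / R))) i = x i"
        proof (cases "i \<in> I")
          case i: True
          then have "\<bar>x i / R\<bar> \<le> pi / 2" using True by blast
          then have "- (pi/2) \<le> x i / R" "x i / R \<le> pi/2" by linarith+
          then have "arcsin (sin (x i / R)) = x i / R" by (rule arcsin_sin)
          then show ?thesis using i R by simp
        qed (use x in \<open>auto simp: PiE_def extensional_def\<close>)
      qed
      moreover have cm: "max 0 (cos (x i / R)) = cos (x i / R)" if "i \<in> I" for i
      proof -
        have "\<bar>x i / R\<bar> \<le> pi / 2" using True that by blast
        then have "- (pi/2) \<le> x i / R" "x i / R \<le> pi/2" by linarith+
        then show ?thesis by (intro max_absorb2 cos_ge_zero)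
      qed
      ultimately have "f x - g (wrap R x) = f x * (1 - (\<Prod>i\<in>I. max 0 (cos (x i / R))))" unfolding gw by (simp add: algebra_simps)
      then have "\<bar>f x - g (wrap R x)\<bar> = \<bar>f x\<bar> * (1 - (\<Prod>i\<in>I. max 0 (cos (x i / R))))" using p01 by (simp add: abs_mult)
      also have "\<dots> \<le> B * (\<Sum>i\<in>I. 1 - max 0 (cos (x i / R)))"
        using one_minus_sum_le_prod[OF finI, of "\<lambda>i. max 0 (cos (x i / R))"] B[OF x] p01 B0 by (intro mult_mono) auto
      also have "\<dots> \<le> B * (\<Sum>i\<in>I. 2 * (x i / R)\<^sup>2)"
      proof (intro mult_left_mono sum_mono)
        fix i assume i: "i \<in> I"
        have "1 - cos (x i / R) \<le> (x i / R)\<^sup>2 / 2" by (rule one_minus_cos_le)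
        also have "\<dots> \<le> 2 * (x i / R)\<^sup>2" by simp
        finally show "1 - max 0 (cos (x i / R)) \<le> 2 * (x i / R)\<^sup>2" unfolding cm[OF i] .
      qed (use B0 in auto)
      also have "\<dots> = 2 * B * ((\<Sum>k\<in>I. (x k)\<^sup>2) / R\<^sup>2)" unfolding sumR by (simp add: sum_distrib_left mult_ac)
      finally show ?thesis by simp
    next
      case False
      then obtain k where k: "k \<in> I" "\<bar>x k / R\<bar> > pi / 2" by auto
      \<comment> \<open>Outside the box the quadratic sum is at least 1, and the trivial bound 2 B
        is absorbed into it.\<close>
      then have "\<bar>x k / R\<bar> \<ge> 1" using pi_gt3 by linarith
      then have "1 \<le> (x k / R)\<^sup>2" using one_le_power[of "\<bar>x k / R\<bar>" 2] by (simp only: power2_abs)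
      also have "\<dots> \<le> (\<Sum>k\<in>I. (x k / R)\<^sup>2)" using k finI by (intro member_le_sum) auto
      finally have s1: "1 \<le> (\<Sum>k\<in>I. (x k)\<^sup>2) / R\<^sup>2" unfolding sumR .
      have "\<bar>g (wrap R x)\<bar> \<le> B * 1" unfolding gw abs_mult using p01 B0 by (intro mult_mono B) auto
      then have "\<bar>f x - g (wrap R x)\<bar> \<le> 2 * B * 1" using B[OF x] by linarith
      also have "\<dots> \<le> 2 * B * ((\<Sum>k\<in>I. (x k)\<^sup>2) / R\<^sup>2)" using s1 B0 by (intro mult_left_mono) auto
      finally show ?thesis by simp
    qed
  qed
  then have "\<bar>f x - P x\<bar> \<le> e + 2 * B * (\<Sum>k\<in>I. (x k)\<^sup>2) / R\<^sup>2" if "x \<in> (\<Pi>\<^sub>E i\<in>I. UNIV)" for x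
    using P(2)[of x] that by fastforce
  with P(1) show ?thesis by blast
qed

text \<open>Uniform second moments play the role of tightness: the quadratic error of the
  trigonometric approximation integrates to a constant over R^2, uniformly in n, and R is chosen
  before n.\<close>

lemma weak_conv_of_characters:
  assumes \<mu>: "\<And>n. prob_space (\<mu> n)" "\<And>n. sets (\<mu> n) = sets (Pi\<^sub>M I (\<lambda>_. borel))"
    and N: "prob_space N" "sets N = sets (Pi\<^sub>M I (\<lambda>_. borel))"
    and char: "\<And>t. (\<lambda>n. \<integral>x. exp (\<i> * of_real (lf t x)) \<partial>\<mu> n) \<longlonglongrightarrow> (\<integral>x. exp (\<i> * of_real (lf t x)) \<partial>N)"
    and m2\<mu>: "\<And>n k. n \<ge> 1 \<Longrightarrow> k \<in> I \<Longrightarrow> integrable (\<mu> n) (\<lambda>x. (x k)\<^sup>2) \<and> (\<integral>x. (x k)\<^sup>2 \<partial>\<mu> n) \<le> C"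
    and m2N: "\<And>k. k \<in> I \<Longrightarrow> integrable N (\<lambda>x. (x k)\<^sup>2) \<and> (\<integral>x. (x k)\<^sup>2 \<partial>N) \<le> C"
  shows "weak_conv_vec I \<mu> N"
  unfolding weak_conv_vec_def
proof (intro allI impI, elim conjE)
  fix f assume f: "continuous_map (powertop_real I) euclideanreal f" and bnd: "bounded (f ` topspace (powertop_real I))"
  obtain B where B: "B \<ge> 1" "\<And>x. x \<in> (\<Pi>\<^sub>E i\<in>I. UNIV) \<Longrightarrow> \<bar>f x\<bar> \<le> B"
  proof -
    obtain B where "\<And>x. x \<in> (\<Pi>\<^sub>E i\<in>I. UNIV) \<Longrightarrow> \<bar>f x\<bar> \<le> B"
      using bnd unfolding bounded_iff by auto
    then show ?thesis by (intro that[of "max B 1"]) (auto simp: le_max_iff_disj)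
  qed
  define D where "D = 2 * B * (1 + real (card I) * \<bar>C\<bar>)"
  have D: "D > 0" using B by (auto simp: D_def intro!: mult_pos_pos add_pos_nonneg)
  have fm: "f \<in> borel_measurable (Pi\<^sub>M I (\<lambda>_. borel))" by (rule continuous_imp_measurable_PiM[OF f])
  have key: "\<bar>(\<integral>x. f x \<partial>Q) - (\<integral>x. P x \<partial>Q)\<bar> \<le> e + D / R\<^sup>2"
    if P: "trig_poly P" "\<forall>x\<in>(\<Pi>\<^sub>E i\<in>I. UNIV). \<bar>f x - P x\<bar> \<le> e + 2 * B * (\<Sum>k\<in>I. (x k)\<^sup>2) / R\<^sup>2"
      and Q: "prob_space Q" "sets Q = sets (Pi\<^sub>M I (\<lambda>_. borel))"
      and m2: "\<And>k. k \<in> I \<Longrightarrow> integrable Q (\<lambda>x. (x k)\<^sup>2) \<and> (\<integral>x. (x k)\<^sup>2 \<partial>Q) \<le> C" and R: "R > 0" for P e R Q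
  proof -
    interpret Q: prob_space Q by fact
    have sp: "space Q = (\<Pi>\<^sub>E i\<in>I. UNIV)" using sets_eq_imp_space_eq[OF Q(2)] by (simp add: space_PiM)
    have [measurable]: "f \<in> borel_measurable Q" "P \<in> borel_measurable Q"
      using fm tp_bounded_measurable[OF P(1)] measurable_cong_sets[OF Q(2) refl, of borel] by auto
    obtain B' where B': "\<And>x. \<bar>P x\<bar> \<le> B'" using tp_bounded_measurable[OF P(1)] by auto
    have i: "integrable Q f" "integrable Q P"
      using B(2) sp by (auto intro!: Q.integrable_const_bound[of f B] Q.integrable_const_bound[of P B'] simp: B')
    have i2: "integrable Q (\<lambda>x. e + 2 * B * (\<Sum>k\<in>I. (x k)\<^sup>2) / R\<^sup>2)"
      using m2 by (intro Bochner_Integration.integrable_add integrable_divide integrable_mult_right Bochner_Integration.integrable_sum) auto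
    have "\<bar>(\<integral>x. f x \<partial>Q) - (\<integral>x. P x \<partial>Q)\<bar> = \<bar>\<integral>x. f x - P x \<partial>Q\<bar>" using i by simp
    also have "\<dots> \<le> (\<integral>x. \<bar>f x - P x\<bar> \<partial>Q)" using integral_abs_bound by blast
    also have "\<dots> \<le> (\<integral>x. e + 2 * B * (\<Sum>k\<in>I. (x k)\<^sup>2) / R\<^sup>2 \<partial>Q)"
      using i i2 P(2) sp by (intro integral_mono integrable_abs Bochner_Integration.integrable_diff) auto
    also have "\<dots> = e + 2 * B * (\<Sum>k\<in>I. \<integral>x. (x k)\<^sup>2 \<partial>Q) / R\<^sup>2"
      using m2 by (simp add: Q.prob_space)
    also have "\<dots> \<le> e + D / R\<^sup>2"
    proof -
      have "(\<Sum>k\<in>I. \<integral>x. (x k)\<^sup>2 \<partial>Q) \<le> (\<Sum>k\<in>I. \<bar>C\<bar>)" using m2 by (intro sum_mono) (meson abs_ge_self order_trans)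
      also have "\<dots> \<le> 1 + real (card I) * \<bar>C\<bar>" by simp
      finally show ?thesis unfolding D_def using B by (intro add_left_mono divide_right_mono mult_left_mono) auto
    qed
    finally show ?thesis .
  qed
  show "(\<lambda>n. \<integral>x. f x \<partial>\<mu> n) \<longlonglongrightarrow> (\<integral>x. f x \<partial>N)"
  proof (rule LIMSEQ_I)
    fix \<epsilon> :: real assume \<epsilon>: "\<epsilon> > 0"
    \<comment> \<open>Two approximations, each costing at most \<open>e + D / R^2\<close>, that is a
      quarter of \<epsilon>, leave one half for the trigonometric polynomial.\<close>
    define e where "e = \<epsilon> / 8"
    define R where "R = sqrt (8 * D / \<epsilon>)"
    have R: "R > 0" "D / R\<^sup>2 = \<epsilon> / 8" and e: "e > 0" using D \<epsilon> by (auto simp: R_def e_def)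
    obtain P where P: "trig_poly P" "\<forall>x\<in>(\<Pi>\<^sub>E i\<in>I. UNIV). \<bar>f x - P x\<bar> \<le> e + 2 * B * (\<Sum>k\<in>I. (x k)\<^sup>2) / R\<^sup>2"
      using trig_poly_approx[OF f B(2) e R(1)] by blast
    have "(\<lambda>n. \<integral>x. P x \<partial>\<mu> n) \<longlonglongrightarrow> (\<integral>x. P x \<partial>N)" by (rule tp_integral_tendsto[OF P(1) \<mu> N char])
    from LIMSEQ_D[OF this half_gt_zero[OF \<epsilon>]]
    obtain n0 where n0: "\<And>n. n \<ge> n0 \<Longrightarrow> \<bar>(\<integral>x. P x \<partial>\<mu> n) - (\<integral>x. P x \<partial>N)\<bar> < \<epsilon> / 2" by auto
    show "\<exists>n0. \<forall>n\<ge>n0. norm ((\<integral>x. f x \<partial>\<mu> n) - (\<integral>x. f x \<partial>N)) < \<epsilon>"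
    proof (intro exI[of _ "max n0 1"] allI impI)
      fix n assume n: "n \<ge> max n0 1"
      have "\<bar>(\<integral>x. f x \<partial>\<mu> n) - (\<integral>x. P x \<partial>\<mu> n)\<bar> \<le> e + D / R\<^sup>2"
        by (rule key[OF P \<mu> m2\<mu> R(1)]) (use n in auto)
      moreover have "\<bar>(\<integral>x. f x \<partial>N) - (\<integral>x. P x \<partial>N)\<bar> \<le> e + D / R\<^sup>2"
        by (rule key[OF P N m2N R(1)])
      ultimately show "norm ((\<integral>x. f x \<partial>\<mu> n) - (\<integral>x. f x \<partial>N)) < \<epsilon>"
        using n0[of n] n R(2) e_def unfolding real_norm_def by linarith
    qed
  qed
qed

end

section \<open>Gaussian vectors\<close>

text \<open>Cholesky factorization by induction: subtracting the rank one matrix of the scaled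
  column p leaves a positive semidefinite matrix on the remaining indices. Singular matrices are
  allowed, and a zero pivot forces its whole row to vanish.\<close>

lemma psd_factorization:
  fixes V :: "'i \<Rightarrow> 'i \<Rightarrow> real"
  assumes "finite I" "\<And>i k. i \<in> I \<Longrightarrow> k \<in> I \<Longrightarrow> V i k = V k i"
    and "\<And>t. 0 \<le> (\<Sum>i\<in>I. \<Sum>k\<in>I. t i * t k * V i k)"
  shows "\<exists>(d::nat) a. \<forall>i\<in>I. \<forall>k\<in>I. V i k = (\<Sum>j<d. a j i * a j k)"
  using assms
proof (induction I arbitrary: V rule: finite_induct)
  case (insert p I)
  have pI: "p \<notin> I" "finite I" using insert by auto
  have sym: "V i k = V k i" if "i \<in> insert p I" "k \<in> insert p I" for i k using insert that by blast
  have exp: "(\<Sum>i\<in>insert p I. \<Sum>k\<in>insert p I. t i * t k * W i k) =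
     (t p)\<^sup>2 * W p p + t p * (\<Sum>k\<in>I. t k * W p k) + t p * (\<Sum>k\<in>I. t k * W k p) + (\<Sum>i\<in>I. \<Sum>k\<in>I. t i * t k * W i k)" for t and W :: "'i \<Rightarrow> 'i \<Rightarrow> real"
    using pI by (simp add: sum.distrib sum_distrib_left power2_eq_square mult_ac)
  have expV: "0 \<le> (t p)\<^sup>2 * V p p + 2 * t p * (\<Sum>k\<in>I. t k * V p k) + (\<Sum>i\<in>I. \<Sum>k\<in>I. t i * t k * V i k)" for t
  proof -
    have "(\<Sum>k\<in>I. t k * V k p) = (\<Sum>k\<in>I. t k * V p k)" using sym by (intro sum.cong) auto
    then show ?thesis using insert.prems(2)[of t] unfolding exp by (simp add: algebra_simps)
  qed
  have pp: "V p p \<ge> 0"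
  proof -
    have "(\<Sum>k\<in>I. (if k = p then 1 else 0) * V p k) = 0" "(\<Sum>i\<in>I. \<Sum>k\<in>I. (if i = p then 1 else 0) * (if k = p then 1 else 0) * V i k) = 0"
      using pI by (auto intro!: sum.neutral)
    then show ?thesis using expV[of "\<lambda>k. if k = p then 1 else 0"] by simp
  qed
  define b where "b k = (if V p p = 0 then 0 else V p k / sqrt (V p p))" for k
  have bV: "b p * b k = V p k" if k: "k \<in> insert p I" for k
  proof (cases "V p p = 0")
    case False
    with pp have "V p p > 0" by simp
    then show ?thesis by (simp add: b_def real_sqrt_mult_self field_simps flip: power2_eq_square)
  next
    case True
    show ?thesis
    proof (cases "k = p")
      case kp: False
      then have kI: "k \<in> I" using k by simp
      have "V p k = 0"
      proof (rule ccontr)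
        assume nz: "V p k \<noteq> 0"
        \<comment> \<open>With the pivot equal to 0 the quadratic form is affine in the weight of p;
          this weight gives it the value -1.\<close>
        define c where "c = - (V k k + 1) / (2 * V p k)"
        define t where "t i = (if i = p then c else if i = k then 1 else 0)" for i
        have tI: "t i = (if i = k then 1 else 0)" if "i \<in> I" for i using that pI kp by (auto simp: t_def)
        have s1: "(\<Sum>i\<in>I. t i * V p i) = V p k"
        proof -
          have "(\<Sum>i\<in>I. t i * V p i) = (\<Sum>i\<in>I. if i = k then V p i else 0)" by (intro sum.cong) (auto simp: tI)
          then show ?thesis using pI kI by simp
        qed
        have s2: "(\<Sum>i\<in>I. \<Sum>j\<in>I. t i * t j * V i j) = V k k"
        proof -
          have "(\<Sum>i\<in>I. \<Sum>j\<in>I. t i * t j * V i j) = (\<Sum>i\<in>I. if i = k then (\<Sum>j\<in>I. if j = k then V i j else 0) else 0)"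
            by (intro sum.cong refl) (auto simp: tI intro!: sum.cong)
          then show ?thesis using pI kI by simp
        qed
        have "2 * c * V p k + V k k = -1" using nz by (simp add: c_def field_simps)
        moreover have "t p = c" by (simp add: t_def)
        ultimately show False using expV[of t] True unfolding s1 s2 by simp
      qed
      then show ?thesis using True by (simp add: b_def)
    qed (use True in \<open>simp add: b_def\<close>)
  qed
  define W where "W i k = V i k - b i * b k" for i k
  have "0 \<le> (\<Sum>i\<in>I. \<Sum>k\<in>I. t i * t k * W i k)" for t
  proof -
    define B where "B = (\<Sum>k\<in>I. t k * b k)"
    \<comment> \<open>The weight of p that annihilates the completed square, so that only the
      reduced form remains.\<close>
    define c where "c = (if b p = 0 then 0 else - B / b p)"
    define u where "u i = (if i = p then c else t i)" for i
    have uI: "u i = t i" if "i \<in> I" for i using that pI by (auto simp: u_def)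
    have 1: "(\<Sum>k\<in>I. u k * V p k) = b p * B"
      unfolding B_def sum_distrib_left using bV by (intro sum.cong) (auto simp: uI mult_ac)
    have 2: "(\<Sum>i\<in>I. \<Sum>k\<in>I. u i * u k * V i k) = (\<Sum>i\<in>I. \<Sum>k\<in>I. t i * t k * W i k) + B\<^sup>2"
    proof -
      have "B\<^sup>2 = (\<Sum>i\<in>I. \<Sum>k\<in>I. t i * t k * (b i * b k))"
        unfolding B_def power2_eq_square sum_product by (simp add: mult_ac)
      then show ?thesis unfolding W_def by (simp add: uI right_diff_distrib sum_subtractf cong: sum.cong)
    qed
    have "0 \<le> c\<^sup>2 * (b p * b p) + 2 * c * (b p * B) + (\<Sum>i\<in>I. \<Sum>k\<in>I. t i * t k * W i k) + B\<^sup>2"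
      using expV[of u] bV[of p] unfolding 1 2 by (simp add: u_def)
    also have "\<dots> = (c * b p + B)\<^sup>2 + (\<Sum>i\<in>I. \<Sum>k\<in>I. t i * t k * W i k)"
      by (simp add: power2_eq_square algebra_simps)
    finally have *: "0 \<le> (c * b p + B)\<^sup>2 + (\<Sum>i\<in>I. \<Sum>k\<in>I. t i * t k * W i k)" .
    have "c * b p + B = 0"
    proof (cases "b p = 0")
      case True
      then have "V p p = 0" using bV[of p] by simp
      then have "B = 0" by (simp add: B_def b_def)
      with True show ?thesis by simp
    qed (simp add: c_def)
    with * show ?thesis by simp
  qed
  moreover have "W i k = W k i" if "i \<in> I" "k \<in> I" for i k using sym that by (simp add: W_def mult.commute)
  ultimately obtain d :: nat and a where a: "\<forall>i\<in>I. \<forall>k\<in>I. W i k = (\<Sum>j<d. a j i * a j k)"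
    using insert.IH[of W] by blast
  define a' where "a' j i = (if j = d then b i else if i = p then 0 else a j i)" for j i
  have "V i k = (\<Sum>j<Suc d. a' j i * a' j k)" if ik: "i \<in> insert p I" "k \<in> insert p I" for i k
  proof -
    have "(\<Sum>j<d. a' j i * a' j k) = (if i = p \<or> k = p then 0 else \<Sum>j<d. a j i * a j k)"
      by (auto simp: a'_def)
    moreover have "(\<Sum>j<d. a j i * a j k) = V i k - b i * b k" if "i \<noteq> p" "k \<noteq> p"
      using a ik that by (auto simp: W_def)
    moreover have "b i * b k = V i k" if "i = p \<or> k = p"
      using that bV[OF ik(1)] bV[OF ik(2)] sym ik by (auto simp: mult.commute)
    ultimately show ?thesis by (auto simp: a'_def)
  qed
  then show ?case by blast
qed auto

lemma char_normal_density:
  assumes "s > 0"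
  shows "char (density lborel (\<lambda>x. ennreal (normal_density 0 s x))) u = of_real (exp (- (s * u)\<^sup>2 / 2))"
proof -
  interpret prob_space std_normal_distribution by (rule prob_space_normal_density) simp
  have "distributed std_normal_distribution lborel (\<lambda>x. x) std_normal_density"
    unfolding distributed_def by (auto simp: distr_id2)
  from normal_density_affine[OF this, of s 0] assms
  have "distributed std_normal_distribution lborel (\<lambda>x. s * x) (normal_density 0 s)" by simp
  then have "distr std_normal_distribution lborel (\<lambda>x. s * x) = density lborel (\<lambda>x. ennreal (normal_density 0 s x))"
    by (simp add: distributed_def)
  then have "char (density lborel (\<lambda>x. ennreal (normal_density 0 s x))) u = (\<integral>x. iexp (u * x) \<partial>distr std_normal_distribution lborel (\<lambda>x. s * x))"
    by (simp add: char_def)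
  also have "\<dots> = (\<integral>x. iexp (u * (s * x)) \<partial>std_normal_distribution)"
    by (subst integral_distr) auto
  also have "\<dots> = char std_normal_distribution (s * u)"
    unfolding char_def by (simp add: mult_ac)
  also have "\<dots> = of_real (exp (- (s * u)\<^sup>2 / 2))" by (simp add: char_std_normal_distribution)
  finally show ?thesis .
qed

text \<open>The image of independent standard normal variables under the factor of V. Independence
  gives the characteristic function, and one-dimensional uniqueness identifies the law of each
  linear form, with a Dirac mass when its variance is 0.\<close>

lemma gaussian_exists:
  fixes V :: "nat \<Rightarrow> nat \<Rightarrow> real"
  assumes I: "finite I" and sym: "\<And>i k. i \<in> I \<Longrightarrow> k \<in> I \<Longrightarrow> V i k = V k i"
    and psd: "\<And>t. 0 \<le> (\<Sum>i\<in>I. \<Sum>k\<in>I. t i * t k * V i k)"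
  shows "\<exists>N. centered_gaussian I N \<and> (\<forall>k\<in>I. integrable N (\<lambda>x. (x k)\<^sup>2)) \<and>
    (\<forall>t. (\<integral>x. exp (\<i> * of_real (\<Sum>k\<in>I. t k * x k)) \<partial>N) = of_real (exp (- (\<Sum>i\<in>I. \<Sum>k\<in>I. t i * t k * V i k) / 2)))"
proof -
  obtain d :: nat and a where a: "\<And>i k. i \<in> I \<Longrightarrow> k \<in> I \<Longrightarrow> V i k = (\<Sum>j<d. a j i * a j k)"
    using psd_factorization[OF I sym psd] by blast
  define G where "G = Pi\<^sub>M {..<d} (\<lambda>_. std_normal_distribution)"
  interpret std: prob_space std_normal_distribution by (rule prob_space_normal_density) simp
  interpret P: product_prob_space "\<lambda>_. std_normal_distribution" "{..<d}" ..
  have Gp: "prob_space G" unfolding G_def by (rule prob_space_PiM) (rule prob_space_normal_density, simp)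
  interpret G: prob_space G by (rule Gp)
  have Gm [measurable]: "(\<lambda>g. g j) \<in> borel_measurable G" if "j < d" for j
    unfolding G_def using that measurable_component_singleton[of j "{..<d}" "\<lambda>_. std_normal_distribution"] by simp
  define T where "T g = (\<lambda>i\<in>I. \<Sum>j<d. a j i * g j)" for g :: "nat \<Rightarrow> real"
  have Tm [measurable]: "T \<in> G \<rightarrow>\<^sub>M Pi\<^sub>M I (\<lambda>_. borel)"
    unfolding T_def by (intro measurable_restrict borel_measurable_sum) auto
  define N where "N = distr G (Pi\<^sub>M I (\<lambda>_. borel)) T"
  have Np: "prob_space N" unfolding N_def by (rule G.prob_space_distr) simp
  interpret N: prob_space N by (rule Np)
  have Ns [measurable_cong]: "sets N = sets (Pi\<^sub>M I (\<lambda>_. borel))" by (simp add: N_def)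
  have lfm [measurable]: "(\<lambda>x. \<Sum>k\<in>I. t k * x k) \<in> borel_measurable (Pi\<^sub>M I (\<lambda>_. borel))" for t :: "nat \<Rightarrow> real" by measurable
  define Q where "Q t = (\<Sum>i\<in>I. \<Sum>k\<in>I. t i * t k * V i k)" for t
  have char: "(\<integral>x. exp (\<i> * of_real (\<Sum>k\<in>I. t k * x k)) \<partial>N) = of_real (exp (- Q t / 2))" for t
  proof -
    define b where "b j = (\<Sum>k\<in>I. t k * a j k)" for j
    have Tb: "(\<Sum>k\<in>I. t k * T g k) = (\<Sum>j<d. b j * g j)" for g
      unfolding T_def b_def sum_distrib_right
      by (subst sum.swap) (auto simp: sum_distrib_left mult_ac intro!: sum.cong)
    have "(\<integral>x. exp (\<i> * of_real (\<Sum>k\<in>I. t k * x k)) \<partial>N) = (\<integral>g. exp (\<i> * of_real (\<Sum>k\<in>I. t k * T g k)) \<partial>G)"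
      unfolding N_def by (rule integral_distr[OF Tm]) measurable
    also have "\<dots> = (\<integral>g. (\<Prod>j<d. iexp (b j * g j)) \<partial>G)"
      unfolding Tb by (simp add: exp_sum sum_distrib_left)
    also have "\<dots> = (\<Prod>j<d. \<integral>x. iexp (b j * x) \<partial>std_normal_distribution)"
      unfolding G_def
    proof (rule P.product_integral_prod)
      show "integrable std_normal_distribution (\<lambda>x. iexp (b j * x))" for j
        by (rule std.integrable_const_bound[of _ 1]) auto
    qed simp
    also have "\<dots> = (\<Prod>j<d. of_real (exp (- (b j)\<^sup>2 / 2)))"
      using char_std_normal_distribution unfolding char_def by (auto simp: fun_eq_iff intro!: prod.cong)
    also have "\<dots> = of_real (exp (- (\<Sum>j<d. (b j)\<^sup>2) / 2))"
      by (simp add: exp_sum[symmetric] sum_negf sum_divide_distrib flip: of_real_prod)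
    also have "(\<Sum>j<d. (b j)\<^sup>2) = Q t"
    proof -
      have "Q t = (\<Sum>i\<in>I. \<Sum>k\<in>I. \<Sum>j<d. (t i * a j i) * (t k * a j k))"
        unfolding Q_def by (intro sum.cong refl) (simp add: a sum_distrib_left mult_ac)
      also have "\<dots> = (\<Sum>i\<in>I. \<Sum>j<d. \<Sum>k\<in>I. (t i * a j i) * (t k * a j k))"
        by (intro sum.cong refl sum.swap)
      also have "\<dots> = (\<Sum>j<d. \<Sum>i\<in>I. \<Sum>k\<in>I. (t i * a j i) * (t k * a j k))" by (rule sum.swap)
      also have "\<dots> = (\<Sum>j<d. (b j)\<^sup>2)" unfolding b_def power2_eq_square sum_product ..
      finally show ?thesis by simp
    qed
    finally show ?thesis .
  qed
  have law: "distr N borel (\<lambda>x. \<Sum>k\<in>I. t k * x k) = (if sqrt (Q t) = 0 then return borel 0 else density lborel (\<lambda>x. ennreal (normal_density 0 (sqrt (Q t)) x)))" for t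
  proof (rule Levy_uniqueness)
    have Q0: "Q t \<ge> 0" using psd by (simp add: Q_def)
    have mN: "(\<lambda>x. \<Sum>k\<in>I. t k * x k) \<in> borel_measurable N"
      by (simp only: measurable_cong_sets[OF Ns refl] lfm)
    show "real_distribution (distr N borel (\<lambda>x. \<Sum>k\<in>I. t k * x k))"
      by (rule N.real_distribution_distr[OF mN])
    show "real_distribution (if sqrt (Q t) = 0 then return borel 0 else density lborel (\<lambda>x. ennreal (normal_density 0 (sqrt (Q t)) x)))"
      using Q0 by (auto simp: real_distribution_def real_distribution_axioms_def intro!: prob_space_return prob_space_normal_density)
    show "char (distr N borel (\<lambda>x. \<Sum>k\<in>I. t k * x k)) = char (if sqrt (Q t) = 0 then return borel 0 else density lborel (\<lambda>x. ennreal (normal_density 0 (sqrt (Q t)) x)))"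
    proof
      fix u
      have "char (distr N borel (\<lambda>x. \<Sum>k\<in>I. t k * x k)) u = (\<integral>x. exp (\<i> * of_real (\<Sum>k\<in>I. (u * t k) * x k)) \<partial>N)"
        unfolding char_def by (subst integral_distr[OF mN]) (simp_all add: sum_distrib_left mult.assoc)
      also have "\<dots> = of_real (exp (- (u\<^sup>2 * Q t) / 2))"
        unfolding char Q_def by (simp add: sum_distrib_left power2_eq_square mult_ac)
      also have "\<dots> = char (if sqrt (Q t) = 0 then return borel 0 else density lborel (\<lambda>x. ennreal (normal_density 0 (sqrt (Q t)) x))) u"
      proof (cases "Q t = 0")
        case True
        then show ?thesis by (simp add: char_def integral_return)
      next
        case False
        then have "Q t > 0" using Q0 by simp
        then show ?thesis by (simp add: char_normal_density power_mult_distrib mult.commute)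
      qed
      finally show "char (distr N borel (\<lambda>x. \<Sum>k\<in>I. t k * x k)) u = char (if sqrt (Q t) = 0 then return borel 0 else density lborel (\<lambda>x. ennreal (normal_density 0 (sqrt (Q t)) x))) u" .
    qed
  qed
  have "centered_gaussian I N"
    unfolding centered_gaussian_def
  proof (intro conjI allI)
    fix t
    show "\<exists>s\<ge>0. distr N borel (\<lambda>x. \<Sum>i\<in>I. t i * x i) = (if s = 0 then return borel 0 else density lborel (\<lambda>x. ennreal (normal_density 0 s x)))"
      using law[of t] psd[of t] by (intro exI[of _ "sqrt (Q t)"]) (simp add: Q_def)
  qed (auto simp: Np Ns)
  moreover have "integrable N (\<lambda>x. (x k)\<^sup>2)" if k: "k \<in> I" for k
  proof -
    define t where "t i = (if i = k then 1 else 0 :: real)" for i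
    have tk: "(\<Sum>i\<in>I. t i * x i) = x k" for x
    proof -
      have "(\<Sum>i\<in>I. t i * x i) = (\<Sum>i\<in>I. if i = k then x i else 0)" by (intro sum.cong) (auto simp: t_def)
      then show ?thesis using I k by simp
    qed
    have "integrable (distr N borel (\<lambda>x. \<Sum>i\<in>I. t i * x i)) (\<lambda>y. y\<^sup>2)"
    proof (cases "sqrt (Q t) = 0")
      case True
      then show ?thesis unfolding law by (simp add: integrable_iff_bounded nn_integral_return)
    next
      case False
      then have "sqrt (Q t) > 0" using psd[of t] by (simp add: Q_def)
      then have "integrable lborel (\<lambda>x. normal_density 0 (sqrt (Q t)) x * (x - 0)^2)" by (rule integrable_normal_moment)
      then show ?thesis unfolding law using False by (simp add: integrable_density)
    qed
    moreover have "(\<lambda>x. x k) \<in> borel_measurable N"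
      unfolding measurable_cong_sets[OF Ns refl] by (rule measurable_component_singleton[OF k])
    ultimately show ?thesis by (simp add: integrable_distr_eq tk)
  qed
  ultimately show ?thesis using char unfolding Q_def by blast
qed

section \<open>The Gaussian regime\<close>

lemma telescoped_recursion:
  "(\<Sum>j<Suc n. Gp m \<alpha> (Suc j) (Suc n) * Gp m \<beta> (Suc j) (Suc n)) =
    (1 + \<alpha> / of_nat (n + m)) * (1 + \<beta> / of_nat (n + m)) * (\<Sum>j<n. Gp m \<alpha> (Suc j) n * Gp m \<beta> (Suc j) n) + 1"
proof -
  have "(\<Sum>j<n. Gp m \<alpha> (Suc j) (Suc n) * Gp m \<beta> (Suc j) (Suc n)) =
    (\<Sum>j<n. (1 + \<alpha> / of_nat (n + m)) * (1 + \<beta> / of_nat (n + m)) * (Gp m \<alpha> (Suc j) n * Gp m \<beta> (Suc j) n))"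
    by (intro sum.cong refl) (simp add: Gp_Suc mult_ac del: of_nat_add)
  then show ?thesis by (simp add: sum_distrib_left)
qed

text \<open>The sum satisfies the same first order recursion as \<open>(n + m) / (1 - \<alpha> - \<beta>)\<close> up to an error
  \<open>O(1 / n)\<close>.\<close>

lemma Gp_pair_sum_limit:
  assumes m: "m \<ge> 2" and s: "Re \<alpha> \<le> s" "Re \<beta> \<le> s" "0 < s" "s < 1/2"
  shows "(\<lambda>n. (\<Sum>j<n. Gp m \<alpha> (Suc j) n * Gp m \<beta> (Suc j) n) / of_nat n) \<longlonglongrightarrow> 1 / (1 - \<alpha> - \<beta>)"
proof -
  define \<sigma> where "\<sigma> = 1 - \<alpha> - \<beta>"
  have "Re \<sigma> > 0" using s by (simp add: \<sigma>_def)
  then have \<sigma>: "\<sigma> \<noteq> 0" by auto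
  define T where "T n = (\<Sum>j<n. Gp m \<alpha> (Suc j) n * Gp m \<beta> (Suc j) n)" for n
  define x where "x n = (of_nat (n + m) :: complex)" for n
  have x: "x n \<noteq> 0" "x (Suc n) = x n + 1" for n
    using m unfolding x_def of_nat_eq_0_iff by auto
  define e where "e n = T n - x n / \<sigma>" for n
  define d where "d n = (\<alpha> * \<beta>) / \<sigma> / x n" for n
  have rec: "e (Suc n) = (1 + \<alpha> / x n) * (1 + \<beta> / x n) * e n + d n" for n
  proof -
    have "T (Suc n) = (1 + \<alpha> / x n) * (1 + \<beta> / x n) * T n + 1"
      unfolding T_def x_def by (rule telescoped_recursion)
    then have "e (Suc n) = (1 + \<alpha> / x n) * (1 + \<beta> / x n) * e n + ((1 + \<alpha> / x n) * (1 + \<beta> / x n) * x n + \<sigma> - (x n + 1)) / \<sigma>"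
      using \<sigma> by (simp add: e_def x field_simps)
    also have "(1 + \<alpha> / x n) * (1 + \<beta> / x n) * x n + \<sigma> - (x n + 1) = \<alpha> * \<beta> / x n"
      using x[of n] by (simp add: \<sigma>_def field_simps)
    finally show ?thesis by (simp add: d_def)
  qed
  \<comment> \<open>Variation of constants: every inhomogeneity \<open>d j\<close> is propagated by
    the two growth factors from time j + 1 to n.\<close>
  have sol: "e n = Gp m \<alpha> 0 n * Gp m \<beta> 0 n * e 0 + (\<Sum>j<n. Gp m \<alpha> (Suc j) n * Gp m \<beta> (Suc j) n * d j)" for n
  proof (induction n)
    case (Suc n)
    have "(\<Sum>j<n. Gp m \<alpha> (Suc j) (Suc n) * Gp m \<beta> (Suc j) (Suc n) * d j) =
      (1 + \<alpha> / x n) * (1 + \<beta> / x n) * (\<Sum>j<n. Gp m \<alpha> (Suc j) n * Gp m \<beta> (Suc j) n * d j)"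
      unfolding sum_distrib_left x_def by (intro sum.cong refl) (simp add: Gp_Suc mult_ac del: of_nat_add)
    moreover have "Gp m \<alpha> 0 (Suc n) * Gp m \<beta> 0 (Suc n) = (1 + \<alpha> / x n) * (1 + \<beta> / x n) * (Gp m \<alpha> 0 n * Gp m \<beta> 0 n)"
      unfolding x_def by (simp add: Gp_Suc mult_ac del: of_nat_add)
    ultimately show ?case unfolding rec Suc by (simp add: algebra_simps)
  qed simp
  define A where "A = exp (s + (cmod \<alpha>)\<^sup>2) * exp (s + (cmod \<beta>)\<^sup>2)"
  have GG: "cmod (Gp m \<alpha> j n * Gp m \<beta> j n) \<le> A * (real (n + m) powr (2 * s) * real (j + m) powr (- 2 * s))" if "j \<le> n" for j n
  proof -
    have "cmod (Gp m \<alpha> j n * Gp m \<beta> j n) \<le> (exp (s + (cmod \<alpha>)\<^sup>2) * (real (n + m) / real (j + m)) powr s) * (exp (s + (cmod \<beta>)\<^sup>2) * (real (n + m) / real (j + m)) powr s)"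
      unfolding norm_mult using s that m by (intro mult_mono norm_Gp_le) auto
    also have "\<dots> = A * ((real (n + m) / real (j + m)) powr s)\<^sup>2" by (simp add: A_def power2_eq_square)
    also have "((real (n + m) / real (j + m)) powr s)\<^sup>2 = real (n + m) powr (2 * s) * real (j + m) powr (- 2 * s)"
      using m by (simp add: powr_pow powr_divide powr_minus field_simps mult.commute)
    finally show ?thesis .
  qed
  define c1 where "c1 = cmod (\<alpha> * \<beta> / \<sigma>)"
  define Z where "Z = (\<Sum>j. real (Suc j) powr (- 2 * s - 1))"
  have eb: "cmod (e n) \<le> (A * cmod (e 0) + A * c1 * Z) * real (n + m) powr (2 * s)" for n
  proof -
    define N where "N = real (n + m) powr (2 * s)"
    have A0: "A > 0" by (simp add: A_def)
    have "cmod (e n) \<le> cmod (Gp m \<alpha> 0 n * Gp m \<beta> 0 n) * cmod (e 0) + (\<Sum>j<n. cmod (Gp m \<alpha> (Suc j) n * Gp m \<beta> (Suc j) n) * cmod (d j))"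
      unfolding sol[of n] by (rule order_trans[OF norm_triangle_ineq add_mono]) (auto simp: norm_mult intro: order_trans[OF norm_sum])
    also have "\<dots> \<le> A * N * cmod (e 0) + (\<Sum>j<n. A * N * c1 * real (Suc j) powr (- 2 * s - 1))"
    proof (intro add_mono mult_right_mono sum_mono)
      have "real (0 + m) powr (- 2 * s) \<le> 1 powr (- 2 * s)" using m s by (intro powr_mono2') auto
      then have "A * (N * real (0 + m) powr (- 2 * s)) \<le> A * (N * 1)" using A0 by (intro mult_left_mono) (auto simp: N_def)
      then show "cmod (Gp m \<alpha> 0 n * Gp m \<beta> 0 n) \<le> A * N" using GG[of 0 n] by (simp add: N_def)
      fix j assume "j \<in> {..<n}"
      then have j: "Suc j \<le> n" by simp
      have "cmod (Gp m \<alpha> (Suc j) n * Gp m \<beta> (Suc j) n) * cmod (d j) \<le> (A * (N * real (Suc j + m) powr (- 2 * s))) * (c1 / real (j + m))"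
      proof (rule mult_mono)
        show "cmod (d j) \<le> c1 / real (j + m)" by (simp add: d_def c1_def x_def norm_divide norm_mult mult.commute del: of_nat_add)
      qed (use GG[OF j] A0 in \<open>auto simp: N_def\<close>)
      also have "\<dots> \<le> (A * (N * real (Suc j) powr (- 2 * s))) * (c1 / real (Suc j))"
        using A0 s m by (intro mult_mono divide_left_mono mult_left_mono powr_mono2') (auto simp: N_def c1_def)
      also have "\<dots> = A * N * c1 * (real (Suc j) powr (- 2 * s) / real (Suc j) powr 1)" by simp
      also have "\<dots> = A * N * c1 * real (Suc j) powr (- 2 * s - 1)" by (simp only: powr_diff)
      finally show "cmod (Gp m \<alpha> (Suc j) n * Gp m \<beta> (Suc j) n) * cmod (d j) \<le> A * N * c1 * real (Suc j) powr (- 2 * s - 1)" .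
    qed auto
    also have "\<dots> = A * N * cmod (e 0) + A * N * c1 * (\<Sum>j<n. real (Suc j) powr (- 2 * s - 1))"
      by (simp add: sum_distrib_left)
    also have "\<dots> \<le> A * N * cmod (e 0) + A * N * c1 * Z"
      unfolding Z_def using A0 s by (intro add_left_mono mult_left_mono sum_Suc_powr_le) (auto simp: N_def c1_def)
    finally show ?thesis by (simp add: N_def algebra_simps)
  qed
  define K where "K = A * cmod (e 0) + A * c1 * Z"
  have "(\<lambda>n. e n / of_nat n) \<longlonglongrightarrow> 0"
  proof (rule Lim_null_comparison)
    \<comment> \<open>The deviation is of order n^(2s), and 2s < 1.\<close>
    have "(\<lambda>n. K * (real (n + m) powr (2 * s) / real n)) \<longlonglongrightarrow> 0" using s by real_asymp
    then show "(\<lambda>n. K * (real (n + m) powr (2 * s) / real n)) \<longlonglongrightarrow> 0" .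
    show "\<forall>\<^sub>F n in sequentially. norm (e n / of_nat n) \<le> K * (real (n + m) powr (2 * s) / real n)"
      using eb by (intro always_eventually allI) (simp add: norm_divide K_def divide_right_mono)
  qed
  moreover have "(\<lambda>n. (of_nat n + of_nat m) / \<sigma> / of_nat n :: complex) \<longlonglongrightarrow> 1 / \<sigma>"
  proof -
    have "(\<lambda>n. 1 / \<sigma> + of_nat m / \<sigma> * (1 / of_nat n)) \<longlonglongrightarrow> 1 / \<sigma> + of_nat m / \<sigma> * 0"
      by (intro tendsto_intros lim_1_over_n)
    then have "(\<lambda>n. 1 / \<sigma> + of_nat m / \<sigma> * (1 / of_nat n)) \<longlonglongrightarrow> 1 / \<sigma>" by simp
    then show ?thesis
      by (rule Lim_transform_eventually) (use eventually_gt_at_top[of 0] in eventually_elim, use \<sigma> in \<open>simp add: field_simps\<close>)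
  qed
  ultimately have "(\<lambda>n. e n / of_nat n + (of_nat n + of_nat m) / \<sigma> / of_nat n) \<longlonglongrightarrow> 0 + 1 / \<sigma>"
    by (rule tendsto_add)
  moreover have "e n / of_nat n + (of_nat n + of_nat m) / \<sigma> / of_nat n = T n / of_nat n" for n
    by (simp add: e_def x_def diff_divide_distrib)
  ultimately show ?thesis by (simp add: T_def \<sigma>_def)
qed

text \<open>\<open>Y_even_moment_le\<close> requires an exponent above 1/2 and would exceed order n.
  Here the sum of squared growth factors is the pair sum for \<open>l\<close> and
  \<open>cnj l\<close>, and this has a finite limit after division by n.\<close>

lemma Y_second_moment_linear:
  assumes m: "m \<ge> 2" and l: "l \<in> chi_roots m" and s: "Re l < 1/2"
  shows "\<exists>C\<ge>0. \<forall>n\<ge>1. Ew m n (\<lambda>w. (cmod (Y m l w))\<^sup>2) \<le> C * real n"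
proof -
  \<comment> \<open>\<open>Gp_pair_sum_limit\<close> needs a positive exponent, also for roots with
    negative real part.\<close>
  define t where "t = max (Re l) (1/4)"
  have t: "Re l \<le> t" "0 < t" "t < 1/2" using s by (auto simp: t_def)
  have eq: "(\<Sum>j<n. Gp m l (Suc j) n * Gp m (cnj l) (Suc j) n) = of_real (\<Sum>j<n. (cmod (Gp m l (Suc j) n))\<^sup>2)" for n
  proof -
    have "Gp m (cnj l) j n = cnj (Gp m l j n)" for j by (simp add: Gp_def)
    then show ?thesis by (simp add: complex_mult_cnj cmod_power2 flip: of_real_power)
  qed
  have "Bseq (\<lambda>n. (\<Sum>j<n. Gp m l (Suc j) n * Gp m (cnj l) (Suc j) n) / of_nat n)"
    using Gp_pair_sum_limit[OF m t(1) _ t(2,3), of "cnj l"] t by (intro convergent_imp_Bseq) (auto simp: convergent_def)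
  then obtain K where K: "K > 0" "\<And>n. cmod ((\<Sum>j<n. Gp m l (Suc j) n * Gp m (cnj l) (Suc j) n) / of_nat n) \<le> K"
    by (auto simp: Bseq_def)
  have sumK: "(\<Sum>j=0..<n. (cmod (Gp m l (Suc j) n))\<^sup>2) \<le> K * real n" if n: "n \<ge> 1" for n
  proof -
    have "(\<Sum>j<n. (cmod (Gp m l (Suc j) n))\<^sup>2) / real n \<le> K"
      using K(2)[of n] unfolding eq norm_divide norm_of_real norm_of_nat by (simp add: sum_nonneg)
    then show ?thesis using n by (simp add: field_simps atLeast0LessThan)
  qed
  define c where "c = exp (t + (cmod l)\<^sup>2) * real m"
  define C where "C = 4 * (momK m l 1 * K + c\<^sup>2 * real (m + 1))"
  show ?thesis
  proof (intro exI[of _ C] conjI allI impI)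
    show "C \<ge> 0" using momK_pos[of m l 1] K by (auto simp: C_def)
    fix n :: nat assume n: "n \<ge> 1"
    have b: "Ew m n (\<lambda>w. cmod (Gp m l n n * Y m l w - Gp m l 0 n * Y m l (drop (n - 0) w)) ^ (2*1)) \<le> momK m l 1 * (\<Sum>j=0..<n. (cmod (Gp m l (Suc j) n))\<^sup>2)^1"
      by (rule moment_bound[OF m l, where q="\<lambda>j. Gp m l j n"]) (auto simp: Gp_rec)
    have "cmod (Gp m l 0 n * of_nat m) \<le> c * real (n + m) powr (1/2)"
    proof -
      have "cmod (Gp m l 0 n) \<le> exp (t + (cmod l)\<^sup>2) * (real (n + m) / real (0 + m)) powr t"
        by (rule norm_Gp_le[OF m]) (use t in auto)
      also have "(real (n + m) / real (0 + m)) powr t \<le> real (n + m) powr t"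
        using m t by (intro powr_mono2) (auto simp: divide_le_eq mult_le_cancel_left1)
      also have "\<dots> \<le> real (n + m) powr (1/2)" using m t by (intro powr_mono) auto
      finally show ?thesis using m by (simp add: norm_mult c_def mult_right_mono mult_ac)
    qed
    then have g0: "(cmod (Gp m l 0 n * of_nat m))\<^sup>2 \<le> c\<^sup>2 * real (m + 1) * real n"
    proof -
      assume *: "cmod (Gp m l 0 n * of_nat m) \<le> c * real (n + m) powr (1/2)"
      have "(cmod (Gp m l 0 n * of_nat m))\<^sup>2 \<le> (c * real (n + m) powr (1/2))\<^sup>2" by (intro power_mono *) auto
      also have "\<dots> = c\<^sup>2 * real (n + m)" using m by (simp add: power_mult_distrib powr_pow)
      also have "\<dots> \<le> c\<^sup>2 * (real (m + 1) * real n)"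
      proof (rule mult_left_mono)
        show "real (n + m) \<le> real (m + 1) * real n" using n mult_left_mono[of 1 "real n" "real m"] by (simp add: algebra_simps)
      qed simp
      finally show ?thesis by (simp add: mult.assoc)
    qed
    have "Ew m n (\<lambda>w. (cmod (Y m l w))\<^sup>2) \<le> Ew m n (\<lambda>w. 2^2 * ((cmod (Gp m l n n * Y m l w - Gp m l 0 n * Y m l (drop (n - 0) w)))^(2*1) + c\<^sup>2 * real (m + 1) * real n))"
    proof (rule Ew_mono)
      fix w assume w: "w \<in> words m n"
      define d where "d = Gp m l n n * Y m l w - Gp m l 0 n * Y m l (drop (n - 0) w)"
      have "Y m l w = d + Gp m l 0 n * of_nat m" using length_words[OF w] Y_Nil[OF m] by (simp add: d_def)
      then have "(cmod (Y m l w))\<^sup>2 \<le> (cmod d + cmod (Gp m l 0 n * of_nat m))\<^sup>2" using norm_triangle_ineq by (intro power_mono) auto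
      also have "\<dots> \<le> 2^2 * ((cmod d)\<^sup>2 + (cmod (Gp m l 0 n * of_nat m))\<^sup>2)" by (rule sum_power_le) auto
      also have "\<dots> \<le> 2^2 * ((cmod d)^(2*1) + c\<^sup>2 * real (m + 1) * real n)" using g0 by simp
      finally show "(cmod (Y m l w))\<^sup>2 \<le> 2^2 * ((cmod (Gp m l n n * Y m l w - Gp m l 0 n * Y m l (drop (n - 0) w)))^(2*1) + c\<^sup>2 * real (m + 1) * real n)"
        by (simp add: d_def)
    qed
    also have "\<dots> \<le> 2^2 * (momK m l 1 * (K * real n) + c\<^sup>2 * real (m + 1) * real n)"
      unfolding Ew_cmult Ew_add Ew_const[OF m]
      using b sumK[OF n] momK_pos[of m l 1] by (intro mult_left_mono add_mono order_trans[OF b]) auto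
    also have "\<dots> = C * real n" by (simp add: C_def algebra_simps)
    finally show "Ew m n (\<lambda>w. (cmod (Y m l w))\<^sup>2) \<le> C * real n" .
  qed
qed

text \<open>With the exponent 3/4 the mean of |Y(j)|/(j+m) decays like j^(-1/4). This is the rate at
  which the insertion probabilities approach their limits, and it makes the variance error summable
  in \<open>char_limit\<close>.\<close>

lemma Y_first_moment:
  assumes m: "m \<ge> 2" and l: "l \<in> chi_roots m" and s: "Re l < 1/2"
  shows "\<exists>C\<ge>0. \<forall>n. Ew m n (\<lambda>w. cmod (Y m l w)) \<le> C * real (n + m) powr (3/4)"
proof -
  obtain C where C: "C \<ge> 0" "\<And>n. Ew m n (\<lambda>w. cmod (Y m l w) ^ (2*1)) \<le> C * real (n + m) powr (2 * (3/4) * real 1)"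
    using Y_even_moment_le[OF m l, of "3/4" 1] s by auto
  show ?thesis
  proof (intro exI[of _ "1 + C"] conjI allI)
    fix n
    define a where "a = real (n + m) powr (3/4)"
    have a: "a > 0" "real (n + m) powr (2 * (3/4) * real 1) = a\<^sup>2" using m by (auto simp: a_def powr_pow)
    have dom: "x \<le> a + 1 / a * x ^ (2*1)" if "x \<ge> 0" for x
    proof (cases "x \<le> a")
      case False
      then have "x * a \<le> x * x" using that by (intro mult_left_mono) auto
      then have "x \<le> 1 / a * x ^ (2*1)" using a by (simp add: power2_eq_square field_simps)
      then show ?thesis using a by linarith
    qed (use a in \<open>simp add: add_increasing2\<close>)
    have "Ew m n (\<lambda>w. cmod (Y m l w)) \<le> Ew m n (\<lambda>w. a + 1 / a * cmod (Y m l w) ^ (2*1))"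
      by (rule Ew_mono) (rule dom, simp)
    also have "\<dots> \<le> a + 1 / a * (C * a\<^sup>2)"
      unfolding Ew_add Ew_cmult Ew_const[OF m] using C(2)[of n] a by (intro add_left_mono mult_left_mono) auto
    also have "\<dots> = (1 + C) * a" using a by (simp add: power2_eq_square algebra_simps)
    finally show "Ew m n (\<lambda>w. cmod (Y m l w)) \<le> (1 + C) * real (n + m) powr (3/4)" by (simp add: a_def)
  qed (use C in simp)
qed

section \<open>One step of the characteristic function\<close>

definition Rt :: "nat \<Rightarrow> complex set" where "Rt m = chi_roots m - {1}"

definition ell :: "nat \<Rightarrow> (complex \<Rightarrow> complex) \<Rightarrow> nat list \<Rightarrow> real" where
  "ell m q w = Re (\<Sum>l\<in>Rt m. q l * Y m l w)"

definition Zn :: "nat \<Rightarrow> nat list \<Rightarrow> real" where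
  "Zn m w = (\<Sum>l\<in>Rt m. cmod (Y m l w))"

text \<open>The jump of \<open>ell\<close> without drift correction. Its mean square under the limit
  law v(1) of the insertion types replaces the random conditional variance.\<close>

definition var_form :: "nat \<Rightarrow> (complex \<Rightarrow> complex) \<Rightarrow> nat \<Rightarrow> real" where
  "var_form m q k = Re (\<Sum>l\<in>Rt m. q l * Uinc m l k)"

lemma finite_Rt: "m \<ge> 1 \<Longrightarrow> finite (Rt m)"
  using finite_chi_roots by (simp add: Rt_def)

lemma Y_one: assumes "m \<ge> 2" "w \<in> words m n" shows "Y m 1 w = of_nat (n + m)"
proof -
  have "Y m 1 w = of_real (\<Sum>k=1..m. real (gaps m k) * st m w k)"
    by (simp add: Y_def U_one[OF assms(1)])
  moreover have "(\<Sum>k=1..m. real (gaps m k) * st m w k) = real (n + m)"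
    using sum_gaps_st[OF assms(1), of w] assms(2) by (simp add: words_def)
  ultimately show ?thesis by (simp only: of_real_of_nat_eq)
qed

lemma st_decomposition:
  assumes m: "m \<ge> 2" and w: "w \<in> words m n" and k: "k \<in> {1..m}"
  shows "of_real (st m w k) = of_nat (n + m) * yvec m 1 k + (\<Sum>l\<in>Rt m. Y m l w * yvec m l k)"
proof -
  have "chi_roots m = insert 1 (Rt m)" "1 \<notin> Rt m" using one_in_chi_roots[of m] m by (auto simp: Rt_def)
  then show ?thesis
    using spectral_decomposition[OF m k, of "\<lambda>k. of_real (st m w k)"] finite_Rt[of m] m Y_one[OF m w]
    unfolding Y_def[symmetric] by simp
qed

text \<open>In the spectral decomposition of the state, the coordinate of the root 1 contributes
  exactly v(1) to the insertion probability; the other coordinates are bounded by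
  \<open>Zn\<close>.\<close>

lemma step_prob_decomposition:
  assumes m: "m \<ge> 2" and w: "w \<in> words m n" and k: "k \<in> {1..m}"
  shows "\<bar>step_prob m w k - v_vec m 1 k\<bar> \<le> (\<Sum>l\<in>Rt m. real (gaps m k) * cmod (yvec m l k)) * (Zn m w / real (n + m))"
proof -
  have g: "of_nat (gaps m k) \<noteq> (0::complex)" using gaps_nonzero[of m k] m k by auto
  have nm: "of_nat (n + m) \<noteq> (0::complex)" using m unfolding of_nat_eq_0_iff by simp
  have "complex_of_real (step_prob m w k - v_vec m 1 k) = of_nat (gaps m k) / of_nat (n + m) * of_real (st m w k) - v_vec m 1 k"
    using k w by (simp add: step_prob_def v_vec_of_real words_def)
  also have "\<dots> = of_nat (gaps m k) / of_nat (n + m) * (\<Sum>l\<in>Rt m. Y m l w * yvec m l k)"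
    unfolding st_decomposition[OF m w k] P_inv_def using g nm m by (simp add: distrib_left del: of_nat_add)
  finally have e: "complex_of_real (step_prob m w k - v_vec m 1 k) = of_nat (gaps m k) / of_nat (n + m) * (\<Sum>l\<in>Rt m. Y m l w * yvec m l k)" .
  have "\<bar>step_prob m w k - v_vec m 1 k\<bar> = cmod (complex_of_real (step_prob m w k - v_vec m 1 k))" by (simp only: norm_of_real)
  also have "\<dots> = real (gaps m k) / real (n + m) * cmod (\<Sum>l\<in>Rt m. Y m l w * yvec m l k)"
    unfolding e norm_mult norm_divide norm_of_nat ..
  also have "\<dots> \<le> real (gaps m k) / real (n + m) * (\<Sum>l\<in>Rt m. Zn m w * cmod (yvec m l k))"
  proof (intro mult_left_mono order_trans[OF norm_sum] sum_mono)
    fix l assume "l \<in> Rt m"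
    then have "cmod (Y m l w) \<le> Zn m w" unfolding Zn_def using finite_Rt[of m] m by (intro member_le_sum) auto
    then show "cmod (Y m l w * yvec m l k) \<le> Zn m w * cmod (yvec m l k)" by (simp add: norm_mult mult_right_mono)
  qed auto
  also have "\<dots> = (\<Sum>l\<in>Rt m. real (gaps m k) * cmod (yvec m l k)) * (Zn m w / real (n + m))"
    by (simp add: sum_distrib_left sum_distrib_right mult_ac)
  finally show ?thesis .
qed

lemma one_minus_exp_le:
  assumes "(x::real) \<ge> 0" shows "\<bar>1 - x - exp (- x)\<bar> \<le> x\<^sup>2 / 2"
proof -
  have "(\<lambda>x. 1 - x + x\<^sup>2 / 2 - exp (- x)) 0 \<le> (\<lambda>x. 1 - x + x\<^sup>2 / 2 - exp (- x)) x"
  proof (rule DERIV_nonneg_imp_nondecreasing[OF assms])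
    fix y :: real
    have "((\<lambda>x. 1 - x + x\<^sup>2 / 2 - exp (- x)) has_real_derivative (-1 + y + exp (- y))) (at y)"
      by (auto intro!: derivative_eq_intros)
    moreover have "-1 + y + exp (- y) \<ge> 0" using exp_ge_add_one_self[of "-y"] by simp
    ultimately show "\<exists>d. ((\<lambda>x. 1 - x + x\<^sup>2 / 2 - exp (- x)) has_real_derivative d) (at y) \<and> 0 \<le> d" by blast
  qed
  moreover have "1 - x \<le> exp (- x)" using exp_ge_add_one_self[of "-x"] by simp
  ultimately show ?thesis by simp
qed

definition stepC :: "nat \<Rightarrow> real" where
  "stepC m = (let D = (\<Sum>l\<in>Rt m. devB m l) in D^3 + D^4 + 2 * D * (\<Sum>l\<in>Rt m. cmod l) +
     D\<^sup>2 * (\<Sum>k=1..m. \<Sum>l\<in>Rt m. real (gaps m k) * cmod (yvec m l k)))"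

lemma stepC_nonneg: "stepC m \<ge> 0"
proof -
  have "0 \<le> (\<Sum>l\<in>Rt m. devB m l)" using devB_pos order_trans[OF zero_le_one] by (intro sum_nonneg) blast
  then show ?thesis unfolding stepC_def Let_def by (auto intro!: add_nonneg_nonneg mult_nonneg_nonneg sum_nonneg)
qed

text \<open>Three errors: the Taylor remainder of third order, whose linear term drops out as the
  jumps are centred; the replacement of the conditional variance by the limit variance, which costs
  \<open>Zn\<close> over n + m; and the passage from 1 - S/2 to exp(-S/2), of fourth order.\<close>

lemma step_char_bound:
  assumes m: "m \<ge> 2" and w: "w \<in> words m n" "pr m w \<noteq> 0"
  defines "d \<equiv> \<lambda>q k. Re (\<Sum>l\<in>Rt m. q l * dev m l w k)"
  shows "cmod ((\<Sum>k=1..m. step_prob m w k *\<^sub>R iexp (d q k)) - of_real (exp (- (\<Sum>k=1..m. v_vec m 1 k * (var_form m q k)\<^sup>2) / 2)))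
    \<le> stepC m * ((\<Sum>l\<in>Rt m. cmod (q l))^3 + (\<Sum>l\<in>Rt m. cmod (q l))^4 + (\<Sum>l\<in>Rt m. cmod (q l))\<^sup>2 * (Zn m w / real (n + m)))"
proof -
  define Q where "Q = (\<Sum>l\<in>Rt m. cmod (q l))"
  define D where "D = (\<Sum>l\<in>Rt m. devB m l)"
  define \<Lambda> where "\<Lambda> = (\<Sum>l\<in>Rt m. cmod l)"
  define C1 where "C1 = (\<Sum>k=1..m. \<Sum>l\<in>Rt m. real (gaps m k) * cmod (yvec m l k))"
  define z where "z = Zn m w / real (n + m)"
  define p where "p k = step_prob m w k" for k
  define v where "v k = v_vec m (1::real) k" for k
  define e where "e k = var_form m q k" for k
  define S where "S = (\<Sum>k=1..m. v k * (e k)\<^sup>2)"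
  have fin: "finite (Rt m)" using finite_Rt m by auto
  have len: "length w = n" using w(1) by (rule length_words)
  have p0: "p k \<ge> 0" for k using step_prob_nonneg[OF w(2)] by (simp add: p_def)
  have ps: "(\<Sum>k=1..m. p k) = 1" using sum_step_prob[OF m w(1)] by (simp add: p_def)
  have v0: "v k \<ge> 0" for k using v_vec_one_nonneg[OF m] by (simp add: v_def)
  have vs: "(\<Sum>k=1..m. v k) = 1" using sum_v_vec_one[OF m] by (simp add: v_def)
  have nn: "Q \<ge> 0" "D \<ge> 0" "\<Lambda> \<ge> 0" "C1 \<ge> 0" "z \<ge> 0"
    using devB_pos order_trans[OF zero_le_one]
    by (auto simp: Q_def D_def \<Lambda>_def C1_def z_def Zn_def intro!: sum_nonneg divide_nonneg_nonneg mult_nonneg_nonneg)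
  have lin: "\<bar>Re (\<Sum>l\<in>Rt m. q l * f l)\<bar> \<le> D * Q" if f: "\<And>l. l \<in> Rt m \<Longrightarrow> cmod (f l) \<le> devB m l" for f
  proof -
    have "\<bar>Re (\<Sum>l\<in>Rt m. q l * f l)\<bar> \<le> (\<Sum>l\<in>Rt m. cmod (q l) * cmod (f l))"
      unfolding norm_mult[symmetric] by (rule order_trans[OF abs_Re_le_cmod norm_sum])
    also have "\<dots> \<le> (\<Sum>l\<in>Rt m. cmod (q l) * D)"
    proof (intro sum_mono mult_left_mono)
      fix l assume l: "l \<in> Rt m"
      have "devB m l \<le> D" unfolding D_def using l fin devB_pos order_trans[OF zero_le_one] by (intro member_le_sum) auto
      then show "cmod (f l) \<le> D" using f[OF l] by simp
    qed auto
    also have "\<dots> = D * Q" by (simp add: Q_def sum_distrib_left mult.commute)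
    finally show ?thesis .
  qed
  have dle: "\<bar>d q k\<bar> \<le> D * Q" if "k \<in> {1..m}" for k
    unfolding d_def by (rule lin) (rule dev_le[OF m w that])
  have ele: "\<bar>e k\<bar> \<le> D * Q" if k: "k \<in> {1..m}" for k
    unfolding e_def var_form_def
  proof (rule lin)
    fix l
    have "cmod (Uinc m l k) \<le> (\<Sum>k=1..m. cmod (Uinc m l k))" using k by (intro member_le_sum) auto
    then show "cmod (Uinc m l k) \<le> devB m l" unfolding devB_def by (simp add: add_increasing2 sum_nonneg)
  qed
  have mean: "(\<Sum>k=1..m. p k * d q k) = 0"
  proof -
    have "(\<Sum>k=1..m. p k * d q k) = Re (\<Sum>k=1..m. of_real (p k) * (\<Sum>l\<in>Rt m. q l * dev m l w k))"
      unfolding d_def Re_sum by (simp add: sum_distrib_left)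
    also have "(\<Sum>k=1..m. of_real (p k) * (\<Sum>l\<in>Rt m. q l * dev m l w k)) = (\<Sum>l\<in>Rt m. q l * (\<Sum>k=1..m. of_real (p k) * dev m l w k))"
      unfolding sum_distrib_left by (subst sum.swap) (simp add: mult_ac)
    also have "\<dots> = 0"
    proof (intro sum.neutral ballI)
      fix l assume "l \<in> Rt m"
      then have "(\<Sum>k=1..m. of_real (p k) * dev m l w k) = 0"
        unfolding p_def by (intro mean_dev[OF m _ w(1)]) (simp add: Rt_def)
      then show "q l * (\<Sum>k=1..m. of_real (p k) * dev m l w k) = 0" by (simp only: mult_zero_right)
    qed
    finally show ?thesis by simp
  qed
  have de: "\<bar>d q k - e k\<bar> \<le> Q * \<Lambda> * z" for k
  proof -
    have "d q k - e k = - Re (\<Sum>l\<in>Rt m. q l * (l / of_nat (n + m) * Y m l w))"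
      unfolding d_def e_def var_form_def dev_def len by (simp add: right_diff_distrib sum_subtractf del: of_nat_add)
    then have "\<bar>d q k - e k\<bar> \<le> cmod (\<Sum>l\<in>Rt m. q l * (l / of_nat (n + m) * Y m l w))"
      by (simp only: abs_minus_cancel abs_Re_le_cmod)
    also have "\<dots> \<le> (\<Sum>l\<in>Rt m. Q * \<Lambda> * (cmod (Y m l w) / real (n + m)))"
    proof (intro order_trans[OF norm_sum] sum_mono)
      fix l assume l: "l \<in> Rt m"
      have "cmod (q l) \<le> Q" "cmod l \<le> \<Lambda>" unfolding Q_def \<Lambda>_def using l fin by (auto intro!: member_le_sum)
      then have "cmod (q l) * cmod l * (cmod (Y m l w) / real (n + m)) \<le> Q * \<Lambda> * (cmod (Y m l w) / real (n + m))"
        using nn by (intro mult_right_mono mult_mono) auto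
      then show "cmod (q l * (l / of_nat (n + m) * Y m l w)) \<le> Q * \<Lambda> * (cmod (Y m l w) / real (n + m))"
        unfolding norm_mult norm_divide norm_of_nat by (simp add: mult_ac)
    qed
    also have "\<dots> = Q * \<Lambda> * z" by (simp add: z_def Zn_def sum_distrib_left sum_divide_distrib)
    finally show ?thesis .
  qed
  have b1: "cmod ((\<Sum>k=1..m. p k *\<^sub>R iexp (d q k)) - of_real (1 - (\<Sum>k=1..m. p k * (d q k)\<^sup>2) / 2)) \<le> (D * Q)^3"
  proof -
    have "(\<Sum>k=1..m. of_real (p k) * (1 + \<i> * of_real (d q k) - of_real ((d q k)\<^sup>2) / 2)) =
        of_real (\<Sum>k=1..m. p k) + \<i> * of_real (\<Sum>k=1..m. p k * d q k) - of_real (\<Sum>k=1..m. p k * (d q k)\<^sup>2) / 2"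
      by (simp add: algebra_simps sum.distrib sum_subtractf sum_distrib_left sum_divide_distrib)
    then have "(\<Sum>k=1..m. p k *\<^sub>R iexp (d q k)) - of_real (1 - (\<Sum>k=1..m. p k * (d q k)\<^sup>2) / 2) =
      (\<Sum>k=1..m. of_real (p k) * (iexp (d q k) - (1 + \<i> * of_real (d q k) - of_real ((d q k)\<^sup>2) / 2)))"
      unfolding ps mean by (simp add: scaleR_conv_of_real right_diff_distrib sum_subtractf)
    also have "cmod \<dots> \<le> (\<Sum>k=1..m. p k * (D * Q)^3)"
    proof (intro order_trans[OF norm_sum] sum_mono)
      fix k assume k: "k \<in> {1..m}"
      have "(\<Sum>j\<le>2. f j) = f 0 + f 1 + f 2" for f :: "nat \<Rightarrow> complex" by (simp add: numeral_2_eq_2)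
      then have "(\<Sum>j\<le>2. (\<i> * of_real (d q k))^j / fact j) = 1 + \<i> * of_real (d q k) - of_real ((d q k)\<^sup>2) / 2"
        by (simp add: power_mult_distrib)
      then have "cmod (iexp (d q k) - (1 + \<i> * of_real (d q k) - of_real ((d q k)\<^sup>2) / 2)) \<le> \<bar>d q k\<bar>^3 / fact 3"
        using iexp_approx1[of "d q k" 2] by (simp add: numeral_3_eq_3 numeral_2_eq_2)
      also have "\<dots> \<le> \<bar>d q k\<bar>^3" by (simp add: divide_le_eq mult_le_cancel_left1 fact_numeral)
      also have "\<dots> \<le> (D * Q)^3" by (intro power_mono dle k) auto
      finally show "cmod (of_real (p k) * (iexp (d q k) - (1 + \<i> * of_real (d q k) - of_real ((d q k)\<^sup>2) / 2))) \<le> p k * (D * Q)^3"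
        using p0[of k] by (simp add: norm_mult mult_left_mono)
    qed
    also have "\<dots> = (D * Q)^3" using ps by (simp flip: sum_distrib_right)
    finally show ?thesis .
  qed
  have b2: "\<bar>(\<Sum>k=1..m. p k * (d q k)\<^sup>2) - S\<bar> \<le> Q\<^sup>2 * z * (2 * D * \<Lambda> + D\<^sup>2 * C1)"
  proof -
    have "(\<Sum>k=1..m. p k * (d q k)\<^sup>2) - S = (\<Sum>k=1..m. p k * ((d q k)\<^sup>2 - (e k)\<^sup>2)) + (\<Sum>k=1..m. (p k - v k) * (e k)\<^sup>2)"
      by (simp add: S_def sum_subtractf right_diff_distrib left_diff_distrib)
    also have "\<bar>\<dots>\<bar> \<le> (\<Sum>k=1..m. \<bar>p k * ((d q k)\<^sup>2 - (e k)\<^sup>2)\<bar>) + (\<Sum>k=1..m. \<bar>(p k - v k) * (e k)\<^sup>2\<bar>)"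
      by (rule order_trans[OF abs_triangle_ineq add_mono]) (rule sum_abs)+
    also have "\<dots> \<le> (\<Sum>k=1..m. p k * (2 * (D * Q) * (Q * \<Lambda> * z))) + (\<Sum>k=1..m. ((\<Sum>l\<in>Rt m. real (gaps m k) * cmod (yvec m l k)) * z) * (D * Q)\<^sup>2)"
    proof (intro add_mono sum_mono)
      fix k assume k: "k \<in> {1..m}"
      have "\<bar>(d q k)\<^sup>2 - (e k)\<^sup>2\<bar> = \<bar>d q k + e k\<bar> * \<bar>d q k - e k\<bar>"
        unfolding abs_mult[symmetric] by (intro arg_cong[of _ _ abs]) (simp add: power2_eq_square algebra_simps)
      also have "\<dots> \<le> (2 * (D * Q)) * (Q * \<Lambda> * z)"
        using dle[OF k] ele[OF k] de[of k] nn by (intro mult_mono) auto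
      finally show "\<bar>p k * ((d q k)\<^sup>2 - (e k)\<^sup>2)\<bar> \<le> p k * (2 * (D * Q) * (Q * \<Lambda> * z))"
        using p0[of k] by (simp add: abs_mult mult_left_mono)
      have "(e k)\<^sup>2 \<le> (D * Q)\<^sup>2" using power_mono[OF ele[OF k], of 2] by simp
      then show "\<bar>(p k - v k) * (e k)\<^sup>2\<bar> \<le> ((\<Sum>l\<in>Rt m. real (gaps m k) * cmod (yvec m l k)) * z) * (D * Q)\<^sup>2"
        unfolding abs_mult p_def v_def z_def using step_prob_decomposition[OF m w(1) k]
        by (intro mult_mono) auto
    qed
    also have "\<dots> = 2 * (D * Q) * (Q * \<Lambda> * z) + C1 * z * (D * Q)\<^sup>2"
      using ps by (simp add: C1_def flip: sum_distrib_right)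
    also have "\<dots> = Q\<^sup>2 * z * (2 * D * \<Lambda> + D\<^sup>2 * C1)" by (simp add: power2_eq_square algebra_simps)
    finally show ?thesis .
  qed
  have S0: "S \<ge> 0" unfolding S_def using v0 by (intro sum_nonneg) auto
  have SD: "S \<le> (D * Q)\<^sup>2"
  proof -
    have "S \<le> (\<Sum>k=1..m. v k * (D * Q)\<^sup>2)" unfolding S_def
    proof (intro sum_mono mult_left_mono)
      fix k assume "k \<in> {1..m}"
      then show "(e k)\<^sup>2 \<le> (D * Q)\<^sup>2" using power_mono[OF ele, of k 2] by simp
    qed (use v0 in auto)
    then show ?thesis using vs by (simp flip: sum_distrib_right)
  qed
  have b3: "\<bar>1 - S / 2 - exp (- S / 2)\<bar> \<le> (D * Q)^4"
  proof -
    have "\<bar>1 - S / 2 - exp (- (S / 2))\<bar> \<le> (S / 2)\<^sup>2 / 2" by (rule one_minus_exp_le) (use S0 in simp)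
    also have "\<dots> \<le> S\<^sup>2" by (simp add: power_divide)
    also have "\<dots> \<le> ((D * Q)\<^sup>2)\<^sup>2" using SD S0 by (intro power_mono) auto
    finally show ?thesis by simp
  qed
  have tri: "cmod (a - c) \<le> cmod (a - b) + cmod (b - c)" for a b c :: complex
    using norm_triangle_ineq[of "a - b" "b - c"] by simp
  have "cmod ((\<Sum>k=1..m. p k *\<^sub>R iexp (d q k)) - of_real (exp (- S / 2))) \<le>
     cmod ((\<Sum>k=1..m. p k *\<^sub>R iexp (d q k)) - of_real (1 - (\<Sum>k=1..m. p k * (d q k)\<^sup>2) / 2)) + cmod (of_real (1 - (\<Sum>k=1..m. p k * (d q k)\<^sup>2) / 2) - of_real (exp (- S / 2)))"
    by (rule tri)
  also have "cmod (of_real (1 - (\<Sum>k=1..m. p k * (d q k)\<^sup>2) / 2) - of_real (exp (- S / 2))) = \<bar>(1 - (\<Sum>k=1..m. p k * (d q k)\<^sup>2) / 2) - exp (- S / 2)\<bar>"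
    by (simp only: of_real_diff[symmetric] norm_of_real)
  also have "\<dots> \<le> \<bar>(\<Sum>k=1..m. p k * (d q k)\<^sup>2) - S\<bar> + \<bar>1 - S / 2 - exp (- S / 2)\<bar>" by linarith
  finally have "cmod ((\<Sum>k=1..m. p k *\<^sub>R iexp (d q k)) - of_real (exp (- S / 2))) \<le> (D * Q)^3 + (Q\<^sup>2 * z * (2 * D * \<Lambda> + D\<^sup>2 * C1) + (D * Q)^4)"
    using b1 b2 b3 by linarith
  also have "\<dots> = D^3 * Q^3 + (2 * D * \<Lambda> + D\<^sup>2 * C1) * (Q\<^sup>2 * z) + D^4 * Q^4" by (simp add: power_mult_distrib)
  also have "\<dots> \<le> stepC m * Q^3 + stepC m * (Q\<^sup>2 * z) + stepC m * Q^4"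
  proof -
    have s: "stepC m = D^3 + D^4 + 2 * D * \<Lambda> + D\<^sup>2 * C1"
      by (simp only: stepC_def Let_def D_def \<Lambda>_def C1_def)
    have "0 \<le> D^3" "0 \<le> D^4" "0 \<le> 2 * D * \<Lambda>" "0 \<le> D\<^sup>2 * C1" using nn by simp_all
    then have "D^3 \<le> stepC m" "2 * D * \<Lambda> + D\<^sup>2 * C1 \<le> stepC m" "D^4 \<le> stepC m" unfolding s by linarith+
    then show ?thesis using nn by (intro add_mono mult_right_mono) auto
  qed
  finally show ?thesis unfolding S_def p_def v_def e_def Q_def z_def by (simp add: algebra_simps)
qed

text \<open>With the coefficients \<open>qn m c n j\<close>, the form \<open>ell\<close> at time \<open>j\<close> is the conditional expectation, given
  the history up to time \<open>j\<close>, of the form with coefficients \<open>c / \<surd>n\<close> at time \<open>n\<close>.\<close>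

definition qn :: "nat \<Rightarrow> (complex \<Rightarrow> complex) \<Rightarrow> nat \<Rightarrow> nat \<Rightarrow> complex \<Rightarrow> complex" where
  "qn m c n j l = c l * Gp m l j n / of_real (sqrt (real n))"

text \<open>The accumulated limiting covariance of two forms at time n. The jump from time j to j +
  1 carries the coefficient of time j + 1. Two arguments are kept so that the limit yields a
  covariance matrix by bilinearity.\<close>

definition cov_form :: "nat \<Rightarrow> nat \<Rightarrow> (complex \<Rightarrow> complex) \<Rightarrow> (complex \<Rightarrow> complex) \<Rightarrow> real" where
  "cov_form m n c c' = (\<Sum>j<n. \<Sum>k=1..m. v_vec m 1 k * (var_form m (qn m c n (Suc j)) k * var_form m (qn m c' n (Suc j)) k))"

lemma ell_Cons:
  assumes "length w = j" "\<And>l. l \<in> Rt m \<Longrightarrow> q l = q' l * (1 + l / of_nat (j + m))"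
  shows "ell m q' (k # w) = ell m q w + Re (\<Sum>l\<in>Rt m. q' l * dev m l w k)"
proof -
  have "(\<Sum>l\<in>Rt m. q' l * Y m l (k # w)) = (\<Sum>l\<in>Rt m. q l * Y m l w + q' l * dev m l w k)"
    using assms by (intro sum.cong refl) (simp add: Y_Cons dev_def algebra_simps del: of_nat_add)
  then show ?thesis by (simp only: ell_def sum.distrib plus_complex.sel)
qed

text \<open>Conditioning on the history splits off the factor of the last jump; the rest has modulus
  1, so the one-step error is simply averaged, and only the mean of \<open>Zn\<close>
  enters.\<close>

lemma char_recursion:
  assumes m: "m \<ge> 2" and q: "\<And>l. l \<in> Rt m \<Longrightarrow> q l = q' l * (1 + l / of_nat (j + m))"
  shows "cmod (Ew m (Suc j) (\<lambda>w. iexp (ell m q' w)) -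
      of_real (exp (- (\<Sum>k=1..m. v_vec m 1 k * (var_form m q' k)\<^sup>2) / 2)) * Ew m j (\<lambda>w. iexp (ell m q w)))
    \<le> stepC m * ((\<Sum>l\<in>Rt m. cmod (q' l))^3 + (\<Sum>l\<in>Rt m. cmod (q' l))^4 + (\<Sum>l\<in>Rt m. cmod (q' l))\<^sup>2 * (Ew m j (Zn m) / real (j + m)))"
proof -
  define Q where "Q = (\<Sum>l\<in>Rt m. cmod (q' l))"
  define E where "E = complex_of_real (exp (- (\<Sum>k=1..m. v_vec m 1 k * (var_form m q' k)\<^sup>2) / 2))"
  define d where "d w k = Re (\<Sum>l\<in>Rt m. q' l * dev m l w k)" for w k
  have "Ew m (Suc j) (\<lambda>w. iexp (ell m q' w)) = Ew m j (\<lambda>w. (\<Sum>k=1..m. step_prob m w k *\<^sub>R iexp (d w k)) * iexp (ell m q w))"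
    unfolding Ew_Suc
  proof (rule Ew_cong)
    fix w assume w: "w \<in> words m j"
    have "iexp (ell m q' (k # w)) = iexp (d w k) * iexp (ell m q w)" for k
    proof -
      have "ell m q' (k # w) = d w k + ell m q w"
        unfolding d_def by (subst ell_Cons[OF length_words[OF w] q]) simp_all
      then show ?thesis by (simp only: of_real_add distrib_left exp_add)
    qed
    then show "(\<Sum>k=1..m. step_prob m w k *\<^sub>R iexp (ell m q' (k # w))) = (\<Sum>k=1..m. step_prob m w k *\<^sub>R iexp (d w k)) * iexp (ell m q w)"
      by (simp add: sum_distrib_right)
  qed
  then have "Ew m (Suc j) (\<lambda>w. iexp (ell m q' w)) - E * Ew m j (\<lambda>w. iexp (ell m q w)) =
     Ew m j (\<lambda>w. ((\<Sum>k=1..m. step_prob m w k *\<^sub>R iexp (d w k)) - E) * iexp (ell m q w))"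
    by (simp only: left_diff_distrib Ew_diff Ew_cmult)
  also have "cmod \<dots> \<le> Ew m j (\<lambda>w. cmod (((\<Sum>k=1..m. step_prob m w k *\<^sub>R iexp (d w k)) - E) * iexp (ell m q w)))"
    by (rule norm_Ew_le)
  also have "\<dots> \<le> Ew m j (\<lambda>w. stepC m * (Q^3 + Q^4 + Q\<^sup>2 / real (j + m) * Zn m w))"
  proof (rule Ew_mono)
    fix w assume w: "w \<in> words m j" "pr m w \<noteq> 0"
    have "cmod ((\<Sum>k=1..m. step_prob m w k *\<^sub>R iexp (d w k)) - E) \<le> stepC m * (Q^3 + Q^4 + Q\<^sup>2 * (Zn m w / real (j + m)))"
      unfolding d_def E_def Q_def by (rule step_char_bound[OF m w])
    then show "cmod (((\<Sum>k=1..m. step_prob m w k *\<^sub>R iexp (d w k)) - E) * iexp (ell m q w)) \<le> stepC m * (Q^3 + Q^4 + Q\<^sup>2 / real (j + m) * Zn m w)"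
      by (simp add: norm_mult)
  qed
  also have "\<dots> = stepC m * (Q^3 + Q^4 + Q\<^sup>2 * (Ew m j (Zn m) / real (j + m)))"
    unfolding Ew_cmult Ew_add Ew_const[OF m] by simp
  finally show ?thesis by (simp add: E_def Q_def)
qed

text \<open>The factors exp(-S/2) are at most 1, so an error made at one step is never amplified
  later and the errors add up.\<close>

lemma telescope_product_bound:
  fixes \<Phi> :: "nat \<Rightarrow> complex" and S r :: "nat \<Rightarrow> real"
  assumes "\<And>j. j < n \<Longrightarrow> cmod (\<Phi> (Suc j) - of_real (exp (- S j / 2)) * \<Phi> j) \<le> r j" "\<And>j. S j \<ge> 0"
  shows "cmod (\<Phi> n - of_real (exp (- (\<Sum>j<n. S j) / 2)) * \<Phi> 0) \<le> (\<Sum>j<n. r j)"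
  using assms(1)
proof (induction n)
  case (Suc n)
  define P where "P = (\<lambda>n. complex_of_real (exp (- (\<Sum>j<n. S j) / 2)))"
  have P: "P (Suc n) = of_real (exp (- S n / 2)) * P n"
    unfolding P_def of_real_mult[symmetric] exp_add[symmetric] by (simp add: add_divide_distrib add.commute)
  have "\<Phi> (Suc n) - P (Suc n) * \<Phi> 0 = (\<Phi> (Suc n) - of_real (exp (- S n / 2)) * \<Phi> n) + of_real (exp (- S n / 2)) * (\<Phi> n - P n * \<Phi> 0)"
    unfolding P by (simp add: algebra_simps)
  also have "cmod \<dots> \<le> r n + 1 * (\<Sum>j<n. r j)"
  proof (intro order_trans[OF norm_triangle_ineq add_mono])
    show "cmod (\<Phi> (Suc n) - of_real (exp (- S n / 2)) * \<Phi> n) \<le> r n" using Suc.prems by simp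
    show "cmod (of_real (exp (- S n / 2)) * (\<Phi> n - P n * \<Phi> 0)) \<le> 1 * (\<Sum>j<n. r j)"
      unfolding norm_mult norm_of_real P_def using assms(2)[of n] Suc by (intro mult_mono) auto
  qed
  finally show ?case unfolding P_def by (simp only: sum.lessThan_Suc mult_1 add.commute)
qed simp

section \<open>The limit law when all other roots have real part below 1/2\<close>

context
  fixes m :: nat
  assumes m: "m \<ge> 2" and sub: "\<And>l. l \<in> chi_roots m \<Longrightarrow> l \<noteq> 1 \<Longrightarrow> Re l < 1/2"
begin

lemma fin: "finite (Rt m)" using finite_Rt m by auto

text \<open>The floor 5/12 makes 3s, 4s and 2s + 1/4 exceed 1, which are the exponents of the error
  series in \<open>char_limit\<close>.\<close>

lemma common_exponent: "\<exists>s. 5/12 \<le> s \<and> s < 1/2 \<and> (\<forall>l\<in>Rt m. Re l \<le> s)"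
proof (intro exI[of _ "Max (insert (5/12) (Re ` Rt m))"] conjI)
  show "5/12 \<le> Max (insert (5/12) (Re ` Rt m))" using fin by (intro Max_ge) auto
  show "Max (insert (5/12) (Re ` Rt m)) < 1/2" using fin sub by (subst Max_less_iff) (auto simp: Rt_def)
  show "\<forall>l\<in>Rt m. Re l \<le> Max (insert (5/12) (Re ` Rt m))" using fin by auto
qed

lemma qn_sum_bound:
  fixes c :: "complex \<Rightarrow> complex"
  assumes s: "5/12 \<le> s" "s < 1/2" "\<And>l. l \<in> Rt m \<Longrightarrow> Re l \<le> s"
  defines "K \<equiv> (\<Sum>l\<in>Rt m. cmod (c l) * exp (s + (cmod l)\<^sup>2))"
  shows "j \<le> n \<Longrightarrow> (\<Sum>l\<in>Rt m. cmod (qn m c n j l)) \<le> K * (real (n + m) powr s / sqrt (real n)) * real (j + m) powr (-s)"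
proof -
  assume j: "j \<le> n"
  have "(\<Sum>l\<in>Rt m. cmod (qn m c n j l)) \<le> (\<Sum>l\<in>Rt m. cmod (c l) * exp (s + (cmod l)\<^sup>2) * ((real (n + m) powr s / sqrt (real n)) * real (j + m) powr (-s)))"
  proof (rule sum_mono)
    fix l assume l: "l \<in> Rt m"
    have "cmod (qn m c n j l) = cmod (c l) * cmod (Gp m l j n) / sqrt (real n)"
      by (simp add: qn_def norm_mult norm_divide)
    also have "\<dots> \<le> cmod (c l) * (exp (s + (cmod l)\<^sup>2) * (real (n + m) / real (j + m)) powr s) / sqrt (real n)"
      using s(1) s(3)[OF l] j by (intro divide_right_mono mult_left_mono norm_Gp_le[OF m]) auto
    also have "(real (n + m) / real (j + m)) powr s = real (n + m) powr s * real (j + m) powr (-s)"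
      by (simp add: powr_divide powr_minus_divide)
    finally show "cmod (qn m c n j l) \<le> cmod (c l) * exp (s + (cmod l)\<^sup>2) * ((real (n + m) powr s / sqrt (real n)) * real (j + m) powr (-s))"
      by (simp add: mult_ac)
  qed
  then show ?thesis by (simp only: K_def sum_distrib_right mult.assoc)
qed

lemma cov_form_nonneg: "cov_form m n c c \<ge> 0"
  unfolding cov_form_def
  by (intro sum_nonneg) (rule mult_nonneg_nonneg[OF v_vec_one_nonneg[OF m] zero_le_square])

text \<open>The coefficients at step j are at most \<open>b n\<close> times j^(-s), with
  \<open>b n\<close> of order n^(s - 1/2). Each error is therefore a positive power of
  \<open>b n\<close> times a partial sum of a convergent series, and tends to 0.\<close>

lemma char_limit:
  assumes V: "(\<lambda>n. cov_form m n c c) \<longlonglongrightarrow> V"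
  shows "(\<lambda>n. Ew m n (\<lambda>w. iexp (ell m (qn m c n n) w))) \<longlonglongrightarrow> of_real (exp (- V / 2))"
proof -
  obtain s where s: "5/12 \<le> s" "s < 1/2" and Rs: "\<And>l. l \<in> Rt m \<Longrightarrow> Re l \<le> s" using common_exponent by blast
  define K where "K = (\<Sum>l\<in>Rt m. cmod (c l) * exp (s + (cmod l)\<^sup>2))"
  define b where "b n = K * (real (n + m) powr s / sqrt (real n))" for n
  have K0: "K \<ge> 0" unfolding K_def by (intro sum_nonneg) auto
  have b0: "b n \<ge> 0" for n using K0 by (simp add: b_def)
  have blim: "b \<longlonglongrightarrow> 0"
  proof -
    have "(\<lambda>n. real (n + m) powr s / sqrt (real n)) \<longlonglongrightarrow> 0" using s by real_asymp
    from tendsto_mult[OF tendsto_const this, of K] show ?thesis by (simp add: b_def[abs_def])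
  qed
  have Q: "(\<Sum>l\<in>Rt m. cmod (qn m c n j l)) \<le> b n * real (j + m) powr (-s)" if "j \<le> n" for n j
    unfolding b_def K_def using qn_sum_bound[OF s Rs that] by blast
  have "\<exists>C. \<forall>l\<in>Rt m. C l \<ge> 0 \<and> (\<forall>n. Ew m n (\<lambda>w. cmod (Y m l w)) \<le> C l * real (n + m) powr (3/4))"
    by (rule bchoice) (use Y_first_moment[OF m] sub in \<open>auto simp: Rt_def\<close>)
  then obtain C where C: "\<And>l. l \<in> Rt m \<Longrightarrow> C l \<ge> 0" "\<And>l n. l \<in> Rt m \<Longrightarrow> Ew m n (\<lambda>w. cmod (Y m l w)) \<le> C l * real (n + m) powr (3/4)" by blast
  define CZ where "CZ = (\<Sum>l\<in>Rt m. C l)"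
  have CZ0: "CZ \<ge> 0" unfolding CZ_def using C(1) by (intro sum_nonneg)
  have EZ: "Ew m n (Zn m) \<le> CZ * real (n + m) powr (3/4)" for n
  proof -
    have "Ew m n (Zn m) = (\<Sum>l\<in>Rt m. Ew m n (\<lambda>w. cmod (Y m l w)))"
      unfolding Zn_def[abs_def] by (rule Ew_sum)
    also have "\<dots> \<le> (\<Sum>l\<in>Rt m. C l * real (n + m) powr (3/4))" by (intro sum_mono C)
    finally show ?thesis by (simp add: CZ_def sum_distrib_right)
  qed
  define Z3 where "Z3 = (\<Sum>j. real (Suc j) powr (-(3 * s)))"
  define Z4 where "Z4 = (\<Sum>j. real (Suc j) powr (-(4 * s)))"
  define Z2 where "Z2 = (\<Sum>j. real (Suc j) powr (-(2 * s) - 1/4))"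
  define \<Phi> where "\<Phi> n j = Ew m j (\<lambda>w. iexp (ell m (qn m c n j) w))" for n j
  define S where "S n j = (\<Sum>k=1..m. v_vec m 1 k * (var_form m (qn m c n (Suc j)) k)\<^sup>2)" for n j
  have S0: "S n j \<ge> 0" for n j unfolding S_def using v_vec_one_nonneg[OF m] by (intro sum_nonneg mult_nonneg_nonneg) auto
  have Ssum: "(\<Sum>j<n. S n j) = cov_form m n c c" for n
    by (simp add: S_def cov_form_def power2_eq_square)
  define r where "r n j = stepC m * ((b n)^3 * real (Suc j) powr (-(3 * s)) + (b n)^4 * real (Suc j) powr (-(4 * s)) + (b n)\<^sup>2 * CZ * real (Suc j) powr (-(2 * s) - 1/4))" for n j
  have step: "cmod (\<Phi> n (Suc j) - of_real (exp (- S n j / 2)) * \<Phi> n j) \<le> r n j" if j: "j < n" for n j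
  proof -
    define Qj where "Qj = (\<Sum>l\<in>Rt m. cmod (qn m c n (Suc j) l))"
    have Q0: "Qj \<ge> 0" unfolding Qj_def by (intro sum_nonneg) auto
    have "Qj \<le> b n * real (Suc j + m) powr (-s)" unfolding Qj_def using j by (intro Q) auto
    also have "\<dots> \<le> b n * real (Suc j) powr (-s)" using b0 s by (intro mult_left_mono powr_mono2') auto
    finally have Qle: "Qj \<le> b n * real (Suc j) powr (-s)" .
    have pw: "Qj^i \<le> (b n)^i * real (Suc j) powr (-(real i * s))" for i
    proof -
      have "Qj^i \<le> (b n * real (Suc j) powr (-s))^i" using Q0 Qle by (intro power_mono) auto
      also have "\<dots> = (b n)^i * real (Suc j) powr (-s * real i)"
        unfolding power_mult_distrib by (subst powr_pow) auto
      finally show ?thesis by (simp add: mult.commute)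
    qed
    have "cmod (\<Phi> n (Suc j) - of_real (exp (- S n j / 2)) * \<Phi> n j) \<le> stepC m * (Qj^3 + Qj^4 + Qj\<^sup>2 * (Ew m j (Zn m) / real (j + m)))"
      unfolding \<Phi>_def S_def Qj_def
    proof (rule char_recursion[OF m])
      fix l show "qn m c n j l = qn m c n (Suc j) l * (1 + l / of_nat (j + m))"
        using j by (simp add: qn_def Gp_rec[of j n] del: of_nat_add)
    qed
    also have "\<dots> \<le> r n j"
      unfolding r_def
    proof (intro mult_left_mono add_mono stepC_nonneg)
      show "Qj^3 \<le> (b n)^3 * real (Suc j) powr (-(3 * s))" using pw[of 3] by simp
      show "Qj^4 \<le> (b n)^4 * real (Suc j) powr (-(4 * s))" using pw[of 4] by simp
      have "Ew m j (Zn m) / real (j + m) \<le> CZ * (real (j + m) powr (3/4) / real (j + m) powr 1)"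
        using EZ[of j] by (simp add: divide_right_mono)
      also have "\<dots> = CZ * real (j + m) powr (-1/4)" by (simp only: powr_diff[symmetric]) simp
      also have "\<dots> \<le> CZ * real (Suc j) powr (-1/4)" using CZ0 m by (intro mult_left_mono powr_mono2') auto
      finally have z: "Ew m j (Zn m) / real (j + m) \<le> CZ * real (Suc j) powr (-1/4)" .
      have "0 \<le> Ew m j (Zn m) / real (j + m)"
        by (intro divide_nonneg_nonneg Ew_nonneg) (auto simp: Zn_def intro!: sum_nonneg)
      then have "Qj\<^sup>2 * (Ew m j (Zn m) / real (j + m)) \<le> ((b n)\<^sup>2 * real (Suc j) powr (-(real 2 * s))) * (CZ * real (Suc j) powr (-1/4))"
        using z CZ0 by (intro mult_mono pw) auto
      also have "\<dots> = (b n)\<^sup>2 * CZ * (real (Suc j) powr (-(2 * s)) * real (Suc j) powr (-1/4))" by simp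
      also have "real (Suc j) powr (-(2 * s)) * real (Suc j) powr (-1/4) = real (Suc j) powr (-(2 * s) - 1/4)"
        unfolding powr_add[symmetric] by simp
      finally show "Qj\<^sup>2 * (Ew m j (Zn m) / real (j + m)) \<le> (b n)\<^sup>2 * CZ * real (Suc j) powr (-(2 * s) - 1/4)" .
    qed
    finally show ?thesis .
  qed
  have total: "cmod (\<Phi> n n - of_real (exp (- cov_form m n c c / 2)) * \<Phi> n 0) \<le> stepC m * ((b n)^3 * Z3 + (b n)^4 * Z4 + (b n)\<^sup>2 * CZ * Z2)" for n
  proof -
    have "cmod (\<Phi> n n - of_real (exp (- (\<Sum>j<n. S n j) / 2)) * \<Phi> n 0) \<le> (\<Sum>j<n. r n j)"
      by (rule telescope_product_bound) (use step S0 in auto)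
    also have "\<dots> = stepC m * ((b n)^3 * (\<Sum>j<n. real (Suc j) powr (-(3 * s))) + (b n)^4 * (\<Sum>j<n. real (Suc j) powr (-(4 * s))) + (b n)\<^sup>2 * CZ * (\<Sum>j<n. real (Suc j) powr (-(2 * s) - 1/4)))"
      by (simp add: r_def sum_distrib_left sum.distrib distrib_left)
    also have "\<dots> \<le> stepC m * ((b n)^3 * Z3 + (b n)^4 * Z4 + (b n)\<^sup>2 * CZ * Z2)"
      unfolding Z3_def Z4_def Z2_def using s b0 CZ0 stepC_nonneg
      by (intro mult_left_mono add_mono sum_Suc_powr_le) auto
    finally show ?thesis unfolding Ssum .
  qed
  have "(\<lambda>n. stepC m * ((b n)^3 * Z3 + (b n)^4 * Z4 + (b n)\<^sup>2 * CZ * Z2)) \<longlonglongrightarrow> stepC m * (0^3 * Z3 + 0^4 * Z4 + 0\<^sup>2 * CZ * Z2)"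
    by (intro tendsto_intros blim)
  then have "(\<lambda>n. stepC m * ((b n)^3 * Z3 + (b n)^4 * Z4 + (b n)\<^sup>2 * CZ * Z2)) \<longlonglongrightarrow> 0" by simp
  then have diff: "(\<lambda>n. \<Phi> n n - of_real (exp (- cov_form m n c c / 2)) * \<Phi> n 0) \<longlonglongrightarrow> 0"
    by (rule Lim_null_comparison[rotated]) (use total in auto)
  \<comment> \<open>The initial state, carried forward to time n, is negligible on the scale of the
    square root of n, so the characteristic function at time 0 tends to 1.\<close>
  have "(\<lambda>n. ell m (qn m c n 0) []) \<longlonglongrightarrow> 0"
  proof (rule Lim_null_comparison)
    show "(\<lambda>n. b n * real m) \<longlonglongrightarrow> 0" using tendsto_mult[OF blim tendsto_const] by simp
    show "\<forall>\<^sub>F n in sequentially. norm (ell m (qn m c n 0) []) \<le> b n * real m"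
    proof (intro always_eventually allI)
      fix n
      have "norm (ell m (qn m c n 0) []) \<le> (\<Sum>l\<in>Rt m. cmod (qn m c n 0 l * Y m l []))"
        unfolding ell_def real_norm_def by (rule order_trans[OF abs_Re_le_cmod norm_sum])
      also have "\<dots> = (\<Sum>l\<in>Rt m. cmod (qn m c n 0 l)) * real m"
        by (simp add: Y_Nil[OF m] norm_mult sum_distrib_right)
      also have "\<dots> \<le> (b n * real (0 + m) powr (-s)) * real m" by (intro mult_right_mono Q) auto
      also have "\<dots> \<le> (b n * 1 powr (-s)) * real m" using b0 m s by (intro mult_right_mono mult_left_mono powr_mono2') auto
      finally show "norm (ell m (qn m c n 0) []) \<le> b n * real m" by simp
    qed
  qed
  then have "(\<lambda>n. \<Phi> n 0) \<longlonglongrightarrow> iexp 0"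
    unfolding \<Phi>_def Ew_0 by (intro tendsto_intros)
  then have "(\<lambda>n. of_real (exp (- cov_form m n c c / 2)) * \<Phi> n 0) \<longlonglongrightarrow> of_real (exp (- V / 2)) * iexp 0"
    by (intro tendsto_intros V) auto
  from tendsto_add[OF diff this] show ?thesis by (simp add: \<Phi>_def)
qed

text \<open>Since 2 Re a Re b is the real part of a b + a (cnj b), the form is a fixed combination
  of the pair sums of \<open>Gp_pair_sum_limit\<close> for the pairs (l, l') and (l, cnj
  l').\<close>

lemma cov_form_convergent: "convergent (\<lambda>n. cov_form m n c c')"
proof -
  obtain s where s: "5/12 \<le> s" "s < 1/2" and Rs: "\<And>l. l \<in> Rt m \<Longrightarrow> Re l \<le> s" using common_exponent by blast
  define T where "T \<alpha> \<beta> n = (\<Sum>j<n. Gp m \<alpha> (Suc j) n * Gp m \<beta> (Suc j) n) / of_nat n" for \<alpha> \<beta> n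
  have T: "convergent (T \<alpha> \<beta>)" if "Re \<alpha> \<le> s" "Re \<beta> \<le> s" for \<alpha> \<beta>
    unfolding convergent_def T_def using Gp_pair_sum_limit[OF m that _ s(2)] s by auto
  have expand: "(\<Sum>j<n. (\<Sum>l\<in>Rt m. A l * f l j / r) * (\<Sum>l\<in>Rt m. B l * g l j / r)) = (\<Sum>l\<in>Rt m. \<Sum>l'\<in>Rt m. A l * B l' * ((\<Sum>j<n. f l j * g l' j) / (r * r)))"
    for A B and f g :: "complex \<Rightarrow> nat \<Rightarrow> complex" and r :: complex and n :: nat
  proof -
    have "(\<Sum>j<n. (\<Sum>l\<in>Rt m. A l * f l j / r) * (\<Sum>l\<in>Rt m. B l * g l j / r)) = (\<Sum>j<n. \<Sum>l\<in>Rt m. \<Sum>l'\<in>Rt m. A l * B l' * ((f l j * g l' j) / (r * r)))"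
      unfolding sum_product by (simp add: mult_ac)
    also have "\<dots> = (\<Sum>l\<in>Rt m. \<Sum>j<n. \<Sum>l'\<in>Rt m. A l * B l' * ((f l j * g l' j) / (r * r)))" by (rule sum.swap)
    also have "\<dots> = (\<Sum>l\<in>Rt m. \<Sum>l'\<in>Rt m. \<Sum>j<n. A l * B l' * ((f l j * g l' j) / (r * r)))" by (intro sum.cong refl sum.swap)
    finally show ?thesis by (simp add: sum_distrib_left sum_divide_distrib)
  qed
  have rr: "of_real (sqrt (real n)) * of_real (sqrt (real n)) = (of_nat n :: complex)" for n
    by (simp flip: of_real_mult)
  have cG: "cnj (Gp m l j n) = Gp m (cnj l) j n" for l j n by (simp add: Gp_def)
  define F where "F k n = (\<Sum>l\<in>Rt m. \<Sum>l'\<in>Rt m. (c l * Uinc m l k) * (c' l' * Uinc m l' k) * T l l' n)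
     + (\<Sum>l\<in>Rt m. \<Sum>l'\<in>Rt m. (c l * Uinc m l k) * cnj (c' l' * Uinc m l' k) * T l (cnj l') n)" for k n
  have "cov_form m n c c' = (\<Sum>k=1..m. v_vec m 1 k * (Re (F k n) / 2))" for n
  proof -
    have "(\<Sum>j<n. var_form m (qn m c n (Suc j)) k * var_form m (qn m c' n (Suc j)) k) = Re (F k n) / 2" for k
    proof -
      define r where "r = complex_of_real (sqrt (real n))"
      define a where "a j = (\<Sum>l\<in>Rt m. (c l * Uinc m l k) * Gp m l (Suc j) n / r)" for j
      define a' where "a' j = (\<Sum>l\<in>Rt m. (c' l * Uinc m l k) * Gp m l (Suc j) n / r)" for j
      have vf: "var_form m (qn m c n (Suc j)) k = Re (a j)" "var_form m (qn m c' n (Suc j)) k = Re (a' j)" for j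
        unfolding var_form_def qn_def a_def a'_def r_def by (intro arg_cong[of _ _ Re] sum.cong refl; simp add: mult_ac)+
      have ca': "cnj (a' j) = (\<Sum>l\<in>Rt m. cnj (c' l * Uinc m l k) * Gp m (cnj l) (Suc j) n / r)" for j
        unfolding a'_def by (simp add: cG r_def)
      have "F k n = (\<Sum>j<n. a j * a' j) + (\<Sum>j<n. a j * cnj (a' j))"
        unfolding ca' unfolding a_def a'_def expand F_def T_def r_def rr ..
      then have "F k n = (\<Sum>j<n. a j * a' j + a j * cnj (a' j))" by (simp only: sum.distrib)
      then have "Re (F k n) = (\<Sum>j<n. Re (a j * a' j + a j * cnj (a' j)))" by (simp only: Re_sum)
      also have "\<dots> = (\<Sum>j<n. 2 * (Re (a j) * Re (a' j)))" by (intro sum.cong refl) (simp add: algebra_simps)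
      finally show ?thesis unfolding vf by (simp add: sum_distrib_left[symmetric])
    qed
    then show ?thesis unfolding cov_form_def
      by (subst sum.swap) (simp only: sum_distrib_left[symmetric])
  qed
  moreover have "convergent (\<lambda>n. \<Sum>k=1..m. v_vec m 1 k * (Re (F k n) / 2))"
  proof -
    have "\<exists>L. (\<lambda>n. Re (F k n)) \<longlonglongrightarrow> L" for k
    proof -
      have "convergent (F k)" unfolding F_def
        using Rs T by (intro convergent_add convergent_sum convergent_mult convergent_const) auto
      then show ?thesis unfolding convergent_def using tendsto_Re by blast
    qed
    then obtain L where "\<And>k. (\<lambda>n. Re (F k n)) \<longlonglongrightarrow> L k" by metis
    then have "(\<lambda>n. \<Sum>k=1..m. v_vec m 1 k * (Re (F k n) / 2)) \<longlonglongrightarrow> (\<Sum>k=1..m. v_vec m 1 k * (L k / 2))"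
      by (intro tendsto_intros) auto
    then show ?thesis by (auto simp: convergent_def)
  qed
  ultimately show ?thesis by simp
qed

lemma var_form_linear:
  "var_form m (qn m (\<lambda>l. \<Sum>i\<in>A. of_real (t i) * c i l) n j) k = (\<Sum>i\<in>A. t i * var_form m (qn m (c i) n j) k)"
proof -
  have "(\<Sum>l\<in>Rt m. qn m (\<lambda>l. \<Sum>i\<in>A. of_real (t i) * c i l) n j l * Uinc m l k) = (\<Sum>l\<in>Rt m. \<Sum>i\<in>A. of_real (t i) * (qn m (c i) n j l * Uinc m l k))"
    unfolding qn_def by (intro sum.cong refl) (simp add: sum_distrib_left sum_distrib_right sum_divide_distrib mult_ac)
  also have "\<dots> = (\<Sum>i\<in>A. of_real (t i) * (\<Sum>l\<in>Rt m. qn m (c i) n j l * Uinc m l k))"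
    unfolding sum_distrib_left by (rule sum.swap)
  finally show ?thesis unfolding var_form_def by simp
qed

lemma cov_form_linear:
  "cov_form m n (\<lambda>l. \<Sum>i\<in>A. of_real (t i) * c i l) (\<lambda>l. \<Sum>i\<in>A. of_real (t i) * c i l) = (\<Sum>i\<in>A. \<Sum>i'\<in>A. t i * t i' * cov_form m n (c i) (c i'))"
proof -
  have "cov_form m n (\<lambda>l. \<Sum>i\<in>A. of_real (t i) * c i l) (\<lambda>l. \<Sum>i\<in>A. of_real (t i) * c i l) =
    (\<Sum>j<n. \<Sum>k=1..m. \<Sum>i\<in>A. \<Sum>i'\<in>A. t i * t i' * (v_vec m 1 k * (var_form m (qn m (c i) n (Suc j)) k * var_form m (qn m (c i') n (Suc j)) k)))"
    unfolding cov_form_def var_form_linear sum_product by (simp add: sum_distrib_left mult_ac)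
  also have "\<dots> = (\<Sum>i\<in>A. \<Sum>i'\<in>A. \<Sum>j<n. \<Sum>k=1..m. t i * t i' * (v_vec m 1 k * (var_form m (qn m (c i) n (Suc j)) k * var_form m (qn m (c i') n (Suc j)) k)))"
    by (subst sum.swap[of _ _ "{1..m}"], subst sum.swap[of _ _ "{..<n}"], intro sum.cong refl,
        subst sum.swap[of _ _ "{1..m}"], subst sum.swap[of _ _ "{..<n}"], intro sum.cong refl sum.swap)
  finally show ?thesis by (simp add: cov_form_def sum_distrib_left)
qed

text \<open>The constant term is the offset between the n + m gaps and the centring by n; it
  disappears after division by the square root of n.\<close>

lemma st_centered:
  assumes w: "w \<in> words m n" and k: "k \<in> {1..m}"
  shows "st m w k - real n * P_inv m (v_vec m 1) k = real m * P_inv m (v_vec m 1) k + Re (\<Sum>l\<in>Rt m. Y m l w * yvec m l k)"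
proof -
  have Re: "Re (of_nat a * of_real x) = real a * x" for a :: nat and x :: real by simp
  have "st m w k = Re (of_real (st m w k))" by (rule Re_complex_of_real[symmetric])
  also have "of_real (st m w k) = of_nat (n + m) * of_real (P_inv m (v_vec m 1) k) + (\<Sum>l\<in>Rt m. Y m l w * yvec m l k)"
    using st_decomposition[OF m w k] by (simp only: yvec_one)
  also have "Re \<dots> = real (n + m) * P_inv m (v_vec m 1) k + Re (\<Sum>l\<in>Rt m. Y m l w * yvec m l k)"
    by (simp only: plus_complex.sel Re)
  finally show ?thesis by (simp add: distrib_right)
qed

definition st_scaled :: "nat \<Rightarrow> nat list \<Rightarrow> nat \<Rightarrow> real" where
  "st_scaled n w k = (st m w k - real n * P_inv m (v_vec m 1) k) / sqrt (real n)"

lemma linear_form_st_scaled: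
  assumes w: "w \<in> words m n"
  shows "(\<Sum>k=1..m. t k * st_scaled n w k) =
    (\<Sum>k=1..m. t k * P_inv m (v_vec m 1) k) * real m / sqrt (real n) + ell m (qn m (\<lambda>l. \<Sum>k=1..m. of_real (t k) * yvec m l k) n n) w"
proof -
  define r where "r = sqrt (real n)"
  have "(\<Sum>l\<in>Rt m. qn m (\<lambda>l. \<Sum>k=1..m. of_real (t k) * yvec m l k) n n l * Y m l w) =
      (\<Sum>l\<in>Rt m. \<Sum>k=1..m. of_real (t k / r) * (Y m l w * yvec m l k))"
    unfolding qn_def Gp_self r_def
    by (intro sum.cong refl) (simp add: sum_distrib_left sum_distrib_right sum_divide_distrib mult_ac)
  also have "\<dots> = (\<Sum>k=1..m. of_real (t k / r) * (\<Sum>l\<in>Rt m. Y m l w * yvec m l k))"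
    unfolding sum_distrib_left by (rule sum.swap)
  finally have "ell m (qn m (\<lambda>l. \<Sum>k=1..m. of_real (t k) * yvec m l k) n n) w = (\<Sum>k=1..m. t k / r * Re (\<Sum>l\<in>Rt m. Y m l w * yvec m l k))"
    unfolding ell_def by (simp only: Re_sum times_complex.sel Re_complex_of_real Im_complex_of_real) simp
  moreover have "(\<Sum>k=1..m. t k * st_scaled n w k) =
      (\<Sum>k=1..m. t k * P_inv m (v_vec m 1) k * real m / r + t k / r * Re (\<Sum>l\<in>Rt m. Y m l w * yvec m l k))"
    by (intro sum.cong refl) (simp only: st_scaled_def st_centered[OF w] r_def distrib_left add_divide_distrib times_divide_eq_right times_divide_eq_left mult.assoc mult.commute[of _ "real m"] mult.left_commute[of "real m"])
  ultimately show ?thesis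
    by (simp only: sum.distrib r_def sum_distrib_right sum_divide_distrib)
qed

lemma st_scaled_second_moment:
  "\<exists>C. \<forall>n\<ge>1. \<forall>k\<in>{1..m}. Ew m n (\<lambda>w. (st_scaled n w k)\<^sup>2) \<le> C"
proof -
  have "\<exists>C. \<forall>l\<in>Rt m. C l \<ge> 0 \<and> (\<forall>n\<ge>1. Ew m n (\<lambda>w. (cmod (Y m l w))\<^sup>2) \<le> C l * real n)"
    by (rule bchoice) (use Y_second_moment_linear[OF m] sub in \<open>auto simp: Rt_def\<close>)
  then obtain C where C: "\<And>l n. l \<in> Rt m \<Longrightarrow> n \<ge> 1 \<Longrightarrow> Ew m n (\<lambda>w. (cmod (Y m l w))\<^sup>2) \<le> C l * real n" by blast
  define a where "a k = real m * P_inv m (v_vec m (1::real)) k" for k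
  define y where "y k = (\<Sum>l\<in>Rt m. (cmod (yvec m l k))\<^sup>2)" for k
  define B where "B k = 2 * (a k)\<^sup>2 + 2 * ((\<Sum>l\<in>Rt m. C l) * y k)" for k
  have y0: "y k \<ge> 0" for k unfolding y_def by (intro sum_nonneg) auto
  have "Ew m n (\<lambda>w. (st_scaled n w k)\<^sup>2) \<le> B k" if n: "n \<ge> 1" and k: "k \<in> {1..m}" for n k
  proof -
    have "Ew m n (\<lambda>w. (st_scaled n w k)\<^sup>2) \<le> Ew m n (\<lambda>w. 2 / real n * ((a k)\<^sup>2 + y k * (\<Sum>l\<in>Rt m. (cmod (Y m l w))\<^sup>2)))"
    proof (rule Ew_mono)
      fix w assume w: "w \<in> words m n"
      define R where "R = Re (\<Sum>l\<in>Rt m. Y m l w * yvec m l k)"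
      have "\<bar>R\<bar> \<le> (\<Sum>l\<in>Rt m. cmod (Y m l w) * cmod (yvec m l k))"
        unfolding R_def norm_mult[symmetric] by (rule order_trans[OF abs_Re_le_cmod norm_sum])
      then have "R\<^sup>2 \<le> (\<Sum>l\<in>Rt m. cmod (Y m l w) * cmod (yvec m l k))\<^sup>2"
        using power_mono[of "\<bar>R\<bar>" _ 2] by simp
      also have "\<dots> \<le> (\<Sum>l\<in>Rt m. (cmod (Y m l w))\<^sup>2) * y k"
        unfolding y_def by (rule Cauchy_Schwarz_ineq_sum)
      finally have R: "R\<^sup>2 \<le> (\<Sum>l\<in>Rt m. (cmod (Y m l w))\<^sup>2) * y k" .
      have "(st_scaled n w k)\<^sup>2 = (a k + R)\<^sup>2 / real n"
        unfolding st_scaled_def st_centered[OF w k] a_def R_def power_divide using n by simp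
      also have "\<dots> \<le> (2 * ((a k)\<^sup>2 + R\<^sup>2)) / real n"
        using sum_squares_bound[of "a k" R] by (intro divide_right_mono) (simp_all add: power2_sum)
      also have "\<dots> \<le> (2 * ((a k)\<^sup>2 + (\<Sum>l\<in>Rt m. (cmod (Y m l w))\<^sup>2) * y k)) / real n"
        using R by (intro divide_right_mono) simp_all
      finally show "(st_scaled n w k)\<^sup>2 \<le> 2 / real n * ((a k)\<^sup>2 + y k * (\<Sum>l\<in>Rt m. (cmod (Y m l w))\<^sup>2))"
        by (simp add: mult.commute)
    qed
    also have "\<dots> = 2 / real n * ((a k)\<^sup>2 + y k * (\<Sum>l\<in>Rt m. Ew m n (\<lambda>w. (cmod (Y m l w))\<^sup>2)))"
      unfolding Ew_cmult Ew_add Ew_sum Ew_const[OF m] ..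
    also have "\<dots> \<le> 2 / real n * (real n * (a k)\<^sup>2 + y k * (\<Sum>l\<in>Rt m. C l * real n))"
    proof (intro mult_left_mono add_mono sum_mono C n y0)
      show "(a k)\<^sup>2 \<le> real n * (a k)\<^sup>2" using n by (simp add: mult_le_cancel_right1)
    qed auto
    also have "\<dots> = B k" using n by (simp add: B_def sum_distrib_right[symmetric] field_simps)
    finally show ?thesis .
  qed
  moreover have "B k \<le> Max (B ` {1..m})" if "k \<in> {1..m}" for k using that by (intro Max_ge) auto
  ultimately show ?thesis by (meson order_trans)
qed

text \<open>The covariance matrix consists of the limits of \<open>cov_form\<close> for the
  coordinate functions, whose coefficients in the eigencoordinates are the entries of
  \<open>yvec\<close>; it is positive semidefinite as a limit of nonnegative forms.\<close>

lemma gaussian_limit: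
  assumes chain: "btree_fringe_chain m M L"
  shows "\<exists>N. centered_gaussian {1..m} N \<and>
    weak_conv_vec {1..m}
      (\<lambda>n. distr M (Pi\<^sub>M {1..m} (\<lambda>_. borel))
        (\<lambda>\<omega>. \<lambda>k\<in>{1..m}. (L n \<omega> k - real n * P_inv m (v_vec m 1) k) / sqrt (real n))) N"
proof -
  interpret prob_space M using chain by (simp add: btree_fringe_chain_def)
  have [measurable]: "(\<lambda>\<omega>. L n \<omega> j) \<in> borel_measurable M" if "j \<in> {1..m}" for n j
    using chain that by (auto simp: btree_fringe_chain_def)
  define I where "I = {1..m}"
  have finI: "finite I" by (simp add: I_def)
  define c where "c i l = yvec m l i" for i l
  define V where "V i i' = lim (\<lambda>n. cov_form m n (c i) (c i'))" for i i'
  define ct where "ct t l = (\<Sum>i\<in>I. of_real (t i) * c i l)" for t l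
  have V: "(\<lambda>n. cov_form m n (c i) (c i')) \<longlonglongrightarrow> V i i'" for i i'
    unfolding V_def using cov_form_convergent convergent_LIMSEQ_iff by blast
  have VT: "(\<lambda>n. cov_form m n (ct t) (ct t)) \<longlonglongrightarrow> (\<Sum>i\<in>I. \<Sum>i'\<in>I. t i * t i' * V i i')" for t
    unfolding ct_def cov_form_linear by (intro tendsto_intros V)
  have sym: "V i i' = V i' i" for i i'
    unfolding V_def cov_form_def by (simp add: mult.commute)
  have psd: "0 \<le> (\<Sum>i\<in>I. \<Sum>i'\<in>I. t i * t i' * V i i')" for t
    by (rule LIMSEQ_le_const[OF VT]) (use cov_form_nonneg in auto)
  obtain N where N: "centered_gaussian I N" "\<And>k. k \<in> I \<Longrightarrow> integrable N (\<lambda>x. (x k)\<^sup>2)"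
      "\<And>t. (\<integral>x. exp (\<i> * of_real (\<Sum>k\<in>I. t k * x k)) \<partial>N) = of_real (exp (- (\<Sum>i\<in>I. \<Sum>k\<in>I. t i * t k * V i k) / 2))"
    using gaussian_exists[OF finI sym psd] by blast
  define X where "X n \<omega> = (\<lambda>k\<in>I. (L n \<omega> k - real n * P_inv m (v_vec m 1) k) / sqrt (real n))" for n \<omega>
  define \<mu> where "\<mu> n = distr M (Pi\<^sub>M I (\<lambda>_. borel)) (X n)" for n
  have X [measurable]: "X n \<in> M \<rightarrow>\<^sub>M Pi\<^sub>M I (\<lambda>_. borel)" for n
    unfolding X_def I_def by (rule measurable_restrict) measurable
  have Xst: "X n \<omega> k = st_scaled n w k" if "w \<in> words m n" "\<omega> \<in> hist_event m M L w" "k \<in> I" for n \<omega> w k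
  proof -
    have "L n \<omega> k = st m w k"
      using that length_words[OF that(1)] by (auto simp: hist_event_def I_def)
    then show ?thesis using that(3) by (simp add: X_def st_scaled_def)
  qed
  obtain C where C: "\<And>n k. n \<ge> 1 \<Longrightarrow> k \<in> I \<Longrightarrow> Ew m n (\<lambda>w. (st_scaled n w k)\<^sup>2) \<le> C"
    using st_scaled_second_moment unfolding I_def by blast
  define CN where "CN = Max (insert C ((\<lambda>k. \<integral>x. (x k)\<^sup>2 \<partial>N) ` I))"
  have "weak_conv_vec I \<mu> N"
  proof (rule weak_conv_of_characters[OF finI, where C=CN])
    show "prob_space (\<mu> n)" for n unfolding \<mu>_def by (rule prob_space_distr) measurable
    show "sets (\<mu> n) = sets (Pi\<^sub>M I (\<lambda>_. borel))" for n by (simp add: \<mu>_def)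
    show "prob_space N" "sets N = sets (Pi\<^sub>M I (\<lambda>_. borel))" using N(1) by (simp_all add: centered_gaussian_def)
    show "integrable N (\<lambda>x. (x k)\<^sup>2) \<and> (\<integral>x. (x k)\<^sup>2 \<partial>N) \<le> CN" if "k \<in> I" for k
      using N(2)[OF that] that finI by (auto simp: CN_def intro!: Max_ge)
    show "integrable (\<mu> n) (\<lambda>x. (x k)\<^sup>2) \<and> (\<integral>x. (x k)\<^sup>2 \<partial>\<mu> n) \<le> CN" if n: "n \<ge> 1" and k: "k \<in> I" for n k
    proof -
      have [measurable]: "(\<lambda>x. (x k)\<^sup>2) \<in> borel_measurable (Pi\<^sub>M I (\<lambda>_. borel :: real measure))"
        using k by measurable
      have h: "(X n \<omega> k)\<^sup>2 = (st_scaled n w k)\<^sup>2" if "w \<in> words m n" "\<omega> \<in> hist_event m M L w" for w \<omega>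
        using Xst[OF that k] by simp
      have Xm: "(\<lambda>\<omega>. (X n \<omega> k)\<^sup>2) \<in> borel_measurable M" by measurable
      have "integrable (\<mu> n) (\<lambda>x. (x k)\<^sup>2)"
        unfolding \<mu>_def by (subst integrable_distr_eq) (use integral_history(1)[OF m chain Xm h] in auto)
      moreover have "(\<integral>x. (x k)\<^sup>2 \<partial>\<mu> n) = Ew m n (\<lambda>w. (st_scaled n w k)\<^sup>2)"
        unfolding \<mu>_def by (subst integral_distr) (use integral_history(2)[OF m chain Xm h] in auto)
      moreover have "C \<le> CN" using finI by (auto simp: CN_def intro!: Max_ge)
      ultimately show ?thesis using C[OF n k] by simp
    qed
    show "(\<lambda>n. \<integral>x. exp (\<i> * of_real (lf I t x)) \<partial>\<mu> n) \<longlonglongrightarrow> (\<integral>x. exp (\<i> * of_real (lf I t x)) \<partial>N)" for t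
    proof -
      \<comment> \<open>The deterministic shift left over from centring by n; divided by the square
        root of n it only contributes a phase tending to 1.\<close>
      define \<kappa> where "\<kappa> = (\<Sum>k=1..m. t k * P_inv m (v_vec m (1::real)) k) * real m"
      have ct: "ct t = (\<lambda>l. \<Sum>k=1..m. of_real (t k) * yvec m l k)"
        by (simp add: ct_def[abs_def] c_def I_def)
      have e: "(\<integral>x. exp (\<i> * of_real (lf I t x)) \<partial>\<mu> n) = iexp (\<kappa> / sqrt (real n)) * Ew m n (\<lambda>w. iexp (ell m (qn m (ct t) n n) w))" for n
      proof -
        have lfm: "(\<lambda>x. exp (\<i> * of_real (lf I t x))) \<in> borel_measurable (Pi\<^sub>M I (\<lambda>_. borel :: real measure))"
          unfolding lf_def[OF finI] by measurable
        have Xm: "(\<lambda>\<omega>. exp (\<i> * of_real (lf I t (X n \<omega>)))) \<in> borel_measurable M"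
          by (rule measurable_compose[OF X lfm])
        have h: "exp (\<i> * of_real (lf I t (X n \<omega>))) = iexp (\<kappa> / sqrt (real n)) * iexp (ell m (qn m (ct t) n n) w)"
          if w: "w \<in> words m n" "\<omega> \<in> hist_event m M L w" for w \<omega>
        proof -
          have "lf I t (X n \<omega>) = (\<Sum>k=1..m. t k * st_scaled n w k)"
            unfolding lf_def[OF finI] unfolding I_def using Xst[OF w] by (intro sum.cong refl) (simp add: I_def)
          also have "\<dots> = \<kappa> / sqrt (real n) + ell m (qn m (ct t) n n) w"
            unfolding linear_form_st_scaled[OF w(1)] \<kappa>_def ct ..
          finally show ?thesis by (simp only: of_real_add distrib_left exp_add)
        qed
        have "(\<integral>x. exp (\<i> * of_real (lf I t x)) \<partial>\<mu> n) = (\<integral>\<omega>. exp (\<i> * of_real (lf I t (X n \<omega>))) \<partial>M)"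
          unfolding \<mu>_def by (rule integral_distr[OF X lfm])
        also have "\<dots> = Ew m n (\<lambda>w. iexp (\<kappa> / sqrt (real n)) * iexp (ell m (qn m (ct t) n n) w))"
          by (rule integral_history(2)[OF m chain Xm h])
        finally show ?thesis unfolding Ew_cmult .
      qed
      have "(\<lambda>n. \<kappa> / sqrt (real n)) \<longlonglongrightarrow> 0" by real_asymp
      then have "(\<lambda>n. iexp (\<kappa> / sqrt (real n)) * Ew m n (\<lambda>w. iexp (ell m (qn m (ct t) n n) w))) \<longlonglongrightarrow>
          iexp 0 * of_real (exp (- (\<Sum>i\<in>I. \<Sum>i'\<in>I. t i * t i' * V i i') / 2))"
        by (intro tendsto_mult tendsto_exp tendsto_of_real tendsto_const char_limit[OF VT])
      then show ?thesis unfolding e by (simp only: lf_def[OF finI] N(3) of_real_0 mult_zero_right exp_zero mult_1)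
    qed
  qed
  then show ?thesis using N(1) unfolding \<mu>_def X_def I_def by blast
qed

end

theorem corollary1:
  fixes m :: nat and M :: "'a measure" and L :: "nat \<Rightarrow> 'a \<Rightarrow> nat \<Rightarrow> real"
  assumes "m \<ge> 2"
    and "btree_fringe_chain m M L"
  shows "(m \<le> 59 \<longrightarrow>
           (\<exists>N. centered_gaussian {1..m} N \<and>
             weak_conv_vec {1..m}
               (\<lambda>n. distr M (Pi\<^sub>M {1..m} (\<lambda>_. borel))
                 (\<lambda>\<omega>. \<lambda>k\<in>{1..m}. (L n \<omega> k - real n * P_inv m (v_vec m 1) k) / sqrt (real n))) N)) \<and>
         (m \<ge> 60 \<longrightarrow>
           (\<exists>W :: 'a \<Rightarrow> complex.
             integrable M W \<and>
             (\<integral>\<omega>. W \<omega> \<partial>M) = fact m / Gamma (of_nat m + lambda2 m) \<and>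
             (AE \<omega> in M.
               (\<lambda>n. L2_set (btree_remainder m L W n \<omega>) {1..m}) \<in> o(\<lambda>n. real n powr sigma2 m)) \<and>
             (\<forall>p::real. p \<ge> 1 \<longrightarrow>
               (\<forall>n. integrable M (\<lambda>\<omega>. L2_set (btree_remainder m L W n \<omega>) {1..m} powr p)) \<and>
               (\<lambda>n. (\<integral>\<omega>. L2_set (btree_remainder m L W n \<omega>) {1..m} powr p \<partial>M) powr (1 / p))
                 \<in> o(\<lambda>n. real n powr sigma2 m))))"
proof (intro conjI impI)
  assume "m \<le> 59"
  then show "\<exists>N. centered_gaussian {1..m} N \<and>
      weak_conv_vec {1..m}
        (\<lambda>n. distr M (Pi\<^sub>M {1..m} (\<lambda>_. borel))
          (\<lambda>\<omega>. \<lambda>k\<in>{1..m}. (L n \<omega> k - real n * P_inv m (v_vec m 1) k) / sqrt (real n))) N"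
    using assms root_Re_less_half by (intro gaussian_limit) auto
next
  assume m: "m \<ge> 60"
  interpret prob_space M using assms(2) by (simp add: btree_fringe_chain_def)
  obtain W where W: "integrable M W" "(\<integral>\<omega>. W \<omega> \<partial>M) = fact m / Gamma (of_nat m + lambda2 m)"
      "negl M (sigma2 m) (\<lambda>n \<omega>. L2_set (btree_remainder m L W n \<omega>) {1..m})"
    using remainder_negl[OF m assms(2)] by blast
  show "\<exists>W :: 'a \<Rightarrow> complex.
      integrable M W \<and>
      (\<integral>\<omega>. W \<omega> \<partial>M) = fact m / Gamma (of_nat m + lambda2 m) \<and>
      (AE \<omega> in M.
        (\<lambda>n. L2_set (btree_remainder m L W n \<omega>) {1..m}) \<in> o(\<lambda>n. real n powr sigma2 m)) \<and>
      (\<forall>p::real. p \<ge> 1 \<longrightarrow>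
        (\<forall>n. integrable M (\<lambda>\<omega>. L2_set (btree_remainder m L W n \<omega>) {1..m} powr p)) \<and>
        (\<lambda>n. (\<integral>\<omega>. L2_set (btree_remainder m L W n \<omega>) {1..m} powr p \<partial>M) powr (1 / p))
          \<in> o(\<lambda>n. real n powr sigma2 m))"
    by (intro exI[of _ W] conjI allI impI W negl_imp_smallo[OF W(3)])
qed

end
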